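(* Let $d\ge1$ and let $\mathcal O$ be an arbitrary operad. For any $a\in \mathrm{Der}(\mathcal O)[[z]]$, there is a unique vector field $Y(a)$ on the variety $\mathrm{Hom}_{\mathrm{Op}}(\mathrm{HyperCom}_d,\mathcal O)$, depending linearly on $a$ (including infinite sums over powers of $z$), satisfying, for all $D\in\mathrm{Der}(\mathcal O)$, $p\ge0$, $n\ge2$, $k\ge 0$, $$[(Y(Dz^p))(f)](\mu_{n}^{(k)})= D\bigl(f(\mu_n^{(k+p)})\bigr)+\sum_{q\ge1}\ \sum_{\substack{p_0+\cdots+p_q+q=p\\ S_0\sqcup \cdots\sqcup S_{q}=\underline{n}}} f(\mu^{(k+p_{q})}_{S_{q}\sqcup\{\star\}})\circ_\star f(\mu^{(p_{q-1})}_{S_{q-1}\sqcup\{\star\}})\circ_\star\cdots\circ_\star f(\mu^{(p_1)}_{S_1\sqcup\{\star\}}) \circ_\star D(f(\mu^{(p_0)}_{S_0})).$$ The assignment $a\mapsto Y(a)$ is a Lie algebra homomorphism from $\mathrm{Der}(\mathcal O)[[z]]$ to the Lie algebra of vector fields on $\mathrm{Hom}_{\mathrm{Op}}(\mathrm{HyperCom}_d,\mathcal O)$: for all $a,a'\in\mathrm{Der}(\mathcal O)[[z]]$, we have $Y([a,a'])=[Y(a),Y(a')]$.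
   Context: Ground field of characteristic zero; operads are in graded vector spaces with Koszul signs; $\underline{n}=\{1,\dots,n\}$. In the formula, the sum runs over ordered set partitions with $|S_0|\ge2$ and $S_1,\dots,S_q\ne\varnothing$ and over integers $p_i\ge0$; $\mu_S^{(p)}$ is $\mu_{|S|}^{(p)}$ with inputs labelled by $S$, and compositions are nested, each operation being inserted into the slot $\star$ of the operation to its left. $\mathrm{HyperCom}_d$ is the homology operad of the operad of Chen--Gibney--Krashen spaces $\overline{\mathcal{CGK}}_d(n)$ (the compactification, as the closure in $\prod_{K\subseteq\underline n,|K|\ge2}\mathbb{P}((\mathbb{C}^d)^K/\mathbb{C}^d)$, of the space of configurations of $n$ points in $\mathbb{C}^d$ modulo translations and homotheties, with compositions given by inclusions of boundary divisors). Algebraically, it is the operad generated by totally symmetric operations $\mu_n^{(p)}$, $n\ge2$, $p\ge0$, of homological degree $2(d(n-1)-1-p)$ with the defining relations, for all $n\ge2$, $i\ne j\in\underline{n}$, $m\ge d$: $$\sum_{q\ge1}\sum_{\substack{S_1\sqcup \cdots\sqcup S_q=\underline{n}\\ S_1,\ldots,S_q\ne\varnothing,\ \{i,j\}\subseteq S_1}}\sum_{p_1+\cdots+p_q+q-1=m}\mu^{(p_q)}_{S_q\sqcup\{\star\}}\circ_\star\cdots\circ_\star\mu^{(p_2)}_{S_2\sqcup\{\star\}}\circ_\star\mu^{(p_1)}_{S_1}=0.$$ It is concentrated in non-negative degrees; in particular $\mu_n^{(p)}=0$ for $p>d(n-1)-1$, so for fixed $n,k$ only finitely many powers of $z$ contribute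 to the formula. $\mathrm{Der}(\mathcal O)$ is the graded Lie algebra of operadic derivations of $\mathcal O$; the bracket on $\mathrm{Der}(\mathcal O)[[z]]$ is $z$-bilinear ($z$ of even degree). $\mathrm{Hom}_{\mathrm{Op}}(\mathrm{HyperCom}_d,\mathcal O)$ is the set of operad morphisms, viewed as a (pro-)algebraic variety with coordinates the images of the generators. For $f$ in it, an $f$-derivation is a map $E\colon\mathrm{HyperCom}_d\to\mathcal O$ of species with $E(u\circ_\star v)=E(u)\circ_\star f(v)+ f(u)\circ_\star E(v)$ (with Koszul signs if $E$ has non-zero degree). The tangent space at $f$ is the space of $f$-derivations, and a vector field assigns to each $f$ an $f$-derivation, algebraically in $f$. The bracket of vector fields is normalized as $[V,W](f)=d_fV(W(f))-d_fW(V(f))$ (with Koszul signs), so that linear vector fields $v_A\colon x\mapsto Ax$ satisfy $[v_A,v_B]=v_{[A,B]}$. *)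

theory Defs
  imports Complex_Main "HOL-Library.Function_Algebras" "HOL-Library.Groups_Big_Fun"
begin

section \<open>Operads in graded vector spaces\<close>

text \<open>
  Operads are treated as species: there is a component for every finite set of labels, the labels
  being natural numbers. The set \<open>{1..n}\<close> is the standard set of \<open>n\<close> labels, and the label \<open>0\<close>
  plays the role of \<open>\<star>\<close>. All elements are homogeneous: \<open>op_space P I j\<close> is the degree \<open>j\<close> part of
  the component on the set \<open>I\<close>, and \<open>op_comp P s x y\<close> is \<open>x \<circ>\<^sub>s y\<close>, which inserts \<open>y\<close> into the
  input \<open>s\<close> of \<open>x\<close>. Addition is a field of the record because the operad \<open>HyperCom\<close> below
  consists of equivalence classes, whose type is not an additive group.
\<close>

record ('k, 'x) operad_str =
  op_space :: "nat set \<Rightarrow> int \<Rightarrow> 'x set"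
  op_add :: "'x \<Rightarrow> 'x \<Rightarrow> 'x"
  op_scale :: "'k \<Rightarrow> 'x \<Rightarrow> 'x"
  op_relabel :: "(nat \<Rightarrow> nat) \<Rightarrow> 'x \<Rightarrow> 'x"
  op_comp :: "nat \<Rightarrow> 'x \<Rightarrow> 'x \<Rightarrow> 'x"
  op_unit :: "nat \<Rightarrow> 'x"

text \<open>The Koszul sign \<open>(-1)\<^bsup>ij\<^esup>\<close>.\<close>

definition ksgn :: "int \<Rightarrow> int \<Rightarrow> 'k::ring_1" where
  "ksgn i j = (if odd i \<and> odd j then - 1 else 1)"

text \<open>
  The components of an operad are subspaces of one ambient vector space in which their sum over all
  label sets and all degrees is direct (\<open>direct\<close>); any operad can be put into this form. Thus a
  non-zero element determines its label set and its degree. Since \<open>op_comp s x y\<close> removes the label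
  \<open>s\<close> of \<open>x\<close>, the element \<open>y\<close> is allowed to have an input labelled \<open>s\<close>.
\<close>

locale operad =
  fixes P :: "('k::field_char_0, 'a::ab_group_add) operad_str"
  assumes add: "op_add P = (+)"
    and vector_space: "vector_space (op_scale P)"
    and space_infinite: "infinite I \<Longrightarrow> op_space P I j = {}"
    and subspace: "finite I \<Longrightarrow> module.subspace (op_scale P) (op_space P I j)"
    and direct: "\<lbrakk>finite Q; \<And>I j. (I, j) \<in> Q \<Longrightarrow> w (I, j) \<in> op_space P I j; (\<Sum>q\<in>Q. w q) = 0;
        q \<in> Q\<rbrakk> \<Longrightarrow> w q = 0"
    and relabel_space: "\<lbrakk>x \<in> op_space P I i; inj_on \<sigma> I\<rbrakk> \<Longrightarrow> op_relabel P \<sigma> x \<in> op_space P (\<sigma> ` I) i"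
    and relabel_add: "\<lbrakk>x \<in> op_space P I i; y \<in> op_space P I i; inj_on \<sigma> I\<rbrakk> \<Longrightarrow>
        op_relabel P \<sigma> (x + y) = op_relabel P \<sigma> x + op_relabel P \<sigma> y"
    and relabel_scale: "\<lbrakk>x \<in> op_space P I i; inj_on \<sigma> I\<rbrakk> \<Longrightarrow>
        op_relabel P \<sigma> (op_scale P c x) = op_scale P c (op_relabel P \<sigma> x)"
    and relabel_cong: "\<lbrakk>x \<in> op_space P I i; inj_on \<sigma> I; \<And>a. a \<in> I \<Longrightarrow> \<sigma> a = \<tau> a\<rbrakk> \<Longrightarrow>
        op_relabel P \<sigma> x = op_relabel P \<tau> x"
    and relabel_id: "x \<in> op_space P I i \<Longrightarrow> op_relabel P id x = x"
    and relabel_relabel: "\<lbrakk>x \<in> op_space P I i; inj_on \<sigma> I; inj_on \<tau> (\<sigma> ` I)\<rbrakk> \<Longrightarrow>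
        op_relabel P \<tau> (op_relabel P \<sigma> x) = op_relabel P (\<tau> \<circ> \<sigma>) x"
    and comp_space: "\<lbrakk>x \<in> op_space P I i; y \<in> op_space P J j; s \<in> I; (I - {s}) \<inter> J = {}\<rbrakk> \<Longrightarrow>
        op_comp P s x y \<in> op_space P ((I - {s}) \<union> J) (i + j)"
    and comp_add_left: "\<lbrakk>x \<in> op_space P I i; x' \<in> op_space P I i; y \<in> op_space P J j; s \<in> I;
        (I - {s}) \<inter> J = {}\<rbrakk> \<Longrightarrow> op_comp P s (x + x') y = op_comp P s x y + op_comp P s x' y"
    and comp_add_right: "\<lbrakk>x \<in> op_space P I i; y \<in> op_space P J j; y' \<in> op_space P J j; s \<in> I;
        (I - {s}) \<inter> J = {}\<rbrakk> \<Longrightarrow> op_comp P s x (y + y') = op_comp P s x y + op_comp P s x y'"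
    and comp_scale_left: "\<lbrakk>x \<in> op_space P I i; y \<in> op_space P J j; s \<in> I; (I - {s}) \<inter> J = {}\<rbrakk> \<Longrightarrow>
        op_comp P s (op_scale P c x) y = op_scale P c (op_comp P s x y)"
    and comp_scale_right: "\<lbrakk>x \<in> op_space P I i; y \<in> op_space P J j; s \<in> I; (I - {s}) \<inter> J = {}\<rbrakk> \<Longrightarrow>
        op_comp P s x (op_scale P c y) = op_scale P c (op_comp P s x y)"
    and comp_relabel: "\<lbrakk>x \<in> op_space P I i; y \<in> op_space P J j; s \<in> I; (I - {s}) \<inter> J = {};
        inj_on \<sigma> ((I - {s}) \<union> J); inj_on \<tau> I; \<And>a. a \<in> I - {s} \<Longrightarrow> \<tau> a = \<sigma> a\<rbrakk> \<Longrightarrow>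
        op_relabel P \<sigma> (op_comp P s x y) = op_comp P (\<tau> s) (op_relabel P \<tau> x) (op_relabel P \<sigma> y)"
    and comp_sequential: "\<lbrakk>x \<in> op_space P I i; y \<in> op_space P J j; z \<in> op_space P K k; s \<in> I; t \<in> J;
        (I - {s}) \<inter> J = {}; (J - {t}) \<inter> K = {}; (I - {s}) \<inter> K = {}\<rbrakk> \<Longrightarrow>
        op_comp P t (op_comp P s x y) z = op_comp P s x (op_comp P t y z)"
    and comp_parallel: "\<lbrakk>x \<in> op_space P I i; y \<in> op_space P J j; z \<in> op_space P K k; s \<in> I; t \<in> I;
        s \<noteq> t; (I - {s}) \<inter> J = {}; (I - {t}) \<inter> K = {}; J \<inter> K = {}\<rbrakk> \<Longrightarrow>
        op_comp P t (op_comp P s x y) z = op_scale P (ksgn j k) (op_comp P s (op_comp P t x z) y)"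
    and unit_space: "op_unit P a \<in> op_space P {a} 0"
    and relabel_unit: "op_relabel P \<sigma> (op_unit P a) = op_unit P (\<sigma> a)"
    and unit_comp: "y \<in> op_space P J j \<Longrightarrow> op_comp P a (op_unit P a) y = y"
    and comp_unit: "\<lbrakk>x \<in> op_space P I i; s \<in> I; a \<notin> I - {s}\<rbrakk> \<Longrightarrow>
        op_comp P s x (op_unit P a) = op_relabel P (id(s := a)) x"

definition operad_hom :: "('k, 'x) operad_str \<Rightarrow> ('k, 'y) operad_str \<Rightarrow> ('x \<Rightarrow> 'y) \<Rightarrow> bool" where
  "operad_hom P Q f \<longleftrightarrow>
     (\<forall>I j. \<forall>u\<in>op_space P I j. f u \<in> op_space Q I j) \<and>
     (\<forall>I j. \<forall>u\<in>op_space P I j. \<forall>v\<in>op_space P I j. f (op_add P u v) = op_add Q (f u) (f v)) \<and>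
     (\<forall>I j c. \<forall>u\<in>op_space P I j. f (op_scale P c u) = op_scale Q c (f u)) \<and>
     (\<forall>I j \<sigma>. \<forall>u\<in>op_space P I j. inj_on \<sigma> I \<longrightarrow> f (op_relabel P \<sigma> u) = op_relabel Q \<sigma> (f u)) \<and>
     (\<forall>I i J j s. \<forall>u\<in>op_space P I i. \<forall>v\<in>op_space P J j. s \<in> I \<longrightarrow> (I - {s}) \<inter> J = {} \<longrightarrow>
        f (op_comp P s u v) = op_comp Q s (f u) (f v)) \<and>
     (\<forall>a. f (op_unit P a) = op_unit Q a)"

definition f_derivation ::
  "('k::ring_1, 'x) operad_str \<Rightarrow> ('k, 'y) operad_str \<Rightarrow> ('x \<Rightarrow> 'y) \<Rightarrow> int \<Rightarrow> ('x \<Rightarrow> 'y) \<Rightarrow> bool" where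
  "f_derivation P Q f e E \<longleftrightarrow>
     (\<forall>I j. \<forall>u\<in>op_space P I j. E u \<in> op_space Q I (j + e)) \<and>
     (\<forall>I j. \<forall>u\<in>op_space P I j. \<forall>v\<in>op_space P I j. E (op_add P u v) = op_add Q (E u) (E v)) \<and>
     (\<forall>I j c. \<forall>u\<in>op_space P I j. E (op_scale P c u) = op_scale Q c (E u)) \<and>
     (\<forall>I j \<sigma>. \<forall>u\<in>op_space P I j. inj_on \<sigma> I \<longrightarrow> E (op_relabel P \<sigma> u) = op_relabel Q \<sigma> (E u)) \<and>
     (\<forall>I i J j s. \<forall>u\<in>op_space P I i. \<forall>v\<in>op_space P J j. s \<in> I \<longrightarrow> (I - {s}) \<inter> J = {} \<longrightarrow>
        E (op_comp P s u v) =
          op_add Q (op_comp Q s (E u) (f v)) (op_scale Q (ksgn e i) (op_comp Q s (f u) (E v))))"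


section \<open>Derivations and power series of derivations\<close>

text \<open>
  An element of \<open>Der(P)\<close> is the direct sum of its homogeneous components: it is given by a family
  \<open>D\<close> with \<open>D e\<close> a derivation of degree \<open>e\<close>, almost all of which vanish.
\<close>

definition Der :: "('k::field_char_0, 'a::ab_group_add) operad_str \<Rightarrow> (int \<Rightarrow> 'a \<Rightarrow> 'a) set" where
  "Der P = {D. (\<forall>e. f_derivation P P (\<lambda>x. x) e (D e)) \<and>
               finite {e. \<exists>I j. \<exists>x\<in>op_space P I j. D e x \<noteq> 0}}"

text \<open>\<open>Der(P)[[z]]\<close>: \<open>a p\<close> is the coefficient of \<open>z\<^sup>p\<close>.\<close>

definition Der_series ::
  "('k::field_char_0, 'a::ab_group_add) operad_str \<Rightarrow> (nat \<Rightarrow> int \<Rightarrow> 'a \<Rightarrow> 'a) set" where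
  "Der_series P = {a. \<forall>p. a p \<in> Der P}"

definition z_monomial ::
  "(int \<Rightarrow> 'a \<Rightarrow> 'a::ab_group_add) \<Rightarrow> nat \<Rightarrow> nat \<Rightarrow> int \<Rightarrow> 'a \<Rightarrow> 'a" where
  "z_monomial D p = (\<lambda>p'. if p' = p then D else 0)"

text \<open>
  The \<open>z\<close>-bilinear extension of the graded commutator. \<open>Sum_any\<close> is the sum over the (finite) set of
  indices with a non-zero term.
\<close>

definition Der_bracket ::
  "('k::field_char_0, 'a::ab_group_add) operad_str \<Rightarrow> (nat \<Rightarrow> int \<Rightarrow> 'a \<Rightarrow> 'a) \<Rightarrow>
   (nat \<Rightarrow> int \<Rightarrow> 'a \<Rightarrow> 'a) \<Rightarrow> nat \<Rightarrow> int \<Rightarrow> 'a \<Rightarrow> 'a" where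
  "Der_bracket P a b = (\<lambda>p e x. \<Sum>r\<le>p. Sum_any (\<lambda>e1.
      a r e1 (b (p - r) (e - e1) x) -
      op_scale P (ksgn e1 (e - e1)) (b (p - r) (e - e1) (a r e1 x))))"


section \<open>The operad HyperCom\<close>

text \<open>
  The operad is constructed from its presentation: well-formed formal expressions in the generators
  \<open>Gen S p\<close> (that is, \<open>\<mu>\<^sub>S\<^bsup>(p)\<^esup>\<close>) modulo the congruence \<open>hc_eq\<close> generated by the axioms of operads,
  the total symmetry of the generators and the defining relations.
\<close>

datatype 'k hterm =
    Zero "nat set" int
  | Add "'k hterm" "'k hterm"
  | Scale 'k "'k hterm"
  | Relabel "nat \<Rightarrow> nat" "'k hterm"
  | Comp nat "'k hterm" "'k hterm"
  | Unit nat
  | Gen "nat set" nat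

definition mu_deg :: "nat \<Rightarrow> nat \<Rightarrow> nat \<Rightarrow> int" where
  "mu_deg d n p = 2 * (int d * (int n - 1) - 1 - int p)"

primrec arity :: "'k hterm \<Rightarrow> nat set" where
  "arity (Zero I j) = I"
| "arity (Add t u) = arity t"
| "arity (Scale c t) = arity t"
| "arity (Relabel \<sigma> t) = \<sigma> ` arity t"
| "arity (Comp s t u) = (arity t - {s}) \<union> arity u"
| "arity (Unit a) = {a}"
| "arity (Gen I p) = I"

primrec tdeg :: "nat \<Rightarrow> 'k hterm \<Rightarrow> int" where
  "tdeg d (Zero I j) = j"
| "tdeg d (Add t u) = tdeg d t"
| "tdeg d (Scale c t) = tdeg d t"
| "tdeg d (Relabel \<sigma> t) = tdeg d t"
| "tdeg d (Comp s t u) = tdeg d t + tdeg d u"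
| "tdeg d (Unit a) = 0"
| "tdeg d (Gen I p) = mu_deg d (card I) p"

primrec wf_term :: "nat \<Rightarrow> 'k hterm \<Rightarrow> bool" where
  "wf_term d (Zero I j) \<longleftrightarrow> finite I"
| "wf_term d (Add t u) \<longleftrightarrow> wf_term d t \<and> wf_term d u \<and> arity t = arity u \<and> tdeg d t = tdeg d u"
| "wf_term d (Scale c t) \<longleftrightarrow> wf_term d t"
| "wf_term d (Relabel \<sigma> t) \<longleftrightarrow> wf_term d t \<and> inj_on \<sigma> (arity t)"
| "wf_term d (Comp s t u) \<longleftrightarrow>
     wf_term d t \<and> wf_term d u \<and> s \<in> arity t \<and> (arity t - {s}) \<inter> arity u = {}"
| "wf_term d (Unit a) \<longleftrightarrow> True"
| "wf_term d (Gen I p) \<longleftrightarrow> finite I \<and> 2 \<le> card I"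

text \<open>Lists \<open>[S\<^sub>1, \<dots>, S\<^sub>q]\<close> of pairwise disjoint sets with union \<open>I\<close>; the sets may be empty.\<close>

definition set_splits :: "nat set \<Rightarrow> nat set list set" where
  "set_splits I = {Ss. sorted_wrt (\<lambda>A B. A \<inter> B = {}) Ss \<and> \<Union> (set Ss) = I}"

definition ordered_partitions :: "nat set \<Rightarrow> nat set list set" where
  "ordered_partitions I = {Ss \<in> set_splits I. {} \<notin> set Ss}"

text \<open>
  \<open>nest cmp g x [(S\<^sub>1, p\<^sub>1), \<dots>, (S\<^sub>q, p\<^sub>q)]\<close> is
  \<open>g (S\<^sub>q \<union> {\<star>}) p\<^sub>q \<circ>\<^sub>\<star> (\<dots> \<circ>\<^sub>\<star> (g (S\<^sub>1 \<union> {\<star>}) p\<^sub>1 \<circ>\<^sub>\<star> x))\<close>, with \<open>\<star> = 0\<close>.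
\<close>

definition nest ::
  "(nat \<Rightarrow> 'x \<Rightarrow> 'x \<Rightarrow> 'x) \<Rightarrow> (nat set \<Rightarrow> nat \<Rightarrow> 'x) \<Rightarrow> 'x \<Rightarrow> (nat set \<times> nat) list \<Rightarrow> 'x" where
  "nest cmp g x L = foldl (\<lambda>y (S, p). cmp 0 (g (insert 0 S) p) y) x L"

text \<open>The index set of the defining relation with parameters \<open>n, i, j, m\<close>.\<close>

definition rel_index :: "nat \<Rightarrow> nat \<Rightarrow> nat \<Rightarrow> nat \<Rightarrow> (nat set list \<times> nat list) set" where
  "rel_index n i j m = {(Ss, ps). Ss \<in> ordered_partitions {1..n} \<and> length ps = length Ss \<and>
      1 \<le> length Ss \<and> {i, j} \<subseteq> hd Ss \<and> sum_list ps + length Ss - 1 = m}"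

fun rel_term :: "nat set list \<times> nat list \<Rightarrow> 'k hterm" where
  "rel_term (Ss, ps) = nest Comp Gen (Gen (hd Ss) (hd ps)) (zip (tl Ss) (tl ps))"

inductive hc_eq :: "nat \<Rightarrow> 'k::field_char_0 hterm \<Rightarrow> 'k hterm \<Rightarrow> bool" for d :: nat where
  refl: "wf_term d t \<Longrightarrow> hc_eq d t t"
| sym: "hc_eq d t u \<Longrightarrow> hc_eq d u t"
| trans: "hc_eq d t u \<Longrightarrow> hc_eq d u v \<Longrightarrow> hc_eq d t v"
| cong_Add: "\<lbrakk>hc_eq d t t'; hc_eq d u u'; wf_term d (Add t u)\<rbrakk> \<Longrightarrow> hc_eq d (Add t u) (Add t' u')"
| cong_Scale: "hc_eq d t t' \<Longrightarrow> hc_eq d (Scale c t) (Scale c t')"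
| cong_Relabel: "\<lbrakk>hc_eq d t t'; wf_term d (Relabel \<sigma> t)\<rbrakk> \<Longrightarrow> hc_eq d (Relabel \<sigma> t) (Relabel \<sigma> t')"
| cong_Comp: "\<lbrakk>hc_eq d t t'; hc_eq d u u'; wf_term d (Comp s t u)\<rbrakk> \<Longrightarrow>
    hc_eq d (Comp s t u) (Comp s t' u')"
| add_assoc: "\<lbrakk>wf_term d (Add t u); wf_term d (Add u v)\<rbrakk> \<Longrightarrow>
    hc_eq d (Add (Add t u) v) (Add t (Add u v))"
| add_commute: "wf_term d (Add t u) \<Longrightarrow> hc_eq d (Add t u) (Add u t)"
| add_zero: "wf_term d t \<Longrightarrow> hc_eq d (Add t (Zero (arity t) (tdeg d t))) t"
| add_neg: "wf_term d t \<Longrightarrow> hc_eq d (Add t (Scale (- 1) t)) (Zero (arity t) (tdeg d t))"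
| scale_add: "wf_term d (Add t u) \<Longrightarrow> hc_eq d (Scale c (Add t u)) (Add (Scale c t) (Scale c u))"
| add_scale: "wf_term d t \<Longrightarrow> hc_eq d (Scale (c + c') t) (Add (Scale c t) (Scale c' t))"
| scale_scale: "wf_term d t \<Longrightarrow> hc_eq d (Scale c (Scale c' t)) (Scale (c * c') t)"
| scale_one: "wf_term d t \<Longrightarrow> hc_eq d (Scale 1 t) t"
| relabel_add: "wf_term d (Relabel \<sigma> (Add t u)) \<Longrightarrow>
    hc_eq d (Relabel \<sigma> (Add t u)) (Add (Relabel \<sigma> t) (Relabel \<sigma> u))"
| relabel_scale: "wf_term d (Relabel \<sigma> t) \<Longrightarrow>
    hc_eq d (Relabel \<sigma> (Scale c t)) (Scale c (Relabel \<sigma> t))"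
| relabel_cong: "\<lbrakk>wf_term d (Relabel \<sigma> t); \<And>a. a \<in> arity t \<Longrightarrow> \<sigma> a = \<tau> a\<rbrakk> \<Longrightarrow>
    hc_eq d (Relabel \<sigma> t) (Relabel \<tau> t)"
| relabel_id: "wf_term d t \<Longrightarrow> hc_eq d (Relabel id t) t"
| relabel_relabel: "wf_term d (Relabel \<tau> (Relabel \<sigma> t)) \<Longrightarrow>
    hc_eq d (Relabel \<tau> (Relabel \<sigma> t)) (Relabel (\<tau> \<circ> \<sigma>) t)"
| comp_add_left: "\<lbrakk>wf_term d (Add t t'); wf_term d (Comp s t u)\<rbrakk> \<Longrightarrow>
    hc_eq d (Comp s (Add t t') u) (Add (Comp s t u) (Comp s t' u))"
| comp_add_right: "\<lbrakk>wf_term d (Add u u'); wf_term d (Comp s t u)\<rbrakk> \<Longrightarrow>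
    hc_eq d (Comp s t (Add u u')) (Add (Comp s t u) (Comp s t u'))"
| comp_scale_left: "wf_term d (Comp s t u) \<Longrightarrow>
    hc_eq d (Comp s (Scale c t) u) (Scale c (Comp s t u))"
| comp_scale_right: "wf_term d (Comp s t u) \<Longrightarrow>
    hc_eq d (Comp s t (Scale c u)) (Scale c (Comp s t u))"
| comp_relabel: "\<lbrakk>wf_term d (Relabel \<sigma> (Comp s t u)); inj_on \<tau> (arity t);
    \<And>a. a \<in> arity t - {s} \<Longrightarrow> \<tau> a = \<sigma> a\<rbrakk> \<Longrightarrow>
    hc_eq d (Relabel \<sigma> (Comp s t u)) (Comp (\<tau> s) (Relabel \<tau> t) (Relabel \<sigma> u))"
| comp_sequential: "\<lbrakk>wf_term d (Comp s t u); wf_term d (Comp r u v);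
    (arity t - {s}) \<inter> arity v = {}\<rbrakk> \<Longrightarrow>
    hc_eq d (Comp r (Comp s t u) v) (Comp s t (Comp r u v))"
| comp_parallel: "\<lbrakk>wf_term d (Comp s t u); wf_term d (Comp r t v); s \<noteq> r;
    arity u \<inter> arity v = {}\<rbrakk> \<Longrightarrow>
    hc_eq d (Comp r (Comp s t u) v)
      (Scale (ksgn (tdeg d u) (tdeg d v)) (Comp s (Comp r t v) u))"
| relabel_unit: "hc_eq d (Relabel \<sigma> (Unit a)) (Unit (\<sigma> a))"
| unit_comp: "wf_term d u \<Longrightarrow> hc_eq d (Comp a (Unit a) u) u"
| comp_unit: "\<lbrakk>wf_term d t; s \<in> arity t; a \<notin> arity t - {s}\<rbrakk> \<Longrightarrow>
    hc_eq d (Comp s t (Unit a)) (Relabel (id(s := a)) t)"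
| symmetric: "\<lbrakk>finite I; 2 \<le> card I; inj_on \<sigma> I\<rbrakk> \<Longrightarrow>
    hc_eq d (Relabel \<sigma> (Gen I p)) (Gen (\<sigma> ` I) p)"
| defining_relation: "\<lbrakk>2 \<le> n; i \<in> {1..n}; j \<in> {1..n}; i \<noteq> j; d \<le> m;
    distinct L; set L = rel_index n i j m\<rbrakk> \<Longrightarrow>
    hc_eq d (foldr Add (map rel_term L) (Zero {1..n} (mu_deg d n m))) (Zero {1..n} (mu_deg d n m))"

definition hc_class :: "nat \<Rightarrow> 'k::field_char_0 hterm \<Rightarrow> 'k hterm set" where
  "hc_class d t = {u. hc_eq d t u}"

definition rep :: "'k hterm set \<Rightarrow> 'k hterm" where
  "rep u = (SOME t. t \<in> u)"

definition HyperCom :: "nat \<Rightarrow> ('k::field_char_0, 'k hterm set) operad_str" where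
  "HyperCom d = \<lparr>
     op_space = (\<lambda>I j. {hc_class d t |t. wf_term d t \<and> arity t = I \<and> tdeg d t = j}),
     op_add = (\<lambda>u v. hc_class d (Add (rep u) (rep v))),
     op_scale = (\<lambda>c u. hc_class d (Scale c (rep u))),
     op_relabel = (\<lambda>\<sigma> u. hc_class d (Relabel \<sigma> (rep u))),
     op_comp = (\<lambda>s u v. hc_class d (Comp s (rep u) (rep v))),
     op_unit = (\<lambda>a. hc_class d (Unit a)) \<rparr>"

definition mu :: "nat \<Rightarrow> nat set \<Rightarrow> nat \<Rightarrow> 'k::field_char_0 hterm set" where
  "mu d S p = hc_class d (Gen S p)"


section \<open>The graded variety of morphisms\<close>

text \<open>
  The derivative of a vector field on the variety of morphisms has to be taken along
  \<open>f\<close>-derivations of any degree. For a direction of non-zero degree this involves points of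
  the graded variety with values in graded commutative algebras, not just points over the ground
  field. The algebras used are the graded multiple dual numbers
  \<open>A\<^sub>\<delta> = k[\<epsilon>\<^sub>0, \<dots>, \<epsilon>\<^bsub>r-1\<^esub>] / (\<epsilon>\<^sub>0\<^sup>2, \<dots>, \<epsilon>\<^bsub>r-1\<^esub>\<^sup>2)\<close> with \<open>\<epsilon>\<^sub>i\<close> of degree \<open>\<delta>\<^sub>i\<close>, where \<open>\<delta>\<close> is a list of
  length \<open>r\<close>; the empty list gives the ground field. A basis of \<open>A\<^sub>\<delta>\<close> consists of the products
  \<open>\<epsilon>\<^sub>S\<close> of the \<open>\<epsilon>\<^sub>i\<close>, \<open>i \<in> S\<close>, in increasing order, for \<open>S \<subseteq> {..<r}\<close>. An element
  \<open>\<Sum>\<^sub>S x\<^sub>S \<otimes> \<epsilon>\<^sub>S\<close> of \<open>P \<otimes> A\<^sub>\<delta>\<close> is encoded as the function \<open>S \<mapsto> x\<^sub>S\<close>, with value \<open>0\<close> unless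
  \<open>S \<subseteq> {..<r}\<close>.
\<close>

definition eps_deg :: "int list \<Rightarrow> nat set \<Rightarrow> int" where
  "eps_deg \<delta> S = (\<Sum>i\<in>S. \<delta> ! i)"

text \<open>For disjoint \<open>S\<close>, \<open>T\<close>, this is the sign in \<open>\<epsilon>\<^sub>S \<epsilon>\<^sub>T = \<plusminus> \<epsilon>\<^bsub>S \<union> T\<^esub>\<close>.\<close>

definition eps_sign :: "int list \<Rightarrow> nat set \<Rightarrow> nat set \<Rightarrow> 'k::comm_ring_1" where
  "eps_sign \<delta> S T = (\<Prod>s\<in>S. \<Prod>t\<in>T. if t < s then ksgn (\<delta> ! s) (\<delta> ! t) else 1)"

text \<open>The degree of a non-zero homogeneous element.\<close>

definition degree_of :: "('k, 'a) operad_str \<Rightarrow> 'a \<Rightarrow> int" where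
  "degree_of P x = (SOME j. \<exists>I. x \<in> op_space P I j)"

text \<open>
  The operad \<open>P \<otimes> A\<^sub>\<delta>\<close>, with composition
  \<open>(x \<otimes> \<epsilon>\<^sub>T) \<circ>\<^sub>s (y \<otimes> \<epsilon>\<^sub>U) = (-1)\<^bsup>|\<epsilon>\<^sub>T||y|\<^esup> (x \<circ>\<^sub>s y) \<otimes> \<epsilon>\<^sub>T \<epsilon>\<^sub>U\<close>.
\<close>

definition base_change ::
  "('k::field_char_0, 'a::ab_group_add) operad_str \<Rightarrow> int list \<Rightarrow> ('k, nat set \<Rightarrow> 'a) operad_str" where
  "base_change P \<delta> = \<lparr>
     op_space = (\<lambda>I j. {X. (\<forall>S. S \<subseteq> {..<length \<delta>} \<longrightarrow> X S \<in> op_space P I (j - eps_deg \<delta> S)) \<and>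
                          (\<forall>S. \<not> S \<subseteq> {..<length \<delta>} \<longrightarrow> X S = 0)}),
     op_add = (+),
     op_scale = (\<lambda>c X S. op_scale P c (X S)),
     op_relabel = (\<lambda>\<sigma> X S. op_relabel P \<sigma> (X S)),
     op_comp = (\<lambda>s X Y S. if S \<subseteq> {..<length \<delta>} then
         (\<Sum>T\<in>Pow S. op_scale P
             (ksgn (eps_deg \<delta> T) (degree_of P (Y (S - T))) * eps_sign \<delta> T (S - T))
             (op_comp P s (X T) (Y (S - T))))
       else 0),
     op_unit = (\<lambda>a S. if S = {} then op_unit P a else 0) \<rparr>"

text \<open>The extension \<open>D \<otimes> 1\<close> to \<open>P \<otimes> A\<^sub>\<delta>\<close> of a linear map \<open>D\<close>.\<close>

definition extend_map :: "('a \<Rightarrow> 'a) \<Rightarrow> (nat set \<Rightarrow> 'a) \<Rightarrow> nat set \<Rightarrow> 'a" where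
  "extend_map D X = (\<lambda>S. D (X S))"

text \<open>
  The points over \<open>A\<^sub>\<delta>\<close> of the variety of operad morphisms from \<open>HyperCom d\<close> to \<open>P\<close>.
\<close>

definition Hom_points ::
  "nat \<Rightarrow> ('k::field_char_0, 'a::ab_group_add) operad_str \<Rightarrow> int list \<Rightarrow>
   ('k hterm set \<Rightarrow> nat set \<Rightarrow> 'a) set" where
  "Hom_points d P \<delta> = {f. operad_hom (HyperCom d) (base_change P \<delta>) f}"


section \<open>Vector fields\<close>

text \<open>
  For a list \<open>gs = [(m\<^sub>1, l\<^sub>1), \<dots>]\<close>, a multilinear map \<open>P(m\<^sub>1) \<otimes> P(m\<^sub>2) \<otimes> \<dots> \<rightarrow> P(n)\<close> of
  degree \<open>c\<close>, where \<open>P(m)\<close> is the component on \<open>{1..m}\<close>, with arguments given as a list.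
\<close>

definition graded_multilinear ::
  "('k::field_char_0, 'a::ab_group_add) operad_str \<Rightarrow> (nat \<times> nat) list \<Rightarrow> nat \<Rightarrow> int \<Rightarrow>
   ('a list \<Rightarrow> 'a) \<Rightarrow> bool" where
  "graded_multilinear P gs n c T \<longleftrightarrow>
     (\<forall>xs js. length xs = length gs \<longrightarrow> length js = length gs \<longrightarrow>
        (\<forall>i<length gs. xs ! i \<in> op_space P {1..fst (gs ! i)} (js ! i)) \<longrightarrow>
        T xs \<in> op_space P {1..n} (sum_list js + c) \<and>
        (\<forall>i<length gs. \<forall>y\<in>op_space P {1..fst (gs ! i)} (js ! i).
           T (xs[i := xs ! i + y]) = T xs + T (xs[i := y])) \<and>
        (\<forall>i<length gs. \<forall>b. T (xs[i := op_scale P b (xs ! i)]) = op_scale P b (T xs)))"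

text \<open>
  The \<open>A\<^sub>\<delta>\<close>-multilinear extension of \<open>T\<close>: it maps \<open>x\<^sub>1 \<otimes> \<epsilon>\<^bsub>T1\<^esub>, x\<^sub>2 \<otimes> \<epsilon>\<^bsub>T2\<^esub>, \<dots>\<close> to
  \<open>\<plusminus> T(x\<^sub>1, x\<^sub>2, \<dots>) \<otimes> \<epsilon>\<^bsub>T1\<^esub> \<epsilon>\<^bsub>T2\<^esub> \<dots>\<close> with the sign from moving each \<open>\<epsilon>\<close> past the later \<open>x\<close>.
\<close>

definition extend_multilinear ::
  "('k::field_char_0, 'a::ab_group_add) operad_str \<Rightarrow> int list \<Rightarrow> ('a list \<Rightarrow> 'a) \<Rightarrow>
   (nat set \<Rightarrow> 'a) list \<Rightarrow> nat set \<Rightarrow> 'a" where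
  "extend_multilinear P \<delta> T Xs = (\<lambda>S. if S \<subseteq> {..<length \<delta>} then
     (\<Sum>Us\<in>{Us \<in> set_splits S. length Us = length Xs}.
        op_scale P
          (\<Prod>b<length Xs. \<Prod>a<b. ksgn (eps_deg \<delta> (Us ! a)) (degree_of P ((Xs ! b) (Us ! b))) *
                                eps_sign \<delta> (Us ! a) (Us ! b))
          (T (map2 (\<lambda>X U. X U) Xs Us)))
     else 0)"

text \<open>
  A vector field of degree \<open>e\<close> assigns to each point \<open>f\<close> an \<open>f\<close>-derivation of degree \<open>e\<close> whose value
  on each generator is a polynomial in the coordinates \<open>f(\<mu>\<^sub>m\<^bsup>(l)\<^esup>)\<close>. A polynomial is a finite
  sum of monomials \<open>T(f(\<mu>\<^bsub>m1\<^esub>\<^bsup>(l1)\<^esup>), f(\<mu>\<^bsub>m2\<^esub>\<^bsup>(l2)\<^esup>), \<dots>)\<close> with \<open>T\<close> graded multilinear; the same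
  polynomial is used for points over all \<open>A\<^sub>\<delta>\<close>.
\<close>

definition homogeneous_vector_field ::
  "nat \<Rightarrow> ('k::field_char_0, 'a::ab_group_add) operad_str \<Rightarrow> int \<Rightarrow>
   (int list \<Rightarrow> ('k hterm set \<Rightarrow> nat set \<Rightarrow> 'a) \<Rightarrow> 'k hterm set \<Rightarrow> nat set \<Rightarrow> 'a) \<Rightarrow> bool" where
  "homogeneous_vector_field d P e V \<longleftrightarrow>
     (\<forall>\<delta>. \<forall>f\<in>Hom_points d P \<delta>. f_derivation (HyperCom d) (base_change P \<delta>) f e (V \<delta> f)) \<and>
     (\<forall>n k. 2 \<le> n \<longrightarrow> (\<exists>Ms.
        (\<forall>(gs, T)\<in>set Ms. (\<forall>(m, l)\<in>set gs. 2 \<le> m) \<and>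
           graded_multilinear P gs n (e + mu_deg d n k - (\<Sum>(m, l)\<leftarrow>gs. mu_deg d m l)) T) \<and>
        (\<forall>\<delta>. \<forall>f\<in>Hom_points d P \<delta>.
           V \<delta> f (mu d {1..n} k) =
             (\<Sum>(gs, T)\<leftarrow>Ms. extend_multilinear P \<delta> T (map (\<lambda>(m, l). f (mu d {1..m} l)) gs)))))"

text \<open>
  A vector field is a sum of homogeneous components \<open>V e\<close> of degrees \<open>e\<close>; only finitely many of them
  are non-zero on any given generator, so that the values of the sum are polynomial as well.
\<close>

definition vector_field ::
  "nat \<Rightarrow> ('k::field_char_0, 'a::ab_group_add) operad_str \<Rightarrow>
   (int \<Rightarrow> int list \<Rightarrow> ('k hterm set \<Rightarrow> nat set \<Rightarrow> 'a) \<Rightarrow> 'k hterm set \<Rightarrow> nat set \<Rightarrow> 'a) \<Rightarrow> bool" where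
  "vector_field d P V \<longleftrightarrow>
     (\<forall>e. homogeneous_vector_field d P e (V e)) \<and>
     (\<forall>n k. 2 \<le> n \<longrightarrow> finite {e. \<exists>\<delta>. \<exists>f\<in>Hom_points d P \<delta>. V e \<delta> f (mu d {1..n} k) \<noteq> 0})"

definition vf_eq ::
  "nat \<Rightarrow> ('k::field_char_0, 'a::ab_group_add) operad_str \<Rightarrow>
   (int \<Rightarrow> int list \<Rightarrow> ('k hterm set \<Rightarrow> nat set \<Rightarrow> 'a) \<Rightarrow> 'k hterm set \<Rightarrow> nat set \<Rightarrow> 'a) \<Rightarrow>
   (int \<Rightarrow> int list \<Rightarrow> ('k hterm set \<Rightarrow> nat set \<Rightarrow> 'a) \<Rightarrow> 'k hterm set \<Rightarrow> nat set \<Rightarrow> 'a) \<Rightarrow> bool" where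
  "vf_eq d P V W \<longleftrightarrow>
     (\<forall>e \<delta>. \<forall>f\<in>Hom_points d P \<delta>. \<forall>I j. \<forall>u\<in>op_space (HyperCom d) I j. V e \<delta> f u = W e \<delta> f u)"

text \<open>
  For an \<open>f\<close>-derivation \<open>E\<close> of degree \<open>e\<close>, the point \<open>f + E \<epsilon>\<close> over \<open>A\<^sub>\<delta>[\<epsilon>]/(\<epsilon>\<^sup>2)\<close> with \<open>\<epsilon>\<close> of degree
  \<open>-e\<close>, and the derivative \<open>d\<^sub>fV(E)\<close>, defined by \<open>V(f + E \<epsilon>) = V(f) + d\<^sub>fV(E) \<epsilon>\<close>.
\<close>

definition tangent_point ::
  "int list \<Rightarrow> ('h \<Rightarrow> nat set \<Rightarrow> 'a) \<Rightarrow> ('h \<Rightarrow> nat set \<Rightarrow> 'a) \<Rightarrow> 'h \<Rightarrow> nat set \<Rightarrow> 'a" where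
  "tangent_point \<delta> f E = (\<lambda>u S. if length \<delta> \<in> S then E u (S - {length \<delta>}) else f u S)"

definition dir_deriv ::
  "(int list \<Rightarrow> ('h \<Rightarrow> nat set \<Rightarrow> 'a) \<Rightarrow> 'h \<Rightarrow> nat set \<Rightarrow> 'a::ab_group_add) \<Rightarrow>
   int list \<Rightarrow> ('h \<Rightarrow> nat set \<Rightarrow> 'a) \<Rightarrow> int \<Rightarrow> ('h \<Rightarrow> nat set \<Rightarrow> 'a) \<Rightarrow> 'h \<Rightarrow> nat set \<Rightarrow> 'a" where
  "dir_deriv V \<delta> f e E = (\<lambda>u S. if S \<subseteq> {..<length \<delta>}
     then V (\<delta> @ [- e]) (tangent_point \<delta> f E) u (insert (length \<delta>) S) else 0)"

text \<open>
  The bracket: on homogeneous components, \<open>[V, W](f) = d\<^sub>fV(W(f)) - (-1)\<^bsup>|V||W|\<^esup> d\<^sub>fW(V(f))\<close>.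
\<close>

definition vf_bracket ::
  "('k::field_char_0, 'a::ab_group_add) operad_str \<Rightarrow>
   (int \<Rightarrow> int list \<Rightarrow> ('h \<Rightarrow> nat set \<Rightarrow> 'a) \<Rightarrow> 'h \<Rightarrow> nat set \<Rightarrow> 'a) \<Rightarrow>
   (int \<Rightarrow> int list \<Rightarrow> ('h \<Rightarrow> nat set \<Rightarrow> 'a) \<Rightarrow> 'h \<Rightarrow> nat set \<Rightarrow> 'a) \<Rightarrow>
   int \<Rightarrow> int list \<Rightarrow> ('h \<Rightarrow> nat set \<Rightarrow> 'a) \<Rightarrow> 'h \<Rightarrow> nat set \<Rightarrow> 'a" where
  "vf_bracket P V W = (\<lambda>e \<delta> f u. Sum_any (\<lambda>e1.
     dir_deriv (V e1) \<delta> f (e - e1) (W (e - e1) \<delta> f) u -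
     op_scale (base_change P \<delta>) (ksgn e1 (e - e1))
       (dir_deriv (W (e - e1)) \<delta> f e1 (V e1 \<delta> f) u)))"


section \<open>The action\<close>

text \<open>The index set of the formula: lists \<open>[S\<^sub>0, \<dots>, S\<^sub>q]\<close> and \<open>[p\<^sub>0, \<dots>, p\<^sub>q]\<close> with \<open>q \<ge> 1\<close>.\<close>

definition action_index :: "nat \<Rightarrow> nat \<Rightarrow> (nat set list \<times> nat list) set" where
  "action_index n p = {(Ss, ps). Ss \<in> ordered_partitions {1..n} \<and> length ps = length Ss \<and>
      2 \<le> length Ss \<and> 2 \<le> card (hd Ss) \<and> sum_list ps + (length Ss - 1) = p}"

text \<open>
  The value on \<open>\<mu>\<^sub>n\<^bsup>(k)\<^esup>\<close> of the vector field for \<open>D z\<^sup>p\<close> at the point \<open>f\<close> over \<open>A\<^sub>\<delta>\<close>, for a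
  homogeneous derivation \<open>D\<close>.
\<close>

definition action_formula ::
  "nat \<Rightarrow> ('k::field_char_0, 'a::ab_group_add) operad_str \<Rightarrow> ('a \<Rightarrow> 'a) \<Rightarrow> nat \<Rightarrow> int list \<Rightarrow>
   ('k hterm set \<Rightarrow> nat set \<Rightarrow> 'a) \<Rightarrow> nat \<Rightarrow> nat \<Rightarrow> nat set \<Rightarrow> 'a" where
  "action_formula d P D p \<delta> f n k =
     extend_map D (f (mu d {1..n} (k + p))) +
     (\<Sum>(Ss, ps)\<in>action_index n p.
        nest (op_comp (base_change P \<delta>)) (\<lambda>S r. f (mu d S r))
          (extend_map D (f (mu d (hd Ss) (hd ps))))
          (zip (tl Ss) (butlast (tl ps) @ [k + last ps])))"

text \<open>
  The assignment of vector fields \<open>Y(a)\<close> to \<open>a \<in> Der(P)[[z]]\<close> is linear, including infinite sums over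
  powers of \<open>z\<close>, and is given by the formula on monomials. If \<open>D\<close> has degree \<open>e\<close>, then \<open>D z\<^sup>p\<close>
  and its vector field have degree \<open>e - 2p\<close>.
\<close>

definition action_assignment ::
  "nat \<Rightarrow> ('k::field_char_0, 'a::ab_group_add) operad_str \<Rightarrow>
   ((nat \<Rightarrow> int \<Rightarrow> 'a \<Rightarrow> 'a) \<Rightarrow>
     int \<Rightarrow> int list \<Rightarrow> ('k hterm set \<Rightarrow> nat set \<Rightarrow> 'a) \<Rightarrow> 'k hterm set \<Rightarrow> nat set \<Rightarrow> 'a) \<Rightarrow> bool" where
  "action_assignment d P Y \<longleftrightarrow>
     (\<forall>a\<in>Der_series P. vector_field d P (Y a)) \<and>
     (\<forall>a\<in>Der_series P. \<forall>b\<in>Der_series P. vf_eq d P (Y (a + b)) (Y a + Y b)) \<and>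
     (\<forall>c. \<forall>a\<in>Der_series P. vf_eq d P (Y (\<lambda>p e x. op_scale P c (a p e x)))
        (\<lambda>e \<delta> f u. op_scale (base_change P \<delta>) c (Y a e \<delta> f u))) \<and>
     (\<forall>a\<in>Der_series P. \<forall>e \<delta>. \<forall>f\<in>Hom_points d P \<delta>. \<forall>I j. \<forall>u\<in>op_space (HyperCom d) I j.
        finite {p. Y (z_monomial (a p) p) e \<delta> f u \<noteq> 0} \<and>
        Y a e \<delta> f u = Sum_any (\<lambda>p. Y (z_monomial (a p) p) e \<delta> f u)) \<and>
     (\<forall>D\<in>Der P. \<forall>p n k. 2 \<le> n \<longrightarrow> (\<forall>e \<delta>. \<forall>f\<in>Hom_points d P \<delta>.
        Y (z_monomial D p) (e - 2 * int p) \<delta> f (mu d {1..n} k) =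
          action_formula d P (D e) p \<delta> f n k))"

end

theory Submission
  imports Defs
begin

text \<open>
  A morphism \<open>f\<close> is encoded by the generating series \<open>m\<^sub>I = \<Sum>\<^sub>k f(\<mu>\<^sub>I\<^bsup>(k)\<^esup>) w\<^bsup>k+1\<^esup>\<close>, \<open>|I| \<ge> 2\<close>, with \<open>w\<close> of
  degree 2. Families indexed by finite sets form a graded right pre-Lie algebra for the product
  \<open>(X \<cdot> Y)\<^sub>I\<close>, the sum of \<open>X\<^bsub>A \<squnion> \<star>\<^esub> \<circ>\<^sub>\<star> Y\<^bsub>I - A\<^esub>\<close> over \<open>A \<subseteq> I\<close>, and the inverse of \<open>Y \<mapsto> Y - m \<cdot> Y\<close> is given by
  nested compositions over ordered partitions. Hence the defining relations say that the solution
  \<open>\<Gamma>\<^bsup>ij\<^esup>\<close> of \<open>\<Gamma> - m \<cdot> \<Gamma> = m|\<^bsub>I \<ni> i, j\<^esub>\<close> has degree at most \<open>d\<close> in \<open>w\<close>. If \<open>G\<close> is the solution of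
  \<open>G - m \<cdot> G = D m\<close> and \<open>G\<^sub>>\<close> is its part in degrees above \<open>p\<close>, then the right-hand side of the formula
  for \<open>D z\<^sup>p\<close> is the coefficient of \<open>w\<^bsup>k+p+1\<^esup>\<close> in \<open>G\<^sub>> - m \<cdot> G\<^sub>>\<close>.

  The variation of \<open>\<Gamma>\<close> caused by a variation \<open>\<eta> - m \<cdot> \<eta>\<close> of \<open>m\<close> is linear in \<open>\<eta>\<close>, raises degrees by at
  most that of \<open>\<eta>\<close>, and equals \<open>D \<Gamma>\<close> for \<open>\<eta> = G\<close>. Splitting \<open>G\<close> at degree \<open>p\<close> shows that the formula
  respects the relations to first order, so it defines a morphism over dual numbers, that is, an
  \<open>f\<close>-derivation. The bracket formula is a consequence of the pre-Lie identity: terms truncated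
  below on one side and above on the other cancel in the commutator.
\<close>

text \<open>The offset in w^(k+1) makes the exponent of w count the upper indices together with the
  number of factors: p_1 + ... + p_q + q - 1 = m becomes total exponent m + 1, and the sums over
  partitions and exponents become coefficients of iterated products. With w of degree 2 each m_I has
  degree 2d(|I| - 1), which is even and additive under composition, so no sign depends on arities or
  exponents.

  The obstacle is that the degree of m in w has no bound uniform in the number of labels; only
  \<Gamma> has one. The variation of \<Gamma> is therefore brought into a form that contains \<eta>
  and \<Gamma> but not m, and only then can degrees be estimated.

  Derivatives are algebraic: a field is evaluated at f + E \<epsilon>, and the variation formulas
  are the \<epsilon>-components of the undeformed equations over the larger coefficients. Hence the
  theory of families is developed for an arbitrary operad and applied to its base changes. The sums
  over powers of z are finite on each generator because the relations force m_I to have degree at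
  most d(|I| - 1) in w.\<close>

context operad
begin

section \<open>Elementary consequences of the operad axioms\<close>

sublocale vs: vector_space "op_scale P"
  by (rule vector_space)

lemma scale_ksgn: "op_scale P (ksgn i j) x = (if odd i \<and> odd j then - x else x)"
  by (simp add: ksgn_def)

lemma space_finite: "x \<in> op_space P I j \<Longrightarrow> finite I"
  using space_infinite by blast

lemma space_zero: "finite I \<Longrightarrow> 0 \<in> op_space P I j"
  by (rule vs.subspace_0[OF subspace])

lemma space_add: "x \<in> op_space P I j \<Longrightarrow> y \<in> op_space P I j \<Longrightarrow> x + y \<in> op_space P I j"
  by (rule vs.subspace_add[OF subspace[OF space_finite]])

lemma space_scale: "x \<in> op_space P I j \<Longrightarrow> op_scale P c x \<in> op_space P I j"
  by (rule vs.subspace_scale[OF subspace[OF space_finite]])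

lemma space_neg: "x \<in> op_space P I j \<Longrightarrow> - x \<in> op_space P I j"
  by (rule vs.subspace_neg[OF subspace[OF space_finite]])

lemma space_diff: "x \<in> op_space P I j \<Longrightarrow> y \<in> op_space P I j \<Longrightarrow> x - y \<in> op_space P I j"
  by (rule vs.subspace_diff[OF subspace[OF space_finite]])

lemma space_sum:
  "finite I \<Longrightarrow> (\<And>a. a \<in> A \<Longrightarrow> f a \<in> op_space P I j) \<Longrightarrow> (\<Sum>a\<in>A. f a) \<in> op_space P I j"
  by (rule vs.subspace_sum[OF subspace])

text \<open>Apply \<open>direct\<close> to the vanishing sum x + (-x), with the two copies placed in
  the two components. Besides making degrees well defined, this proves elements to be zero by
  placing them in two different degrees.\<close>

lemma space_unique:
  assumes "x \<in> op_space P I i" "x \<in> op_space P J j" "x \<noteq> 0"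
  shows "I = J \<and> i = j"
proof (rule ccontr)
  assume "\<not> (I = J \<and> i = j)"
  then have ne: "(I, i) \<noteq> (J, j)" by simp
  define w where "w q = (if q = (I, i) then x else - x)" for q
  have "w (I, i) = 0"
  proof (rule direct)
    show "w (I', j') \<in> op_space P I' j'" if "(I', j') \<in> {(I, i), (J, j)}" for I' j'
      using that assms ne space_neg by (auto simp: w_def)
    show "(\<Sum>q\<in>{(I, i), (J, j)}. w q) = 0"
      using ne by (auto simp: w_def)
  qed auto
  then show False using assms by (simp add: w_def)
qed

lemma degree_of_eq: "x \<in> op_space P I j \<Longrightarrow> x \<noteq> 0 \<Longrightarrow> degree_of P x = j"
  unfolding degree_of_def by (rule someI2, blast) (use space_unique in blast)

text \<open>Zero lies in the component on the empty set, on which every map is injective. The same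
  device, with zero placed in the component on {s} or on the empty set, gives the rules for
  compositions with zero below.\<close>

lemma relabel_zero [simp]: "op_relabel P \<sigma> 0 = 0"
  using relabel_add[of 0 "{}" 0 0 \<sigma>] space_zero by auto

lemma relabel_neg: "x \<in> op_space P I i \<Longrightarrow> inj_on \<sigma> I \<Longrightarrow> op_relabel P \<sigma> (- x) = - op_relabel P \<sigma> x"
  using relabel_scale[of x I i \<sigma> "-1"] by simp

lemma relabel_diff: "x \<in> op_space P I i \<Longrightarrow> y \<in> op_space P I i \<Longrightarrow> inj_on \<sigma> I \<Longrightarrow>
    op_relabel P \<sigma> (x - y) = op_relabel P \<sigma> x - op_relabel P \<sigma> y"
  using relabel_add[of x I i "- y" \<sigma>] relabel_neg[of y I i \<sigma>] space_neg by simp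

lemma relabel_sum:
  assumes "inj_on \<sigma> I" "finite I" "\<And>a. a \<in> A \<Longrightarrow> f a \<in> op_space P I i"
  shows "op_relabel P \<sigma> (\<Sum>a\<in>A. f a) = (\<Sum>a\<in>A. op_relabel P \<sigma> (f a))"
  using assms(3)
proof (induction A rule: infinite_finite_induct)
  case (insert a A)
  then show ?case
    using relabel_add[of "f a" I i "\<Sum>a\<in>A. f a" \<sigma>] space_sum[OF assms(2), of A f i] assms by auto
qed auto

lemma comp_zero_left [simp]: "y \<in> op_space P J j \<Longrightarrow> op_comp P s 0 y = 0"
  using comp_add_left[of 0 "{s}" 0 0 y J j s] space_zero by auto

lemma comp_zero_right [simp]: "x \<in> op_space P I i \<Longrightarrow> s \<in> I \<Longrightarrow> op_comp P s x 0 = 0"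
  using comp_add_right[of x I i 0 "{}" 0 0 s] space_zero by auto

lemma comp_neg_left: "\<lbrakk>x \<in> op_space P I i; y \<in> op_space P J j; s \<in> I; (I - {s}) \<inter> J = {}\<rbrakk> \<Longrightarrow>
    op_comp P s (- x) y = - op_comp P s x y"
  using comp_scale_left[of x I i y J j s "-1"] by simp

lemma comp_neg_right: "\<lbrakk>x \<in> op_space P I i; y \<in> op_space P J j; s \<in> I; (I - {s}) \<inter> J = {}\<rbrakk> \<Longrightarrow>
    op_comp P s x (- y) = - op_comp P s x y"
  using comp_scale_right[of x I i y J j s "-1"] by simp

lemma comp_sum_left:
  assumes "finite I" "\<And>a. a \<in> A \<Longrightarrow> f a \<in> op_space P I i"
    and "y \<in> op_space P J j" "s \<in> I" "(I - {s}) \<inter> J = {}"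
  shows "op_comp P s (\<Sum>a\<in>A. f a) y = (\<Sum>a\<in>A. op_comp P s (f a) y)"
  using assms(2)
proof (induction A rule: infinite_finite_induct)
  case (insert a A)
  then show ?case
    using comp_add_left[of "f a" I i "\<Sum>a\<in>A. f a" y J j s] space_sum[OF assms(1), of A f i] assms
    by auto
qed (use assms in auto)

lemma comp_sum_right:
  assumes "finite J" "\<And>a. a \<in> A \<Longrightarrow> f a \<in> op_space P J j"
    and "x \<in> op_space P I i" "s \<in> I" "(I - {s}) \<inter> J = {}"
  shows "op_comp P s x (\<Sum>a\<in>A. f a) = (\<Sum>a\<in>A. op_comp P s x (f a))"
  using assms(2)
proof (induction A rule: infinite_finite_induct)
  case (insert a A)
  then show ?case
    using comp_add_right[of x I i "f a" J j "\<Sum>a\<in>A. f a" s] space_sum[OF assms(1), of A f j] assms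
    by auto
qed (use assms in auto)

text \<open>Only the label \<open>s\<close> of \<open>x\<close> is renamed, so that nothing is required of \<open>y\<close>.\<close>

lemma comp_rename_slot:
  assumes "x \<in> op_space P I i" "y \<in> op_space P J j" "s \<in> I" "(I - {s}) \<inter> J = {}" "t \<notin> I - {s}"
  shows "op_comp P t (op_relabel P (id(s := t)) x) y = op_comp P s x y"
proof -
  have "op_relabel P id (op_comp P s x y) =
    op_comp P ((id(s := t)) s) (op_relabel P (id(s := t)) x) (op_relabel P id y)"
    by (rule comp_relabel[OF assms(1-4)]) (use assms in \<open>auto simp: inj_on_def\<close>)
  then show ?thesis
    using relabel_id[OF assms(2)] relabel_id[OF comp_space[OF assms(1-4)]] by simp
qed

end

section \<open>Rules for derivations and morphisms\<close>

abbreviation derivation ::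
  "('k::field_char_0, 'a::ab_group_add) operad_str \<Rightarrow> int \<Rightarrow> ('a \<Rightarrow> 'a) \<Rightarrow> bool" where
  "derivation P e D \<equiv> f_derivation P P (\<lambda>x. x) e D"

lemma f_derivationD:
  assumes "f_derivation P Q f e E"
  shows "u \<in> op_space P I j \<Longrightarrow> E u \<in> op_space Q I (j + e)"
    and "u \<in> op_space P I j \<Longrightarrow> v \<in> op_space P I j \<Longrightarrow> E (op_add P u v) = op_add Q (E u) (E v)"
    and "u \<in> op_space P I j \<Longrightarrow> E (op_scale P c u) = op_scale Q c (E u)"
    and "u \<in> op_space P I j \<Longrightarrow> inj_on \<sigma> I \<Longrightarrow> E (op_relabel P \<sigma> u) = op_relabel Q \<sigma> (E u)"
    and "u \<in> op_space P I i \<Longrightarrow> v \<in> op_space P J j \<Longrightarrow> s \<in> I \<Longrightarrow> (I - {s}) \<inter> J = {} \<Longrightarrow>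
      E (op_comp P s u v) =
        op_add Q (op_comp Q s (E u) (f v)) (op_scale Q (ksgn e i) (op_comp Q s (f u) (E v)))"
  using assms unfolding f_derivation_def by simp_all

lemma operad_homD:
  assumes "operad_hom P Q f"
  shows "u \<in> op_space P I j \<Longrightarrow> f u \<in> op_space Q I j"
    and "u \<in> op_space P I j \<Longrightarrow> v \<in> op_space P I j \<Longrightarrow> f (op_add P u v) = op_add Q (f u) (f v)"
    and "u \<in> op_space P I j \<Longrightarrow> f (op_scale P c u) = op_scale Q c (f u)"
    and "u \<in> op_space P I j \<Longrightarrow> inj_on \<sigma> I \<Longrightarrow> f (op_relabel P \<sigma> u) = op_relabel Q \<sigma> (f u)"
    and "u \<in> op_space P I i \<Longrightarrow> v \<in> op_space P J j \<Longrightarrow> s \<in> I \<Longrightarrow> (I - {s}) \<inter> J = {} \<Longrightarrow>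
      f (op_comp P s u v) = op_comp Q s (f u) (f v)"
    and "f (op_unit P a) = op_unit Q a"
  using assms unfolding operad_hom_def by simp_all

context operad
begin

lemma derivationD:
  assumes "derivation P e D"
  shows "x \<in> op_space P I j \<Longrightarrow> D x \<in> op_space P I (j + e)"
    and "x \<in> op_space P I j \<Longrightarrow> y \<in> op_space P I j \<Longrightarrow> D (x + y) = D x + D y"
    and "x \<in> op_space P I j \<Longrightarrow> D (op_scale P c x) = op_scale P c (D x)"
    and "x \<in> op_space P I j \<Longrightarrow> inj_on \<sigma> I \<Longrightarrow> D (op_relabel P \<sigma> x) = op_relabel P \<sigma> (D x)"
    and "x \<in> op_space P I i \<Longrightarrow> y \<in> op_space P J j \<Longrightarrow> s \<in> I \<Longrightarrow> (I - {s}) \<inter> J = {} \<Longrightarrow>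
      D (op_comp P s x y) = op_comp P s (D x) y + op_scale P (ksgn e i) (op_comp P s x (D y))"
  using f_derivationD[OF assms] by (simp_all add: add)

lemma derivation_zero: "derivation P e D \<Longrightarrow> D 0 = 0"
  using derivationD(2)[of e D 0 "{}" 0 0] space_zero by simp

lemma derivation_neg: "derivation P e D \<Longrightarrow> x \<in> op_space P I j \<Longrightarrow> D (- x) = - D x"
  using derivationD(3)[of e D x I j "-1"] by simp

lemma derivation_diff:
  "derivation P e D \<Longrightarrow> x \<in> op_space P I j \<Longrightarrow> y \<in> op_space P I j \<Longrightarrow> D (x - y) = D x - D y"
  using derivationD(2)[of e D x I j "- y"] derivation_neg[of e D y I j] space_neg by simp

lemma derivation_sum:
  assumes "derivation P e D" "finite I" "\<And>a. a \<in> A \<Longrightarrow> f a \<in> op_space P I i"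
  shows "D (\<Sum>a\<in>A. f a) = (\<Sum>a\<in>A. D (f a))"
  using assms(3)
proof (induction A rule: infinite_finite_induct)
  case (insert a A)
  then show ?case
    using derivationD(2)[OF assms(1), of "f a" I i "\<Sum>a\<in>A. f a"] space_sum[OF assms(2), of A f i]
    by auto
qed (use assms(1) derivation_zero in auto)

end

section \<open>Base change to multiple dual numbers\<close>

lemma base_change_simps [simp]:
  "op_add (base_change P \<delta>) = (+)"
  "op_scale (base_change P \<delta>) = (\<lambda>c X S. op_scale P c (X S))"
  "op_relabel (base_change P \<delta>) = (\<lambda>\<sigma> X S. op_relabel P \<sigma> (X S))"
  "op_unit (base_change P \<delta>) = (\<lambda>a S. if S = {} then op_unit P a else 0)"
  by (simp_all add: base_change_def)

lemma base_change_space: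
  "X \<in> op_space (base_change P \<delta>) I j \<longleftrightarrow>
     (\<forall>S. S \<subseteq> {..<length \<delta>} \<longrightarrow> X S \<in> op_space P I (j - eps_deg \<delta> S)) \<and>
     (\<forall>S. \<not> S \<subseteq> {..<length \<delta>} \<longrightarrow> X S = 0)"
  by (simp add: base_change_def)

lemma base_change_comp:
  "op_comp (base_change P \<delta>) s X Y S = (if S \<subseteq> {..<length \<delta>} then
     (\<Sum>T\<in>Pow S. op_scale P
        (ksgn (eps_deg \<delta> T) (degree_of P (Y (S - T))) * eps_sign \<delta> T (S - T))
        (op_comp P s (X T) (Y (S - T)))) else 0)"
  by (simp add: base_change_def)

lemma eps_deg_append: "S \<subseteq> {..<length \<delta>} \<Longrightarrow> eps_deg (\<delta> @ [c]) S = eps_deg \<delta> S"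
  by (auto simp: eps_deg_def nth_append intro!: sum.cong)

lemma eps_deg_append_insert:
  "S \<subseteq> {..<length \<delta>} \<Longrightarrow> eps_deg (\<delta> @ [c]) (insert (length \<delta>) S) = eps_deg \<delta> S + c"
proof -
  assume S: "S \<subseteq> {..<length \<delta>}"
  then have "finite S" "length \<delta> \<notin> S" by (auto simp: finite_subset)
  then have "eps_deg (\<delta> @ [c]) (insert (length \<delta>) S) = c + eps_deg (\<delta> @ [c]) S"
    by (simp add: eps_deg_def)
  with S show ?thesis by (simp add: eps_deg_append)
qed

lemma ksgn_sum: "finite S \<Longrightarrow> ksgn c (\<Sum>i\<in>S. f i) = (\<Prod>i\<in>S. ksgn c (f i) :: 'k::comm_ring_1)"
proof (induction S rule: finite_induct)
  case (insert a S)
  have "ksgn c (x + y) = (ksgn c x * ksgn c y :: 'k)" for x y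
    by (simp add: ksgn_def)
  with insert show ?case by simp
qed (simp add: ksgn_def)

lemma eps_sign_append:
  assumes "S \<subseteq> {..<length \<delta>}" "T \<subseteq> {..<length \<delta>}"
  shows "eps_sign (\<delta> @ [c]) S T = eps_sign \<delta> S T"
  unfolding eps_sign_def using assms by (intro prod.cong refl) (auto simp: nth_append)

text \<open>The new \<epsilon> has the largest index, so as part of the right factor it already
  stands in last place and no reordering sign arises.\<close>

lemma eps_sign_append_right:
  assumes "S \<subseteq> {..<length \<delta>}" "T \<subseteq> {..<length \<delta>}"
  shows "eps_sign (\<delta> @ [c]) S (insert (length \<delta>) T) = (eps_sign \<delta> S T :: 'a::comm_ring_1)"
proof -
  have "finite T" "length \<delta> \<notin> T" using assms by (auto simp: finite_subset)
  then have "(\<Prod>t\<in>insert (length \<delta>) T. if t < s then ksgn ((\<delta> @ [c]) ! s) ((\<delta> @ [c]) ! t) else 1) =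
      (\<Prod>t\<in>T. if t < s then ksgn ((\<delta> @ [c]) ! s) ((\<delta> @ [c]) ! t) else (1::'a))" if "s \<in> S" for s
    using assms(1) that by (subst prod.insert) auto
  then have "eps_sign (\<delta> @ [c]) S (insert (length \<delta>) T) = (eps_sign (\<delta> @ [c]) S T :: 'a)"
    unfolding eps_sign_def by (rule prod.cong[OF HOL.refl])
  then show ?thesis using eps_sign_append[OF assms] by simp
qed

text \<open>As part of the left factor the new \<epsilon> has to pass all of the right factor to
  reach last place.\<close>

lemma eps_sign_append_left:
  assumes "S \<subseteq> {..<length \<delta>}" "T \<subseteq> {..<length \<delta>}"
  shows "eps_sign (\<delta> @ [c]) (insert (length \<delta>) S) T = ksgn c (eps_deg \<delta> T) * eps_sign \<delta> S T"
proof -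
  have fin: "finite S" "length \<delta> \<notin> S" "finite T" using assms by (auto simp: finite_subset)
  have "(\<Prod>t\<in>T. if t < length \<delta> then ksgn ((\<delta> @ [c]) ! length \<delta>) ((\<delta> @ [c]) ! t) else 1) =
      (\<Prod>t\<in>T. ksgn c (\<delta> ! t) :: 'a)"
    using assms(2) by (intro prod.cong refl) (auto simp: nth_append)
  also have "\<dots> = ksgn c (eps_deg \<delta> T)"
    by (simp add: eps_deg_def ksgn_sum[OF fin(3)])
  finally show ?thesis
    using fin eps_sign_append[OF assms, of c, where 'a = 'a] unfolding eps_sign_def by simp
qed

lemma sum_Pow_insert:
  assumes "finite S" "a \<notin> S"
  shows "(\<Sum>T\<in>Pow (insert a S). f T) = (\<Sum>T\<in>Pow S. f T) + (\<Sum>T\<in>Pow S. f (insert a T))"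
proof -
  have "Pow (insert a S) = Pow S \<union> insert a ` Pow S" by (rule Pow_insert)
  moreover have "Pow S \<inter> insert a ` Pow S = {}" using assms by auto
  moreover have "inj_on (insert a) (Pow S)"
    using assms(2) by (intro inj_onI) (metis Diff_insert_absorb PowD subsetD)
  ultimately show ?thesis using assms(1) by (simp add: sum.union_disjoint sum.reindex)
qed

text \<open>
  The coefficients \<open>x\<close> and \<open>y\<close> of an element \<open>x + y \<epsilon>\<^sub>r\<close> of
  \<open>P \<otimes> A[\<epsilon>\<^sub>r]\<close>.
\<close>

definition low :: "nat \<Rightarrow> (nat set \<Rightarrow> 'a) \<Rightarrow> nat set \<Rightarrow> 'a::ab_group_add" where
  "low r X = (\<lambda>S. if S \<subseteq> {..<r} then X S else 0)"

definition high :: "nat \<Rightarrow> (nat set \<Rightarrow> 'a) \<Rightarrow> nat set \<Rightarrow> 'a::ab_group_add" where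
  "high r X = (\<lambda>S. if S \<subseteq> {..<r} then X (insert r S) else 0)"

lemma low_high_add [simp]:
  "low r (X + Y) = low r X + low r Y" "high r (X + Y) = high r X + high r Y"
  "low r (X - Y) = low r X - low r Y" "high r (X - Y) = high r X - high r Y"
  "low r (- X) = - low r X" "high r (- X) = - high r X"
  "low r 0 = 0" "high r 0 = 0"
  by (auto simp: low_def high_def fun_eq_iff)

lemma low_high_sum: "low r (\<Sum>a\<in>A. f a) = (\<Sum>a\<in>A. low r (f a))"
  "high r (\<Sum>a\<in>A. f a) = (\<Sum>a\<in>A. high r (f a))"
  by (induction A rule: infinite_finite_induct) auto

lemma subset_lessThan_Suc:
  fixes S :: "nat set"
  assumes "S \<subseteq> {..<Suc r}"
  obtains "S \<subseteq> {..<r}" | T where "T \<subseteq> {..<r}" "S = insert r T"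
proof (cases "r \<in> S")
  case True
  then have "S - {r} \<subseteq> {..<r}" "S = insert r (S - {r})"
    using assms by (auto simp: less_Suc_eq)
  then show ?thesis using that(2) by blast
next
  case False
  then have "S \<subseteq> {..<r}" using assms by (force simp: less_Suc_eq)
  then show ?thesis by (rule that(1))
qed

lemma low_high_eqI:
  assumes "low r X = low r Y" "high r X = high r Y"
    and "\<And>S. \<not> S \<subseteq> {..<Suc r} \<Longrightarrow> X S = 0" "\<And>S. \<not> S \<subseteq> {..<Suc r} \<Longrightarrow> Y S = 0"
  shows "X = Y"
proof
  fix S
  show "X S = Y S"
  proof (cases "S \<subseteq> {..<Suc r}")
    case True
    then show ?thesis
    proof (cases rule: subset_lessThan_Suc)
      case 1
      then show ?thesis using fun_cong[OF assms(1), of S] by (simp add: low_def)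
    next
      case (2 T)
      then show ?thesis using fun_cong[OF assms(2), of T] by (simp add: high_def)
    qed
  qed (use assms in auto)
qed

lemma vector_space_pointwise:
  fixes sc :: "'k::field \<Rightarrow> 'a::ab_group_add \<Rightarrow> 'a"
  assumes "vector_space sc"
  shows "vector_space (\<lambda>c X (S::'b). sc c (X S))"
proof -
  interpret vector_space sc by fact
  show ?thesis
    by unfold_locales (auto simp: fun_eq_iff scale_right_distrib scale_left_distrib)
qed

text \<open>Multiple dual numbers are treated by adjoining one \<epsilon> at a time: an element of
  the larger operad is a pair, its \<open>low\<close> and \<open>high\<close> part over the smaller
  one, and the sum over subsets in the composition collapses to at most two terms. That the smaller
  base change is an operad is the induction hypothesis in \<open>operad_base_change\<close>.\<close>

locale base_change_step = P: operad P + Q: operad "base_change P \<delta>"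
  for P :: "('k::field_char_0, 'a::ab_group_add) operad_str" and \<delta> :: "int list" +
  fixes c :: int
begin

abbreviation "r \<equiv> length \<delta>"
abbreviation "Q \<equiv> base_change P \<delta>"
abbreviation "Q' \<equiv> base_change P (\<delta> @ [c])"

lemma outside: "X \<in> op_space Q' I j \<Longrightarrow> \<not> S \<subseteq> {..<Suc r} \<Longrightarrow> X S = 0"
  by (simp add: base_change_space)

lemma eqI:
  assumes "X \<in> op_space Q' I i" "Y \<in> op_space Q' J j" "low r X = low r Y" "high r X = high r Y"
  shows "X = Y"
  using assms(3,4) outside[OF assms(1)] outside[OF assms(2)] by (rule low_high_eqI)

lemma low_space: "X \<in> op_space Q' I j \<Longrightarrow> low r X \<in> op_space Q I j"
  by (auto simp: base_change_space low_def eps_deg_append)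
    (metis eps_deg_append lessThan_Suc subset_insertI2)

lemma high_space: 
  assumes X: "X \<in> op_space Q' I j"
  shows "high r X \<in> op_space Q I (j - c)"
proof -
  have "X (insert r S) \<in> op_space P I (j - c - eps_deg \<delta> S)" if "S \<subseteq> {..<r}" for S
  proof -
    have "insert r S \<subseteq> {..<length (\<delta> @ [c])}" using that by auto
    then have "X (insert r S) \<in> op_space P I (j - eps_deg (\<delta> @ [c]) (insert r S))"
      using X unfolding base_change_space by blast
    then show ?thesis using that by (simp add: eps_deg_append_insert algebra_simps)
  qed
  then show ?thesis by (simp add: base_change_space high_def)
qed

lemma spaceI:
  assumes "low r X \<in> op_space Q I j" "high r X \<in> op_space Q I (j - c)"
    and "\<And>S. \<not> S \<subseteq> {..<Suc r} \<Longrightarrow> X S = 0"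
  shows "X \<in> op_space Q' I j"
proof -
  have "X S \<in> op_space P I (j - eps_deg (\<delta> @ [c]) S)" if "S \<subseteq> {..<Suc r}" for S
    using that
  proof (cases rule: subset_lessThan_Suc)
    case 1
    have "low r X S \<in> op_space P I (j - eps_deg \<delta> S)"
      using assms(1) 1 unfolding base_change_space by blast
    then show ?thesis using 1 by (simp add: low_def eps_deg_append)
  next
    case (2 T)
    have "high r X T \<in> op_space P I (j - c - eps_deg \<delta> T)"
      using assms(2) 2 unfolding base_change_space by blast
    then show ?thesis using 2 by (simp add: high_def eps_deg_append_insert algebra_simps)
  qed
  then show ?thesis using assms(3) by (auto simp: base_change_space)
qed

lemma low_comp:
  "low r (op_comp Q' s X Y) = op_comp Q s (low r X) (low r Y)"
proof
  fix S
  show "low r (op_comp Q' s X Y) S = op_comp Q s (low r X) (low r Y) S"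
  proof (cases "S \<subseteq> {..<r}")
    case True
    have "S \<subseteq> {..<Suc r}" using True by auto
    moreover have "T \<subseteq> {..<r}" "S - T \<subseteq> {..<r}" if "T \<in> Pow S" for T
      using True that by auto
    ultimately show ?thesis
      using True
      by (auto simp: low_def base_change_comp eps_deg_append eps_sign_append intro!: sum.cong)
  qed (simp add: low_def base_change_comp)
qed

text \<open>The Leibniz rule for \<epsilon>-components. Since \<epsilon> is written on the right, it
  has to pass the second factor, of total degree j, when it comes from the first one; this is the
  origin of the sign.\<close>

lemma high_comp:
  assumes X: "X \<in> op_space Q' I i" and Y: "Y \<in> op_space Q' J j"
    and s: "s \<in> I" "(I - {s}) \<inter> J = {}"
  shows "high r (op_comp Q' s X Y) =
    op_comp Q s (low r X) (high r Y) + op_scale Q (ksgn c j) (op_comp Q s (high r X) (low r Y))"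
proof
  fix S
  show "high r (op_comp Q' s X Y) S = (op_comp Q s (low r X) (high r Y) +
      op_scale Q (ksgn c j) (op_comp Q s (high r X) (low r Y))) S"
  proof (cases "S \<subseteq> {..<r}")
    case True
    then have S: "finite S" "r \<notin> S" "insert r S \<subseteq> {..<length (\<delta> @ [c])}"
      by (auto simp: finite_subset)
    \<comment> \<open>The subsets of \<open>insert r S\<close> that avoid r put the new \<epsilon>
      into Y, those that contain r put it into X.\<close>
    define F where "F T = op_scale P (ksgn (eps_deg (\<delta> @ [c]) T) (degree_of P (Y (insert r S - T))) *
        eps_sign (\<delta> @ [c]) T (insert r S - T)) (op_comp P s (X T) (Y (insert r S - T)))" for T
    have "high r (op_comp Q' s X Y) S = (\<Sum>T\<in>Pow S. F T) + (\<Sum>T\<in>Pow S. F (insert r T))"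
      unfolding sum_Pow_insert[OF S(1,2), symmetric] using True S(3)
      by (simp add: high_def base_change_comp F_def)
    moreover have "(\<Sum>T\<in>Pow S. F T) = op_comp Q s (low r X) (high r Y) S"
    proof -
      have "F T = op_scale P (ksgn (eps_deg \<delta> T) (degree_of P (high r Y (S - T))) *
        eps_sign \<delta> T (S - T)) (op_comp P s (low r X T) (high r Y (S - T)))" if "T \<in> Pow S" for T
      proof -
        have "T \<subseteq> {..<r}" "S - T \<subseteq> {..<r}" "insert r S - T = insert r (S - T)"
          using True that by auto
        then show ?thesis
          by (simp add: F_def low_def high_def eps_deg_append eps_sign_append_right)
      qed
      then show ?thesis using True by (simp add: base_change_comp)
    qed
    moreover have "(\<Sum>T\<in>Pow S. F (insert r T)) =
        op_scale Q (ksgn c j) (op_comp Q s (high r X) (low r Y)) S"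
    proof -
      have "F (insert r T) = op_scale P (ksgn c j) (op_scale P (ksgn (eps_deg \<delta> T)
          (degree_of P (low r Y (S - T))) *
        eps_sign \<delta> T (S - T)) (op_comp P s (high r X T) (low r Y (S - T))))" if "T \<in> Pow S" for T
      proof -
        have T: "T \<subseteq> {..<r}" "S - T \<subseteq> {..<r}" "insert r S - insert r T = S - T"
          using True that S(2) by auto
        have Ysp: "Y (S - T) \<in> op_space P J (j - eps_deg \<delta> (S - T))"
        proof -
          have "S - T \<subseteq> {..<length (\<delta> @ [c])}" using T(2) by auto
          then have "Y (S - T) \<in> op_space P J (j - eps_deg (\<delta> @ [c]) (S - T))"
            using Y unfolding base_change_space by blast
          then show ?thesis using T(2) by (simp add: eps_deg_append)
        qed
        have "insert r T \<subseteq> {..<length (\<delta> @ [c])}" using T(1) by auto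
        then have Xsp: "X (insert r T) \<in> op_space P I (i - eps_deg (\<delta> @ [c]) (insert r T))"
          using X unfolding base_change_space by blast
        show ?thesis
        \<comment> \<open>\<open>degree_of\<close> carries no information at zero; there both sides
          vanish because the composition does.\<close>
        proof (cases "Y (S - T) = 0")
          case True
          then show ?thesis using T s(1) P.comp_zero_right[OF Xsp s(1)]
            by (simp add: F_def low_def high_def)
        next
          case False
          then have deg: "degree_of P (Y (S - T)) = j - eps_deg \<delta> (S - T)"
            by (rule P.degree_of_eq[OF Ysp])
          \<comment> \<open>Passing \<epsilon> first over the coefficient of Y and then over the
            remaining \<epsilon>'s of Y amounts to passing it over the total degree j.\<close>
          have "ksgn (eps_deg \<delta> T + c) (j - eps_deg \<delta> (S - T)) * ksgn c (eps_deg \<delta> (S - T)) =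
              (ksgn c j * ksgn (eps_deg \<delta> T) (j - eps_deg \<delta> (S - T)) :: 'k)"
            by (auto simp: ksgn_def)
          then show ?thesis
            using T deg
            by (simp add: F_def low_def high_def eps_deg_append_insert eps_sign_append_left
                flip: mult.assoc)
        qed
      qed
      then show ?thesis using True by (simp add: base_change_comp P.vs.scale_sum_right)
    qed
    ultimately show ?thesis by simp
  qed (simp add: high_def base_change_comp)
qed

lemma low_high_pointwise [simp]:
  "low r (\<lambda>S. op_scale P b (X S)) = (\<lambda>S. op_scale P b (low r X S))"
  "high r (\<lambda>S. op_scale P b (X S)) = (\<lambda>S. op_scale P b (high r X S))"
  "low r (\<lambda>S. op_relabel P \<sigma> (X S)) = (\<lambda>S. op_relabel P \<sigma> (low r X S))"
  "high r (\<lambda>S. op_relabel P \<sigma> (X S)) = (\<lambda>S. op_relabel P \<sigma> (high r X S))"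
  by (auto simp: low_def high_def fun_eq_iff)

lemma low_high_unit [simp]:
  "low r (\<lambda>S. if S = {} then u else 0) = (\<lambda>S. if S = {} then u else 0)"
  "high r (\<lambda>S. if S = {} then u else 0) = 0"
  by (auto simp: low_def high_def fun_eq_iff)

lemma comp_space': "\<lbrakk>X \<in> op_space Q' I i; Y \<in> op_space Q' J j; s \<in> I; (I - {s}) \<inter> J = {}\<rbrakk> \<Longrightarrow>
    op_comp Q' s X Y \<in> op_space Q' ((I - {s}) \<union> J) (i + j)"
proof (rule spaceI)
  assume XY: "X \<in> op_space Q' I i" "Y \<in> op_space Q' J j" "s \<in> I" "(I - {s}) \<inter> J = {}"
  show "low r (op_comp Q' s X Y) \<in> op_space Q ((I - {s}) \<union> J) (i + j)"
    unfolding low_comp using Q.comp_space[OF low_space low_space] XY by blast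
  have "op_comp Q s (low r X) (high r Y) \<in> op_space Q ((I - {s}) \<union> J) (i + (j - c))"
    using Q.comp_space[OF low_space high_space] XY by blast
  moreover have "op_comp Q s (high r X) (low r Y) \<in> op_space Q ((I - {s}) \<union> J) (i - c + j)"
    using Q.comp_space[OF high_space low_space] XY by blast
  moreover have "i + (j - c) = i + j - c" "i - c + j = i + j - c" by auto
  ultimately show "high r (op_comp Q' s X Y) \<in> op_space Q ((I - {s}) \<union> J) (i + j - c)"
    unfolding high_comp[OF XY] by (metis Q.space_add Q.space_scale)
qed (simp add: base_change_comp)

text \<open>Equality in the larger operad is tested on low and high parts. The low part of an axiom
  is the same axiom of the smaller operad; the high part is a sum of instances with one argument
  replaced by its high part, where only the signs have to be matched.\<close>

lemma operad_step: "operad Q'"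
proof (rule operad.intro)
  show "op_add Q' = (+)" by simp
  show "vector_space (op_scale Q')"
    using vector_space_pointwise[OF P.vector_space] by simp
next
  fix I :: "nat set" and j assume "infinite I"
  then show "op_space Q' I j = {}"
    using P.space_infinite by (force simp: base_change_space)
next
  interpret V: vector_space "op_scale Q'"
    using vector_space_pointwise[OF P.vector_space] by simp
  fix I :: "nat set" and j assume "finite I"
  then show "V.subspace (op_space Q' I j)"
    unfolding V.subspace_def
    by (auto simp: base_change_space P.space_zero P.space_add P.space_scale)
next
  fix K :: "(nat set \<times> int) set" and w q
  assume K: "finite K" "\<And>I j. (I, j) \<in> K \<Longrightarrow> w (I, j) \<in> op_space Q' I j" "(\<Sum>q\<in>K. w q) = 0" "q \<in> K"
  show "w q = 0"
  proof
    fix S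
    show "w q S = 0 S"
    proof (cases "S \<subseteq> {..<length (\<delta> @ [c])}")
      case True
      \<comment> \<open>The coefficient at S of an element of degree j has degree j minus that of
        the corresponding product of \<epsilon>'s. This shift of indices is injective, so
        \<open>direct\<close> for P applies to the coefficients at S.\<close>
      define g where "g = (\<lambda>(I::nat set, j). (I, j - eps_deg (\<delta> @ [c]) S))"
      define g' where "g' = (\<lambda>(I::nat set, j). (I, j + eps_deg (\<delta> @ [c]) S))"
      have gg: "g' (g q) = q" for q by (simp add: g_def g'_def split: prod.splits)
      have inj: "inj_on g K" by (rule inj_on_inverseI) (rule gg)
      have "w (g' (g q)) S = 0"
      proof (rule P.direct[where w = "\<lambda>q. w (g' q) S" and Q = "g ` K"])
        show "w (g' (I, j)) S \<in> op_space P I j" if "(I, j) \<in> g ` K" for I j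
        proof -
          from that obtain j' where j': "(I, j') \<in> K" "j = j' - eps_deg (\<delta> @ [c]) S"
            by (auto simp: g_def)
          then have "w (I, j') S \<in> op_space P I j"
            using K(2)[OF j'(1)] True unfolding base_change_space by blast
          with j' show ?thesis by (simp add: g'_def)
        qed
        have "(\<Sum>q\<in>g ` K. w (g' q) S) = (\<Sum>q\<in>K. w q S)"
          by (simp add: sum.reindex[OF inj] gg)
        also have "\<dots> = (\<Sum>q\<in>K. w q) S" by (induction K rule: infinite_finite_induct) auto
        finally show "(\<Sum>q\<in>g ` K. w (g' q) S) = 0" using K(3) by simp
      qed (use K in auto)
      then show ?thesis by (simp add: gg)
    next
      case False
      then show ?thesis using K(2)[of "fst q" "snd q"] K(4) by (simp add: base_change_space)
    qed
  qed
next
  fix X I i b and \<sigma> :: "nat \<Rightarrow> nat" assume X: "X \<in> op_space Q' I i" and \<sigma>: "inj_on \<sigma> I"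
  show "op_relabel Q' \<sigma> X \<in> op_space Q' (\<sigma> ` I) i"
    using X \<sigma> by (simp add: base_change_space P.relabel_space)
  show "op_relabel Q' \<sigma> (op_scale Q' b X) = op_scale Q' b (op_relabel Q' \<sigma> X)"
    using X \<sigma> P.relabel_scale
    by (simp add: base_change_space fun_eq_iff) (metis P.relabel_zero P.vs.scale_zero_right)
next
  fix X Y I i and \<sigma> :: "nat \<Rightarrow> nat" assume X: "X \<in> op_space Q' I i" "Y \<in> op_space Q' I i" and \<sigma>: "inj_on \<sigma> I"
  show "op_relabel Q' \<sigma> (X + Y) = op_relabel Q' \<sigma> X + op_relabel Q' \<sigma> Y"
    using X \<sigma> P.relabel_add
    by (simp add: base_change_space fun_eq_iff) (metis P.relabel_zero add_0)
next
  fix X I i and \<sigma> \<tau> :: "nat \<Rightarrow> nat"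
  assume X: "X \<in> op_space Q' I i" and \<sigma>: "inj_on \<sigma> I" and "\<And>a. a \<in> I \<Longrightarrow> \<sigma> a = \<tau> a"
  then show "op_relabel Q' \<sigma> X = op_relabel Q' \<tau> X"
    using P.relabel_cong[OF _ \<sigma>, of _ _ \<tau>]
    by (simp add: base_change_space fun_eq_iff) (metis P.relabel_zero)
next
  fix X I i assume X: "X \<in> op_space Q' I i" 
  show "op_relabel Q' id X = X"
    using X P.relabel_id by (simp add: base_change_space fun_eq_iff) (metis P.relabel_zero)
  fix \<sigma> \<tau> :: "nat \<Rightarrow> nat" assume "inj_on \<sigma> I" "inj_on \<tau> (\<sigma> ` I)"
  then show "op_relabel Q' \<tau> (op_relabel Q' \<sigma> X) = op_relabel Q' (\<tau> \<circ> \<sigma>) X"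
    using X P.relabel_relabel by (simp add: base_change_space fun_eq_iff) (metis P.relabel_zero)
next
  fix X I i Y J j s assume XY: "X \<in> op_space Q' I i" "Y \<in> op_space Q' J j" "s \<in> I" "(I - {s}) \<inter> J = {}"
  then show "op_comp Q' s X Y \<in> op_space Q' ((I - {s}) \<union> J) (i + j)" by (rule comp_space')
next
  interpret V: vector_space "op_scale Q'"
    using vector_space_pointwise[OF P.vector_space] by simp
  have sub: "V.subspace (op_space Q' I j)" if "finite I" for I j
    unfolding V.subspace_def using that
    by (auto simp: base_change_space P.space_zero P.space_add P.space_scale)
  have fin: "finite I" if "X \<in> op_space Q' I i" for X I i
    using low_space[OF that] Q.space_finite by blast
  note add = V.subspace_add[OF sub[OF fin]] and scl = V.subspace_scale[OF sub[OF fin]]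
  {
    fix X X' I i Y J j s
    assume XY: "X \<in> op_space Q' I i" "X' \<in> op_space Q' I i" "Y \<in> op_space Q' J j" "s \<in> I" "(I - {s}) \<inter> J = {}"
    note c1 = comp_space'[OF XY(1,3-5)] and c2 = comp_space'[OF XY(2,3-5)]
    note XX = add[OF XY(1) XY(1,2)]
    show "op_comp Q' s (X + X') Y = op_comp Q' s X Y + op_comp Q' s X' Y"
    proof (rule eqI[OF comp_space'[OF XX XY(3-5)] add[OF c1 c1 c2]])
      show "low r (op_comp Q' s (X + X') Y) = low r (op_comp Q' s X Y + op_comp Q' s X' Y)"
        using XY by (simp add: low_comp Q.comp_add_left[OF low_space low_space low_space])
      show "high r (op_comp Q' s (X + X') Y) = high r (op_comp Q' s X Y + op_comp Q' s X' Y)"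
        using XY Q.vs.scale_right_distrib
        by (simp add: high_comp[OF XX XY(3-5)] high_comp[OF XY(1,3-5)] high_comp[OF XY(2,3-5)]
            Q.comp_add_left[OF low_space low_space high_space]
            Q.comp_add_left[OF high_space high_space low_space])
    qed
  next
    fix X I i Y Y' J j s
    assume XY: "X \<in> op_space Q' I i" "Y \<in> op_space Q' J j" "Y' \<in> op_space Q' J j" "s \<in> I" "(I - {s}) \<inter> J = {}"
    note c1 = comp_space'[OF XY(1,2,4,5)] and c2 = comp_space'[OF XY(1,3,4,5)]
    note YY = add[OF XY(2) XY(2,3)]
    show "op_comp Q' s X (Y + Y') = op_comp Q' s X Y + op_comp Q' s X Y'"
    proof (rule eqI[OF comp_space'[OF XY(1) YY XY(4,5)] add[OF c1 c1 c2]])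
      show "low r (op_comp Q' s X (Y + Y')) = low r (op_comp Q' s X Y + op_comp Q' s X Y')"
        using XY by (simp add: low_comp Q.comp_add_right[OF low_space low_space low_space])
      show "high r (op_comp Q' s X (Y + Y')) = high r (op_comp Q' s X Y + op_comp Q' s X Y')"
        using XY Q.vs.scale_right_distrib
        by (simp add: high_comp[OF XY(1) YY XY(4,5)] high_comp[OF XY(1,2,4,5)] high_comp[OF XY(1,3,4,5)]
            Q.comp_add_right[OF low_space high_space high_space]
            Q.comp_add_right[OF high_space low_space low_space])
    qed
  next
    fix X I i Y J j s b
    assume XY: "X \<in> op_space Q' I i" "Y \<in> op_space Q' J j" "s \<in> I" "(I - {s}) \<inter> J = {}"
    note c1 = comp_space'[OF XY]
    note XX = scl[OF XY(1) XY(1), of b] and YY = scl[OF XY(2) XY(2), of b]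
    show "op_comp Q' s (op_scale Q' b X) Y = op_scale Q' b (op_comp Q' s X Y)"
    proof (rule eqI[OF comp_space'[OF XX XY(2-4)] scl[OF c1 c1]])
      show "low r (op_comp Q' s (op_scale Q' b X) Y) = low r (op_scale Q' b (op_comp Q' s X Y))"
        using Q.comp_scale_left[OF low_space low_space, OF XY, of b] by (simp add: low_comp)
      show "high r (op_comp Q' s (op_scale Q' b X) Y) = high r (op_scale Q' b (op_comp Q' s X Y))"
        using Q.comp_scale_left[OF low_space high_space, OF XY, of b]
          Q.comp_scale_left[OF high_space low_space, OF XY, of b]
        by (simp add: high_comp[OF XX XY(2-4), unfolded base_change_simps] high_comp[OF XY] P.vs.scale_right_distrib P.vs.scale_left_commute fun_eq_iff)
    qed
    show "op_comp Q' s X (op_scale Q' b Y) = op_scale Q' b (op_comp Q' s X Y)"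
    proof (rule eqI[OF comp_space'[OF XY(1) YY XY(3,4)] scl[OF c1 c1]])
      show "low r (op_comp Q' s X (op_scale Q' b Y)) = low r (op_scale Q' b (op_comp Q' s X Y))"
        using Q.comp_scale_right[OF low_space low_space, OF XY, of b] by (simp add: low_comp)
      show "high r (op_comp Q' s X (op_scale Q' b Y)) = high r (op_scale Q' b (op_comp Q' s X Y))"
        using Q.comp_scale_right[OF low_space high_space, OF XY, of b]
          Q.comp_scale_right[OF high_space low_space, OF XY, of b]
        by (simp add: high_comp[OF XY(1) YY XY(3,4), unfolded base_change_simps] high_comp[OF XY] P.vs.scale_right_distrib P.vs.scale_left_commute fun_eq_iff)
    qed
  }
next
  have rel: "op_relabel Q' \<sigma> X \<in> op_space Q' (\<sigma> ` I) i" if "X \<in> op_space Q' I i" "inj_on \<sigma> I" for X I i \<sigma>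
    using that by (simp add: base_change_space P.relabel_space)
  fix X I i Y J j s and \<sigma> \<tau> :: "nat \<Rightarrow> nat"
  assume XY: "X \<in> op_space Q' I i" "Y \<in> op_space Q' J j" "s \<in> I" "(I - {s}) \<inter> J = {}"
    and \<sigma>: "inj_on \<sigma> ((I - {s}) \<union> J)" and \<tau>: "inj_on \<tau> I" "\<And>a. a \<in> I - {s} \<Longrightarrow> \<tau> a = \<sigma> a"
  have \<sigma>J: "inj_on \<sigma> J" using \<sigma> by (rule inj_on_subset) simp
  have disj: "(\<tau> ` I - {\<tau> s}) \<inter> \<sigma> ` J = {}"
  proof -
    have "\<tau> ` I - {\<tau> s} = \<tau> ` (I - {s})"
      using inj_on_image_set_diff[OF \<tau>(1), of I "{s}"] XY(3) by simp
    also have "\<dots> = \<sigma> ` (I - {s})" using \<tau>(2) by (rule image_cong[OF HOL.refl])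
    finally have "\<tau> ` I - {\<tau> s} = \<sigma> ` (I - {s})" .
    moreover have "\<sigma> ` (I - {s}) \<inter> \<sigma> ` J = {}"
      using inj_on_image_Int[OF \<sigma>, of "I - {s}" J] XY(4) by simp
    ultimately show ?thesis by simp
  qed
  note X' = rel[OF XY(1) \<tau>(1)] and Y' = rel[OF XY(2) \<sigma>J]
  have s': "\<tau> s \<in> \<tau> ` I" using XY(3) by simp
  note q = Q.comp_relabel[OF _ _ XY(3,4) \<sigma> \<tau>]
  show "op_relabel Q' \<sigma> (op_comp Q' s X Y) = op_comp Q' (\<tau> s) (op_relabel Q' \<tau> X) (op_relabel Q' \<sigma> Y)"
  proof (rule eqI[OF rel[OF comp_space'[OF XY] \<sigma>] comp_space'[OF X' Y' s' disj]])
    show "low r (op_relabel Q' \<sigma> (op_comp Q' s X Y)) =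
        low r (op_comp Q' (\<tau> s) (op_relabel Q' \<tau> X) (op_relabel Q' \<sigma> Y))"
      using q[OF low_space low_space, OF XY(1,2)] by (simp add: low_comp)
    have "op_relabel Q \<sigma> (op_comp Q s (low r X) (high r Y) +
        op_scale Q (ksgn c j) (op_comp Q s (high r X) (low r Y))) =
      op_relabel Q \<sigma> (op_comp Q s (low r X) (high r Y)) +
        op_scale Q (ksgn c j) (op_relabel Q \<sigma> (op_comp Q s (high r X) (low r Y)))"
    proof -
      have a: "op_comp Q s (low r X) (high r Y) \<in> op_space Q ((I - {s}) \<union> J) (i + j - c)"
        using Q.comp_space[OF low_space high_space, OF XY] by (simp add: algebra_simps)
      have b: "op_comp Q s (high r X) (low r Y) \<in> op_space Q ((I - {s}) \<union> J) (i + j - c)"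
        using Q.comp_space[OF high_space low_space, OF XY] by (simp add: algebra_simps)
      show ?thesis
        unfolding Q.relabel_add[OF a Q.space_scale[OF b] \<sigma>] Q.relabel_scale[OF b \<sigma>] ..
    qed
    moreover have "high r (op_relabel Q' \<rho> W) = op_relabel Q \<rho> (high r W)"
      "low r (op_relabel Q' \<rho> W) = op_relabel Q \<rho> (low r W)" for \<rho> W by simp_all
    ultimately show "high r (op_relabel Q' \<sigma> (op_comp Q' s X Y)) =
        high r (op_comp Q' (\<tau> s) (op_relabel Q' \<tau> X) (op_relabel Q' \<sigma> Y))"
      using q[OF low_space high_space, OF XY(1,2)] q[OF high_space low_space, OF XY(1,2)]
      by (simp only: high_comp[OF X' Y' s' disj] high_comp[OF XY])
  qed
next
  fix X I i Y J j Z K k s t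
  assume XY: "X \<in> op_space Q' I i" "Y \<in> op_space Q' J j" "Z \<in> op_space Q' K k" "s \<in> I" "t \<in> J"
    "(I - {s}) \<inter> J = {}" "(J - {t}) \<inter> K = {}" "(I - {s}) \<inter> K = {}"
  have t: "t \<in> (I - {s}) \<union> J" "((I - {s}) \<union> J - {t}) \<inter> K = {}" "(I - {s}) \<inter> ((J - {t}) \<union> K) = {}"
    using XY(5-8) by auto
  note XY1 = comp_space'[OF XY(1,2,4,6)] and YZ1 = comp_space'[OF XY(2,3,5,7)]
  note q = Q.comp_sequential[OF _ _ _ XY(4-8)]
  show "op_comp Q' t (op_comp Q' s X Y) Z = op_comp Q' s X (op_comp Q' t Y Z)"
  proof (rule eqI[OF comp_space'[OF XY1 XY(3) t(1,2)] comp_space'[OF XY(1) YZ1 XY(4) t(3)]])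
    show "low r (op_comp Q' t (op_comp Q' s X Y) Z) = low r (op_comp Q' s X (op_comp Q' t Y Z))"
      unfolding low_comp using q[OF low_space low_space low_space] XY by blast
    have a: "op_comp Q s (low r X) (high r Y) \<in> op_space Q ((I - {s}) \<union> J) (i + j - c)"
      using Q.comp_space[OF low_space high_space, OF XY(1,2,4,6)] by (simp add: algebra_simps)
    have b: "op_comp Q s (high r X) (low r Y) \<in> op_space Q ((I - {s}) \<union> J) (i + j - c)"
      using Q.comp_space[OF high_space low_space, OF XY(1,2,4,6)] by (simp add: algebra_simps)
    have a': "op_comp Q t (low r Y) (high r Z) \<in> op_space Q ((J - {t}) \<union> K) (j + k - c)"
      using Q.comp_space[OF low_space high_space, OF XY(2,3,5,7)] by (simp add: algebra_simps)
    have b': "op_comp Q t (high r Y) (low r Z) \<in> op_space Q ((J - {t}) \<union> K) (j + k - c)"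
      using Q.comp_space[OF high_space low_space, OF XY(2,3,5,7)] by (simp add: algebra_simps)
    show "high r (op_comp Q' t (op_comp Q' s X Y) Z) = high r (op_comp Q' s X (op_comp Q' t Y Z))"
      unfolding high_comp[OF XY1 XY(3) t(1,2)] high_comp[OF XY(1) YZ1 XY(4) t(3)]
        high_comp[OF XY(1,2,4,6)] high_comp[OF XY(2,3,5,7)] low_comp
        Q.comp_add_left[OF a Q.space_scale[OF b] low_space[OF XY(3)] t(1,2)]
        Q.comp_add_right[OF low_space[OF XY(1)] a' Q.space_scale[OF b'] XY(4) t(3)]
        Q.comp_scale_left[OF b low_space[OF XY(3)] t(1,2)]
        Q.comp_scale_right[OF low_space[OF XY(1)] b' XY(4) t(3)]
        q[OF low_space low_space high_space, OF XY(1-3)]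
        q[OF low_space high_space low_space, OF XY(1-3)]
        q[OF high_space low_space low_space, OF XY(1-3)]
      unfolding Q.scale_ksgn by (auto simp: algebra_simps)
  qed
next
  interpret V: vector_space "op_scale Q'"
    using vector_space_pointwise[OF P.vector_space] by simp
  have scl: "op_scale Q' b X \<in> op_space Q' I i" if "X \<in> op_space Q' I i" for b X I i
    using that by (auto simp: base_change_space P.space_scale)
  fix X I i Y J j Z K k s t
  assume XY: "X \<in> op_space Q' I i" "Y \<in> op_space Q' J j" "Z \<in> op_space Q' K k" "s \<in> I" "t \<in> I"
    "s \<noteq> t" "(I - {s}) \<inter> J = {}" "(I - {t}) \<inter> K = {}" "J \<inter> K = {}"
  have t: "t \<in> (I - {s}) \<union> J" "((I - {s}) \<union> J - {t}) \<inter> K = {}"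
    "s \<in> (I - {t}) \<union> K" "((I - {t}) \<union> K - {s}) \<inter> J = {}"
    using XY(4-9) by auto
  note XY1 = comp_space'[OF XY(1,2,4,7)] and XZ1 = comp_space'[OF XY(1,3,5,8)]
  note q = Q.comp_parallel[OF _ _ _ XY(4-9)]
  show "op_comp Q' t (op_comp Q' s X Y) Z = op_scale Q' (ksgn j k) (op_comp Q' s (op_comp Q' t X Z) Y)"
  proof (rule eqI[OF comp_space'[OF XY1 XY(3) t(1,2)] scl[OF comp_space'[OF XZ1 XY(2) t(3,4)]]])
    show "low r (op_comp Q' t (op_comp Q' s X Y) Z) =
        low r (op_scale Q' (ksgn j k) (op_comp Q' s (op_comp Q' t X Z) Y))"
      using q[OF low_space low_space low_space, OF XY(1-3)] by (simp add: low_comp)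
    have a: "op_comp Q s (low r X) (high r Y) \<in> op_space Q ((I - {s}) \<union> J) (i + j - c)"
      using Q.comp_space[OF low_space high_space, OF XY(1,2,4,7)] by (simp add: algebra_simps)
    have b: "op_comp Q s (high r X) (low r Y) \<in> op_space Q ((I - {s}) \<union> J) (i + j - c)"
      using Q.comp_space[OF high_space low_space, OF XY(1,2,4,7)] by (simp add: algebra_simps)
    have a': "op_comp Q t (low r X) (high r Z) \<in> op_space Q ((I - {t}) \<union> K) (i + k - c)"
      using Q.comp_space[OF low_space high_space, OF XY(1,3,5,8)] by (simp add: algebra_simps)
    have b': "op_comp Q t (high r X) (low r Z) \<in> op_space Q ((I - {t}) \<union> K) (i + k - c)"
      using Q.comp_space[OF high_space low_space, OF XY(1,3,5,8)] by (simp add: algebra_simps)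
    have scale_high: "high r (op_scale Q' d W) = op_scale Q d (high r W)" for d W by simp
    show "high r (op_comp Q' t (op_comp Q' s X Y) Z) =
        high r (op_scale Q' (ksgn j k) (op_comp Q' s (op_comp Q' t X Z) Y))"
      unfolding scale_high high_comp[OF XY1 XY(3) t(1,2)] high_comp[OF XZ1 XY(2) t(3,4)]
        high_comp[OF XY(1,2,4,7)] high_comp[OF XY(1,3,5,8)] low_comp
        Q.comp_add_left[OF a Q.space_scale[OF b] low_space[OF XY(3)] t(1,2)]
        Q.comp_add_left[OF a' Q.space_scale[OF b'] low_space[OF XY(2)] t(3,4)]
        Q.comp_scale_left[OF b low_space[OF XY(3)] t(1,2)]
        Q.comp_scale_left[OF b' low_space[OF XY(2)] t(3,4)]
        q[OF low_space low_space high_space, OF XY(1-3)]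
        q[OF low_space high_space low_space, OF XY(1-3)]
        q[OF high_space low_space low_space, OF XY(1-3)]
      unfolding Q.scale_ksgn
      by (cases "odd c"; cases "odd j"; cases "odd k") (simp_all add: algebra_simps)
  qed
next
  have un: "op_unit Q' a \<in> op_space Q' {a} 0" for a
    by (rule spaceI) (use Q.unit_space[of a] Q.space_zero in auto)
  fix a show "op_unit Q' a \<in> op_space Q' {a} 0" by (rule un)
  fix \<sigma> show "op_relabel Q' \<sigma> (op_unit Q' a) = op_unit Q' (\<sigma> a)"
    using P.relabel_unit by auto
  fix Y J j assume Y: "Y \<in> op_space Q' J j"
  have "({a} - {a}) \<union> J = J" by simp
  then show "op_comp Q' a (op_unit Q' a) Y = Y"
    using comp_space'[OF un Y, of a a] Q.unit_comp[OF low_space[OF Y], of a]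
      Q.unit_comp[OF high_space[OF Y], of a] high_comp[OF un Y, of a a]
    by (intro eqI[OF _ Y]) (auto simp: low_comp low_space[OF Y, THEN Q.comp_zero_left])
next
  have un: "op_unit Q' a \<in> op_space Q' {a} 0" for a
    by (rule spaceI) (use Q.unit_space[of a] Q.space_zero in auto)
  have rel: "op_relabel Q' \<sigma> X \<in> op_space Q' (\<sigma> ` I) i" if "X \<in> op_space Q' I i" "inj_on \<sigma> I" for X I i \<sigma>
    using that by (simp add: base_change_space P.relabel_space)
  fix X I i s a assume X: "X \<in> op_space Q' I i" "s \<in> I" "a \<notin> I - {s}"
  have inj: "inj_on (id(s := a)) I" and d: "(I - {s}) \<inter> {a} = {}"
    using X by (auto simp: inj_on_def)
  have "low r (op_unit Q' a) = op_unit Q a" "high r (op_unit Q' a) = 0" by simp_all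
  then show "op_comp Q' s X (op_unit Q' a) = op_relabel Q' (id(s := a)) X"
    using Q.comp_unit[OF low_space[OF X(1)] X(2,3)] Q.comp_unit[OF high_space[OF X(1)] X(2,3)]
      high_comp[OF X(1) un X(2) d] Q.comp_zero_right[OF low_space[OF X(1)] X(2)]
    by (intro eqI[OF comp_space'[OF X(1) un X(2) d] rel[OF X(1) inj]])
      (auto simp: low_comp ksgn_def)
qed

end

section \<open>The empty list of dual numbers and the general base change\<close>

lemma base_change_Nil_space:
  "X \<in> op_space (base_change P []) I j \<longleftrightarrow> X {} \<in> op_space P I j \<and> (\<forall>S. S \<noteq> {} \<longrightarrow> X S = 0)"
  by (auto simp: base_change_space eps_deg_def)

lemma (in operad) base_change_Nil_comp:
  "op_comp (base_change P []) s X Y = (\<lambda>S. if S = {} then op_comp P s (X {}) (Y {}) else 0)"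
  by (auto simp: base_change_comp eps_deg_def eps_sign_def ksgn_def fun_eq_iff)

context operad
begin

lemma operad_base_change_Nil: "operad (base_change P [])"
proof (rule operad.intro)
  let ?Q = "base_change P []"
  note sp = base_change_Nil_space and cmp = base_change_Nil_comp
  show "op_add ?Q = (+)" by simp
  show V: "vector_space (op_scale ?Q)"
    using vector_space_pointwise[OF vector_space] by simp
  show "op_space ?Q I j = {}" if "infinite I" for I j
    using space_infinite[OF that] by (auto simp: sp)
  interpret V: vector_space "op_scale ?Q" by (rule V)
  show "V.subspace (op_space ?Q I j)" if "finite I" for I j
    unfolding V.subspace_def using that by (auto simp: sp space_zero space_add space_scale)
  show "w q = 0" if K: "finite K" "\<And>I j. (I, j) \<in> K \<Longrightarrow> w (I, j) \<in> op_space ?Q I j"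
    "(\<Sum>q\<in>K. w q) = 0" "q \<in> K" for K w q
  proof -
    have "(\<Sum>q\<in>K. w q {}) = (\<Sum>q\<in>K. w q) {}" by (induction K rule: infinite_finite_induct) auto
    then have "w q {} = 0"
      using K by (intro direct[of K "\<lambda>q. w q {}"]) (auto simp: sp)
    then have "w q S = 0" for S
      using K(2)[of "fst q" "snd q"] K(4) by (cases "S = {}") (simp_all add: sp)
    then show ?thesis by (simp add: fun_eq_iff)
  qed
next
  note sp = base_change_Nil_space and cmp = base_change_Nil_comp
  let ?Q = "base_change P []"
  show "op_comp ?Q a (op_unit ?Q a) y = y" if "y \<in> op_space ?Q J j" for a y J j
    using that unit_comp[of "y {}" J j a] by (auto simp: sp cmp fun_eq_iff)
  show "op_comp ?Q s x (op_unit ?Q a) = op_relabel ?Q (id(s := a)) x"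
    if "x \<in> op_space ?Q I i" "s \<in> I" "a \<notin> I - {s}" for x I i s a
    using that comp_unit[of "x {}" I i s a] by (auto simp: sp cmp fun_eq_iff)
  show "op_comp ?Q t (op_comp ?Q s x y) z = op_scale ?Q (ksgn j k) (op_comp ?Q s (op_comp ?Q t x z) y)"
    if "x \<in> op_space ?Q I i" "y \<in> op_space ?Q J j" "z \<in> op_space ?Q K k" "s \<in> I" "t \<in> I"
      "s \<noteq> t" "(I - {s}) \<inter> J = {}" "(I - {t}) \<inter> K = {}" "J \<inter> K = {}" for x y z I i J j K k s t
    using comp_parallel[of "x {}" I i "y {}" J j "z {}" K k s t] that
    by (auto simp: sp cmp fun_eq_iff)
  show "op_comp ?Q t (op_comp ?Q s x y) z = op_comp ?Q s x (op_comp ?Q t y z)"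
    if "x \<in> op_space ?Q I i" "y \<in> op_space ?Q J j" "z \<in> op_space ?Q K k" "s \<in> I" "t \<in> J"
      "(I - {s}) \<inter> J = {}" "(J - {t}) \<inter> K = {}" "(I - {s}) \<inter> K = {}" for x y z I i J j K k s t
    using comp_sequential[of "x {}" I i "y {}" J j "z {}" K k s t] that
    by (auto simp: sp cmp fun_eq_iff)
  show "op_relabel ?Q \<sigma> (op_comp ?Q s x y) = op_comp ?Q (\<tau> s) (op_relabel ?Q \<tau> x) (op_relabel ?Q \<sigma> y)"
    if "x \<in> op_space ?Q I i" "y \<in> op_space ?Q J j" "s \<in> I" "(I - {s}) \<inter> J = {}"
      "inj_on \<sigma> ((I - {s}) \<union> J)" "inj_on \<tau> I" "\<And>a. a \<in> I - {s} \<Longrightarrow> \<tau> a = \<sigma> a"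
    for x y I i J j s and \<sigma> \<tau> :: "nat \<Rightarrow> nat"
    using comp_relabel[of "x {}" I i "y {}" J j s \<sigma> \<tau>] that
    by (auto simp: sp cmp fun_eq_iff)
  show "op_relabel ?Q \<sigma> x \<in> op_space ?Q (\<sigma> ` I) i" if "x \<in> op_space ?Q I i" "inj_on \<sigma> I" for x I i \<sigma>
    using that relabel_space[of "x {}" I i \<sigma>] by (simp add: sp)
  show "op_relabel ?Q \<sigma> (x + y) = op_relabel ?Q \<sigma> x + op_relabel ?Q \<sigma> y"
    if "x \<in> op_space ?Q I i" "y \<in> op_space ?Q I i" "inj_on \<sigma> I" for x y I i \<sigma>
  proof
    fix S show "op_relabel ?Q \<sigma> (x + y) S = (op_relabel ?Q \<sigma> x + op_relabel ?Q \<sigma> y) S"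
      using that relabel_add[of "x {}" I i "y {}" \<sigma>] by (cases "S = {}") (simp_all add: sp)
  qed
  show "op_relabel ?Q \<sigma> (op_scale ?Q c x) = op_scale ?Q c (op_relabel ?Q \<sigma> x)"
    if "x \<in> op_space ?Q I i" "inj_on \<sigma> I" for x I i \<sigma> c
  proof
    fix S show "op_relabel ?Q \<sigma> (op_scale ?Q c x) S = op_scale ?Q c (op_relabel ?Q \<sigma> x) S"
      using that relabel_scale[of "x {}" I i \<sigma> c] by (cases "S = {}") (simp_all add: sp)
  qed
  show "op_relabel ?Q \<sigma> x = op_relabel ?Q \<tau> x"
    if "x \<in> op_space ?Q I i" "inj_on \<sigma> I" "\<And>a. a \<in> I \<Longrightarrow> \<sigma> a = \<tau> a" for x I i and \<sigma> \<tau> :: "nat \<Rightarrow> nat"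
  proof
    fix S show "op_relabel ?Q \<sigma> x S = op_relabel ?Q \<tau> x S"
      using that relabel_cong[of "x {}" I i \<sigma> \<tau>] by (cases "S = {}") (simp_all add: sp)
  qed
  show "op_relabel ?Q id x = x" if "x \<in> op_space ?Q I i" for x I i
  proof
    fix S show "op_relabel ?Q id x S = x S"
      using that relabel_id[of "x {}" I i] by (cases "S = {}") (simp_all add: sp)
  qed
  show "op_relabel ?Q \<tau> (op_relabel ?Q \<sigma> x) = op_relabel ?Q (\<tau> \<circ> \<sigma>) x"
    if "x \<in> op_space ?Q I i" "inj_on \<sigma> I" "inj_on \<tau> (\<sigma> ` I)" for x I i \<sigma> \<tau>
  proof
    fix S show "op_relabel ?Q \<tau> (op_relabel ?Q \<sigma> x) S = op_relabel ?Q (\<tau> \<circ> \<sigma>) x S"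
      using that relabel_relabel[of "x {}" I i \<sigma> \<tau>] by (cases "S = {}") (simp_all add: sp)
  qed
  show "op_comp ?Q s x y \<in> op_space ?Q ((I - {s}) \<union> J) (i + j)"
    if "x \<in> op_space ?Q I i" "y \<in> op_space ?Q J j" "s \<in> I" "(I - {s}) \<inter> J = {}" for x y I i J j s
    using that comp_space[of "x {}" I i "y {}" J j s] by (simp add: sp cmp)
  show "op_comp ?Q s (x + x') y = op_comp ?Q s x y + op_comp ?Q s x' y"
    if "x \<in> op_space ?Q I i" "x' \<in> op_space ?Q I i" "y \<in> op_space ?Q J j" "s \<in> I" "(I - {s}) \<inter> J = {}"
    for x x' y I i J j s
    using that comp_add_left[of "x {}" I i "x' {}" "y {}" J j s] by (simp add: sp cmp fun_eq_iff)
  show "op_comp ?Q s x (y + y') = op_comp ?Q s x y + op_comp ?Q s x y'"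
    if "x \<in> op_space ?Q I i" "y \<in> op_space ?Q J j" "y' \<in> op_space ?Q J j" "s \<in> I" "(I - {s}) \<inter> J = {}"
    for x y y' I i J j s
    using that comp_add_right[of "x {}" I i "y {}" J j "y' {}" s] by (simp add: sp cmp fun_eq_iff)
  show "op_comp ?Q s (op_scale ?Q c x) y = op_scale ?Q c (op_comp ?Q s x y)"
    "op_comp ?Q s x (op_scale ?Q c y) = op_scale ?Q c (op_comp ?Q s x y)"
    if "x \<in> op_space ?Q I i" "y \<in> op_space ?Q J j" "s \<in> I" "(I - {s}) \<inter> J = {}" for x y I i J j s c
    using that comp_scale_left[of "x {}" I i "y {}" J j s c] comp_scale_right[of "x {}" I i "y {}" J j s c]
    by (simp_all add: sp cmp fun_eq_iff)
qed (simp_all add: base_change_Nil_space fun_eq_iff relabel_unit unit_space)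

lemma operad_base_change: "operad (base_change P \<delta>)"
proof (induction \<delta> rule: rev_induct)
  case (snoc c \<delta>)
  interpret Q: operad "base_change P \<delta>" by (rule snoc)
  interpret base_change_step P \<delta> c by unfold_locales
  show ?case by (rule operad_step)
qed (rule operad_base_change_Nil)

lemma base_change_step: "base_change_step P \<delta>"
proof -
  interpret Q: operad "base_change P \<delta>" by (rule operad_base_change)
  show ?thesis by unfold_locales
qed

lemma extend_map_pointwise:
  assumes D: "derivation P e D" and X: "X \<in> op_space (base_change P \<delta>) I j"
  shows "extend_map D X \<in> op_space (base_change P \<delta>) I (j + e)"
    and "Y \<in> op_space (base_change P \<delta>) I j \<Longrightarrow> extend_map D (X + Y) = extend_map D X + extend_map D Y"
    and "extend_map D (\<lambda>S. op_scale P c (X S)) = (\<lambda>S. op_scale P c (extend_map D X S))"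
    and "inj_on \<sigma> I \<Longrightarrow>
      extend_map D (\<lambda>S. op_relabel P \<sigma> (X S)) = (\<lambda>S. op_relabel P \<sigma> (extend_map D X S))"
proof -
  note D0 = derivation_zero[OF D] and DD = derivationD[OF D]
  \<comment> \<open>Coefficients outside the range are zero, which also lies in a component on I
    once I is known to be finite.\<close>
  have cases: "\<exists>j. Z S \<in> op_space P I j" if "Z \<in> op_space (base_change P \<delta>) I j" for S Z
  proof -
    have "Z {} \<in> op_space P I (j - eps_deg \<delta> {})" using that by (simp add: base_change_space)
    then have "0 \<in> op_space P I 0" by (rule space_zero[OF space_finite])
    then show ?thesis
      using that unfolding base_change_space by (cases "S \<subseteq> {..<length \<delta>}") metis+
  qed
  show "extend_map D X \<in> op_space (base_change P \<delta>) I (j + e)"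
    unfolding base_change_space extend_map_def
  proof (intro conjI allI impI)
    fix S assume "S \<subseteq> {..<length \<delta>}"
    then have "D (X S) \<in> op_space P I (j - eps_deg \<delta> S + e)"
      using X DD(1) unfolding base_change_space by blast
    then show "D (X S) \<in> op_space P I (j + e - eps_deg \<delta> S)" by (simp add: algebra_simps)
  qed (use X D0 in \<open>simp add: base_change_space\<close>)
  show "extend_map D (\<lambda>S. op_scale P c (X S)) = (\<lambda>S. op_scale P c (extend_map D X S))"
    using cases[OF X] DD(3) unfolding extend_map_def by blast
  show "extend_map D (\<lambda>S. op_relabel P \<sigma> (X S)) = (\<lambda>S. op_relabel P \<sigma> (extend_map D X S))"
    if "inj_on \<sigma> I"
    using cases[OF X] DD(4)[OF _ that] unfolding extend_map_def by blast
  show "extend_map D (X + Y) = extend_map D X + extend_map D Y"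
    if Y: "Y \<in> op_space (base_change P \<delta>) I j"
  proof
    fix S
    show "extend_map D (X + Y) S = (extend_map D X + extend_map D Y) S"
    proof (cases "S \<subseteq> {..<length \<delta>}")
      case True
      then show ?thesis using X Y DD(2)[of "X S" I "j - eps_deg \<delta> S" "Y S"]
        by (simp add: base_change_space extend_map_def)
    next
      case False
      then show ?thesis using X Y D0 by (simp add: base_change_space extend_map_def)
    qed
  qed
qed

text \<open>D stands to the left of a coefficient and the \<epsilon>'s to its right, so D \<otimes>
  1 acts on coefficients without a sign. In the induction the high part of the claim reduces to two
  instances of the claim over the smaller algebra.\<close>

lemma extend_map_comp:
  assumes D: "derivation P e D"
    and "X \<in> op_space (base_change P \<delta>) I i" "Y \<in> op_space (base_change P \<delta>) J j"
    and "s \<in> I" "(I - {s}) \<inter> J = {}"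
  shows "extend_map D (op_comp (base_change P \<delta>) s X Y) =
    op_comp (base_change P \<delta>) s (extend_map D X) Y +
    op_scale (base_change P \<delta>) (ksgn e i) (op_comp (base_change P \<delta>) s X (extend_map D Y))"
  using assms(2-5)
proof (induction \<delta> arbitrary: X Y I i J j s rule: rev_induct)
  case Nil
  then show ?case
    using derivationD(5)[OF D, of "X {}" I i "Y {}" J j s] derivation_zero[OF D]
    by (auto simp: base_change_Nil_space base_change_Nil_comp extend_map_def fun_eq_iff)
next
  case (snoc c \<delta>)
  interpret base_change_step P \<delta> c by (rule base_change_step)
  interpret Q': operad Q' by (rule operad_step)
  note dQ = extend_map_pointwise[OF D, where \<delta> = \<delta>]
  have lh: "low r (extend_map D X) = extend_map D (low r X)"
    "high r (extend_map D X) = extend_map D (high r X)" for X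
    using derivation_zero[OF D] by (auto simp: low_def high_def extend_map_def fun_eq_iff)
  have dQ3: "extend_map D (op_scale Q b X) = op_scale Q b (extend_map D X)"
    if "X \<in> op_space Q I j" for b X I j
    using dQ(3)[OF that] by simp
  note sp = extend_map_pointwise(1)[OF D, where \<delta> = "\<delta> @ [c]"]
  note XY = snoc.prems
  note DX = sp[OF XY(1)] and DY = sp[OF XY(2)]
  have m: "op_comp Q' s (extend_map D X) Y \<in> op_space Q' ((I - {s}) \<union> J) (i + j + e)"
    "op_comp Q' s X (extend_map D Y) \<in> op_space Q' ((I - {s}) \<union> J) (i + j + e)"
    using comp_space'[OF DX XY(2-4)] comp_space'[OF XY(1) DY XY(3,4)] by (simp_all add: algebra_simps)
  have a: "op_comp Q s (low r X) (high r Y) \<in> op_space Q ((I - {s}) \<union> J) (i + j - c)"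
    using Q.comp_space[OF low_space high_space, OF XY] by (simp add: algebra_simps)
  have b: "op_comp Q s (high r X) (low r Y) \<in> op_space Q ((I - {s}) \<union> J) (i + j - c)"
    using Q.comp_space[OF high_space low_space, OF XY] by (simp add: algebra_simps)
  have scale_lh: "high r (op_scale Q' d W) = op_scale Q d (high r W)"
    "low r (op_scale Q' d W) = op_scale Q d (low r W)" for d W by simp_all
  show ?case
  proof (rule eqI[OF sp[OF comp_space'[OF XY]] Q'.space_add[OF m(1) Q'.space_scale[OF m(2)]]])
    show "low r (extend_map D (op_comp Q' s X Y)) =
    low r (op_comp Q' s (extend_map D X) Y + op_scale Q' (ksgn e i) (op_comp Q' s X (extend_map D Y)))"
      using snoc.IH[OF low_space low_space, OF XY] by (simp add: lh low_comp fun_eq_iff)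
    show "high r (extend_map D (op_comp Q' s X Y)) =
    high r (op_comp Q' s (extend_map D X) Y + op_scale Q' (ksgn e i) (op_comp Q' s X (extend_map D Y)))"
    unfolding low_high_add scale_lh lh high_comp[OF XY] high_comp[OF DX XY(2-4)]
      high_comp[OF XY(1) DY XY(3,4)] dQ(2)[OF a Q.space_scale[OF b]] dQ3[OF b]
      snoc.IH[OF low_space high_space, OF XY] snoc.IH[OF high_space low_space, OF XY]
    unfolding Q.scale_ksgn
      by (cases "odd c"; cases "odd e"; cases "odd i"; cases "odd j") simp_all
  qed
qed

lemma derivation_extend_map:
  assumes D: "derivation P e D"
  shows "derivation (base_change P \<delta>) e (extend_map D)"
  unfolding f_derivation_def base_change_simps
  using extend_map_pointwise[OF D, where \<delta> = \<delta>] extend_map_comp[OF D, where \<delta> = \<delta>]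
  by (intro conjI allI ballI impI) (simp_all only: base_change_simps)

end

section \<open>The pre-Lie product of families\<close>

text \<open>A sign that acts on every abelian group: elements, power series and families carry the
  same notation, and signs on families require no scalar multiplication of functions.\<close>

definition koszul :: "int \<Rightarrow> int \<Rightarrow> 'a \<Rightarrow> 'a::ab_group_add" where
  "koszul i j x = (if odd i \<and> odd j then - x else x)"

lemma koszul_simps [simp]:
  "koszul i j (0::'a::ab_group_add) = 0"
  "koszul i j (x + y) = koszul i j x + koszul i j y"
  "koszul i j (x - y) = koszul i j x - koszul i j y"
  "koszul i j (- x) = - koszul i j x"
  "koszul i j (koszul i j x) = x"
  by (simp_all add: koszul_def)

lemma koszul_even [simp]: "even i \<Longrightarrow> koszul i j x = x" "even j \<Longrightarrow> koszul i j x = x"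
  by (simp_all add: koszul_def)

lemma koszul_commute: "koszul i j x = koszul j i x"
  by (auto simp: koszul_def)

lemma koszul_fun: "koszul i j X = (\<lambda>a. koszul i j (X a))"
  by (auto simp: koszul_def)

lemma koszul_sum: "koszul i j (\<Sum>a\<in>A. f a) = (\<Sum>a\<in>A. koszul i j (f a))"
  by (simp add: koszul_def sum_negf)

text \<open>The number |I| - 1 is additive when one operation is inserted into another, so products
  add the excess degrees e. The part proportional to |I| - 1 is even, hence e alone decides all
  signs. The value 0 on infinite sets lets identities between families be equations of
  functions.\<close>

definition family :: "('k::field_char_0, 'a::ab_group_add) operad_str \<Rightarrow> int \<Rightarrow> int \<Rightarrow> (nat set \<Rightarrow> 'a) \<Rightarrow> bool" where
  "family P c e X \<longleftrightarrow>
     (\<forall>I. finite I \<longrightarrow> X I \<in> op_space P I (2 * c * (int (card I) - 1) + e)) \<and>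
     (\<forall>I. infinite I \<longrightarrow> X I = 0)"

definition symmetric_family :: "('k::field_char_0, 'a::ab_group_add) operad_str \<Rightarrow> (nat set \<Rightarrow> 'a) \<Rightarrow> bool" where
  "symmetric_family P X \<longleftrightarrow>
     (\<forall>I \<sigma>. finite I \<longrightarrow> inj_on \<sigma> I \<longrightarrow> X (\<sigma> ` I) = op_relabel P \<sigma> (X I))"

definition conv ::
  "('k::field_char_0, 'a::ab_group_add) operad_str \<Rightarrow> nat \<Rightarrow> (nat set \<Rightarrow> 'a) \<Rightarrow> (nat set \<Rightarrow> 'a) \<Rightarrow> nat set \<Rightarrow> 'a" where
  "conv P s X Y J =
     (if finite J then \<Sum>A\<in>Pow J. op_comp P s (X (insert s A)) (Y (J - A)) else 0)"

definition fresh :: "nat set \<Rightarrow> nat" where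
  "fresh I = (LEAST s. s \<notin> I)"

lemma fresh: "finite I \<Longrightarrow> fresh I \<notin> I"
  unfolding fresh_def by (rule LeastI_ex) (rule ex_new_if_finite[OF infinite_UNIV_nat])

text \<open>Every natural number may occur as a label, so no single slot serves all J and a new one
  is chosen for each J. For symmetric X the choice does not matter; identities that need two slots
  at once are proved for \<open>conv\<close> first.\<close>

definition dot ::
  "('k::field_char_0, 'a::ab_group_add) operad_str \<Rightarrow> (nat set \<Rightarrow> 'a) \<Rightarrow> (nat set \<Rightarrow> 'a) \<Rightarrow> nat set \<Rightarrow> 'a" where
  "dot P X Y J = conv P (fresh J) X Y J"

text \<open>Both sides run over the ordered decompositions of J into three parts: the left side
  fixes the union of the first two parts first, the right side the first part.\<close>

lemma sum_Pow_nested: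
  fixes F :: "'a set \<Rightarrow> 'a set \<Rightarrow> 'a set \<Rightarrow> 'b::comm_monoid_add"
  assumes "finite J"
  shows "(\<Sum>C\<in>Pow J. \<Sum>A\<in>Pow C. F A (C - A) (J - C)) =
    (\<Sum>A\<in>Pow J. \<Sum>B\<in>Pow (J - A). F A B (J - A - B))"
proof -
  have fin: "finite (Pow C)" if "C \<in> Pow J" for C
    using that assms finite_subset by auto
  have "(\<Sum>C\<in>Pow J. \<Sum>A\<in>Pow C. F A (C - A) (J - C)) =
      (\<Sum>(C, A)\<in>Sigma (Pow J) Pow. F A (C - A) (J - C))"
    using assms fin by (subst sum.Sigma) auto
  also have "\<dots> = (\<Sum>(A, B)\<in>Sigma (Pow J) (\<lambda>A. Pow (J - A)). F A B (J - A - B))"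
    by (rule sum.reindex_bij_witness[where i = "\<lambda>(A, B). (A \<union> B, A)" and j = "\<lambda>(C, A). (A, C - A)"])
      (auto intro: arg_cong2[where f = "F _"])
  also have "\<dots> = (\<Sum>A\<in>Pow J. \<Sum>B\<in>Pow (J - A). F A B (J - A - B))"
    using assms by (subst sum.Sigma) auto
  finally show ?thesis .
qed

lemma sum_Pow_complement:
  "(\<Sum>A\<in>Pow J. F A (J - A)) = (\<Sum>A\<in>Pow J. F (J - A) A)"
  by (rule sum.reindex_bij_witness[where i = "\<lambda>A. J - A" and j = "\<lambda>A. J - A"])
    (auto simp: double_diff)

context operad
begin

lemma scale_koszul [simp]: "op_scale P (ksgn i j) x = koszul i j x"
  by (simp add: scale_ksgn koszul_def)

lemma space_koszul: "x \<in> op_space P I j \<Longrightarrow> koszul a b x \<in> op_space P I j"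
  by (simp add: koszul_def space_neg)

lemma relabel_koszul: "x \<in> op_space P I j \<Longrightarrow> inj_on \<sigma> I \<Longrightarrow>
    op_relabel P \<sigma> (koszul a b x) = koszul a b (op_relabel P \<sigma> x)"
  by (simp add: koszul_def relabel_neg)

lemma familyD: "family P c e X \<Longrightarrow> finite I \<Longrightarrow> X I \<in> op_space P I (2 * c * (int (card I) - 1) + e)"
  by (simp add: family_def)

lemma family_infinite: "family P c e X \<Longrightarrow> infinite I \<Longrightarrow> X I = 0"
  by (simp add: family_def)

lemma symmetric_familyD:
  "symmetric_family P X \<Longrightarrow> finite I \<Longrightarrow> inj_on \<sigma> I \<Longrightarrow> X (\<sigma> ` I) = op_relabel P \<sigma> (X I)"
  by (simp add: symmetric_family_def)

lemma family_slot:
  assumes "family P c e X" "finite A" "s \<notin> A"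
  shows "X (insert s A) \<in> op_space P (insert s A) (2 * c * int (card A) + e)"
  using familyD[OF assms(1), of "insert s A"] assms by simp

lemma family_term:
  assumes "family P c e X" "family P c e' Y" "finite J" "s \<notin> J" "A \<subseteq> J"
  shows "op_comp P s (X (insert s A)) (Y (J - A)) \<in>
    op_space P J (2 * c * (int (card J) - 1) + (e + e'))"
proof -
  have A: "finite A" "s \<notin> A" "finite (J - A)" using assms finite_subset by auto
  have "op_comp P s (X (insert s A)) (Y (J - A)) \<in> op_space P ((insert s A - {s}) \<union> (J - A))
      (2 * c * int (card A) + e + (2 * c * (int (card (J - A)) - 1) + e'))"
    using A by (intro comp_space[OF family_slot[OF assms(1)] familyD[OF assms(2)]]) auto
  moreover have "(insert s A - {s}) \<union> (J - A) = J" using A assms(4,5) by auto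
  moreover have "card J = card A + card (J - A)"
    using assms(3,5) A by (metis card_Diff_subset card_mono le_add_diff_inverse)
  then have "2 * c * int (card A) + e + (2 * c * (int (card (J - A)) - 1) + e') =
      2 * c * (int (card J) - 1) + (e + e')"
    by (simp add: algebra_simps)
  ultimately show ?thesis by simp
qed

lemma conv_space:
  assumes "family P c e X" "family P c e' Y" "finite J" "s \<notin> J"
  shows "conv P s X Y J \<in> op_space P J (2 * c * (int (card J) - 1) + (e + e'))"
  unfolding conv_def using assms family_term[OF assms] by (auto intro!: space_sum)

text \<open>The part of the product of X, Y, Z in which Y and Z are inserted into two different
  slots of X. It is the difference between the two bracketings.\<close>

definition triple where
  "triple s t X Y Z J = (\<Sum>C\<in>Pow J. \<Sum>A\<in>Pow C.
     op_comp P t (op_comp P s (X (insert t (insert s A))) (Y (C - A))) (Z (J - C)))"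

text \<open>The slot t of a composite of X and Y belongs either to Y or to X. In the first case the
  sequential axiom moves the bracket, in the second Z is inserted into X beside Y.\<close>

lemma conv_conv:
  assumes X: "family P c e1 X" and Y: "family P c e2 Y" and Z: "family P c e3 Z"
    and J: "finite J" "s \<notin> J" "t \<notin> J" "s \<noteq> t"
  shows "conv P t (conv P s X Y) Z J = conv P s X (conv P t Y Z) J + triple s t X Y Z J"
proof -
  have C: "op_comp P t (conv P s X Y (insert t C)) (Z (J - C)) =
      (\<Sum>A\<in>Pow C. op_comp P s (X (insert s A)) (op_comp P t (Y (insert t (C - A))) (Z (J - C)))) +
      (\<Sum>A\<in>Pow C. op_comp P t (op_comp P s (X (insert t (insert s A))) (Y (C - A))) (Z (J - C)))"
    if "C \<in> Pow J" for C
  proof -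
    have C: "finite C" "t \<notin> C" "s \<notin> C" "finite (J - C)" "C \<subseteq> J"
      using that J finite_subset by auto
    let ?f = "\<lambda>A. op_comp P s (X (insert s A)) (Y (insert t (C - A)))"
    let ?g = "\<lambda>A. op_comp P s (X (insert t (insert s A))) (Y (C - A))"
    let ?sp = "op_space P (insert t C) (2 * c * (int (card (insert t C)) - 1) + (e1 + e2))"
    have f: "?f A \<in> ?sp" if "A \<in> Pow C" for A
    proof -
      have "insert t C - A = insert t (C - A)" using C(2) that by auto
      then show ?thesis
        using family_term[OF X Y, of "insert t C" s A] C J that by auto
    qed
    have g: "?g A \<in> ?sp" if "A \<in> Pow C" for A
    proof -
      have "insert t C - insert t A = C - A" using C(2) that by auto
      then show ?thesis
        using family_term[OF X Y, of "insert t C" s "insert t A"] C J that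
        by (auto simp: insert_commute)
    qed
    \<comment> \<open>The label t goes to Y in the first sum and to X in the second.\<close>
    have "conv P s X Y (insert t C) = (\<Sum>A\<in>Pow C. ?f A) + (\<Sum>A\<in>Pow C. ?g A)"
    proof -
      have "insert t C - A = insert t (C - A)" "insert t C - insert t A = C - A" if "A \<in> Pow C" for A
        using that C(2) by auto
      then show ?thesis
        unfolding conv_def using C(1,2) by (simp add: sum_Pow_insert insert_commute)
    qed
    moreover have Zs: "Z (J - C) \<in> op_space P (J - C) (2 * c * (int (card (J - C)) - 1) + e3)"
      by (rule familyD[OF Z C(4)])
    have d: "(insert t C - {t}) \<inter> (J - C) = {}" "t \<in> insert t C" by auto
    have "op_comp P t (\<Sum>A\<in>Pow C. ?f A) (Z (J - C)) = (\<Sum>A\<in>Pow C. op_comp P t (?f A) (Z (J - C)))"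
      "op_comp P t (\<Sum>A\<in>Pow C. ?g A) (Z (J - C)) = (\<Sum>A\<in>Pow C. op_comp P t (?g A) (Z (J - C)))"
      using C(1) by (intro comp_sum_left[OF _ f Zs d(2,1)] comp_sum_left[OF _ g Zs d(2,1)]; simp)+
    moreover have "op_comp P t ((\<Sum>A\<in>Pow C. ?f A) + (\<Sum>A\<in>Pow C. ?g A)) (Z (J - C)) =
        op_comp P t (\<Sum>A\<in>Pow C. ?f A) (Z (J - C)) + op_comp P t (\<Sum>A\<in>Pow C. ?g A) (Z (J - C))"
      using C(1) f g by (intro comp_add_left[OF space_sum space_sum Zs d(2,1)]) auto
    moreover have "op_comp P t (?f A) (Z (J - C)) =
        op_comp P s (X (insert s A)) (op_comp P t (Y (insert t (C - A))) (Z (J - C)))" if "A \<in> Pow C" for A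
    proof -
      have A: "finite A" "s \<notin> A" "finite (C - A)" "t \<notin> C - A" using that C finite_subset by auto
      show ?thesis
        by (rule comp_sequential[OF family_slot[OF X A(1,2)] family_slot[OF Y A(3,4)] Zs])
          (use that C J in auto)
    qed
    ultimately show ?thesis by simp
  qed
  have "(\<Sum>C\<in>Pow J. \<Sum>A\<in>Pow C. op_comp P s (X (insert s A)) (op_comp P t (Y (insert t (C - A))) (Z (J - C))))
      = (\<Sum>A\<in>Pow J. \<Sum>B\<in>Pow (J - A). op_comp P s (X (insert s A)) (op_comp P t (Y (insert t B)) (Z (J - A - B))))"
    by (rule sum_Pow_nested[OF J(1), of "\<lambda>A B C. op_comp P s (X (insert s A)) (op_comp P t (Y (insert t B)) (Z C))"])
  also have "\<dots> = conv P s X (conv P t Y Z) J"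
  proof -
    have "(\<Sum>B\<in>Pow (J - A). op_comp P s (X (insert s A)) (op_comp P t (Y (insert t B)) (Z (J - A - B)))) =
        op_comp P s (X (insert s A)) (\<Sum>B\<in>Pow (J - A). op_comp P t (Y (insert t B)) (Z (J - A - B)))"
      if A: "A \<in> Pow J" for A
    proof -
      have A': "finite A" "s \<notin> A" using A J finite_subset by auto
      show ?thesis
        by (rule comp_sum_right[symmetric, OF _ family_term[OF Y Z] family_slot[OF X A']])
          (use A J in auto)
    qed
    then show ?thesis unfolding conv_def using J(1) by simp
  qed
  finally show ?thesis
    unfolding conv_def[of P t "conv P s X Y"] triple_def using J(1) C by (simp add: sum.distrib)
qed

text \<open>The parallel axiom summed over all decompositions. The degrees of the components of Y
  and Z differ from e2 and e3 by even numbers, so one sign serves all summands.\<close>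

lemma triple_swap:
  assumes X: "family P c e1 X" and Y: "family P c e2 Y" and Z: "family P c e3 Z"
    and J: "finite J" "s \<notin> J" "t \<notin> J" "s \<noteq> t"
  shows "triple s t X Y Z J = koszul e2 e3 (triple t s X Z Y J)"
proof -
  have par: "op_comp P t (op_comp P s (X (insert t (insert s A))) (Y B)) (Z (J - A - B)) =
      koszul e2 e3 (op_comp P s (op_comp P t (X (insert s (insert t A))) (Z (J - A - B))) (Y B))"
    if "A \<subseteq> J" "B \<subseteq> J - A" for A B
  proof -
    have fin: "finite A" "finite B" "s \<notin> insert t A" "t \<notin> A" "finite (J - A - B)"
      using that J finite_subset by (auto intro: finite_subset[of _ J])
    have Xs: "X (insert t (insert s A)) \<in> op_space P (insert t (insert s A)) (2 * c * int (card (insert t A)) + e1)"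
      using family_slot[OF X, of "insert t A" s] fin by (simp add: insert_commute)
    have "ksgn (2 * c * (int (card B) - 1) + e2) (2 * c * (int (card (J - A - B)) - 1) + e3) = (ksgn e2 e3 :: 'k)"
      by (simp add: ksgn_def)
    then show ?thesis
      using comp_parallel[OF Xs familyD[OF Y fin(2)] familyD[OF Z fin(5)], of s t] that J
      by (auto simp: insert_commute)
  qed
  have "triple s t X Y Z J = (\<Sum>A\<in>Pow J. \<Sum>B\<in>Pow (J - A).
      op_comp P t (op_comp P s (X (insert t (insert s A))) (Y B)) (Z (J - A - B)))"
    unfolding triple_def
    by (rule sum_Pow_nested[OF J(1), of "\<lambda>A B C. op_comp P t (op_comp P s (X (insert t (insert s A))) (Y B)) (Z C)"])
  also have "\<dots> = koszul e2 e3 (\<Sum>A\<in>Pow J. \<Sum>B\<in>Pow (J - A).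
      op_comp P s (op_comp P t (X (insert s (insert t A))) (Z (J - A - B))) (Y B))"
    unfolding koszul_sum by (intro sum.cong HOL.refl par) auto
  also have "(\<Sum>A\<in>Pow J. \<Sum>B\<in>Pow (J - A).
      op_comp P s (op_comp P t (X (insert s (insert t A))) (Z (J - A - B))) (Y B)) =
      (\<Sum>A\<in>Pow J. \<Sum>B\<in>Pow (J - A).
      op_comp P s (op_comp P t (X (insert s (insert t A))) (Z B)) (Y (J - A - B)))"
  proof (rule sum.cong[OF HOL.refl])
    fix A show "(\<Sum>B\<in>Pow (J - A). op_comp P s (op_comp P t (X (insert s (insert t A))) (Z (J - A - B))) (Y B)) =
      (\<Sum>B\<in>Pow (J - A). op_comp P s (op_comp P t (X (insert s (insert t A))) (Z B)) (Y (J - A - B)))"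
      by (rule sum_Pow_complement[of "\<lambda>B C. op_comp P s (op_comp P t (X (insert s (insert t A))) (Z C)) (Y B)"])
  qed
  also have "\<dots> = triple t s X Z Y J"
    unfolding triple_def
    by (rule sum_Pow_nested[OF J(1), of "\<lambda>A B C. op_comp P s (op_comp P t (X (insert s (insert t A))) (Z B)) (Y C)", symmetric])
  finally show ?thesis .
qed

lemma conv_pre_lie:
  assumes X: "family P c e1 X" and Y: "family P c e2 Y" and Z: "family P c e3 Z"
    and J: "finite J" "s \<notin> J" "t \<notin> J" "s \<noteq> t"
  shows "conv P t (conv P s X Y) Z J - conv P s X (conv P t Y Z) J =
    koszul e2 e3 (conv P s (conv P t X Z) Y J - conv P t X (conv P s Z Y) J)"
  using conv_conv[OF X Y Z J] conv_conv[OF X Z Y, of J t s] triple_swap[OF X Y Z J] J by simp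

lemma conv_rename_slot:
  assumes X: "family P c e1 X" "symmetric_family P X" and Y: "family P c e2 Y"
    and J: "finite J" "s \<notin> J" "t \<notin> J"
  shows "conv P s X Y J = conv P t X Y J"
proof -
  have "op_comp P t (X (insert t A)) (Y (J - A)) = op_comp P s (X (insert s A)) (Y (J - A))"
    if "A \<in> Pow J" for A
  proof -
    have A: "finite A" "s \<notin> A" "t \<notin> A" "finite (J - A)" using that J finite_subset by auto
    have "(id(s := t)) ` insert s A = insert t A" using A by auto
    moreover have "inj_on (id(s := t)) (insert s A)" using A by (auto simp: inj_on_def)
    ultimately have "X (insert t A) = op_relabel P (id(s := t)) (X (insert s A))"
      using symmetric_familyD[OF X(2), of "insert s A" "id(s := t)"] A(1) by simp
    then show ?thesis
      using comp_rename_slot[OF family_slot[OF X(1) A(1,2)] familyD[OF Y A(4)], of s t] A that by auto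
  qed
  then show ?thesis unfolding conv_def by simp
qed

lemma dot_eq_conv:
  "\<lbrakk>family P c e1 X; symmetric_family P X; family P c e2 Y; s \<notin> J\<rbrakk> \<Longrightarrow> dot P X Y J = conv P s X Y J"
  unfolding dot_def using conv_rename_slot fresh by (cases "finite J") (blast, simp add: conv_def)

lemma family_dot:
  assumes "family P c e1 X" "family P c e2 Y"
  shows "family P c (e1 + e2) (dot P X Y)"
  unfolding family_def dot_def using conv_space[OF assms] fresh by (auto simp: conv_def)

lemma symmetric_family_dot:
  assumes X: "family P c e1 X" "symmetric_family P X" and Y: "family P c e2 Y" "symmetric_family P Y"
  shows "symmetric_family P (dot P X Y)"
  unfolding symmetric_family_def
proof (intro allI impI)
  fix I and \<sigma> :: "nat \<Rightarrow> nat" assume I: "finite I" and \<sigma>: "inj_on \<sigma> I"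
  define s where "s = fresh I"
  define t where "t = fresh (\<sigma> ` I)"
  have s: "s \<notin> I" and t: "t \<notin> \<sigma> ` I" using fresh I by (auto simp: s_def t_def)
  \<comment> \<open>Relabelling a composite by \<sigma> requires a relabelling of X that agrees with
    \<sigma> away from the slot and sends the old slot to the new one.\<close>
  define \<tau> where "\<tau> = \<sigma>(s := t)"
  have "op_relabel P \<sigma> (dot P X Y I) = (\<Sum>A\<in>Pow I. op_relabel P \<sigma> (op_comp P s (X (insert s A)) (Y (I - A))))"
    unfolding dot_def conv_def s_def[symmetric] using I \<sigma> s
    by (auto intro!: relabel_sum[OF _ _ family_term[OF X(1) Y(1)]])
  also have "\<dots> = (\<Sum>A\<in>Pow I. op_comp P t (X (insert t (\<sigma> ` A))) (Y (\<sigma> ` I - \<sigma> ` A)))"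
  proof (rule sum.cong[OF HOL.refl])
    fix A assume "A \<in> Pow I"
    then have A: "finite A" "A \<subseteq> I" "s \<notin> A" "finite (I - A)" "inj_on \<sigma> A" "inj_on \<sigma> (I - A)"
      using I s \<sigma> finite_subset by (auto intro: inj_on_subset)
    have \<tau>A: "\<tau> ` A = \<sigma> ` A" and \<tau>: "inj_on \<tau> (insert s A)"
      using A s t by (auto simp: \<tau>_def inj_on_def)
    have \<tau>s: "\<tau> s = t" by (simp add: \<tau>_def)
    have eq: "(insert s A - {s}) \<union> (I - A) = I" using A by auto
    have \<tau>\<sigma>: "\<tau> a = \<sigma> a" if "a \<in> insert s A - {s}" for a using that by (auto simp: \<tau>_def)
    have "op_relabel P \<sigma> (op_comp P s (X (insert s A)) (Y (I - A))) =
        op_comp P (\<tau> s) (op_relabel P \<tau> (X (insert s A))) (op_relabel P \<sigma> (Y (I - A)))"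
      by (rule comp_relabel[OF family_slot[OF X(1) A(1,3)] familyD[OF Y(1) A(4)] _ _ _ \<tau> \<tau>\<sigma>])
        (simp, use A in blast, unfold eq, rule \<sigma>)
    also have "op_relabel P \<tau> (X (insert s A)) = X (insert t (\<sigma> ` A))"
      using symmetric_familyD[OF X(2) _ \<tau>] A(1) \<tau>A \<tau>s by simp
    also have "op_relabel P \<sigma> (Y (I - A)) = Y (\<sigma> ` I - \<sigma> ` A)"
      using symmetric_familyD[OF Y(2) A(4,6)] inj_on_image_set_diff[OF \<sigma>, of I A] A(2) by simp
    finally show "op_relabel P \<sigma> (op_comp P s (X (insert s A)) (Y (I - A))) =
        op_comp P t (X (insert t (\<sigma> ` A))) (Y (\<sigma> ` I - \<sigma> ` A))"
      by (simp add: \<tau>s)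
  qed
  also have "\<dots> = (\<Sum>B\<in>Pow (\<sigma> ` I). op_comp P t (X (insert t B)) (Y (\<sigma> ` I - B)))"
    using inj_on_image_Pow[OF \<sigma>] by (subst image_Pow_surj[OF HOL.refl, symmetric]) (simp add: sum.reindex)
  also have "\<dots> = dot P X Y (\<sigma> ` I)" using I by (simp add: dot_def conv_def t_def)
  finally show "dot P X Y (\<sigma> ` I) = op_relabel P \<sigma> (dot P X Y I)" ..
qed

lemma family_zero: "family P c e 0"
  by (simp add: family_def space_zero)

lemma family_add: "family P c e X \<Longrightarrow> family P c e Y \<Longrightarrow> family P c e (X + Y)"
  by (simp add: family_def space_add)

lemma family_neg: "family P c e X \<Longrightarrow> family P c e (- X)"
  by (simp add: family_def space_neg)

lemma family_diff: "family P c e X \<Longrightarrow> family P c e Y \<Longrightarrow> family P c e (X - Y)"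
  by (simp add: family_def space_diff)

lemma family_koszul: "family P c e X \<Longrightarrow> family P c e (koszul a b X)"
  by (simp add: koszul_def family_neg)

lemma symmetric_family_diff:
  "\<lbrakk>family P c e X; family P c e Y; symmetric_family P X; symmetric_family P Y\<rbrakk> \<Longrightarrow> symmetric_family P (X - Y)"
  unfolding symmetric_family_def using relabel_diff familyD by (simp add: fun_diff_def) metis

lemma conv_add_left:
  assumes "family P c e X" "family P c e X'" "family P c e' Y" "s \<notin> J"
  shows "conv P s (X + X') Y J = conv P s X Y J + conv P s X' Y J"
proof -
  have "op_comp P s ((X + X') (insert s A)) (Y (J - A)) =
      op_comp P s (X (insert s A)) (Y (J - A)) + op_comp P s (X' (insert s A)) (Y (J - A))"
    if "finite J" "A \<in> Pow J" for A
  proof -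
    have "finite A" "s \<notin> A" "finite (J - A)" using that assms finite_subset by auto
    then show ?thesis
      unfolding plus_fun_apply
      by (intro comp_add_left[OF family_slot[OF assms(1)] family_slot[OF assms(2)] familyD[OF assms(3)]]) auto
  qed
  then show ?thesis by (simp add: conv_def sum.distrib)
qed

lemma conv_add_right:
  assumes "family P c e X" "family P c e' Y" "family P c e' Y'" "s \<notin> J"
  shows "conv P s X (Y + Y') J = conv P s X Y J + conv P s X Y' J"
proof -
  have "op_comp P s (X (insert s A)) ((Y + Y') (J - A)) =
      op_comp P s (X (insert s A)) (Y (J - A)) + op_comp P s (X (insert s A)) (Y' (J - A))"
    if "finite J" "A \<in> Pow J" for A
  proof -
    have "finite A" "s \<notin> A" "finite (J - A)" using that assms finite_subset by auto
    then show ?thesis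
      unfolding plus_fun_apply
      by (intro comp_add_right[OF family_slot[OF assms(1)] familyD[OF assms(2)] familyD[OF assms(3)]]) auto
  qed
  then show ?thesis by (simp add: conv_def sum.distrib)
qed

lemma conv_zero:
  assumes "s \<notin> J"
  shows "family P c e Y \<Longrightarrow> conv P s 0 Y J = 0" "family P c e X \<Longrightarrow> conv P s X 0 J = 0"
  using conv_add_left[of c e 0 0 e Y s J] conv_add_right[of c e X e 0 0 s J] family_zero assms
  by simp_all

lemma conv_neg_left:
  assumes "family P c e X" "family P c e' Y" "s \<notin> J"
  shows "conv P s (- X) Y J = - conv P s X Y J"
  using conv_add_left[OF assms(1) family_neg[OF assms(1)] assms(2,3)] conv_zero(1)[OF assms(3,2)]
  by (simp add: eq_neg_iff_add_eq_0 add.commute)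

lemma conv_neg_right:
  assumes "family P c e X" "family P c e' Y" "s \<notin> J"
  shows "conv P s X (- Y) J = - conv P s X Y J"
  using conv_add_right[OF assms(1,2) family_neg[OF assms(2)] assms(3)] conv_zero(2)[OF assms(3,1)]
  by (simp add: eq_neg_iff_add_eq_0 add.commute)

lemma dot_add_left:
  "\<lbrakk>family P c e X; family P c e X'; family P c e' Y\<rbrakk> \<Longrightarrow> dot P (X + X') Y = dot P X Y + dot P X' Y"
  using conv_add_left fresh by (auto simp: dot_def fun_eq_iff) (metis add.left_neutral conv_def fresh)

lemma dot_add_right:
  "\<lbrakk>family P c e X; family P c e' Y; family P c e' Y'\<rbrakk> \<Longrightarrow> dot P X (Y + Y') = dot P X Y + dot P X Y'"
  using conv_add_right fresh by (auto simp: dot_def fun_eq_iff) (metis add.left_neutral conv_def fresh)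

lemma dot_neg_left: "family P c e X \<Longrightarrow> family P c e' Y \<Longrightarrow> dot P (- X) Y = - dot P X Y"
  using conv_neg_left fresh by (auto simp: dot_def fun_eq_iff) (metis add.inverse_neutral conv_def fresh)

lemma dot_neg_right: "family P c e X \<Longrightarrow> family P c e' Y \<Longrightarrow> dot P X (- Y) = - dot P X Y"
  using conv_neg_right fresh by (auto simp: dot_def fun_eq_iff) (metis add.inverse_neutral conv_def fresh)

lemma dot_diff_left:
  "\<lbrakk>family P c e X; family P c e X'; family P c e' Y\<rbrakk> \<Longrightarrow> dot P (X - X') Y = dot P X Y - dot P X' Y"
  using dot_add_left[of c e X "- X'" e' Y] dot_neg_left[of c e X' e' Y] family_neg by simp

lemma dot_diff_right:
  "\<lbrakk>family P c e X; family P c e' Y; family P c e' Y'\<rbrakk> \<Longrightarrow> dot P X (Y - Y') = dot P X Y - dot P X Y'"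
  using dot_add_right[of c e X e' Y "- Y'"] dot_neg_right[of c e X e' Y'] family_neg by simp

lemma dot_koszul_right: "family P c e X \<Longrightarrow> family P c e' Y \<Longrightarrow> dot P X (koszul a b Y) = koszul a b (dot P X Y)"
  by (simp add: koszul_def dot_neg_right)

lemma dot_pre_lie:
  assumes X: "family P c e1 X" "symmetric_family P X" and Y: "family P c e2 Y" "symmetric_family P Y"
    and Z: "family P c e3 Z" "symmetric_family P Z"
  shows "dot P (dot P X Y) Z - dot P X (dot P Y Z) =
    koszul e2 e3 (dot P (dot P X Z) Y - dot P X (dot P Z Y))"
proof
  fix J
  note XY = family_dot[OF X(1) Y(1)] symmetric_family_dot[OF X Y]
    and XZ = family_dot[OF X(1) Z(1)] symmetric_family_dot[OF X Z]
    and YZ = family_dot[OF Y(1) Z(1)] and ZY = family_dot[OF Z(1) Y(1)]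
  show "(dot P (dot P X Y) Z - dot P X (dot P Y Z)) J =
    koszul e2 e3 (dot P (dot P X Z) Y - dot P X (dot P Z Y)) J"
  proof (cases "finite J")
    case True
    \<comment> \<open>Two slots outside J are fixed for all four products. Each inner product is
      then computed with a slot that also lies outside the larger set, containing the other slot, on
      which it may be evaluated.\<close>
    define s where "s = fresh J"
    define t where "t = fresh (insert s J)"
    have st: "s \<notin> J" "t \<notin> J" "s \<noteq> t" 
      using fresh[OF True] fresh[of "insert s J"] True unfolding s_def t_def by auto
    have *: "conv P s X Y' J = conv P s X Y'' J"
      if "\<And>A. A \<subseteq> J \<Longrightarrow> Y' A = Y'' A" for s X Y' Y''
      unfolding conv_def using that by (auto intro!: sum.cong)
    have **: "conv P s X Y' J = conv P s X' Y' J"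
      if "\<And>A. A \<subseteq> J \<Longrightarrow> X (insert s A) = X' (insert s A)" for s X X' Y'
      unfolding conv_def using that by (auto intro!: sum.cong)
    have "dot P (dot P X Y) Z J = conv P t (conv P s X Y) Z J"
      unfolding dot_eq_conv[OF XY Z(1) st(2)]
      by (rule **) (use st in \<open>auto intro!: dot_eq_conv[OF X Y(1)]\<close>)
    moreover have "dot P X (dot P Y Z) J = conv P s X (conv P t Y Z) J"
      unfolding dot_eq_conv[OF X YZ st(1)]
      by (rule *) (use st in \<open>auto intro!: dot_eq_conv[OF Y Z(1)]\<close>)
    moreover have "dot P (dot P X Z) Y J = conv P s (conv P t X Z) Y J"
      unfolding dot_eq_conv[OF XZ Y(1) st(1)]
      by (rule **) (use st in \<open>auto intro!: dot_eq_conv[OF X Z(1)]\<close>)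
    moreover have "dot P X (dot P Z Y) J = conv P t X (conv P s Z Y) J"
      unfolding dot_eq_conv[OF X ZY st(2)]
      by (rule *) (use st in \<open>auto intro!: dot_eq_conv[OF Z Y(1)]\<close>)
    ultimately show ?thesis
      using conv_pre_lie[OF X(1) Y(1) Z(1) True st] by (simp add: koszul_fun)
  qed (simp add: dot_def conv_def koszul_fun)
qed

lemma conv_derivation:
  assumes D: "derivation P e D" and X: "family P c e1 X" and Y: "family P c e2 Y" and s: "s \<notin> J"
  shows "D (conv P s X Y J) = conv P s (D \<circ> X) Y J + koszul e e1 (conv P s X (D \<circ> Y) J)"
proof (cases "finite J")
  case True
  have "D (op_comp P s (X (insert s A)) (Y (J - A))) =
      op_comp P s (D (X (insert s A))) (Y (J - A)) + koszul e e1 (op_comp P s (X (insert s A)) (D (Y (J - A))))"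
    if "A \<in> Pow J" for A
  proof -
    have A: "finite A" "s \<notin> A" "finite (J - A)" using that s True finite_subset by auto
    have "ksgn e (2 * c * int (card A) + e1) = (ksgn e e1 :: 'k)" by (simp add: ksgn_def)
    then show ?thesis
      using derivationD(5)[OF D family_slot[OF X A(1,2)] familyD[OF Y A(3)], of s] A by auto
  qed
  then show ?thesis
    using derivation_sum[OF D True family_term[OF X Y True s], of "Pow J" "\<lambda>A. A"] True
    by (simp add: conv_def sum.distrib koszul_sum)
qed (simp add: conv_def derivation_zero[OF D])

lemma family_derivation:
  assumes D: "derivation P e D" and X: "family P c e1 X"
  shows "family P c (e1 + e) (D \<circ> X)"
  unfolding family_def using derivationD(1)[OF D familyD[OF X]] family_infinite[OF X] derivation_zero[OF D]
  by (simp add: algebra_simps)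

lemma symmetric_family_derivation:
  assumes D: "derivation P e D" and X: "family P c e1 X" "symmetric_family P X"
  shows "symmetric_family P (D \<circ> X)"
  unfolding symmetric_family_def
  using derivationD(4)[OF D familyD[OF X(1)]] symmetric_familyD[OF X(2)] by simp

lemma dot_derivation:
  assumes D: "derivation P e D" and X: "family P c e1 X" and Y: "family P c e2 Y"
  shows "D \<circ> dot P X Y = dot P (D \<circ> X) Y + koszul e e1 (dot P X (D \<circ> Y))"
proof
  fix J
  show "(D \<circ> dot P X Y) J = (dot P (D \<circ> X) Y + koszul e e1 (dot P X (D \<circ> Y))) J"
  proof (cases "finite J")
    case True
    then show ?thesis using conv_derivation[OF D X Y fresh] by (simp add: dot_def koszul_fun)
  qed (simp add: dot_def conv_def koszul_fun derivation_zero[OF D])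
qed

end

section \<open>Linear equations in families\<close>

text \<open>The operator \<open>Y \<mapsto> Y - m \<cdot> Y\<close> is unitriangular in the number of labels.\<close>

definition app ::
  "('k::field_char_0, 'a::ab_group_add) operad_str \<Rightarrow> (nat set \<Rightarrow> 'a) \<Rightarrow> (nat set \<Rightarrow> 'a) \<Rightarrow> nat set \<Rightarrow> 'a" where
  "app P m Y = Y - dot P m Y"

text \<open>Back substitution in the unitriangular system. The summand with A empty involves m on a
  one-element set, which is zero for all m considered; omitting it makes the recursion descend to
  smaller label sets.\<close>

function solve ::
  "('k::field_char_0, 'a::ab_group_add) operad_str \<Rightarrow> (nat set \<Rightarrow> 'a) \<Rightarrow> (nat set \<Rightarrow> 'a) \<Rightarrow> nat set \<Rightarrow> 'a" where
  "solve P m y J = (if finite J then y J + (\<Sum>A\<in>Pow J - {{}}.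
      op_comp P (fresh J) (m (insert (fresh J) A)) (solve P m y (J - A))) else 0)"
  by auto
termination
proof (relation "measure (\<lambda>(P, m, y, J). card J)", goal_cases)
  case (2 P m y J A)
  then have "J - A \<subset> J" by auto
  with 2 show ?case by (simp add: psubset_card_mono)
qed simp

declare solve.simps [simp del]

context operad
begin

lemma app_apply:
  assumes m: "family P c 0 m" "symmetric_family P m" "\<And>s. m {s} = 0" and Y: "family P c e Y" and J: "finite J" "s \<notin> J"
  shows "app P m Y J = Y J - (\<Sum>A\<in>Pow J - {{}}. op_comp P s (m (insert s A)) (Y (J - A)))"
proof -
  have "dot P m Y J = conv P s m Y J" by (rule dot_eq_conv[OF m(1,2) Y J(2)])
  also have "\<dots> = op_comp P s (m {s}) (Y J) + (\<Sum>A\<in>Pow J - {{}}. op_comp P s (m (insert s A)) (Y (J - A)))"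
    using J by (simp add: conv_def sum.remove[of "Pow J" "{}"])
  finally show ?thesis using familyD[OF Y J(1)] m(3) by (simp add: app_def)
qed

lemma family_app: "family P c 0 m \<Longrightarrow> family P c e Y \<Longrightarrow> family P c e (app P m Y)"
  unfolding app_def using family_dot[of c 0 m e Y] family_diff by simp

lemma symmetric_family_app:
  assumes "family P c 0 m" "symmetric_family P m" "family P c e Y" "symmetric_family P Y"
  shows "symmetric_family P (app P m Y)"
  unfolding app_def
  using symmetric_family_diff[OF assms(3) _ assms(4) symmetric_family_dot[OF assms]]
    family_dot[OF assms(1,3)] by simp

lemma app_add: "\<lbrakk>family P c 0 m; family P c e Y; family P c e Y'\<rbrakk> \<Longrightarrow> app P m (Y + Y') = app P m Y + app P m Y'"
  by (simp add: app_def dot_add_right)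

lemma app_diff: "\<lbrakk>family P c 0 m; family P c e Y; family P c e Y'\<rbrakk> \<Longrightarrow> app P m (Y - Y') = app P m Y - app P m Y'"
  by (simp add: app_def dot_diff_right)

lemma app_koszul: "\<lbrakk>family P c 0 m; family P c e Y\<rbrakk> \<Longrightarrow> app P m (koszul a b Y) = koszul a b (app P m Y)"
  by (simp add: app_def dot_koszul_right)

text \<open>By induction on the number of labels, the equation on J determines Y on J from its
  values on smaller sets. The localization to subsets of N is essential later, where a candidate
  solution is meaningful only on sets that avoid a chosen slot.\<close>

lemma app_unique:
  assumes m: "family P c 0 m" "symmetric_family P m" "\<And>s. m {s} = 0"
    and Y: "family P c e Y" "family P c e Y'"
    and eq: "\<And>J. J \<subseteq> N \<Longrightarrow> app P m Y J = app P m Y' J" and "finite N" "J \<subseteq> N"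
  shows "Y J = Y' J"
  using \<open>J \<subseteq> N\<close>
proof (induction "card J" arbitrary: J rule: less_induct)
  case less
  have J: "finite J" using less.prems assms(7) finite_subset by blast
  have "Y (J - A) = Y' (J - A)" if "A \<in> Pow J - {{}}" for A
  proof -
    have "J - A \<subset> J" using that by auto
    then show ?thesis using less.prems by (intro less.hyps psubset_card_mono[OF J]) auto
  qed
  then have "(\<Sum>A\<in>Pow J - {{}}. op_comp P (fresh J) (m (insert (fresh J) A)) (Y (J - A))) =
    (\<Sum>A\<in>Pow J - {{}}. op_comp P (fresh J) (m (insert (fresh J) A)) (Y' (J - A)))" by simp
  then show ?case
    using eq[OF less.prems] app_apply[OF m Y(1) J fresh[OF J]] app_apply[OF m Y(2) J fresh[OF J]] by simp
qed

lemma app_inject: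
  assumes m: "family P c 0 m" "symmetric_family P m" "\<And>s. m {s} = 0"
    and Y: "family P c e Y" "family P c e Y'" and eq: "app P m Y = app P m Y'"
  shows "Y = Y'"
proof
  fix J show "Y J = Y' J"
    using app_unique[OF m Y, of J J] eq family_infinite[OF Y(1)] family_infinite[OF Y(2)]
    by (cases "finite J") auto
qed

lemma family_solve:
  assumes m: "family P c 0 m" and y: "family P c e y"
  shows "family P c e (solve P m y)"
  unfolding family_def
proof (intro conjI allI impI)
  fix J :: "nat set" assume "finite J"
  then show "solve P m y J \<in> op_space P J (2 * c * (int (card J) - 1) + e)"
  proof (induction "card J" arbitrary: J rule: less_induct)
    case less
    define s where "s = fresh J"
    have s: "s \<notin> J" using fresh[OF less.prems] by (simp add: s_def)
    have "op_comp P s (m (insert s A)) (solve P m y (J - A)) \<in>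
        op_space P J (2 * c * (int (card J) - 1) + e)" if A: "A \<in> Pow J - {{}}" for A
    proof -
      have fin: "finite A" "finite (J - A)" "s \<notin> A" using A less.prems s finite_subset by auto
      have "J - A \<subset> J" using A by auto
      then have IH: "solve P m y (J - A) \<in> op_space P (J - A) (2 * c * (int (card (J - A)) - 1) + e)"
        using less.prems fin by (intro less.hyps psubset_card_mono) auto
      have c: "op_comp P s (m (insert s A)) (solve P m y (J - A)) \<in> op_space P ((insert s A - {s}) \<union> (J - A))
          (2 * c * int (card A) + 0 + (2 * c * (int (card (J - A)) - 1) + e))"
        by (rule comp_space[OF family_slot[OF m fin(1,3)] IH]) (use fin in auto)
      have eq: "(insert s A - {s}) \<union> (J - A) = J" using A fin by auto
      have "card J = card A + card (J - A)"
        using less.prems A fin by (metis DiffD1 PowD card_Diff_subset card_mono le_add_diff_inverse)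
      then have deg: "2 * c * int (card A) + 0 + (2 * c * (int (card (J - A)) - 1) + e) =
          2 * c * (int (card J) - 1) + e" by (simp add: algebra_simps)
      show ?thesis using c unfolding eq deg .
    qed
    then show ?case
      using familyD[OF y less.prems] less.prems unfolding solve.simps[of P m y J] s_def[symmetric]
      by (auto intro!: space_add space_sum)
  qed
qed (simp add: solve.simps)

lemma app_solve:
  assumes m: "family P c 0 m" "symmetric_family P m" "\<And>s. m {s} = 0" and y: "family P c e y"
  shows "app P m (solve P m y) = y"
proof
  fix J show "app P m (solve P m y) J = y J"
  proof (cases "finite J")
    case True
    show ?thesis
      unfolding app_apply[OF m family_solve[OF m(1) y] True fresh[OF True]]
      using True by (simp add: solve.simps[of P m y J])
  next
    case False
    then show ?thesis
      using family_infinite[OF family_app[OF m(1) family_solve[OF m(1) y]]] family_infinite[OF y] by simp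
  qed
qed

lemma solve_eqI:
  assumes m: "family P c 0 m" "symmetric_family P m" "\<And>s. m {s} = 0" and y: "family P c e y"
    and Y: "family P c e Y" and eq: "app P m Y = y"
  shows "solve P m y = Y"
  by (rule app_inject[OF m family_solve[OF m(1) y] Y]) (simp add: app_solve[OF m y] eq)

text \<open>A right-hand side that marks two labels is not symmetric, as a relabelling changes the
  marks. Equivariance is therefore stated for a pair of right-hand sides that match on the subsets
  of J.\<close>

lemma solve_relabel:
  assumes m: "family P c 0 m" "symmetric_family P m" "\<And>s. m {s} = 0"
    and y: "family P c e y" "family P c e y'" and J: "finite J" and \<sigma>: "inj_on \<sigma> J"
    and eq: "\<And>A. A \<subseteq> J \<Longrightarrow> y' (\<sigma> ` A) = op_relabel P \<sigma> (y A)"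
  shows "solve P m y' (\<sigma> ` J) = op_relabel P \<sigma> (solve P m y J)"
  using J \<sigma> eq
proof (induction "card J" arbitrary: J rule: less_induct)
  case less
  note J = less.prems(1) and \<sigma> = less.prems(2)
  define s where "s = fresh J"
  define t where "t = fresh (\<sigma> ` J)"
  have s: "s \<notin> J" and t: "t \<notin> \<sigma> ` J" using fresh J by (auto simp: s_def t_def)
  define \<tau> where "\<tau> = \<sigma>(s := t)"
  have \<tau>s: "\<tau> s = t" by (simp add: \<tau>_def)
  note sol = familyD[OF family_solve[OF m(1) y(1)]]
  let ?f = "\<lambda>A. op_comp P s (m (insert s A)) (solve P m y (J - A))"
  have f: "?f A \<in> op_space P J (2 * c * (int (card J) - 1) + (0 + e))" if "A \<in> Pow J - {{}}" for A
    using family_term[OF m(1) family_solve[OF m(1) y(1)] J s] that by blast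
  have "op_relabel P \<sigma> (solve P m y J) = op_relabel P \<sigma> (y J) + op_relabel P \<sigma> (\<Sum>A\<in>Pow J - {{}}. ?f A)"
    unfolding solve.simps[of P m y J] s_def[symmetric] using J f familyD[OF y(1) J]
    by (auto intro!: relabel_add[OF _ _ \<sigma>] space_sum)
  also have "op_relabel P \<sigma> (\<Sum>A\<in>Pow J - {{}}. ?f A) = (\<Sum>A\<in>Pow J - {{}}. op_relabel P \<sigma> (?f A))"
    by (rule relabel_sum[OF \<sigma> J f])
  also have "\<dots> = (\<Sum>A\<in>Pow J - {{}}. op_comp P t (m (insert t (\<sigma> ` A))) (solve P m y' (\<sigma> ` J - \<sigma> ` A)))"
  proof (rule sum.cong[OF HOL.refl])
    fix A assume "A \<in> Pow J - {{}}"
    then have A: "finite A" "A \<subseteq> J" "s \<notin> A" "finite (J - A)" "inj_on \<sigma> A" "inj_on \<sigma> (J - A)" "J - A \<subset> J"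
      using J s \<sigma> finite_subset by (auto intro: inj_on_subset)
    have \<tau>A: "\<tau> ` A = \<sigma> ` A" and \<tau>: "inj_on \<tau> (insert s A)"
      using A s t by (auto simp: \<tau>_def inj_on_def)
    have eq: "(insert s A - {s}) \<union> (J - A) = J" using A by auto
    have \<tau>\<sigma>: "\<tau> a = \<sigma> a" if "a \<in> insert s A - {s}" for a using that by (auto simp: \<tau>_def)
    have "op_relabel P \<sigma> (?f A) =
        op_comp P (\<tau> s) (op_relabel P \<tau> (m (insert s A))) (op_relabel P \<sigma> (solve P m y (J - A)))"
      by (rule comp_relabel[OF family_slot[OF m(1) A(1,3)] sol[OF A(4)] _ _ _ \<tau> \<tau>\<sigma>])
        (simp, use A in blast, unfold eq, rule \<sigma>)
    also have "op_relabel P \<tau> (m (insert s A)) = m (insert t (\<sigma> ` A))"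
      using symmetric_familyD[OF m(2) _ \<tau>] A(1) \<tau>A \<tau>s by simp
    also have "op_relabel P \<sigma> (solve P m y (J - A)) = solve P m y' (\<sigma> ` (J - A))"
      by (rule less.hyps[OF psubset_card_mono[OF J A(7)] A(4,6), symmetric]) (use less.prems(3) in blast)
    also have "\<sigma> ` (J - A) = \<sigma> ` J - \<sigma> ` A"
      using inj_on_image_set_diff[OF \<sigma>, of J A] A(2) by simp
    finally show "op_relabel P \<sigma> (?f A) = op_comp P t (m (insert t (\<sigma> ` A))) (solve P m y' (\<sigma> ` J - \<sigma> ` A))"
      by (simp add: \<tau>s)
  qed
  also have "\<dots> = (\<Sum>B\<in>Pow (\<sigma> ` J) - {{}}. op_comp P t (m (insert t B)) (solve P m y' (\<sigma> ` J - B)))"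
  proof -
    have "Pow (\<sigma> ` J) - {{}} = image \<sigma> ` (Pow J - {{}})"
      using inj_on_image_set_diff[OF inj_on_image_Pow[OF \<sigma>], of "Pow J" "{{}}"]
        image_Pow_surj[OF HOL.refl, of \<sigma> J] by simp
    moreover have "inj_on (image \<sigma>) (Pow J - {{}})"
      using inj_on_image_Pow[OF \<sigma>] by (rule inj_on_subset) auto
    ultimately show ?thesis by (simp add: sum.reindex)
  qed
  also have "op_relabel P \<sigma> (y J) + \<dots> = solve P m y' (\<sigma> ` J)"
    using J less.prems(3)[of J] by (simp add: solve.simps[of P m y' "\<sigma> ` J"] t_def)
  finally show ?case ..
qed

lemma symmetric_family_solve:
  assumes "family P c 0 m" "symmetric_family P m" "\<And>s. m {s} = 0"
    and "family P c e y" "symmetric_family P y"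
  shows "symmetric_family P (solve P m y)"
  unfolding symmetric_family_def
proof (intro allI impI)
  fix I and \<sigma> :: "nat \<Rightarrow> nat" assume I: "finite I" "inj_on \<sigma> I"
  show "solve P m y (\<sigma> ` I) = op_relabel P \<sigma> (solve P m y I)"
  proof (rule solve_relabel[OF assms(1-4) assms(4) I])
    fix A assume A: "A \<subseteq> I"
    show "y (\<sigma> ` A) = op_relabel P \<sigma> (y A)"
      by (rule symmetric_familyD[OF assms(5) finite_subset[OF A I(1)] inj_on_subset[OF I(2) A]])
  qed
qed

end

section \<open>Power series with coefficients in an operad\<close>

text \<open>The variable has degree 2.\<close>

definition power_series ::
  "('k::field_char_0, 'a::ab_group_add) operad_str \<Rightarrow> ('k, nat \<Rightarrow> 'a) operad_str" where
  "power_series P = \<lparr>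
     op_space = (\<lambda>I j. {X. \<forall>k. X k \<in> op_space P I (j - 2 * int k)}),
     op_add = (+),
     op_scale = (\<lambda>c X k. op_scale P c (X k)),
     op_relabel = (\<lambda>\<sigma> X k. op_relabel P \<sigma> (X k)),
     op_comp = (\<lambda>s X Y k. \<Sum>i\<le>k. op_comp P s (X i) (Y (k - i))),
     op_unit = (\<lambda>a k. if k = 0 then op_unit P a else 0) \<rparr>"

lemma power_series_simps [simp]:
  "op_add (power_series P) = (+)"
  "op_scale (power_series P) = (\<lambda>c X k. op_scale P c (X k))"
  "op_relabel (power_series P) = (\<lambda>\<sigma> X k. op_relabel P \<sigma> (X k))"
  "op_unit (power_series P) = (\<lambda>a k. if k = 0 then op_unit P a else 0)"
  by (simp_all add: power_series_def)

lemma power_series_space: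
  "X \<in> op_space (power_series P) I j \<longleftrightarrow> (\<forall>k. X k \<in> op_space P I (j - 2 * int k))"
  by (simp add: power_series_def)

lemma power_series_comp:
  "op_comp (power_series P) s X Y k = (\<Sum>i\<le>k. op_comp P s (X i) (Y (k - i)))"
  by (simp add: power_series_def)

lemma sum_nested_atMost:
  fixes F :: "nat \<Rightarrow> nat \<Rightarrow> nat \<Rightarrow> 'b::comm_monoid_add"
  shows "(\<Sum>i\<le>k. \<Sum>l\<le>i. F l (i - l) (k - i)) = (\<Sum>l\<le>k. \<Sum>m\<le>k - l. F l m (k - l - m))"
proof -
  have "(\<Sum>i\<le>k. \<Sum>l\<le>i. F l (i - l) (k - i)) = (\<Sum>(i, l)\<in>Sigma {..k} atMost. F l (i - l) (k - i))"
    by (subst sum.Sigma) auto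
  also have "\<dots> = (\<Sum>(l, m)\<in>Sigma {..k} (\<lambda>l. {..k - l}). F l m (k - l - m))"
    by (rule sum.reindex_bij_witness[where i = "\<lambda>(l, m). (l + m, l)" and j = "\<lambda>(i, l). (l, i - l)"]) auto
  also have "\<dots> = (\<Sum>l\<le>k. \<Sum>m\<le>k - l. F l m (k - l - m))"
    by (subst sum.Sigma) auto
  finally show ?thesis .
qed

lemma sum_atMost_flip:
  "(\<Sum>i\<le>k. F i (k - i)) = (\<Sum>i\<le>(k::nat). F (k - i) i)"
  by (rule sum.reindex_bij_witness[where i = "\<lambda>i. k - i" and j = "\<lambda>i. k - i"]) auto

lemma sum_fun_apply: "(\<Sum>a\<in>A. f a) x = (\<Sum>a\<in>A. f a x)"
  by (induction A rule: infinite_finite_induct) auto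

lemma space_cast: "\<lbrakk>x \<in> op_space P I j; I = I'; j = j'\<rbrakk> \<Longrightarrow> x \<in> op_space P I' j'"
  by simp

context operad
begin

lemma power_seriesD: "X \<in> op_space (power_series P) I i \<Longrightarrow> X k \<in> op_space P I (i - 2 * int k)"
  by (simp add: power_series_space)

lemma power_series_term:
  assumes "X \<in> op_space (power_series P) I i" "Y \<in> op_space (power_series P) J j"
    and "s \<in> I" "(I - {s}) \<inter> J = {}" "l \<le> k"
  shows "op_comp P s (X l) (Y (k - l)) \<in> op_space P ((I - {s}) \<union> J) (i + j - 2 * int k)"
proof -
  have "op_comp P s (X l) (Y (k - l)) \<in>
      op_space P ((I - {s}) \<union> J) (i - 2 * int l + (j - 2 * int (k - l)))"
    by (rule comp_space[OF power_seriesD[OF assms(1)] power_seriesD[OF assms(2)] assms(3,4)])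
  then show ?thesis by (rule space_cast) (use assms(5) in \<open>simp_all add: of_nat_diff\<close>)
qed

lemma power_series_finite: "X \<in> op_space (power_series P) I i \<Longrightarrow> finite I"
  using space_finite unfolding power_series_space by blast

text \<open>The variable is even, so coefficients multiply as for ordinary power series and no sign
  arises; each axiom reduces to that of P by reindexing sums over exponents.\<close>

lemma operad_power_series: "operad (power_series P)"
proof (rule operad.intro)
  let ?W = "power_series P"
  note W = power_seriesD
  show "op_add ?W = (+)" by simp
  show V: "vector_space (op_scale ?W)"
    using vector_space_pointwise[OF vector_space] by simp
  show "op_space ?W I j = {}" if "infinite I" for I j
    using space_infinite[OF that] by (auto simp: power_series_space)
  interpret V: vector_space "op_scale ?W" by (rule V)
  show "V.subspace (op_space ?W I j)" if "finite I" for I j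
    unfolding V.subspace_def using that
    by (auto simp: power_series_space space_zero space_add space_scale)
  show "w q = 0" if K: "finite K" "\<And>I j. (I, j) \<in> K \<Longrightarrow> w (I, j) \<in> op_space ?W I j"
    "(\<Sum>q\<in>K. w q) = 0" "q \<in> K" for K w q
  proof
    fix k :: nat
    define h where "h = (\<lambda>(I::nat set, j). (I, j - 2 * int k))"
    define h' where "h' = (\<lambda>(I::nat set, j). (I, j + 2 * int k))"
    have hh: "h' (h q) = q" for q by (simp add: h_def h'_def split: prod.splits)
    have inj: "inj_on h K" by (rule inj_on_inverseI) (rule hh)
    have "w (h' (h q)) k = 0"
    proof (rule direct[where w = "\<lambda>q. w (h' q) k" and Q = "h ` K"])
      show "w (h' (I, j)) k \<in> op_space P I j" if "(I, j) \<in> h ` K" for I j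
      proof -
        from that have "(I, j + 2 * int k) \<in> K" by (auto simp: h_def)
        from W[OF K(2)[OF this], of k] show ?thesis by (simp add: h'_def)
      qed
      have "(\<Sum>q\<in>h ` K. w (h' q) k) = (\<Sum>q\<in>K. w q k)"
        by (simp add: sum.reindex[OF inj] hh)
      also have "\<dots> = (\<Sum>q\<in>K. w q) k" by (induction K rule: infinite_finite_induct) auto
      finally show "(\<Sum>q\<in>h ` K. w (h' q) k) = 0" using K(3) by simp
    qed (use K in auto)
    then show "w q k = 0 k" by (simp add: hh)
  qed
  fix I J :: "nat set" and i j :: int and X Y :: "nat \<Rightarrow> 'a"
  assume X: "X \<in> op_space ?W I i"
  show "op_relabel ?W id X = X"
    using relabel_id[OF W[OF X]] by (simp add: fun_eq_iff)
  {
    fix \<sigma> :: "nat \<Rightarrow> nat" assume \<sigma>: "inj_on \<sigma> I"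
    show "op_relabel ?W \<sigma> X \<in> op_space ?W (\<sigma> ` I) i"
      using relabel_space[OF W[OF X] \<sigma>] by (simp add: power_series_space)
    show "op_relabel ?W \<sigma> (op_scale ?W c X) = op_scale ?W c (op_relabel ?W \<sigma> X)" for c
      using relabel_scale[OF W[OF X] \<sigma>] by (simp add: fun_eq_iff)
    show "op_relabel ?W \<sigma> (X + Y) = op_relabel ?W \<sigma> X + op_relabel ?W \<sigma> Y"
      if "Y \<in> op_space ?W I i" for Y
      using relabel_add[OF W[OF X] W[OF that] \<sigma>] by (simp add: fun_eq_iff)
    show "op_relabel ?W \<sigma> X = op_relabel ?W \<tau> X" if "\<And>a. a \<in> I \<Longrightarrow> \<sigma> a = \<tau> a" for \<tau>
      using relabel_cong[OF W[OF X] \<sigma> that] by (simp add: fun_eq_iff)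
    show "op_relabel ?W \<tau> (op_relabel ?W \<sigma> X) = op_relabel ?W (\<tau> \<circ> \<sigma>) X" if "inj_on \<tau> (\<sigma> ` I)" for \<tau>
      using relabel_relabel[OF W[OF X] \<sigma> that] by (simp add: fun_eq_iff)
  }
  {
    fix s a assume "s \<in> I" "a \<notin> I - {s}"
    have "(\<Sum>l\<le>k. op_comp P s (X l) (if k - l = 0 then op_unit P a else 0)) =
        op_relabel P (id(s := a)) (X k)" for k
    proof -
      have "(\<Sum>l\<le>k. op_comp P s (X l) (if k - l = 0 then op_unit P a else 0)) =
        (\<Sum>l\<le>k. if l = k then op_comp P s (X k) (op_unit P a) else 0)"
        using comp_zero_right[OF W[OF X] \<open>s \<in> I\<close>] by (intro sum.cong) auto
      then show ?thesis using comp_unit[OF W[OF X] \<open>s \<in> I\<close> \<open>a \<notin> I - {s}\<close>] by simp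
    qed
    then show "op_comp ?W s X (op_unit ?W a) = op_relabel ?W (id(s := a)) X"
      by (simp add: fun_eq_iff power_series_comp)
  }
  show "op_comp ?W a (op_unit ?W a) X = X" for a
  proof
    fix k
    have "op_comp ?W a (op_unit ?W a) X k = (\<Sum>l\<le>k. if l = 0 then X k else 0)"
      using unit_comp[OF W[OF X]] comp_zero_left[OF W[OF X]]
      unfolding power_series_comp by (intro sum.cong) auto
    then show "op_comp ?W a (op_unit ?W a) X k = X k" by simp
  qed
  assume Y: "Y \<in> op_space ?W J j"
  {
    fix s assume s: "s \<in> I" "(I - {s}) \<inter> J = {}"
    note c = power_series_term[OF X Y s]
    show "op_comp ?W s X Y \<in> op_space ?W ((I - {s}) \<union> J) (i + j)"
      using c power_series_finite[OF X] power_series_finite[OF Y]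
      by (auto simp: power_series_space power_series_comp intro!: space_sum)
    show "op_comp ?W s (X + X') Y = op_comp ?W s X Y + op_comp ?W s X' Y" if "X' \<in> op_space ?W I i" for X'
      using comp_add_left[OF W[OF X] W[OF that] W[OF Y] s]
      by (simp add: fun_eq_iff power_series_comp sum.distrib)
    show "op_comp ?W s X (Y + Y') = op_comp ?W s X Y + op_comp ?W s X Y'" if "Y' \<in> op_space ?W J j" for Y'
      using comp_add_right[OF W[OF X] W[OF Y] W[OF that] s]
      by (simp add: fun_eq_iff power_series_comp sum.distrib)
    show "op_comp ?W s (op_scale ?W c X) Y = op_scale ?W c (op_comp ?W s X Y)"
      "op_comp ?W s X (op_scale ?W c Y) = op_scale ?W c (op_comp ?W s X Y)" for c
      using comp_scale_left[OF W[OF X] W[OF Y] s] comp_scale_right[OF W[OF X] W[OF Y] s]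
      by (simp_all add: fun_eq_iff power_series_comp vs.scale_sum_right)
    show "op_relabel ?W \<sigma> (op_comp ?W s X Y) = op_comp ?W (\<tau> s) (op_relabel ?W \<tau> X) (op_relabel ?W \<sigma> Y)"
      if "inj_on \<sigma> ((I - {s}) \<union> J)" "inj_on \<tau> I" "\<And>a. a \<in> I - {s} \<Longrightarrow> \<tau> a = \<sigma> a" for \<sigma> \<tau> :: "nat \<Rightarrow> nat"
    proof
      fix k
      have "op_relabel P \<sigma> (\<Sum>l\<le>k. op_comp P s (X l) (Y (k - l))) =
          (\<Sum>l\<le>k. op_relabel P \<sigma> (op_comp P s (X l) (Y (k - l))))"
        using power_series_finite[OF X] power_series_finite[OF Y]
        by (intro relabel_sum[OF that(1) _ c]) auto
      then show "op_relabel ?W \<sigma> (op_comp ?W s X Y) k =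
          op_comp ?W (\<tau> s) (op_relabel ?W \<tau> X) (op_relabel ?W \<sigma> Y) k"
        using comp_relabel[OF W[OF X] W[OF Y] s that] by (simp add: power_series_comp)
    qed
  }
  fix Z :: "nat \<Rightarrow> 'a" and K and k :: int assume Z: "Z \<in> op_space ?W K k"
  {
    fix s t assume st: "s \<in> I" "t \<in> J" "(I - {s}) \<inter> J = {}" "(J - {t}) \<inter> K = {}" "(I - {s}) \<inter> K = {}"
    show "op_comp ?W t (op_comp ?W s X Y) Z = op_comp ?W s X (op_comp ?W t Y Z)"
    proof
      fix n
      have "op_comp ?W t (op_comp ?W s X Y) Z n =
          (\<Sum>a\<le>n. \<Sum>l\<le>a. op_comp P t (op_comp P s (X l) (Y (a - l))) (Z (n - a)))"
        unfolding power_series_comp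
      proof (intro sum.cong HOL.refl)
        fix a
        show "op_comp P t (\<Sum>l\<le>a. op_comp P s (X l) (Y (a - l))) (Z (n - a)) =
            (\<Sum>l\<le>a. op_comp P t (op_comp P s (X l) (Y (a - l))) (Z (n - a)))"
          by (rule comp_sum_left[OF _ power_series_term[OF X Y st(1,3)] W[OF Z]])
            (use st power_series_finite[OF X] power_series_finite[OF Y] in auto)
      qed
      also have "\<dots> = (\<Sum>a\<le>n. \<Sum>l\<le>a. op_comp P s (X l) (op_comp P t (Y (a - l)) (Z (n - a))))"
        by (intro sum.cong HOL.refl comp_sequential[OF W[OF X] W[OF Y] W[OF Z] st])
      also have "\<dots> = (\<Sum>l\<le>n. \<Sum>m\<le>n - l. op_comp P s (X l) (op_comp P t (Y m) (Z (n - l - m))))"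
        by (rule sum_nested_atMost[of "\<lambda>l m q. op_comp P s (X l) (op_comp P t (Y m) (Z q))"])
      also have "\<dots> = op_comp ?W s X (op_comp ?W t Y Z) n"
        unfolding power_series_comp
      proof (intro sum.cong HOL.refl)
        fix l
        show "(\<Sum>m\<le>n - l. op_comp P s (X l) (op_comp P t (Y m) (Z (n - l - m)))) =
            op_comp P s (X l) (\<Sum>m\<le>n - l. op_comp P t (Y m) (Z (n - l - m)))"
          by (rule comp_sum_right[symmetric, OF _ power_series_term[OF Y Z st(2,4)] W[OF X]])
            (use st power_series_finite[OF Z] power_series_finite[OF Y] in auto)
      qed
      finally show "op_comp ?W t (op_comp ?W s X Y) Z n = op_comp ?W s X (op_comp ?W t Y Z) n" .
    qed
  }
  fix s t assume st: "s \<in> I" "t \<in> I" "s \<noteq> t" "(I - {s}) \<inter> J = {}" "(I - {t}) \<inter> K = {}" "J \<inter> K = {}"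
  have expand: "op_comp ?W t (op_comp ?W s X Y) Z n =
      (\<Sum>l\<le>n. \<Sum>m\<le>n - l. op_comp P t (op_comp P s (X l) (Y m)) (Z (n - l - m)))"
    if Y: "Y \<in> op_space ?W J j" and Z: "Z \<in> op_space ?W K k" and
      st: "s \<in> I" "t \<in> I" "s \<noteq> t" "(I - {s}) \<inter> J = {}" "(I - {t}) \<inter> K = {}" "J \<inter> K = {}"
    for Y Z J j K k s t n
  proof -
    have "op_comp ?W t (op_comp ?W s X Y) Z n =
        (\<Sum>a\<le>n. \<Sum>l\<le>a. op_comp P t (op_comp P s (X l) (Y (a - l))) (Z (n - a)))"
      unfolding power_series_comp
    proof (intro sum.cong HOL.refl)
      fix a
      show "op_comp P t (\<Sum>l\<le>a. op_comp P s (X l) (Y (a - l))) (Z (n - a)) =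
          (\<Sum>l\<le>a. op_comp P t (op_comp P s (X l) (Y (a - l))) (Z (n - a)))"
        by (rule comp_sum_left[OF _ power_series_term[OF X Y st(1,4)] W[OF Z]])
          (use st power_series_finite[OF X] power_series_finite[OF Y] in auto)
    qed
    also have "\<dots> = (\<Sum>l\<le>n. \<Sum>m\<le>n - l. op_comp P t (op_comp P s (X l) (Y m)) (Z (n - l - m)))"
      by (rule sum_nested_atMost[of "\<lambda>l m q. op_comp P t (op_comp P s (X l) (Y m)) (Z q)"])
    finally show ?thesis .
  qed
  show "op_comp ?W t (op_comp ?W s X Y) Z = op_scale ?W (ksgn j k) (op_comp ?W s (op_comp ?W t X Z) Y)"
  proof
    fix n
    have sgn: "ksgn (j - 2 * int m) (k - 2 * int m') = (ksgn j k :: 'k)" for m m'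
      by (simp add: ksgn_def)
    have "op_comp ?W t (op_comp ?W s X Y) Z n = (\<Sum>l\<le>n. \<Sum>m\<le>n - l.
        op_scale P (ksgn j k) (op_comp P s (op_comp P t (X l) (Z (n - l - m))) (Y m)))"
      unfolding expand[OF Y Z st]
      by (intro sum.cong HOL.refl)
        (simp only: comp_parallel[OF W[OF X] W[OF Y] W[OF Z] st] sgn)
    also have "\<dots> = op_scale P (ksgn j k)
        (\<Sum>l\<le>n. \<Sum>m\<le>n - l. op_comp P s (op_comp P t (X l) (Z (n - l - m))) (Y m))"
      by (simp only: vs.scale_sum_right)
    also have "(\<Sum>l\<le>n. \<Sum>m\<le>n - l. op_comp P s (op_comp P t (X l) (Z (n - l - m))) (Y m)) =
        (\<Sum>l\<le>n. \<Sum>m\<le>n - l. op_comp P s (op_comp P t (X l) (Z m)) (Y (n - l - m)))"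
    proof (rule sum.cong[OF HOL.refl])
      fix l show "(\<Sum>m\<le>n - l. op_comp P s (op_comp P t (X l) (Z (n - l - m))) (Y m)) =
        (\<Sum>m\<le>n - l. op_comp P s (op_comp P t (X l) (Z m)) (Y (n - l - m)))"
        by (rule sum_atMost_flip[of "\<lambda>m q. op_comp P s (op_comp P t (X l) (Z q)) (Y m)"])
    qed
    also have "\<dots> = op_comp ?W s (op_comp ?W t X Z) Y n"
      using st by (intro expand[OF Z Y, symmetric]) auto
    finally show "op_comp ?W t (op_comp ?W s X Y) Z n =
        op_scale ?W (ksgn j k) (op_comp ?W s (op_comp ?W t X Z) Y) n" by simp
  qed
qed (auto simp: power_series_space relabel_unit unit_space space_zero fun_eq_iff)

lemma derivation_power_series:
  assumes D: "derivation P e D"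
  shows "derivation (power_series P) e (\<lambda>X. D \<circ> X)"
proof -
  note W = power_seriesD
  interpret W: operad "power_series P" by (rule operad_power_series)
  have "D \<circ> op_comp (power_series P) s X Y = op_comp (power_series P) s (D \<circ> X) Y +
      op_scale (power_series P) (ksgn e i) (op_comp (power_series P) s X (D \<circ> Y))"
    if X: "X \<in> op_space (power_series P) I i" and Y: "Y \<in> op_space (power_series P) J j"
      and s: "s \<in> I" "(I - {s}) \<inter> J = {}" for X Y I i J j s
  proof
    fix k
    have "D (op_comp P s (X l) (Y (k - l))) =
        op_comp P s (D (X l)) (Y (k - l)) + koszul e i (op_comp P s (X l) (D (Y (k - l))))" for l
      using derivationD(5)[OF D W[OF X] W[OF Y] s, of l "k - l"] by (simp add: koszul_def)
    moreover have "D (\<Sum>l\<le>k. op_comp P s (X l) (Y (k - l))) = (\<Sum>l\<le>k. D (op_comp P s (X l) (Y (k - l))))"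
      using power_series_finite[OF X] power_series_finite[OF Y]
      by (intro derivation_sum[OF D _ power_series_term[OF X Y s]]) auto
    ultimately show "(D \<circ> op_comp (power_series P) s X Y) k = (op_comp (power_series P) s (D \<circ> X) Y +
      op_scale (power_series P) (ksgn e i) (op_comp (power_series P) s X (D \<circ> Y))) k"
      by (simp add: power_series_comp sum.distrib koszul_sum)
  qed
  moreover have "D \<circ> X \<in> op_space (power_series P) I (j + e)"
    if "X \<in> op_space (power_series P) I j" for X I j
    using derivationD(1)[OF D W[OF that]] by (simp add: power_series_space algebra_simps)
  moreover have "D \<circ> (X + Y) = (D \<circ> X) + (D \<circ> Y)"
    if "X \<in> op_space (power_series P) I j" "Y \<in> op_space (power_series P) I j" for X Y I j
    using derivationD(2)[OF D W[OF that(1)] W[OF that(2)]] by (simp add: fun_eq_iff)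
  moreover have "D \<circ> op_scale (power_series P) c X = op_scale (power_series P) c (D \<circ> X)"
    if "X \<in> op_space (power_series P) I j" for X I j c
    using derivationD(3)[OF D W[OF that]] by (simp add: fun_eq_iff)
  moreover have "D \<circ> op_relabel (power_series P) \<sigma> X = op_relabel (power_series P) \<sigma> (D \<circ> X)"
    if "X \<in> op_space (power_series P) I j" "inj_on \<sigma> I" for X I j \<sigma>
    using derivationD(4)[OF D W[OF that(1)] that(2)] by (simp add: fun_eq_iff)
  ultimately show ?thesis
    unfolding f_derivation_def W.add by (intro conjI allI ballI impI)
qed

end

section \<open>Nested sums over ordered partitions\<close>

text \<open>
  The generating series \<open>\<Sum>\<^sub>k g\<^sup>(\<^sup>k\<^sup>) w\<^bsup>k+1\<^esup>\<close>.
\<close>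

definition gen_family :: "(nat set \<Rightarrow> nat \<Rightarrow> 'a) \<Rightarrow> nat set \<Rightarrow> nat \<Rightarrow> 'a::ab_group_add" where
  "gen_family g I K = (if finite I \<and> 2 \<le> card I \<and> 0 < K then g I (K - 1) else 0)"

text \<open>For e = 0 these are candidate values of a morphism on the generators, relations apart;
  for general e they are candidate values of a derivation along a morphism.\<close>

definition is_gens ::
  "('k::field_char_0, 'a::ab_group_add) operad_str \<Rightarrow> nat \<Rightarrow> int \<Rightarrow> (nat set \<Rightarrow> nat \<Rightarrow> 'a) \<Rightarrow> bool" where
  "is_gens P d e g \<longleftrightarrow> (\<forall>I k. finite I \<longrightarrow> 2 \<le> card I \<longrightarrow>
     g I k \<in> op_space P I (mu_deg d (card I) k + e) \<and>
     (\<forall>\<sigma>. inj_on \<sigma> I \<longrightarrow> g (\<sigma> ` I) k = op_relabel P \<sigma> (g I k)))"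

lemma gen_family_singleton: "gen_family g {s} = 0"
  by (simp add: gen_family_def fun_eq_iff)

lemma ordered_partitions_singleton: "[A] \<in> ordered_partitions I \<longleftrightarrow> A = I \<and> I \<noteq> {}"
  by (auto simp: ordered_partitions_def set_splits_def)

lemma ordered_partitions_snoc:
  "Ss @ [A] \<in> ordered_partitions I \<longleftrightarrow> A \<noteq> {} \<and> A \<subseteq> I \<and> Ss \<in> ordered_partitions (I - A)"
  unfolding ordered_partitions_def set_splits_def by (auto simp: sorted_wrt_append)

lemma nest_snoc: "nest cmp g x (L @ [(A, p)]) = cmp 0 (g (insert 0 A) p) (nest cmp g x L)"
  by (simp add: nest_def)

text \<open>An operation with upper index p contributes w^(p + 1), so K is the exponent of w in the
  whole nested composition.\<close>

definition chain_index :: "nat set \<Rightarrow> nat \<Rightarrow> (nat set list \<times> nat list) set" where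
  "chain_index I K = {(Ss, ps). Ss \<in> ordered_partitions I \<and> length ps = length Ss \<and> Ss \<noteq> [] \<and>
     sum_list ps + length Ss = K}"

text \<open>The last block A belongs to the outermost operation. Splitting it off leaves a chain on
  the remaining labels; i is the exponent of w in the removed factor, whence its upper index i -
  1.\<close>

lemma chain_index_decomp:
  "chain_index I K = (if I \<noteq> {} \<and> 0 < K then {([I], [K - 1])} else {}) \<union>
     (\<lambda>(A, i, Ss, ps). (Ss @ [A], ps @ [i - 1])) `
       (SIGMA A:Pow I - {{}}. SIGMA i:{1..K}. chain_index (I - A) (K - i))"
  (is "_ = ?R")
proof (rule set_eqI, rule iffI)
  fix x assume "x \<in> chain_index I K"
  then obtain Ss ps where x: "x = (Ss, ps)" "Ss \<in> ordered_partitions I" "length ps = length Ss"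
    "Ss \<noteq> []" "sum_list ps + length Ss = K"
    by (auto simp: chain_index_def)
  obtain Ss' A where S: "Ss = Ss' @ [A]" using x(4) by (metis rev_exhaust)
  obtain ps' p where p: "ps = ps' @ [p]" using x(3,4) by (metis length_0_conv rev_exhaust)
  show "x \<in> ?R"
  proof (cases "Ss' = []")
    case True
    then show ?thesis using x S p by (auto simp: ordered_partitions_singleton)
  next
    case False
    then have "(A, Suc p, Ss', ps') \<in> (SIGMA A:Pow I - {{}}. SIGMA i:{1..K}. chain_index (I - A) (K - i))"
      using x S p by (auto simp: chain_index_def ordered_partitions_snoc)
    moreover have "x = (\<lambda>(A, i, Ss, ps). (Ss @ [A], ps @ [i - 1])) (A, Suc p, Ss', ps')"
      using x S p by simp
    ultimately show ?thesis by blast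
  qed
next
  fix x assume "x \<in> ?R"
  then show "x \<in> chain_index I K"
    by (auto simp: chain_index_def ordered_partitions_singleton ordered_partitions_snoc split: if_splits)
qed

lemma finite_chain_index: "finite I \<Longrightarrow> finite (chain_index I K)"
proof (induction "card I" arbitrary: I K rule: less_induct)
  case less
  have "finite (chain_index (I - A) (K - i))" if "A \<in> Pow I - {{}}" for A i
  proof (rule less.hyps)
    have "I - A \<subset> I" using that by auto
    then show "card (I - A) < card I" using less.prems by (rule psubset_card_mono[rotated])
  qed (use less.prems in auto)
  then show ?case
    using less.prems
    by (subst chain_index_decomp, intro finite_UnI finite_imageI finite_SigmaI) auto
qed

definition chain ::
  "('k, 'a) operad_str \<Rightarrow> (nat set \<Rightarrow> nat \<Rightarrow> 'a) \<Rightarrow> (nat set \<Rightarrow> nat \<Rightarrow> 'a) \<Rightarrow> nat set \<Rightarrow> nat \<Rightarrow> 'a::ab_group_add" where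
  "chain P g y I K = (\<Sum>(Ss, ps)\<in>chain_index I K.
     nest (op_comp P) g (y (hd Ss) (hd ps)) (zip (tl Ss) (tl ps)))"

lemma chain_snoc_inj:
  "inj_on (\<lambda>(A, i, Ss, ps). (Ss @ [A], ps @ [i - Suc 0]))
    (SIGMA A:Pow I - {{}}. SIGMA i:{Suc 0..K}. chain_index (I - A) (K - i))"
  by (auto simp: inj_on_def)

lemma chain_rec:
  assumes I: "finite I"
  shows "chain P g y I K = (if I \<noteq> {} \<and> 0 < K then y I (K - 1) else 0) +
    (\<Sum>A\<in>Pow I - {{}}. \<Sum>i\<in>{1..K}. \<Sum>(Ss, ps)\<in>chain_index (I - A) (K - i).
       op_comp P 0 (g (insert 0 A) (i - 1)) (nest (op_comp P) g (y (hd Ss) (hd ps)) (zip (tl Ss) (tl ps))))"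
proof -
  let ?S = "SIGMA A:Pow I - {{}}. SIGMA i:{1..K}. chain_index (I - A) (K - i)"
  let ?h = "\<lambda>(A, i, Ss, ps). (Ss @ [A], ps @ [i - 1])"
  let ?n = "\<lambda>(Ss, ps). nest (op_comp P) g (y (hd Ss) (hd ps)) (zip (tl Ss) (tl ps))"
  have fin: "finite (chain_index (I - A) (K - i))" for A i
    using I by (simp add: finite_chain_index)
  have "chain P g y I K = (\<Sum>x\<in>(if I \<noteq> {} \<and> 0 < K then {([I], [K - 1])} else {}) \<union> ?h ` ?S. ?n x)"
    unfolding chain_def by (subst chain_index_decomp) simp
  also have "\<dots> = (\<Sum>x\<in>(if I \<noteq> {} \<and> 0 < K then {([I], [K - 1])} else {}). ?n x) + (\<Sum>x\<in>?h ` ?S. ?n x)"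
    by (rule sum.union_disjoint) (use I fin in \<open>auto simp: chain_index_def intro!: finite_SigmaI\<close>)
  also have "(\<Sum>x\<in>(if I \<noteq> {} \<and> 0 < K then {([I], [K - 1])} else {}). ?n x) =
      (if I \<noteq> {} \<and> 0 < K then y I (K - 1) else 0)"
    by (simp add: nest_def)
  also have "(\<Sum>x\<in>?h ` ?S. ?n x) = (\<Sum>x\<in>?S. ?n (?h x))"
    using chain_snoc_inj[of I K] by (simp add: sum.reindex)
  also have "\<dots> = (\<Sum>(A, i, Ss, ps)\<in>?S. op_comp P 0 (g (insert 0 A) (i - 1))
      (nest (op_comp P) g (y (hd Ss) (hd ps)) (zip (tl Ss) (tl ps))))"
  proof (rule sum.cong[OF HOL.refl])
    fix x assume "x \<in> ?S"
    then obtain A i Ss ps where x: "x = (A, i, Ss, ps)" "Ss \<noteq> []" "length ps = length Ss"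
      by (auto simp: chain_index_def)
    then have "ps \<noteq> []" by auto
    then show "?n (?h x) = (case x of (A, i, Ss, ps) \<Rightarrow> op_comp P 0 (g (insert 0 A) (i - 1))
      (nest (op_comp P) g (y (hd Ss) (hd ps)) (zip (tl Ss) (tl ps))))"
      using x by (simp add: nest_snoc)
  qed
  also have "\<dots> = (\<Sum>A\<in>Pow I - {{}}. \<Sum>i\<in>{1..K}. \<Sum>(Ss, ps)\<in>chain_index (I - A) (K - i).
       op_comp P 0 (g (insert 0 A) (i - 1)) (nest (op_comp P) g (y (hd Ss) (hd ps)) (zip (tl Ss) (tl ps))))"
    using I fin by (simp add: sum.Sigma split_def)
  finally show ?thesis .
qed

text \<open>Here j is the exponent of w in the chain inside the outermost operation. The condition
  on the exponents in the formula only says that j \<le> p, since the outermost operation takes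
  whatever remains. This is the origin of the truncation at p.\<close>

lemma action_index_decomp:
  "action_index n p = (\<lambda>(A, j, Ss, ps). (Ss @ [A], ps @ [p - j])) `
     (SIGMA A:Pow {1..n} - {{}}. SIGMA j:{..p}.
       {(Ss, ps) \<in> chain_index ({1..n} - A) j. 2 \<le> card (hd Ss)})"
  (is "_ = ?R")
proof (rule set_eqI, rule iffI)
  fix x assume "x \<in> action_index n p"
  then obtain Ss ps where x: "x = (Ss, ps)" "Ss \<in> ordered_partitions {1..n}" "length ps = length Ss"
    "2 \<le> length Ss" "2 \<le> card (hd Ss)" "sum_list ps + (length Ss - 1) = p"
    by (auto simp: action_index_def)
  obtain Ss' A where S: "Ss = Ss' @ [A]" using x(4) by (metis length_0_conv not_numeral_le_zero rev_exhaust)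
  obtain ps' q where p: "ps = ps' @ [q]" using x(3,4) by (metis length_0_conv not_numeral_le_zero rev_exhaust)
  have "Ss' \<noteq> []" using x(4) S by auto
  then have "(A, sum_list ps' + length Ss', Ss', ps') \<in> (SIGMA A:Pow {1..n} - {{}}. SIGMA j:{..p}.
       {(Ss, ps) \<in> chain_index ({1..n} - A) j. 2 \<le> card (hd Ss)})"
    using x S p by (auto simp: chain_index_def ordered_partitions_snoc)
  moreover have "x = (\<lambda>(A, j, Ss, ps). (Ss @ [A], ps @ [p - j])) (A, sum_list ps' + length Ss', Ss', ps')"
    using x S p by auto
  ultimately show "x \<in> ?R" by blast
next
  fix x assume "x \<in> ?R"
  then obtain A j Ss ps where x: "x = (Ss @ [A], ps @ [p - j])" "A \<in> Pow {1..n} - {{}}" "j \<le> p"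
    "(Ss, ps) \<in> chain_index ({1..n} - A) j" "2 \<le> card (hd Ss)" by auto
  then have "Ss \<noteq> []" by (simp add: chain_index_def)
  moreover have "Ss @ [A] \<in> ordered_partitions {1..n}"
    using x unfolding ordered_partitions_snoc by (auto simp: chain_index_def)
  ultimately show "x \<in> action_index n p"
    using x by (cases Ss) (auto simp: action_index_def chain_index_def)
qed

lemma action_sum:
  "(\<Sum>(Ss, ps)\<in>action_index n p. nest (op_comp P) g (y (hd Ss) (hd ps))
      (zip (tl Ss) (butlast (tl ps) @ [k + last ps]))) =
    (\<Sum>A\<in>Pow {1..n} - {{}}. \<Sum>j\<le>p. \<Sum>(Ss, ps)\<in>{(Ss, ps) \<in> chain_index ({1..n} - A) j. 2 \<le> card (hd Ss)}.
      op_comp P 0 (g (insert 0 A) (k + p - j))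
        (nest (op_comp P) g (y (hd Ss) (hd ps)) (zip (tl Ss) (tl ps))))"
proof -
  let ?C = "\<lambda>A j. {(Ss, ps) \<in> chain_index ({1..n} - A) j. 2 \<le> card (hd Ss)}"
  let ?S = "SIGMA A:Pow {1..n} - {{}}. SIGMA j:{..p}. ?C A j"
  let ?h = "\<lambda>(A, j, Ss, ps). (Ss @ [A], ps @ [p - j])"
  let ?n = "\<lambda>(Ss, ps). nest (op_comp P) g (y (hd Ss) (hd ps)) (zip (tl Ss) (butlast (tl ps) @ [k + last ps]))"
  have fin: "finite (?C A j)" for A j
    by (rule finite_subset[OF _ finite_chain_index[of "{1..n} - A" j]]) auto
  have inj: "inj_on ?h ?S" by (auto simp: inj_on_def)
  have "(\<Sum>x\<in>action_index n p. ?n x) = (\<Sum>x\<in>?S. ?n (?h x))"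
    by (subst action_index_decomp, subst sum.reindex[OF inj]) (simp only: o_def)
  also have "\<dots> = (\<Sum>(A, j, Ss, ps)\<in>?S. op_comp P 0 (g (insert 0 A) (k + p - j))
      (nest (op_comp P) g (y (hd Ss) (hd ps)) (zip (tl Ss) (tl ps))))"
  proof (rule sum.cong[OF HOL.refl])
    fix x assume "x \<in> ?S"
    then obtain A j Ss ps where x: "x = (A, j, Ss, ps)" "Ss \<noteq> []" "length ps = length Ss"
      by (auto simp: chain_index_def)
    then have "ps \<noteq> []" by auto
    moreover have "j \<le> p" using \<open>x \<in> ?S\<close> x by simp
    ultimately show "?n (?h x) = (case x of (A, j, Ss, ps) \<Rightarrow> op_comp P 0 (g (insert 0 A) (k + p - j))
      (nest (op_comp P) g (y (hd Ss) (hd ps)) (zip (tl Ss) (tl ps))))"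
      using x by (simp add: nest_snoc)
  qed
  also have "\<dots> = (\<Sum>A\<in>Pow {1..n} - {{}}. \<Sum>j\<le>p. \<Sum>(Ss, ps)\<in>?C A j.
      op_comp P 0 (g (insert 0 A) (k + p - j))
        (nest (op_comp P) g (y (hd Ss) (hd ps)) (zip (tl Ss) (tl ps))))"
    using fin by (simp add: sum.Sigma split_def)
  finally show ?thesis by (simp add: split_def)
qed

definition above :: "nat \<Rightarrow> (nat set \<Rightarrow> nat \<Rightarrow> 'a) \<Rightarrow> nat set \<Rightarrow> nat \<Rightarrow> 'a::ab_group_add" where
  "above p X = (\<lambda>I k. if p < k then X I k else 0)"

definition below :: "nat \<Rightarrow> (nat set \<Rightarrow> nat \<Rightarrow> 'a) \<Rightarrow> nat set \<Rightarrow> nat \<Rightarrow> 'a::ab_group_add" where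
  "below p X = (\<lambda>I k. if k \<le> p then X I k else 0)"

lemma above_add_below: "above p X + below p X = X"
  by (auto simp: above_def below_def fun_eq_iff)

context operad
begin

lemma family_gen_familyI:
  assumes g: "\<And>I k. finite I \<Longrightarrow> 2 \<le> card I \<Longrightarrow> g I k \<in> op_space P I (mu_deg d (card I) k + e)"
  shows "family (power_series P) (int d) e (gen_family g)"
proof -
  have "gen_family g I k \<in> op_space P I (2 * int d * (int (card I) - 1) + e - 2 * int k)" if I: "finite I" for I k
  proof (cases "2 \<le> card I \<and> 0 < k")
    case True
    then have "g I (k - 1) \<in> op_space P I (mu_deg d (card I) (k - 1) + e)"
      using g I by blast
    then have "g I (k - 1) \<in> op_space P I (2 * int d * (int (card I) - 1) + e - 2 * int k)"
      by (rule space_cast) (use True in \<open>simp_all add: mu_deg_def of_nat_diff algebra_simps\<close>)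
    then show ?thesis using True I by (simp add: gen_family_def)
  qed (use I in \<open>auto simp: gen_family_def space_zero\<close>)
  then show ?thesis by (auto simp: family_def power_series_space gen_family_def fun_eq_iff)
qed

lemma is_gens_space: "is_gens P d e g \<Longrightarrow> finite I \<Longrightarrow> 2 \<le> card I \<Longrightarrow>
    g I k \<in> op_space P I (mu_deg d (card I) k + e)"
  by (simp add: is_gens_def)

lemma family_gen_family: "is_gens P d e g \<Longrightarrow> family (power_series P) (int d) e (gen_family g)"
  by (rule family_gen_familyI) (rule is_gens_space)

lemma symmetric_gen_family:
  assumes "is_gens P d e g"
  shows "symmetric_family (power_series P) (gen_family g)"
  unfolding symmetric_family_def
  using assms by (auto simp: is_gens_def gen_family_def fun_eq_iff card_image)

lemma gens_slot:
  assumes "is_gens P d 0 g" "finite A" "A \<noteq> {}" "0 \<notin> A"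
  shows "g (insert 0 A) p \<in> op_space P (insert 0 A) (mu_deg d (Suc (card A)) p)"
proof -
  have "2 \<le> card (insert 0 A)" using assms by (simp add: Suc_le_eq card_gt_0_iff)
  then have "g (insert 0 A) p \<in> op_space P (insert 0 A) (mu_deg d (card (insert 0 A)) p + 0)"
    using assms(1,2) unfolding is_gens_def by blast
  then show ?thesis using assms by simp
qed

lemma nest_space:
  assumes g: "is_gens P d 0 g"
    and y: "\<And>S p. finite S \<Longrightarrow> y S p \<in> op_space P S (mu_deg d (card S) p + e)"
    and "finite I" "0 \<notin> I" "(Ss, ps) \<in> chain_index I K"
  shows "nest (op_comp P) g (y (hd Ss) (hd ps)) (zip (tl Ss) (tl ps)) \<in>
    op_space P I (2 * int d * (int (card I) - 1) + e - 2 * int K)"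
  using assms(3-)
proof (induction Ss arbitrary: I ps K rule: rev_induct)
  case Nil
  then show ?case by (simp add: chain_index_def)
next
  case (snoc A Ss)
  show ?case
  proof (cases "Ss = []")
    case True
    then obtain p where p: "ps = [p]" "A = I" "K = Suc p"
      using snoc.prems(3) by (auto simp: chain_index_def ordered_partitions_singleton length_Suc_conv)
    have "y I p \<in> op_space P I (2 * int d * (int (card I) - 1) + e - 2 * int K)"
      by (rule space_cast[OF y[OF snoc.prems(1), of p]]) (use p in \<open>simp_all add: mu_deg_def algebra_simps\<close>)
    then show ?thesis using p True by (simp add: nest_def)
  next
    case False
    then obtain qs p where p: "ps = qs @ [p]"
      using snoc.prems(3) by (cases ps rule: rev_cases) (auto simp: chain_index_def)
    have A: "A \<noteq> {}" "A \<subseteq> I" and in_chain: "(Ss, qs) \<in> chain_index (I - A) (K - Suc p)" and K: "Suc p \<le> K"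
      using snoc.prems(3) False p by (auto simp: chain_index_def ordered_partitions_snoc)
    have qs: "qs \<noteq> []" "length qs = length Ss" using in_chain by (auto simp: chain_index_def)
    have fin: "finite A" "finite (I - A)" "0 \<notin> A" using A snoc.prems finite_subset by auto
    have ga: "g (insert 0 A) p \<in> op_space P (insert 0 A) (mu_deg d (Suc (card A)) p)"
      by (rule gens_slot[OF g fin(1) A(1) fin(3)])
    have IH: "nest (op_comp P) g (y (hd Ss) (hd qs)) (zip (tl Ss) (tl qs)) \<in>
        op_space P (I - A) (2 * int d * (int (card (I - A)) - 1) + e - 2 * int (K - Suc p))"
      using snoc.IH[OF fin(2) _ in_chain] snoc.prems(2) by simp
    have "op_comp P 0 (g (insert 0 A) p) (nest (op_comp P) g (y (hd Ss) (hd qs)) (zip (tl Ss) (tl qs))) \<in>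
        op_space P ((insert 0 A - {0}) \<union> (I - A)) (mu_deg d (Suc (card A)) p +
          (2 * int d * (int (card (I - A)) - 1) + e - 2 * int (K - Suc p)))"
      by (rule comp_space[OF ga IH]) (use fin in auto)
    moreover have "(insert 0 A - {0}) \<union> (I - A) = I" using A fin by auto
    moreover have "card I = card A + card (I - A)"
      using A snoc.prems(1) fin by (metis card_Diff_subset card_mono le_add_diff_inverse)
    then have "mu_deg d (Suc (card A)) p + (2 * int d * (int (card (I - A)) - 1) + e - 2 * int (K - Suc p)) =
        2 * int d * (int (card I) - 1) + e - 2 * int K"
      using K by (simp add: mu_deg_def of_nat_diff algebra_simps)
    ultimately have "op_comp P 0 (g (insert 0 A) p) (nest (op_comp P) g (y (hd Ss) (hd qs)) (zip (tl Ss) (tl qs))) \<in>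
        op_space P I (2 * int d * (int (card I) - 1) + e - 2 * int K)"
      by (rule space_cast)
    then show ?thesis using False p qs by (simp add: nest_snoc)
  qed
qed

text \<open>The innermost entry zero has every degree, hence so has the composite; an element of two
  different degrees vanishes.\<close>

lemma nest_zero:
  assumes g: "is_gens P d 0 g" and I: "finite I" "0 \<notin> I" "(Ss, ps) \<in> chain_index I K"
  shows "nest (op_comp P) g 0 (zip (tl Ss) (tl ps)) = 0"
proof -
  have z: "nest (op_comp P) g ((\<lambda>S p. 0) (hd Ss) (hd ps)) (zip (tl Ss) (tl ps)) \<in>
      op_space P I (2 * int d * (int (card I) - 1) + e - 2 * int K)" for e
    by (rule nest_space[OF g _ I]) (simp add: space_zero)
  show ?thesis using space_unique[OF z[of 0] z[of 1]] by auto
qed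

lemma chain_slot:
  assumes g: "is_gens P d 0 g"
    and y: "\<And>S p. finite S \<Longrightarrow> y S p \<in> op_space P S (mu_deg d (card S) p + e)"
    and I: "finite I" "0 \<notin> I" and A: "A \<in> Pow I - {{}}"
  shows "(\<Sum>(Ss, ps)\<in>chain_index (I - A) K. op_comp P 0 (g (insert 0 A) i)
      (nest (op_comp P) g (y (hd Ss) (hd ps)) (zip (tl Ss) (tl ps)))) =
    op_comp P 0 (g (insert 0 A) i) (chain P g y (I - A) K)"
proof -
  have fin: "finite A" "finite (I - A)" "0 \<notin> A" "0 \<notin> I - A" using A I finite_subset by auto
  have ga: "g (insert 0 A) i \<in> op_space P (insert 0 A) (mu_deg d (Suc (card A)) i)"
    using gens_slot[OF g fin(1) _ fin(3)] A by auto
  have "op_comp P 0 (g (insert 0 A) i) (\<Sum>x\<in>chain_index (I - A) K.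
      nest (op_comp P) g (y (hd (fst x)) (hd (snd x))) (zip (tl (fst x)) (tl (snd x)))) =
    (\<Sum>x\<in>chain_index (I - A) K. op_comp P 0 (g (insert 0 A) i)
      (nest (op_comp P) g (y (hd (fst x)) (hd (snd x))) (zip (tl (fst x)) (tl (snd x)))))"
    by (rule comp_sum_right[OF fin(2) nest_space[OF g y fin(2,4)] ga]) auto
  then show ?thesis by (simp add: chain_def split_def)
qed

text \<open>Splitting off the outermost operation gives for \<open>chain\<close> the recursion by
  which \<open>solve\<close> is defined. The set I avoids 0 because \<open>nest\<close> uses 0 as
  its slot.\<close>

lemma chain_eq_solve:
  assumes g: "is_gens P d 0 g"
    and y: "\<And>S p. finite S \<Longrightarrow> y S p \<in> op_space P S (mu_deg d (card S) p + e)"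
    and y0: "\<And>S p. card S < 2 \<Longrightarrow> y S p = 0"
    and "finite I" "0 \<notin> I"
  shows "chain P g y I K = solve (power_series P) (gen_family g) (gen_family y) I K"
  using assms(4-)
proof (induction "card I" arbitrary: I K rule: less_induct)
  case less
  interpret W: operad "power_series P" by (rule operad_power_series)
  let ?W = "power_series P"
  let ?m = "gen_family g"
  let ?S = "solve ?W ?m (gen_family y)"
  note m = family_gen_family[OF g] symmetric_gen_family[OF g] gen_family_singleton
  have fy: "family ?W (int d) e (gen_family y)" by (rule family_gen_familyI) (rule y)
  have "gen_family y I = ?S I - (\<Sum>A\<in>Pow I - {{}}. op_comp ?W 0 (?m (insert 0 A)) (?S (I - A)))"
    using W.app_apply[OF m W.family_solve[OF m(1) fy] less.prems] W.app_solve[OF m fy] by simp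
  then have "?S I = gen_family y I + (\<Sum>A\<in>Pow I - {{}}. op_comp ?W 0 (?m (insert 0 A)) (?S (I - A)))"
    by simp
  moreover have "(\<Sum>A\<in>Pow I - {{}}. op_comp ?W 0 (?m (insert 0 A)) (?S (I - A))) K =
      (\<Sum>A\<in>Pow I - {{}}. op_comp ?W 0 (?m (insert 0 A)) (?S (I - A)) K)"
    by (rule sum_fun_apply)
  ultimately have S: "?S I K = gen_family y I K +
      (\<Sum>A\<in>Pow I - {{}}. \<Sum>i\<le>K. op_comp P 0 (?m (insert 0 A) i) (?S (I - A) (K - i)))"
    by (simp add: power_series_comp)
  have "(\<Sum>i\<in>{1..K}. \<Sum>(Ss, ps)\<in>chain_index (I - A) (K - i). op_comp P 0 (g (insert 0 A) (i - 1))
        (nest (op_comp P) g (y (hd Ss) (hd ps)) (zip (tl Ss) (tl ps)))) =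
      (\<Sum>i\<le>K. op_comp P 0 (?m (insert 0 A) i) (?S (I - A) (K - i)))" if A: "A \<in> Pow I - {{}}" for A
  proof -
    have fin: "finite A" "finite (I - A)" "0 \<notin> A" using A less.prems finite_subset by auto
    have cA: "2 \<le> card (insert 0 A)" using A fin by (simp add: Suc_le_eq card_gt_0_iff)
    have "I - A \<subset> I" using A by auto
    then have IH: "chain P g y (I - A) k = ?S (I - A) k" for k
      using less.prems fin by (intro less.hyps psubset_card_mono) auto
    have "(\<Sum>i\<in>{1..K}. \<Sum>(Ss, ps)\<in>chain_index (I - A) (K - i). op_comp P 0 (g (insert 0 A) (i - 1))
        (nest (op_comp P) g (y (hd Ss) (hd ps)) (zip (tl Ss) (tl ps)))) =
      (\<Sum>i\<in>{1..K}. op_comp P 0 (?m (insert 0 A) i) (?S (I - A) (K - i)))"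
      using cA fin
      by (intro sum.cong HOL.refl) (simp add: chain_slot[OF g y less.prems A] IH gen_family_def)
    also have "\<dots> = (\<Sum>i\<le>K. op_comp P 0 (?m (insert 0 A) i) (?S (I - A) (K - i)))"
    proof (rule sum.mono_neutral_left)
      have "op_comp P 0 0 (?S (I - A) k) = 0" for k
        using W.familyD[OF W.family_solve[OF m(1) fy] fin(2)] unfolding power_series_space
        by (meson comp_zero_left)
      then show "\<forall>i\<in>{..K} - {1..K}. op_comp P 0 (?m (insert 0 A) i) (?S (I - A) (K - i)) = 0"
        by (auto simp: gen_family_def)
    qed auto
    finally show ?thesis .
  qed
  moreover have "(if I \<noteq> {} \<and> 0 < K then y I (K - 1) else 0) = gen_family y I K"
    using y0[of I] less.prems(1) by (auto simp: gen_family_def not_le)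
  ultimately show ?case
    unfolding chain_rec[OF less.prems(1), of P g y K] S
    by (intro arg_cong2[where f = "(+)"] sum.cong[OF HOL.refl])
qed

text \<open>Let S be the solution of S - m \<cdot> S = y and S' its part in exponents up to p. The
  first summand is the coefficient of S - m \<cdot> S, the sum over partitions that of m \<cdot> S'.
  Since S' has no coefficient in exponent k + p + 1, the total is the coefficient of (S - S') - m
  \<cdot> (S - S').\<close>

lemma action_sum_eq_app:
  assumes g: "is_gens P d 0 g"
    and y: "\<And>S p. finite S \<Longrightarrow> y S p \<in> op_space P S (mu_deg d (card S) p + e)"
    and y0: "\<And>S p. card S < 2 \<Longrightarrow> y S p = 0" and n: "2 \<le> n"
  shows "y {1..n} (k + p) + (\<Sum>(Ss, ps)\<in>action_index n p. nest (op_comp P) g (y (hd Ss) (hd ps))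
      (zip (tl Ss) (butlast (tl ps) @ [k + last ps]))) =
    app (power_series P) (gen_family g)
      (above p (solve (power_series P) (gen_family g) (gen_family y))) {1..n} (Suc (k + p))"
proof -
  interpret W: operad "power_series P" by (rule operad_power_series)
  let ?W = "power_series P"
  let ?m = "gen_family g"
  let ?I = "{1..n}"
  let ?K = "Suc (k + p)"
  define S where "S = solve ?W ?m (gen_family y)"
  note m = family_gen_family[OF g] symmetric_gen_family[OF g] gen_family_singleton
  have fy: "family ?W (int d) e (gen_family y)" by (rule family_gen_familyI) (rule y)
  have fS: "family ?W (int d) e S" unfolding S_def by (rule W.family_solve[OF m(1) fy])
  have fa: "family ?W (int d) e (above p S)"
    using fS by (auto simp: family_def power_series_space above_def fun_eq_iff space_zero)
  have I: "finite ?I" "0 \<notin> ?I" by auto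
  have app_coeff: "app ?W ?m X ?I ?K = X ?I ?K -
      (\<Sum>A\<in>Pow ?I - {{}}. \<Sum>i\<le>?K. op_comp P 0 (?m (insert 0 A) i) (X (?I - A) (?K - i)))"
    if X: "family ?W (int d) e X" for X
    unfolding W.app_apply[OF m X I] by (simp add: sum_fun_apply power_series_comp)
  have "gen_family y ?I ?K = y ?I (k + p)" using n by (simp add: gen_family_def)
  then have "y ?I (k + p) = app ?W ?m S ?I ?K"
    using W.app_solve[OF m fy] by (simp add: S_def)
  moreover have "(\<Sum>(Ss, ps)\<in>action_index n p. nest (op_comp P) g (y (hd Ss) (hd ps))
      (zip (tl Ss) (butlast (tl ps) @ [k + last ps]))) =
    (\<Sum>A\<in>Pow ?I - {{}}. \<Sum>j\<le>p. op_comp P 0 (g (insert 0 A) (k + p - j)) (S (?I - A) j))"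
    unfolding action_sum
  proof (intro sum.cong HOL.refl)
    fix A j assume A: "A \<in> Pow ?I - {{}}"
    have fin: "finite (?I - A)" "0 \<notin> ?I - A" "0 \<notin> A" "finite A" using A finite_subset by auto
    have ga: "g (insert 0 A) i \<in> op_space P (insert 0 A) (mu_deg d (Suc (card A)) i)" for i
      using gens_slot[OF g fin(4) _ fin(3)] A by auto
    let ?t = "\<lambda>(Ss, ps). op_comp P 0 (g (insert 0 A) (k + p - j))
        (nest (op_comp P) g (y (hd Ss) (hd ps)) (zip (tl Ss) (tl ps)))"
    note nz = nest_zero[OF g fin(1,2)]
    \<comment> \<open>A first block with fewer than two labels contributes zero, since y vanishes
      there; the restriction on the first block can be lifted.\<close>
    have "(\<Sum>x\<in>{(Ss, ps) \<in> chain_index (?I - A) j. 2 \<le> card (hd Ss)}. ?t x) =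
        (\<Sum>x\<in>chain_index (?I - A) j. ?t x)"
    proof (rule sum.mono_neutral_left)
      show "finite (chain_index (?I - A) j)" by (rule finite_chain_index[OF fin(1)])
      show "\<forall>x\<in>chain_index (?I - A) j - {(Ss, ps) \<in> chain_index (?I - A) j. 2 \<le> card (hd Ss)}. ?t x = 0"
      proof
        fix x assume x: "x \<in> chain_index (?I - A) j - {(Ss, ps) \<in> chain_index (?I - A) j. 2 \<le> card (hd Ss)}"
        obtain Ss ps where xx: "x = (Ss, ps)" by fastforce
        then have "y (hd Ss) (hd ps) = 0" using x y0[of "hd Ss"] by auto
        then show "?t x = 0" using nz[of Ss ps j] x xx comp_zero_right[OF ga] by simp
      qed
    qed auto
    also have "\<dots> = op_comp P 0 (g (insert 0 A) (k + p - j)) (chain P g y (?I - A) j)"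
      by (rule chain_slot[OF g y I A])
    also have "chain P g y (?I - A) j = S (?I - A) j"
      unfolding S_def by (rule chain_eq_solve[OF g y y0 fin(1,2)])
    finally show "(\<Sum>x\<in>{(Ss, ps) \<in> chain_index (?I - A) j. 2 \<le> card (hd Ss)}. ?t x) =
        op_comp P 0 (g (insert 0 A) (k + p - j)) (S (?I - A) j)" .
  qed
  moreover have "app ?W ?m (above p S) ?I ?K = app ?W ?m S ?I ?K +
      (\<Sum>A\<in>Pow ?I - {{}}. \<Sum>j\<le>p. op_comp P 0 (g (insert 0 A) (k + p - j)) (S (?I - A) j))"
  proof -
    have "(\<Sum>i\<le>?K. op_comp P 0 (?m (insert 0 A) i) (S (?I - A) (?K - i))) =
        (\<Sum>i\<le>?K. op_comp P 0 (?m (insert 0 A) i) (above p S (?I - A) (?K - i))) +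
        (\<Sum>j\<le>p. op_comp P 0 (g (insert 0 A) (k + p - j)) (S (?I - A) j))"
      if A: "A \<in> Pow ?I - {{}}" for A
    proof -
      have fin: "finite (?I - A)" "0 \<notin> A" "finite A" using A finite_subset by auto
      have cA: "2 \<le> card (insert 0 A)" using A fin by (simp add: Suc_le_eq card_gt_0_iff)
      have mA: "?m (insert 0 A) i \<in> op_space P (insert 0 A) (2 * int d * int (card A) - 2 * int i)" for i
        using power_seriesD[OF W.family_slot[OF m(1) fin(3,2)], of i] by simp
      \<comment> \<open>The coefficient of S in a summand has exponent at most p exactly when i > k;
        these are the summands that \<open>above\<close> removes.\<close>
      have "(\<Sum>i\<le>?K. op_comp P 0 (?m (insert 0 A) i) (S (?I - A) (?K - i))) =
          (\<Sum>i\<le>?K. op_comp P 0 (?m (insert 0 A) i) (above p S (?I - A) (?K - i)) +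
            (if k < i then op_comp P 0 (?m (insert 0 A) i) (S (?I - A) (?K - i)) else 0))"
        using comp_zero_right[OF mA] by (intro sum.cong) (auto simp: above_def)
      also have "\<dots> = (\<Sum>i\<le>?K. op_comp P 0 (?m (insert 0 A) i) (above p S (?I - A) (?K - i))) +
          (\<Sum>i\<le>?K. if k < i then op_comp P 0 (?m (insert 0 A) i) (S (?I - A) (?K - i)) else 0)"
        by (simp only: sum.distrib)
      also have "(\<Sum>i\<le>?K. if k < i then op_comp P 0 (?m (insert 0 A) i) (S (?I - A) (?K - i)) else 0) =
          (\<Sum>i\<in>{k<..?K}. op_comp P 0 (?m (insert 0 A) i) (S (?I - A) (?K - i)))"
        by (intro sum.mono_neutral_cong_right) auto
      also have "\<dots> = (\<Sum>j\<le>p. op_comp P 0 (g (insert 0 A) (k + p - j)) (S (?I - A) j))"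
        by (rule sum.reindex_bij_witness[where i = "\<lambda>j. ?K - j" and j = "\<lambda>i. ?K - i"])
          (use cA fin in \<open>auto simp: gen_family_def Suc_diff_le\<close>)
      finally show ?thesis .
    qed
    moreover have "above p S ?I ?K = S ?I ?K" by (simp add: above_def)
    ultimately show ?thesis unfolding app_coeff[OF fS] app_coeff[OF fa] by (simp add: sum.distrib)
  qed
  ultimately show ?thesis by (simp add: S_def)
qed

end

section \<open>Morphisms and derivations out of HyperCom\<close>

lemma rel_index_chain_index:
  "rel_index n i j m = {(Ss, ps) \<in> chain_index {1..n} (Suc m). {i, j} \<subseteq> hd Ss}"
  by (auto simp: rel_index_def chain_index_def Suc_le_eq)

lemma nest_wf:
  assumes "finite I" "0 \<notin> I" "(Ss, ps) \<in> chain_index I K" "2 \<le> card (hd Ss)"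
  defines "t \<equiv> nest Comp Gen (Gen (hd Ss) (hd ps)) (zip (tl Ss) (tl ps)) :: 'k hterm"
  shows "wf_term d t \<and> arity t = I \<and> tdeg d t = 2 * int d * (int (card I) - 1) - 2 * int K"
  unfolding t_def using assms(1-4)
proof (induction Ss arbitrary: I ps K rule: rev_induct)
  case Nil
  then show ?case by (simp add: chain_index_def)
next
  case (snoc A Ss)
  show ?case
  proof (cases "Ss = []")
    case True
    then obtain p where p: "ps = [p]" "A = I" "K = Suc p"
      using snoc.prems(3) by (auto simp: chain_index_def ordered_partitions_singleton length_Suc_conv)
    then show ?thesis using True snoc.prems by (simp add: nest_def mu_deg_def algebra_simps)
  next
    case False
    then obtain qs p where p: "ps = qs @ [p]"
      using snoc.prems(3) by (cases ps rule: rev_cases) (auto simp: chain_index_def)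
    have A: "A \<noteq> {}" "A \<subseteq> I" and in_chain: "(Ss, qs) \<in> chain_index (I - A) (K - Suc p)" and K: "Suc p \<le> K"
      using snoc.prems(3) False p by (auto simp: chain_index_def ordered_partitions_snoc)
    have qs: "qs \<noteq> []" "length qs = length Ss" using in_chain by (auto simp: chain_index_def)
    have fin: "finite A" "finite (I - A)" "0 \<notin> A" using A snoc.prems finite_subset by auto
    have cA: "card A \<ge> 1" using A fin by (simp add: Suc_le_eq card_gt_0_iff)
    have "card I = card A + card (I - A)"
      using A snoc.prems(1) fin by (metis card_Diff_subset card_mono le_add_diff_inverse)
    moreover have "(A \<union> (I - A)) = I" "A - {0} = A" using A fin by auto
    ultimately show ?thesis
      using snoc.IH[OF fin(2) _ in_chain] snoc.prems(2,4) False p qs fin cA K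
      by (simp add: nest_snoc mu_deg_def of_nat_diff algebra_simps)
  qed
qed

lemma rel_term_wf:
  assumes "x \<in> rel_index n i j m" "i \<noteq> j"
  defines "t \<equiv> rel_term x :: 'k hterm"
  shows "wf_term d t \<and> arity t = {1..n} \<and> tdeg d t = mu_deg d n m"
proof -
  obtain Ss ps where x: "x = (Ss, ps)" "(Ss, ps) \<in> chain_index {1..n} (Suc m)" "{i, j} \<subseteq> hd Ss"
    using assms(1) unfolding rel_index_chain_index by auto
  then have "Ss \<in> ordered_partitions {1..n}" "Ss \<noteq> []" by (simp_all add: chain_index_def)
  then have "hd Ss \<subseteq> {1..n}"
    by (metis (lifting) Sup_upper hd_in_set mem_Collect_eq ordered_partitions_def set_splits_def)
  then have "card {i, j} \<le> card (hd Ss)"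
    using x(3) finite_subset by (intro card_mono) auto
  then have c: "2 \<le> card (hd Ss)" using assms(2) by simp
  have "wf_term d t \<and> arity t = {1..n} \<and>
      tdeg d t = 2 * int d * (int (card {1..n}) - 1) - 2 * int (Suc m)"
    unfolding t_def x(1) rel_term.simps by (rule nest_wf[OF _ _ x(2) c]) auto
  then show ?thesis by (simp add: mu_deg_def algebra_simps)
qed

lemma foldr_Add_wf:
  assumes "\<And>t. t \<in> set ts \<Longrightarrow> wf_term d t \<and> arity t = I \<and> tdeg d t = j" and "finite I"
  shows "wf_term d (foldr Add ts (Zero I j)) \<and> arity (foldr Add ts (Zero I j)) = I \<and>
    tdeg d (foldr Add ts (Zero I j)) = j"
  using assms by (induction ts) auto

lemma wf_term_finite: "wf_term d t \<Longrightarrow> finite (arity t)"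
  by (induction t) auto

lemma hc_eq_wf:
  fixes t u :: "'k::field_char_0 hterm"
  shows "hc_eq d t u \<Longrightarrow> wf_term d t \<and> wf_term d u \<and> arity t = arity u \<and> tdeg d t = tdeg d u"
proof (induction rule: hc_eq.induct)
  case (comp_relabel \<sigma> s t u \<tau>)
  have im: "\<tau> ` (arity t - {s}) = \<sigma> ` (arity t - {s})"
    using comp_relabel(3) by (rule image_cong[OF HOL.refl])
  have im2: "\<tau> ` arity t - {\<tau> s} = \<sigma> ` (arity t - {s})"
    unfolding im[symmetric] using inj_on_image_set_diff[OF comp_relabel(2), of "arity t" "{s}"] comp_relabel(1)
    by simp
  have "inj_on \<sigma> ((arity t - {s}) \<union> arity u)" using comp_relabel(1) by simp
  then have "\<sigma> ` (arity t - {s}) \<inter> \<sigma> ` arity u = {}" "inj_on \<sigma> (arity u)"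
    using inj_on_image_Int[of \<sigma> "(arity t - {s}) \<union> arity u" "arity t - {s}" "arity u"] comp_relabel(1)
    by (auto intro: inj_on_subset)
  then show ?case using comp_relabel im2 by (simp add: image_Un)
next
  case (symmetric I \<sigma> p)
  then show ?case by (simp add: card_image)
next
  case (defining_relation n i j m L)
  have w: "wf_term d t \<and> arity t = {1..n} \<and> tdeg d t = mu_deg d n m"
    if t: "t \<in> set (map rel_term L)" for t :: "'k hterm"
    using t rel_term_wf[of _ n i j m d, where 'k = 'k] defining_relation by auto
  let ?t = "foldr Add (map rel_term L) (Zero {1..n} (mu_deg d n m)) :: 'k hterm"
  have "wf_term d ?t \<and> arity ?t = {1..n} \<and> tdeg d ?t = mu_deg d n m"
    by (rule foldr_Add_wf[OF w]) auto
  then show ?case by simp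
next
  case (relabel_relabel \<tau> \<sigma> t)
  then show ?case by (auto simp: comp_inj_on image_comp)
next
  case (relabel_cong \<sigma> t \<tau>)
  then have "\<sigma> ` arity t = \<tau> ` arity t" by (intro image_cong) auto
  moreover have "inj_on \<tau> (arity t)" using relabel_cong by (simp add: inj_on_def)
  ultimately show ?case using relabel_cong by simp
next
  case (comp_unit t s a)
  have "id(s := a) ` arity t = (arity t - {s}) \<union> {a}" using comp_unit(2) by auto
  moreover have "inj_on (id(s := a)) (arity t)" using comp_unit by (auto simp: inj_on_def)
  ultimately show ?case using comp_unit by simp
next
  case (comp_parallel s t u r v)
  then show ?case by auto
next
  case (comp_sequential s t u r v)
  then show ?case by auto
qed (auto simp: wf_term_finite)

text \<open>An ill-formed term is related to nothing and has the empty class, so equality of classes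
  reflects the congruence as soon as one side is well-formed.\<close>

lemma hc_class_eq_iff: "wf_term d t \<Longrightarrow> hc_class d t = hc_class d u \<longleftrightarrow> hc_eq d t u"
  unfolding hc_class_def using hc_eq.refl hc_eq.sym hc_eq.trans by (metis (full_types) Collect_cong mem_Collect_eq)

lemma rep_hc_class: "wf_term d t \<Longrightarrow> hc_eq d t (rep (hc_class d t))"
  unfolding rep_def hc_class_def by (rule someI2[of _ t]) (auto intro: hc_eq.refl)

lemma HyperCom_simps:
  "op_add (HyperCom d) u v = hc_class d (Add (rep u) (rep v))"
  "op_scale (HyperCom d) c u = hc_class d (Scale c (rep u))"
  "op_relabel (HyperCom d) \<sigma> u = hc_class d (Relabel \<sigma> (rep u))"
  "op_comp (HyperCom d) s u v = hc_class d (Comp s (rep u) (rep v))"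
  "op_unit (HyperCom d) a = hc_class d (Unit a)"
  by (simp_all add: HyperCom_def)

lemma HyperCom_space:
  "u \<in> op_space (HyperCom d) I j \<longleftrightarrow> (\<exists>t. wf_term d t \<and> arity t = I \<and> tdeg d t = j \<and> u = hc_class d t)"
  by (auto simp: HyperCom_def)

lemma HyperComE:
  assumes "u \<in> op_space (HyperCom d) I j"
  obtains t where "wf_term d t" "arity t = I" "tdeg d t = j" "u = hc_class d t"
  using assms by (auto simp: HyperCom_space)

lemma hc_class_space: "wf_term d t \<Longrightarrow> hc_class d t \<in> op_space (HyperCom d) (arity t) (tdeg d t)"
  by (auto simp: HyperCom_space)

lemma hc_class_ops:
  "wf_term d (Add t u) \<Longrightarrow> op_add (HyperCom d) (hc_class d t) (hc_class d u) = hc_class d (Add t u)"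
  "wf_term d (Scale c t) \<Longrightarrow> op_scale (HyperCom d) c (hc_class d t) = hc_class d (Scale c t)"
  "wf_term d (Relabel \<sigma> t) \<Longrightarrow> op_relabel (HyperCom d) \<sigma> (hc_class d t) = hc_class d (Relabel \<sigma> t)"
  "wf_term d (Comp s t u) \<Longrightarrow> op_comp (HyperCom d) s (hc_class d t) (hc_class d u) = hc_class d (Comp s t u)"
proof -
  have *: "hc_class d t = hc_class d u" if "hc_eq d u t" for t u :: "'a hterm"
    using that hc_class_eq_iff[of d u t] hc_eq_wf[OF that] by simp
  show "wf_term d (Add t u) \<Longrightarrow> op_add (HyperCom d) (hc_class d t) (hc_class d u) = hc_class d (Add t u)"
    unfolding HyperCom_simps by (rule *) (auto intro!: hc_eq.cong_Add rep_hc_class)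
  show "wf_term d (Scale c t) \<Longrightarrow> op_scale (HyperCom d) c (hc_class d t) = hc_class d (Scale c t)"
    unfolding HyperCom_simps by (rule *) (auto intro!: hc_eq.cong_Scale rep_hc_class)
  show "wf_term d (Relabel \<sigma> t) \<Longrightarrow> op_relabel (HyperCom d) \<sigma> (hc_class d t) = hc_class d (Relabel \<sigma> t)"
    unfolding HyperCom_simps by (rule *) (auto intro!: hc_eq.cong_Relabel rep_hc_class)
  show "wf_term d (Comp s t u) \<Longrightarrow> op_comp (HyperCom d) s (hc_class d t) (hc_class d u) = hc_class d (Comp s t u)"
    unfolding HyperCom_simps by (rule *) (auto intro!: hc_eq.cong_Comp rep_hc_class)
qed

lemma hc_classI: "hc_eq d t u \<Longrightarrow> hc_class d t = hc_class d u"
  using hc_class_eq_iff[of d t u] hc_eq_wf[of d t u] by simp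

lemma mu_space: "finite I \<Longrightarrow> 2 \<le> card I \<Longrightarrow> mu d I p \<in> op_space (HyperCom d) I (mu_deg d (card I) p)"
  unfolding mu_def using hc_class_space[of d "Gen I p"] by simp

lemma mu_relabel: "\<lbrakk>finite I; 2 \<le> card I; inj_on \<sigma> I\<rbrakk> \<Longrightarrow>
    (mu d (\<sigma> ` I) p :: 'k::field_char_0 hterm set) = op_relabel (HyperCom d) \<sigma> (mu d I p)"
  unfolding mu_def
  using hc_class_ops(3)[of d \<sigma> "Gen I p :: 'k hterm"]
    hc_classI[OF hc_eq.symmetric[of I \<sigma> d p, where 'k = 'k]] by simp

text \<open>Vector fields and the action formula are specified on standard label sets; all other
  generators are reached by total symmetry.\<close>

lemma mu_standard:
  assumes "finite I" "2 \<le> card I"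
  obtains \<sigma> where "inj_on \<sigma> {1..card I}" "\<sigma> ` {1..card I} = I"
    "\<And>p. (mu d I p :: 'k::field_char_0 hterm set) = op_relabel (HyperCom d) \<sigma> (mu d {1..card I} p)"
proof -
  obtain \<sigma> where \<sigma>: "bij_betw \<sigma> {1..card I} I"
    using ex_bij_betw_nat_finite_1[OF assms(1)] by blast
  then have "inj_on \<sigma> {1..card I}" "\<sigma> ` {1..card I} = I" by (auto simp: bij_betw_def)
  moreover then have "(mu d I p :: 'k hterm set) = op_relabel (HyperCom d) \<sigma> (mu d {1..card I} p)" for p
    using mu_relabel[of "{1..card I}" \<sigma> d p, where 'k = 'k] assms(2) by simp
  ultimately show ?thesis by (rule that)
qed

section \<open>Evaluation of terms and the universal property of the presentation\<close>

primrec ev :: "('k, 'a) operad_str \<Rightarrow> (nat set \<Rightarrow> nat \<Rightarrow> 'a) \<Rightarrow> 'k hterm \<Rightarrow> 'a::ab_group_add" where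
  "ev P g (Zero I j) = 0"
| "ev P g (Add t u) = ev P g t + ev P g u"
| "ev P g (Scale c t) = op_scale P c (ev P g t)"
| "ev P g (Relabel \<sigma> t) = op_relabel P \<sigma> (ev P g t)"
| "ev P g (Comp s t u) = op_comp P s (ev P g t) (ev P g u)"
| "ev P g (Unit a) = op_unit P a"
| "ev P g (Gen I p) = g I p"

lemma ev_nest: "ev P g (nest Comp Gen t L) = nest (op_comp P) g (ev P g t) L"
  unfolding nest_def by (induction L arbitrary: t) (auto simp: split_def)

lemma ev_foldr_Add: "ev P g (foldr Add ts (Zero I j)) = (\<Sum>t\<leftarrow>ts. ev P g t)"
  by (induction ts) auto

definition satisfies_relations ::
  "('k, 'a) operad_str \<Rightarrow> nat \<Rightarrow> (nat set \<Rightarrow> nat \<Rightarrow> 'a::ab_group_add) \<Rightarrow> bool" where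
  "satisfies_relations P d g \<longleftrightarrow> (\<forall>n i j m. 2 \<le> n \<longrightarrow> i \<in> {1..n} \<longrightarrow> j \<in> {1..n} \<longrightarrow> i \<noteq> j \<longrightarrow> d \<le> m \<longrightarrow>
     (\<Sum>(Ss, ps)\<in>rel_index n i j m.
        nest (op_comp P) g (g (hd Ss) (hd ps)) (zip (tl Ss) (tl ps))) = 0)"

lemma ev_relation:
  assumes "distinct L" "set L = rel_index n i j m"
  shows "ev P g (foldr Add (map rel_term L) (Zero I k)) =
    (\<Sum>(Ss, ps)\<in>rel_index n i j m. nest (op_comp P) g (g (hd Ss) (hd ps)) (zip (tl Ss) (tl ps)))"
proof -
  have "ev P g (foldr Add (map rel_term L) (Zero I k)) = (\<Sum>x\<leftarrow>L. ev P g (rel_term x))"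
    by (simp add: ev_foldr_Add o_def)
  also have "\<dots> = (\<Sum>x\<in>rel_index n i j m. ev P g (rel_term x))"
    using assms by (simp add: sum_list_distinct_conv_sum_set)
  also have "\<dots> = (\<Sum>(Ss, ps)\<in>rel_index n i j m. nest (op_comp P) g (g (hd Ss) (hd ps)) (zip (tl Ss) (tl ps)))"
    by (intro sum.cong HOL.refl) (auto simp: ev_nest)
  finally show ?thesis .
qed

lemma finite_rel_index: "finite (rel_index n i j m)"
  unfolding rel_index_chain_index by (rule finite_subset[OF _ finite_chain_index[of "{1..n}" "Suc m"]]) auto

context operad
begin

lemma ev_space:
  assumes g: "is_gens P d 0 g"
  shows "wf_term d t \<Longrightarrow> ev P g t \<in> op_space P (arity t) (tdeg d t)"
proof (induction t)
  case (Gen I p)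
  then show ?case using g by (simp add: is_gens_def)
qed (auto simp: space_zero space_scale relabel_space comp_space unit_space intro!: space_add)

text \<open>The structural rules of the congruence are axioms of the target operad, and the
  remaining two are the symmetry of g and the relations. Evaluation therefore descends to classes,
  whatever representative \<open>rep\<close> picks.\<close>

lemma ev_hc_eq:
  assumes g: "is_gens P d 0 g" and rel: "satisfies_relations P d g"
  shows "hc_eq d t u \<Longrightarrow> ev P g t = ev P g u"
proof (induction rule: hc_eq.induct)
  note sp = ev_space[OF g]
  note P = operad_axioms
  {
    case (symmetric I \<sigma> p)
    then show ?case using g by (simp add: is_gens_def)
  next
    case (defining_relation n i j m L)
    show ?case
      unfolding ev_relation[OF defining_relation(6,7)]
      using rel defining_relation unfolding satisfies_relations_def by simp
  next
    case (relabel_add \<sigma> t u)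
    then show ?case using operad.relabel_add[OF P sp[of t], of "ev P g u" \<sigma>] sp[of u] by auto
  next
    case (relabel_scale \<sigma> t c)
    then show ?case using operad.relabel_scale[OF P sp[of t]] by simp
  next
    case (relabel_cong \<sigma> t \<tau>)
    then show ?case using operad.relabel_cong[OF P sp[of t], of \<sigma> \<tau>] by simp
  next
    case (relabel_id t)
    then show ?case using operad.relabel_id[OF P sp[of t]] by simp
  next
    case (relabel_relabel \<tau> \<sigma> t)
    then show ?case using operad.relabel_relabel[OF P sp[of t], of \<sigma> \<tau>] by simp
  next
    case (comp_add_left t t' s u)
    then show ?case
      using operad.comp_add_left[OF P sp[of t], of "ev P g t'" "ev P g u" "arity u" "tdeg d u" s]
        sp[of t'] sp[of u] by simp
  next
    case (comp_add_right u u' s t)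
    then show ?case
      using operad.comp_add_right[OF P sp[of t] sp[of u], of "ev P g u'" s] sp[of u'] by simp
  next
    case (comp_scale_left s t u c)
    then show ?case using operad.comp_scale_left[OF P sp[of t] sp[of u]] by simp
  next
    case (comp_scale_right s t u c)
    then show ?case using operad.comp_scale_right[OF P sp[of t] sp[of u]] by simp
  next
    case (comp_relabel \<sigma> s t u \<tau>)
    then show ?case using operad.comp_relabel[OF P sp[of t] sp[of u], of s \<sigma> \<tau>] by simp
  next
    case (comp_sequential s t u r v)
    then show ?case using operad.comp_sequential[OF P sp[of t] sp[of u] sp[of v], of s r] by simp
  next
    case (comp_parallel s t u r v)
    then show ?case using operad.comp_parallel[OF P sp[of t] sp[of u] sp[of v], of s r] by simp
  next
    case (unit_comp u a)
    then show ?case using operad.unit_comp[OF P sp[of u]] by simp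
  next
    case (comp_unit t s a)
    then show ?case using operad.comp_unit[OF P sp[of t]] by simp
  next
    case (relabel_unit \<sigma> a)
    then show ?case using operad.relabel_unit[OF P] by simp
  }
qed (auto simp: vs.scale_right_distrib vs.scale_left_distrib)

lemma hom_of_gens:
  assumes g: "is_gens P d 0 g" and rel: "satisfies_relations P d g"
  shows "operad_hom (HyperCom d) P (\<lambda>u. ev P g (rep u))"
    and "wf_term d t \<Longrightarrow> ev P g (rep (hc_class d t)) = ev P g t"
proof -
  have *: "ev P g (rep (hc_class d t)) = ev P g t" if "wf_term d t" for t
    using ev_hc_eq[OF g rel rep_hc_class[OF that]] ..
  then show "wf_term d t \<Longrightarrow> ev P g (rep (hc_class d t)) = ev P g t" .
  note sp = ev_space[OF g]
  show "operad_hom (HyperCom d) P (\<lambda>u. ev P g (rep u))"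
    unfolding operad_hom_def
    by (auto elim!: HyperComE simp: hc_class_ops * sp add) (simp add: HyperCom_simps *)
qed

lemma hom_gens:
  assumes f: "operad_hom (HyperCom d) P f"
  shows "is_gens P d 0 (\<lambda>I p. f (mu d I p))"
  unfolding is_gens_def
  using operad_homD(1)[OF f mu_space] operad_homD(4)[OF f mu_space] mu_relabel[where 'k = 'k] by simp

lemma hom_ev:
  assumes f: "operad_hom (HyperCom d) P f"
  shows "wf_term d t \<Longrightarrow> f (hc_class d t) = ev P (\<lambda>I p. f (mu d I p)) t"
proof (induction t)
  case (Zero I j)
  let ?t = "Zero I j :: 'k hterm"
  let ?z = "hc_class d ?t"
  have "hc_eq d (Add ?t ?t) ?t"
    using hc_eq.add_zero[OF Zero] by simp
  then have "op_add (HyperCom d) ?z ?z = ?z"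
    using Zero hc_class_ops(1)[of d ?t ?t] hc_classI[of d "Add ?t ?t" ?t] by simp
  then have "f ?z = f ?z + f ?z"
    using operad_homD(2)[OF f hc_class_space hc_class_space, OF Zero Zero] by (simp add: add)
  then show ?case by simp
next
  case (Add t u)
  then show ?case
    using operad_homD(2)[OF f hc_class_space[of d t], of "hc_class d u"] hc_class_space[of d u]
    by (simp add: add flip: hc_class_ops)
next
  case (Scale c t)
  then show ?case using operad_homD(3)[OF f hc_class_space[of d t]] by (simp flip: hc_class_ops)
next
  case (Relabel \<sigma> t)
  then show ?case using operad_homD(4)[OF f hc_class_space[of d t]] by (simp flip: hc_class_ops)
next
  case (Comp s t u)
  then show ?case
    using operad_homD(5)[OF f hc_class_space[of d t] hc_class_space[of d u]] by (simp flip: hc_class_ops)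
next
  case (Unit a)
  then show ?case using operad_homD(6)[OF f, of a] by (simp add: HyperCom_simps)
qed (simp add: mu_def)

lemma hom_relations:
  assumes f: "operad_hom (HyperCom d) P f"
  shows "satisfies_relations P d (\<lambda>I p. f (mu d I p))"
  unfolding satisfies_relations_def
proof (intro allI impI)
  fix n i j m assume *: "2 \<le> (n::nat)" "i \<in> {1..n}" "j \<in> {1..n}" "i \<noteq> j" "d \<le> m"
  obtain L where L: "distinct L" "set L = rel_index n i j m"
    using finite_distinct_list[OF finite_rel_index] by blast
  let ?z = "Zero {1..n} (mu_deg d n m) :: 'k hterm"
  let ?t = "foldr Add (map rel_term L) ?z"
  have eq: "hc_eq d ?t ?z" by (rule hc_eq.defining_relation[OF * (1-5) L])
  then have "f (hc_class d ?t) = f (hc_class d ?z)" using hc_classI by metis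
  then show "(\<Sum>(Ss, ps)\<in>rel_index n i j m. nest (op_comp P) (\<lambda>I p. f (mu d I p))
      (f (mu d (hd Ss) (hd ps))) (zip (tl Ss) (tl ps))) = 0"
    using hom_ev[OF f, where t = ?t] hom_ev[OF f, where t = ?z] hc_eq_wf[OF eq]
      ev_relation[OF L, where P = P and g = "\<lambda>I p. f (mu d I p)" and I = "{1..n}" and k = "mu_deg d n m"]
    by simp
qed

text \<open>All generators have even degree. This later resolves a mismatch: the signs of
  derivations and those of dual numbers sit on different summands, and they differ from 1 only when
  an argument is odd.\<close>

lemma hom_odd:
  assumes g: "is_gens P d 0 g"
  shows "wf_term d t \<Longrightarrow> odd (tdeg d t) \<Longrightarrow> ev P g t = 0"
proof (induction t)
  case (Comp s t u)
  then show ?case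
    using comp_zero_left[OF ev_space[OF g, of u]] comp_zero_right[OF ev_space[OF g, of t], of s] by auto
qed (auto simp: mu_deg_def)

end

text \<open>Statements about a class are tested on the finitely many generators in a representing
  term; their arities bound the sums over powers of z on that class.\<close>

primrec gens_of :: "'k hterm \<Rightarrow> (nat \<times> nat) set" where
  "gens_of (Zero I j) = {}"
| "gens_of (Add t u) = gens_of t \<union> gens_of u"
| "gens_of (Scale c t) = gens_of t"
| "gens_of (Relabel \<sigma> t) = gens_of t"
| "gens_of (Comp s t u) = gens_of t \<union> gens_of u"
| "gens_of (Unit a) = {}"
| "gens_of (Gen I p) = {(card I, p)}"

lemma finite_gens_of: "finite (gens_of t)"
  by (induction t) auto

lemma gens_of_ge: "wf_term d t \<Longrightarrow> (n, k) \<in> gens_of t \<Longrightarrow> 2 \<le> n"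
  by (induction t) auto

context operad
begin

lemma f_derivation_HyperCom:
  assumes f: "operad_hom (HyperCom d) P f" and E: "f_derivation (HyperCom d) P f e E"
  shows "finite I \<Longrightarrow> E (hc_class d (Zero I j)) = 0" and "E (hc_class d (Unit a)) = 0"
    and "wf_term d (Add t u) \<Longrightarrow> E (hc_class d (Add t u)) = E (hc_class d t) + E (hc_class d u)"
    and "wf_term d (Scale c t) \<Longrightarrow> E (hc_class d (Scale c t)) = op_scale P c (E (hc_class d t))"
    and "wf_term d (Relabel \<sigma> t) \<Longrightarrow> E (hc_class d (Relabel \<sigma> t)) = op_relabel P \<sigma> (E (hc_class d t))"
    and "wf_term d (Comp s t u) \<Longrightarrow> E (hc_class d (Comp s t u)) =
      op_comp P s (E (hc_class d t)) (f (hc_class d u)) +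
      koszul e (tdeg d t) (op_comp P s (f (hc_class d t)) (E (hc_class d u)))"
proof -
  note D = f_derivationD[OF E] and sp = hc_class_space
  show A: "E (hc_class d (Add t u)) = E (hc_class d t) + E (hc_class d u)" if "wf_term d (Add t u)" for t u
    using that D(2)[OF sp[of d t], of "hc_class d u"] sp[of d u] by (simp add: add flip: hc_class_ops)
  show "E (hc_class d (Scale c t)) = op_scale P c (E (hc_class d t))" if "wf_term d (Scale c t)"
    using that D(3)[OF sp[of d t]] by (simp flip: hc_class_ops)
  show "E (hc_class d (Relabel \<sigma> t)) = op_relabel P \<sigma> (E (hc_class d t))" if "wf_term d (Relabel \<sigma> t)"
    using that D(4)[OF sp[of d t]] by (simp flip: hc_class_ops)
  show C: "E (hc_class d (Comp s t u)) =
      op_comp P s (E (hc_class d t)) (f (hc_class d u)) +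
      koszul e (tdeg d t) (op_comp P s (f (hc_class d t)) (E (hc_class d u)))" if "wf_term d (Comp s t u)" for s t u
    using that D(5)[OF sp[of d t] sp[of d u]] by (simp add: add flip: hc_class_ops)
  show "E (hc_class d (Zero I j)) = 0" if "finite I"
  proof -
    let ?t = "Zero I j :: 'k hterm"
    have "hc_eq d (Add ?t ?t) ?t"
      using hc_eq.add_zero[of d ?t] that by simp
    from hc_classI[OF this] show ?thesis using A[of ?t ?t] that by simp
  qed
  have fu: "f (hc_class d (Unit a)) = op_unit P a"
    using operad_homD(6)[OF f, of a] by (simp add: HyperCom_simps)
  have Eu: "E (hc_class d (Unit a)) \<in> op_space P {a} e"
    using D(1)[OF sp[of d "Unit a"]] by simp
  \<comment> \<open>The Leibniz rule on 1 \<circ> 1 = 1 gives E(1) = E(1) + E(1).\<close>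
  have "hc_eq d (Comp a (Unit a) (Unit a)) (Unit a :: 'k hterm)"
    by (rule hc_eq.unit_comp) simp
  from hc_classI[OF this] have "E (hc_class d (Unit a)) = E (hc_class d (Comp a (Unit a) (Unit a)))"
    by simp
  also have "\<dots> = E (hc_class d (Unit a)) + E (hc_class d (Unit a))"
  proof -
    have "id(a := a) = id" by auto
    then show ?thesis
      using C[of a "Unit a" "Unit a"] unit_comp[OF Eu] comp_unit[OF Eu, of a a] relabel_id[OF Eu]
      by (simp add: fu)
  qed
  finally show "E (hc_class d (Unit a)) = 0" by simp
qed

text \<open>The Leibniz rule computes a derivation on a term from f and from its values on the
  generators of the term. All uniqueness statements rest on this, and so does the reduction of
  identities between vector fields to generators.\<close>

lemma f_derivation_cong:
  assumes f: "operad_hom (HyperCom d) P f"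
    and E: "f_derivation (HyperCom d) P f e E" and E': "f_derivation (HyperCom d) P f e E'"
  shows "wf_term d t \<Longrightarrow> (\<And>n k. (n, k) \<in> gens_of t \<Longrightarrow> E (mu d {1..n} k) = E' (mu d {1..n} k)) \<Longrightarrow>
    E (hc_class d t) = E' (hc_class d t)"
proof (induction t)
  case (Gen I p)
  then have I: "finite I" "2 \<le> card I" by simp_all
  from mu_standard[OF I, where d = d and 'k = 'k] obtain \<sigma> where
    \<sigma>: "inj_on \<sigma> {1..card I}" "mu d I p = op_relabel (HyperCom d) \<sigma> (mu d {1..card I} p :: 'k hterm set)"
    by metis
  have sp: "(mu d {1..card I} p :: 'k hterm set) \<in> op_space (HyperCom d) {1..card I} (mu_deg d (card I) p)"
    using mu_space[of "{1..card I}" d p] I by simp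
  show ?case
    using f_derivationD(4)[OF E sp \<sigma>(1)] f_derivationD(4)[OF E' sp \<sigma>(1)] \<sigma>(2) Gen(2)[of "card I" p]
    by (simp add: mu_def)
qed (simp_all add: f_derivation_HyperCom[OF f E] f_derivation_HyperCom[OF f E'])

lemma f_derivation_odd:
  assumes f: "operad_hom (HyperCom d) P f" and E: "f_derivation (HyperCom d) P f e E"
    and u: "u \<in> op_space (HyperCom d) I j" "odd j"
  shows "f u = 0" "E u = 0"
proof -
  obtain t where t: "wf_term d t" "tdeg d t = j" "u = hc_class d t"
    using u(1) by (rule HyperComE)
  note g = hom_gens[OF f]
  show "f u = 0" using hom_ev[OF f t(1)] hom_odd[OF g t(1)] t u(2) by simp
  have "wf_term d t \<Longrightarrow> odd (tdeg d t) \<Longrightarrow> E (hc_class d t) = 0" for t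
  proof (induction t)
    case (Comp s t u)
    have z: "f (hc_class d t) = 0" if "wf_term d t" "odd (tdeg d t)" for t
      using hom_ev[OF f that(1)] hom_odd[OF g that] by simp
    have fs: "f (hc_class d t) \<in> op_space P (arity t) (tdeg d t)"
      "E (hc_class d t) \<in> op_space P (arity t) (tdeg d t + e)" if "wf_term d t" for t
      using operad_homD(1)[OF f hc_class_space[OF that]] f_derivationD(1)[OF E hc_class_space[OF that]] by simp_all
    show ?case
    proof (cases "odd (tdeg d t)")
      case True
      then show ?thesis
        using Comp z[of t] comp_zero_left[OF fs(1)[of u]] comp_zero_left[OF fs(2)[of u]]
        by (simp add: f_derivation_HyperCom(6)[OF f E])
    next
      case False
      then show ?thesis
        using Comp z[of u] comp_zero_right[OF fs(1)[of t], of s] comp_zero_right[OF fs(2)[of t], of s]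
        by (simp add: f_derivation_HyperCom(6)[OF f E])
    qed
  qed (auto simp: f_derivation_HyperCom[OF f E] mu_deg_def)
  then show "E u = 0" using t u(2) by simp
qed

end

section \<open>Tangent points\<close>

context base_change_step
begin

lemma tangent_low_high:
  assumes "f u \<in> op_space Q I j" "E u \<in> op_space Q I k"
  shows "low r (tangent_point \<delta> f E u) = f u" "high r (tangent_point \<delta> f E u) = E u"
    and "\<not> S \<subseteq> {..<Suc r} \<Longrightarrow> tangent_point \<delta> f E u S = 0"
proof -
  have 0: "f u S = 0" "E u S = 0" if "\<not> S \<subseteq> {..<r}" for S
    using assms that by (auto simp: base_change_space)
  have "S - {r} = S" "r \<notin> S" if "S \<subseteq> {..<r}" for S
    using that by auto
  then show "low r (tangent_point \<delta> f E u) = f u" "high r (tangent_point \<delta> f E u) = E u"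
    using 0 by (auto simp: low_def high_def tangent_point_def fun_eq_iff)
  assume S: "\<not> S \<subseteq> {..<Suc r}"
  then have "\<not> S \<subseteq> {..<r}" by (meson lessThan_subset_iff lessI less_imp_le order_trans)
  moreover have "\<not> S - {r} \<subseteq> {..<r}"
    using S by (auto simp: less_Suc_eq)
  ultimately show "tangent_point \<delta> f E u S = 0"
    using 0 by (simp add: tangent_point_def)
qed

end

context operad
begin

text \<open>The degree -e of \<epsilon> makes f + E \<epsilon> homogeneous of degree 0, and the
  \<epsilon>-component of its compatibility with composition is the Leibniz rule for E.\<close>

lemma tangent_point_hom:
  assumes f: "f \<in> Hom_points d P \<delta>" and E: "f_derivation (HyperCom d) (base_change P \<delta>) f e E"
  shows "tangent_point \<delta> f E \<in> Hom_points d P (\<delta> @ [- e])"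
proof -
  interpret base_change_step P \<delta> "- e" by (rule base_change_step)
  interpret Q': operad Q' by (rule operad_step)
  have f: "operad_hom (HyperCom d) Q f" using f by (simp add: Hom_points_def)
  let ?F = "tangent_point \<delta> f E"
  note hf = operad_homD[OF f] and dE = f_derivationD[OF E]
  have lh: "low r (?F u) = f u" "high r (?F u) = E u" if "u \<in> op_space (HyperCom d) I j" for u I j
    using tangent_low_high[of f u I j E "j + e"] hf(1)[OF that] dE(1)[OF that] by simp_all
  have sp: "?F u \<in> op_space Q' I j" if "u \<in> op_space (HyperCom d) I j" for u I j
    using that tangent_low_high(3)[of f u I j E "j + e"] hf(1)[OF that] dE(1)[OF that]
    by (intro spaceI) (simp_all add: lh)
  have odd0: "f u = 0" "E u = 0" if "u \<in> op_space (HyperCom d) I j" "odd j" for u I j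
    using Q.f_derivation_odd[OF f E that] by simp_all
  note lhp = low_high_pointwise
  show ?thesis
    unfolding Hom_points_def mem_Collect_eq operad_hom_def
  proof (intro conjI allI ballI impI)
    fix I j and u :: "'k hterm set" assume u: "u \<in> op_space (HyperCom d) I j"
    show "?F u \<in> op_space Q' I j" by (rule sp[OF u])
    obtain t where t: "wf_term d t" "arity t = I" "tdeg d t = j" "u = hc_class d t"
      using u by (rule HyperComE)
    show "?F (op_scale (HyperCom d) c u) = op_scale Q' c (?F u)" for c
    proof -
      have cu: "op_scale (HyperCom d) c u \<in> op_space (HyperCom d) I j"
        using t hc_class_ops(2)[of d c t] hc_class_space[of d "Scale c t"] by simp
      show ?thesis
        by (rule eqI[OF sp[OF cu] Q'.space_scale[OF sp[OF u]]])
          (use hf(3)[OF u] dE(3)[OF u] in \<open>simp_all add: lh[OF cu] lh[OF u]\<close>)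
    qed
    show "?F (op_relabel (HyperCom d) \<sigma> u) = op_relabel Q' \<sigma> (?F u)" if \<sigma>: "inj_on \<sigma> I" for \<sigma>
    proof -
      have ru: "op_relabel (HyperCom d) \<sigma> u \<in> op_space (HyperCom d) (\<sigma> ` I) j"
        using t \<sigma> hc_class_ops(3)[of d \<sigma> t] hc_class_space[of d "Relabel \<sigma> t"] by simp
      show ?thesis
        by (rule eqI[OF sp[OF ru] Q'.relabel_space[OF sp[OF u] \<sigma>]])
          (use hf(4)[OF u \<sigma>] dE(4)[OF u \<sigma>] in \<open>simp_all add: lh[OF ru] lh[OF u]\<close>)
    qed
    fix v :: "'k hterm set" assume v: "v \<in> op_space (HyperCom d) I j"
    obtain t' where t': "wf_term d t'" "arity t' = I" "tdeg d t' = j" "v = hc_class d t'"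
      using v by (rule HyperComE)
    have uv: "op_add (HyperCom d) u v \<in> op_space (HyperCom d) I j"
      using t t' hc_class_ops(1)[of d t t'] hc_class_space[of d "Add t t'"] by simp
    have "?F (op_add (HyperCom d) u v) = ?F u + ?F v"
      by (rule eqI[OF sp[OF uv] Q'.space_add[OF sp[OF u] sp[OF v]]])
        (use hf(2)[OF u v] dE(2)[OF u v] in \<open>simp_all add: lh[OF uv] lh[OF u] lh[OF v]\<close>)
    then show "?F (op_add (HyperCom d) u v) = op_add Q' (?F u) (?F v)" by simp
  next
    fix I i J j s and u v :: "'k hterm set"
    assume uv: "u \<in> op_space (HyperCom d) I i" "v \<in> op_space (HyperCom d) J j"
      and s: "s \<in> I" "(I - {s}) \<inter> J = {}"
    obtain t where t: "wf_term d t" "arity t = I" "tdeg d t = i" "u = hc_class d t"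
      using uv(1) by (rule HyperComE)
    obtain t' where t': "wf_term d t'" "arity t' = J" "tdeg d t' = j" "v = hc_class d t'"
      using uv(2) by (rule HyperComE)
    have c: "op_comp (HyperCom d) s u v \<in> op_space (HyperCom d) ((I - {s}) \<union> J) (i + j)"
      using t t' s hc_class_ops(4)[of d s t t'] hc_class_space[of d "Comp s t t'"] by simp
    show "?F (op_comp (HyperCom d) s u v) = op_comp Q' s (?F u) (?F v)"
    proof (rule eqI[OF sp[OF c] comp_space'[OF sp[OF uv(1)] sp[OF uv(2)] s]])
      show "low r (?F (op_comp (HyperCom d) s u v)) = low r (op_comp Q' s (?F u) (?F v))"
        unfolding low_comp lh(1)[OF uv(1)] lh(1)[OF uv(2)] lh(1)[OF c] by (rule hf(5)[OF uv s])
      note fu = hf(1)[OF uv(1)] and fv = hf(1)[OF uv(2)] and Eu = dE(1)[OF uv(1)] and Ev = dE(1)[OF uv(2)]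
      \<comment> \<open>The two conventions put their signs on different summands. A sign other than
        1 requires an odd argument, and on odd arguments f and E vanish.\<close>
      have "koszul e i (op_comp Q s (f u) (E v)) = op_comp Q s (f u) (E v)"
        using odd0[OF uv(1)] Q.comp_zero_left[OF Ev, of s] by (cases "odd i") simp_all
      moreover have "koszul (- e) j (op_comp Q s (E u) (f v)) = op_comp Q s (E u) (f v)"
        using odd0[OF uv(2)] Q.comp_zero_right[OF Eu s(1)] by (cases "odd j") simp_all
      ultimately show "high r (?F (op_comp (HyperCom d) s u v)) = high r (op_comp Q' s (?F u) (?F v))"
        unfolding high_comp[OF sp[OF uv(1)] sp[OF uv(2)] s] lh[OF uv(1)] lh[OF uv(2)] lh[OF c]
          dE(5)[OF uv s] Q.scale_koszul Q.add
        by (simp add: add.commute)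
    qed
  next
    fix a
    have E0: "E (op_unit (HyperCom d) a) = 0" "f (op_unit (HyperCom d) a) = op_unit Q a"
      using Q.f_derivation_HyperCom(2)[OF f E] hf(6) by (simp_all add: HyperCom_simps)
    have sa: "op_unit (HyperCom d) a \<in> op_space (HyperCom d) {a} 0"
      using hc_class_space[of d "Unit a"] by (simp add: HyperCom_simps)
    show "?F (op_unit (HyperCom d) a) = op_unit Q' a"
      by (rule eqI[OF sp[OF sa] Q'.unit_space]) (use E0 in \<open>simp_all add: lh[OF sa]\<close>)
  qed
qed

text \<open>Together with \<open>tangent_point_hom\<close> this identifies derivations along f with
  morphisms over dual numbers that reduce to f.\<close>

lemma hom_low_high:
  assumes F: "F \<in> Hom_points d P (\<delta> @ [- e])"
  shows "(\<lambda>u. low (length \<delta>) (F u)) \<in> Hom_points d P \<delta>"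
    and "f_derivation (HyperCom d) (base_change P \<delta>) (\<lambda>u. low (length \<delta>) (F u)) e (\<lambda>u. high (length \<delta>) (F u))"
proof -
  interpret base_change_step P \<delta> "- e" by (rule base_change_step)
  interpret Q': operad Q' by (rule operad_step)
  have F: "operad_hom (HyperCom d) Q' F" using F by (simp add: Hom_points_def)
  note hF = operad_homD[OF F]
  note g = Q'.hom_gens[OF F]
  have odd0: "F u = 0" if "u \<in> op_space (HyperCom d) I j" "odd j" for u I j
    using that by (auto elim!: HyperComE simp: Q'.hom_ev[OF F] Q'.hom_odd[OF g])
  show hom: "(\<lambda>u. low r (F u)) \<in> Hom_points d P \<delta>"
    unfolding Hom_points_def mem_Collect_eq operad_hom_def
    using hF low_space[OF hF(1)] by (simp add: low_comp)
  have C: "high r (F (op_comp (HyperCom d) s u v)) = op_comp Q s (high r (F u)) (low r (F v)) +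
      op_scale Q (ksgn e i) (op_comp Q s (low r (F u)) (high r (F v)))"
    if uv: "u \<in> op_space (HyperCom d) I i" "v \<in> op_space (HyperCom d) J j"
      and s: "s \<in> I" "(I - {s}) \<inter> J = {}" for u v I i J j s
  proof -
    note Fu = hF(1)[OF uv(1)] and Fv = hF(1)[OF uv(2)]
    have "koszul e i (op_comp Q s (low r (F u)) (high r (F v))) = op_comp Q s (low r (F u)) (high r (F v))"
      using odd0[OF uv(1)] Q.comp_zero_left[OF high_space[OF Fv], of s] by (cases "odd i") simp_all
    moreover have "koszul (- e) j (op_comp Q s (high r (F u)) (low r (F v))) = op_comp Q s (high r (F u)) (low r (F v))"
      using odd0[OF uv(2)] Q.comp_zero_right[OF high_space[OF Fu] s(1)] by (cases "odd j") simp_all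
    ultimately show ?thesis
      unfolding hF(5)[OF uv s] high_comp[OF Fu Fv s] Q.scale_koszul by (simp add: add.commute)
  qed
  have sp: "high r (F u) \<in> op_space Q I (j + e)" if "u \<in> op_space (HyperCom d) I j" for u I j
    using high_space[OF hF(1)[OF that]] by simp
  show "f_derivation (HyperCom d) Q (\<lambda>u. low r (F u)) e (\<lambda>u. high r (F u))"
    unfolding f_derivation_def Q.add using sp C hF(2-4) by simp
qed

end

section \<open>The defining relations as a bound on degrees\<close>

text \<open>With i = j it marks a single label; both cases occur in the variation of
  \<Gamma>.\<close>

definition restrict_to :: "nat \<Rightarrow> nat \<Rightarrow> (nat set \<Rightarrow> 'a) \<Rightarrow> nat set \<Rightarrow> 'a::ab_group_add" where
  "restrict_to i j X = (\<lambda>I. if i \<in> I \<and> j \<in> I then X I else 0)"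

context operad
begin

lemma family_restrict_to: "family P c e X \<Longrightarrow> family P c e (restrict_to i j X)"
  by (simp add: family_def restrict_to_def space_zero)

lemma conv_cong:
  "\<lbrakk>\<And>A. A \<subseteq> J \<Longrightarrow> X (insert s A) = X' (insert s A); \<And>A. A \<subseteq> J \<Longrightarrow> Y A = Y' A\<rbrakk> \<Longrightarrow>
    conv P s X Y J = conv P s X' Y' J"
  unfolding conv_def by (auto intro!: sum.cong)

lemma family_above: "family (power_series P) c e X \<Longrightarrow> family (power_series P) c e (above p X)"
  by (auto simp: family_def power_series_space above_def fun_eq_iff space_zero)

lemma family_below: "family (power_series P) c e X \<Longrightarrow> family (power_series P) c e (below p X)"
  by (auto simp: family_def power_series_space below_def fun_eq_iff space_zero)

lemma symmetric_family_above: "symmetric_family (power_series P) X \<Longrightarrow> symmetric_family (power_series P) (above p X)"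
  by (auto simp: symmetric_family_def above_def fun_eq_iff)

lemma family_coeff: "family (power_series P) c e X \<Longrightarrow> finite I \<Longrightarrow>
    X I k \<in> op_space P I (2 * c * (int (card I) - 1) + e - 2 * int k)"
  by (simp add: family_def power_series_space)

lemma conv_coeff:
  "finite J \<Longrightarrow> conv (power_series P) s X Y J K =
    (\<Sum>A\<in>Pow J. \<Sum>l\<le>K. op_comp P s (X (insert s A) l) (Y (J - A) (K - l)))"
  by (simp add: conv_def sum_fun_apply power_series_comp)

lemma conv_coeff_zero:
  assumes X: "family (power_series P) c e X" and Y: "family (power_series P) c e' Y"
    and J: "finite J" "s \<notin> J"
    and zero: "\<And>A l. A \<subseteq> J \<Longrightarrow> l \<le> K \<Longrightarrow> X (insert s A) l = 0 \<or> Y (J - A) (K - l) = 0"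
  shows "conv (power_series P) s X Y J K = 0"
proof -
  have "op_comp P s (X (insert s A) l) (Y (J - A) (K - l)) = 0" if "A \<subseteq> J" "l \<le> K" for A l
  proof -
    have fin: "finite (insert s A)" "finite (J - A)" using J that finite_subset by auto
    from zero[OF that] show ?thesis
      using comp_zero_left[OF family_coeff[OF Y fin(2)]] comp_zero_right[OF family_coeff[OF X fin(1)], of s]
      by auto
  qed
  then show ?thesis unfolding conv_coeff[OF J(1)] by (auto intro!: sum.neutral)
qed

lemma dot_coeff_zero:
  assumes X: "family (power_series P) c e X" and Y: "family (power_series P) c e' Y"
    and zero: "\<And>I I' l. finite I \<Longrightarrow> finite I' \<Longrightarrow> l \<le> K \<Longrightarrow> X I l = 0 \<or> Y I' (K - l) = 0"
  shows "dot (power_series P) X Y J K = 0"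
proof (cases "finite J")
  case True
  then show ?thesis
    unfolding dot_def using zero finite_subset[OF _ True]
    by (intro conv_coeff_zero[OF X Y True fresh[OF True]]) auto
qed (simp add: dot_def conv_def)

end

text \<open>The relations are kept apart, in \<open>hc_point\<close>: for a deformation of
  generators they are what has to be proved.\<close>

locale hc_gens = operad P for P :: "('k::field_char_0, 'a::ab_group_add) operad_str" +
  fixes d :: nat and g :: "nat set \<Rightarrow> nat \<Rightarrow> 'a"
  assumes gens: "is_gens P d 0 g"
begin

abbreviation "W \<equiv> power_series P"
abbreviation "m \<equiv> gen_family g"
abbreviation "c \<equiv> int d"

sublocale W: operad W by (rule operad_power_series)

lemmas m = family_gen_family[OF gens] symmetric_gen_family[OF gens] gen_family_singleton

definition \<Gamma> :: "nat \<Rightarrow> nat \<Rightarrow> nat set \<Rightarrow> nat \<Rightarrow> 'a" where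
  "\<Gamma> i j = solve W m (restrict_to i j m)"

lemma family_\<Gamma>: "family W c 0 (\<Gamma> i j)"
  unfolding \<Gamma>_def by (rule W.family_solve[OF m(1) W.family_restrict_to[OF m(1)]])

lemma app_\<Gamma>: "app W m (\<Gamma> i j) = restrict_to i j m"
  unfolding \<Gamma>_def by (rule W.app_solve[OF m W.family_restrict_to[OF m(1)]])

lemma app_zero: "app W m 0 = 0"
  using W.app_diff[OF m(1) W.family_zero W.family_zero] by simp

text \<open>On all subsets of I the right-hand side of the equation for \<Gamma> vanishes, and so
  does its solution.\<close>

lemma \<Gamma>_support:
  assumes "finite I" "\<not> (i \<in> I \<and> j \<in> I)"
  shows "\<Gamma> i j I = 0"
proof -
  have "\<Gamma> i j I = (0 :: nat set \<Rightarrow> nat \<Rightarrow> 'a) I"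
    by (rule W.app_unique[OF m family_\<Gamma> W.family_zero _ assms(1) order.refl])
      (use assms in \<open>auto simp: app_\<Gamma> app_zero restrict_to_def\<close>)
  then show ?thesis by simp
qed

text \<open>In a relation the innermost block has to contain i and j, which is the restriction on
  the right-hand side of the equation for \<Gamma>; the outer operations come from iterating m.
  Upper indices adding up to k with q - 1 mean exponent k + 1 of w.\<close>

lemma relation_sum:
  assumes "i \<noteq> j"
  shows "(\<Sum>(Ss, ps)\<in>rel_index n i j k. nest (op_comp P) g (g (hd Ss) (hd ps)) (zip (tl Ss) (tl ps))) =
    \<Gamma> i j {1..n} (Suc k)"
proof -
  let ?I = "{1..n}"
  define y where "y S p = (if {i, j} \<subseteq> S \<and> finite S then g S p else 0)" for S p
  have card2: "2 \<le> card S" if "{i, j} \<subseteq> S" "finite S" for S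
    using card_mono[OF that(2,1)] assms by simp
  have ysp: "y S p \<in> op_space P S (mu_deg d (card S) p + 0)" if "finite S" for S p
    using is_gens_space[OF gens that card2] that by (auto simp: y_def space_zero)
  have y0: "y S p = 0" if "card S < 2" for S p
    using card2[of S] that by (auto simp: y_def)
  have gy: "gen_family y = restrict_to i j m"
    using card2 by (auto simp: fun_eq_iff gen_family_def restrict_to_def y_def)
  have "(\<Sum>(Ss, ps)\<in>rel_index n i j k. nest (op_comp P) g (g (hd Ss) (hd ps)) (zip (tl Ss) (tl ps))) =
      (\<Sum>(Ss, ps)\<in>rel_index n i j k. nest (op_comp P) g (y (hd Ss) (hd ps)) (zip (tl Ss) (tl ps)))"
  proof (rule sum.cong[OF HOL.refl])
    fix x assume x: "x \<in> rel_index n i j k"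
    obtain Ss ps where xx: "x = (Ss, ps)" by fastforce
    have "(Ss, ps) \<in> chain_index ?I (Suc k)" and ij: "{i, j} \<subseteq> hd Ss"
      using x xx by (simp_all add: rel_index_chain_index)
    then have "Ss \<in> ordered_partitions ?I" "Ss \<noteq> []" by (simp_all add: chain_index_def)
    then have "hd Ss \<subseteq> ?I"
      by (metis (lifting) Sup_upper hd_in_set mem_Collect_eq ordered_partitions_def set_splits_def)
    then have "finite (hd Ss)" using finite_subset by blast
    then show "(case x of (Ss, ps) \<Rightarrow> nest (op_comp P) g (g (hd Ss) (hd ps)) (zip (tl Ss) (tl ps))) =
        (case x of (Ss, ps) \<Rightarrow> nest (op_comp P) g (y (hd Ss) (hd ps)) (zip (tl Ss) (tl ps)))"
      using xx ij by (simp add: y_def)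
  qed
  also have "\<dots> = chain P g y ?I (Suc k)"
    unfolding chain_def
  proof (rule sum.mono_neutral_left)
    show "\<forall>x\<in>chain_index ?I (Suc k) - rel_index n i j k.
        (case x of (Ss, ps) \<Rightarrow> nest (op_comp P) g (y (hd Ss) (hd ps)) (zip (tl Ss) (tl ps))) = 0"
    proof
      fix x assume x: "x \<in> chain_index ?I (Suc k) - rel_index n i j k"
      obtain Ss ps where xx: "x = (Ss, ps)" by fastforce
      have "y (hd Ss) (hd ps) = 0" using x xx by (auto simp: rel_index_chain_index y_def)
      then show "(case x of (Ss, ps) \<Rightarrow> nest (op_comp P) g (y (hd Ss) (hd ps)) (zip (tl Ss) (tl ps))) = 0"
        using nest_zero[OF gens, of ?I Ss ps "Suc k"] x xx by simp
    qed
  qed (auto simp: finite_chain_index rel_index_chain_index)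
  also have "\<dots> = \<Gamma> i j ?I (Suc k)"
    unfolding \<Gamma>_def gy[symmetric] by (rule chain_eq_solve[OF gens ysp y0]) auto
  finally show ?thesis .
qed

lemma satisfies_relations_iff:
  "satisfies_relations P d g \<longleftrightarrow> (\<forall>n i j K. 2 \<le> n \<longrightarrow> i \<in> {1..n} \<longrightarrow> j \<in> {1..n} \<longrightarrow> i \<noteq> j \<longrightarrow> d < K \<longrightarrow>
     \<Gamma> i j {1..n} K = 0)"
proof -
  have "satisfies_relations P d g \<longleftrightarrow> (\<forall>n i j k. 2 \<le> n \<longrightarrow> i \<in> {1..n} \<longrightarrow> j \<in> {1..n} \<longrightarrow> i \<noteq> j \<longrightarrow> d \<le> k \<longrightarrow>
     \<Gamma> i j {1..n} (Suc k) = 0)"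
    unfolding satisfies_relations_def using relation_sum by simp
  also have "\<dots> \<longleftrightarrow> (\<forall>n i j K. 2 \<le> n \<longrightarrow> i \<in> {1..n} \<longrightarrow> j \<in> {1..n} \<longrightarrow> i \<noteq> j \<longrightarrow> d < K \<longrightarrow>
     \<Gamma> i j {1..n} K = 0)"
    by (metis Suc_le_eq Suc_le_mono less_Suc_eq_le not0_implies_Suc not_less0)
  finally show ?thesis .
qed

lemma \<Gamma>_relabel:
  assumes "finite J" "inj_on \<sigma> J" "i \<in> J" "j \<in> J"
  shows "\<Gamma> (\<sigma> i) (\<sigma> j) (\<sigma> ` J) = op_relabel W \<sigma> (\<Gamma> i j J)"
  unfolding \<Gamma>_def
proof (rule W.solve_relabel[OF m W.family_restrict_to[OF m(1)] W.family_restrict_to[OF m(1)] assms(1,2)])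
  fix A assume A: "A \<subseteq> J"
  have "\<sigma> k \<in> \<sigma> ` A \<longleftrightarrow> k \<in> A" if "k \<in> J" for k
    using A assms(2) that by (auto simp: inj_on_def)
  then show "restrict_to (\<sigma> i) (\<sigma> j) m (\<sigma> ` A) = op_relabel W \<sigma> (restrict_to i j m A)"
    using W.symmetric_familyD[OF m(2) finite_subset[OF A assms(1)] inj_on_subset[OF assms(2) A]] assms(3,4)
    by (auto simp: restrict_to_def fun_eq_iff)
qed

text \<open>For \<open>m\<close> this says that the generators of negative degree, those with p >
  d(n - 1) - 1, are sent to zero.\<close>

definition bounded_family :: "(nat set \<Rightarrow> nat \<Rightarrow> 'a) \<Rightarrow> bool" where
  "bounded_family X \<longleftrightarrow> (\<forall>J K. finite J \<longrightarrow> c * (int (card J) - 1) < int K \<longrightarrow> X J K = 0)"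

subsection \<open>The Lie derivative of the relations\<close>

text \<open>Here the slot s stays fixed while J varies. The value 0 when s is a label of J gives a
  family, to which \<open>app\<close> can be applied.\<close>

definition conv_off :: "nat \<Rightarrow> (nat set \<Rightarrow> nat \<Rightarrow> 'a) \<Rightarrow> (nat set \<Rightarrow> nat \<Rightarrow> 'a) \<Rightarrow> nat set \<Rightarrow> nat \<Rightarrow> 'a" where
  "conv_off s X Y J = (if s \<in> J then 0 else conv W s X Y J)"

lemma family_conv_off:
  "family W c e1 X \<Longrightarrow> family W c e2 Y \<Longrightarrow> family W c (e1 + e2) (conv_off s X Y)"
  unfolding family_def[of W c "e1 + e2"] conv_off_def using W.conv_space W.space_zero by (auto simp: conv_def)

text \<open>Rebracketing m, X, Y moves the operator onto X and leaves the term in which X and Y are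
  inserted into m side by side.\<close>

lemma app_conv_off:
  assumes X: "family W c e1 X" and Y: "family W c e2 Y"
    and J: "finite J" "s \<notin> J" "t \<notin> J" "s \<noteq> t"
  shows "app W m (conv_off s X Y) J = conv W s (app W m X) Y J + W.triple t s m X Y J"
proof -
  note mX = W.family_dot[OF m(1) X]
  have "app W m (conv_off s X Y) J = conv W s X Y J - conv W t m (conv_off s X Y) J"
    using W.dot_eq_conv[OF m(1,2) family_conv_off[OF X Y] J(3)] J by (simp add: app_def conv_off_def)
  also have "conv W t m (conv_off s X Y) J = conv W t m (conv W s X Y) J"
    using J by (intro W.conv_cong) (auto simp: conv_off_def)
  also have "\<dots> = conv W s (conv W t m X) Y J - W.triple t s m X Y J"
    using W.conv_conv[OF m(1) X Y, of J t s] J by simp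
  also have "conv W s (conv W t m X) Y J = conv W s (dot W m X) Y J"
    using J by (intro W.conv_cong W.dot_eq_conv[OF m(1,2) X, symmetric]) auto
  also have "conv W s X Y J - (conv W s (dot W m X) Y J - W.triple t s m X Y J) =
      conv W s (app W m X) Y J + W.triple t s m X Y J"
    using W.conv_add_left[OF X W.family_neg[OF mX, simplified] Y J(2)] W.conv_neg_left[OF mX Y J(2)]
    by (simp add: app_def)
  finally show ?thesis .
qed

text \<open>In m \<cdot> \<eta> each of i and j lies in the part of m or in that of \<eta>, which
  gives four products. Since the slot s is always a label of m, \<open>restrict_to i s m\<close>
  just expresses that i lies in the part of m; writing it with s as a marked label is what lets
  \<Gamma> enter the mixed cases.\<close>

lemma restrict_app:
  assumes \<eta>: "family W c e \<eta>" and J: "finite J" "s \<notin> J" and ij: "i \<noteq> j" "s \<noteq> i" "s \<noteq> j"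
  shows "restrict_to i j (app W m \<eta>) J = app W m (restrict_to i j \<eta>) J -
    conv W s (restrict_to i j m) \<eta> J -
    conv W s (restrict_to i s m) (restrict_to j j \<eta>) J -
    conv W s (restrict_to j s m) (restrict_to i i \<eta>) J"
proof -
  have dot: "dot W m X J = conv W s m X J" if "family W c e X" for X
    by (rule W.dot_eq_conv[OF m(1,2) that J(2)])
  let ?t = "\<lambda>X Y A. op_comp W s (X (insert s A)) (Y (J - A))"
  have t: "(if i \<in> J \<and> j \<in> J then ?t m \<eta> A else 0) = ?t m (restrict_to i j \<eta>) A +
      ?t (restrict_to i j m) \<eta> A + ?t (restrict_to i s m) (restrict_to j j \<eta>) A +
      ?t (restrict_to j s m) (restrict_to i i \<eta>) A" if A: "A \<in> Pow J" for A
  proof -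
    have fin: "finite (insert s A)" "finite (J - A)" "A \<subseteq> J" using A J finite_subset by auto
    have z: "op_comp W s 0 (\<eta> (J - A)) = 0" "op_comp W s (m (insert s A)) 0 = 0" "op_comp W s 0 0 = 0"
      using W.comp_zero_left[OF W.familyD[OF \<eta> fin(2)]] W.comp_zero_right[OF W.familyD[OF m(1) fin(1)], of s]
        W.comp_zero_left[OF W.space_zero[of "{}"]] by auto
    show ?thesis
      using ij fin(3) z by (cases "i \<in> J"; cases "j \<in> J"; cases "i \<in> A"; cases "j \<in> A")
        (auto simp: restrict_to_def)
  qed
  have "(if i \<in> J \<and> j \<in> J then conv W s m \<eta> J else 0) =
      (\<Sum>A\<in>Pow J. if i \<in> J \<and> j \<in> J then ?t m \<eta> A else 0)"
    using J by (cases "i \<in> J \<and> j \<in> J") (auto simp: conv_def)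
  also have "\<dots> = conv W s m (restrict_to i j \<eta>) J +
    conv W s (restrict_to i j m) \<eta> J +
    conv W s (restrict_to i s m) (restrict_to j j \<eta>) J +
    conv W s (restrict_to j s m) (restrict_to i i \<eta>) J"
    using J(1) by (simp add: conv_def sum.distrib t)
  finally have sum: "(if i \<in> J \<and> j \<in> J then conv W s m \<eta> J else 0) = \<dots>" .
  have "restrict_to i j (app W m \<eta>) J = restrict_to i j \<eta> J - (if i \<in> J \<and> j \<in> J then conv W s m \<eta> J else 0)"
    using dot[OF \<eta>] by (simp add: app_def restrict_to_def)
  moreover have "app W m (restrict_to i j \<eta>) J = restrict_to i j \<eta> J - conv W s m (restrict_to i j \<eta>) J"
    using dot[OF W.family_restrict_to[OF \<eta>]] by (simp add: app_def)
  ultimately show ?thesis unfolding sum by simp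
qed

text \<open>A closed form for the variation of \<Gamma> on sets that avoid s. It arises from
  \<open>restrict_app\<close> by replacing each restricted m by the \<Gamma> that \<open>app\<close>
  maps to it; the summand \<eta> \<cdot> \<Gamma> accounts for the variation of the outer
  operations. As m does not occur, the degree in w is at most that of \<eta> plus that of
  \<Gamma>.\<close>

definition lie :: "nat \<Rightarrow> nat \<Rightarrow> nat \<Rightarrow> (nat set \<Rightarrow> nat \<Rightarrow> 'a) \<Rightarrow> nat set \<Rightarrow> nat \<Rightarrow> 'a" where
  "lie s i j \<eta> = restrict_to i j \<eta> - conv_off s (\<Gamma> i j) \<eta> - conv_off s (\<Gamma> i s) (restrict_to j j \<eta>) -
     conv_off s (\<Gamma> j s) (restrict_to i i \<eta>) + dot W \<eta> (\<Gamma> i j)"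

lemma family_lie:
  assumes "family W c e \<eta>"
  shows "family W c e (lie s i j \<eta>)"
  unfolding lie_def
  using family_conv_off[OF family_\<Gamma>] W.family_dot[OF assms family_\<Gamma>] assms W.family_restrict_to[OF assms]
  by (intro W.family_add W.family_diff) auto

text \<open>The side-by-side terms have to disappear. In the two mixed summands they vanish because
  \<Gamma> marks s, which is not among the labels it receives there; those of the summands with the
  unmarked \<eta> on either side of \<Gamma> cancel by \<open>triple_swap\<close>.\<close>

lemma app_lie:
  assumes \<eta>: "family W c e \<eta>" "symmetric_family W \<eta>"
    and J: "finite J" "s \<notin> J" "t \<notin> J" "s \<noteq> t" and ij: "i \<noteq> j" "s \<noteq> i" "s \<noteq> j"
  shows "app W m (lie s i j \<eta>) J = restrict_to i j (app W m \<eta>) J + dot W (app W m \<eta>) (\<Gamma> i j) J"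
proof -
  note R = W.family_restrict_to[OF \<eta>(1)]
  have c0: "family W c e (conv_off s (\<Gamma> i' j') Y)" if "family W c e Y" for i' j' Y
    using family_conv_off[OF family_\<Gamma> that] by simp
  have d0: "family W c e (dot W \<eta> (\<Gamma> i j))" using W.family_dot[OF \<eta>(1) family_\<Gamma>] by simp
  note a = W.app_add[OF m(1)] W.app_diff[OF m(1)]
  have "app W m (lie s i j \<eta>) = app W m (restrict_to i j \<eta>) - app W m (conv_off s (\<Gamma> i j) \<eta>) -
      app W m (conv_off s (\<Gamma> i s) (restrict_to j j \<eta>)) - app W m (conv_off s (\<Gamma> j s) (restrict_to i i \<eta>)) +
      app W m (dot W \<eta> (\<Gamma> i j))"
  proof -
    note f1 = R[of i j] and f2 = c0[OF \<eta>(1), of i j] and f3 = c0[OF R[of j j], of i s]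
      and f4 = c0[OF R[of i i], of j s]
    note f12 = W.family_diff[OF f1 f2] 
    note f123 = W.family_diff[OF f12 f3]
    show ?thesis
      unfolding lie_def a(1)[OF W.family_diff[OF f123 f4] d0] a(2)[OF f123 f4] a(2)[OF f12 f3] a(2)[OF f1 f2] ..
  qed
  moreover have tr: "W.triple t s m (\<Gamma> k s) Y J = 0" if "family W c e Y" for k Y
    unfolding W.triple_def
  proof (intro sum.neutral ballI)
    fix C A assume CA: "C \<in> Pow J" "A \<in> Pow C"
    have fin: "finite (insert s (insert t A))" "finite (J - C)" "finite (C - A)"
      using CA J finite_subset by (auto intro: finite_subset[of _ J])
    have "\<Gamma> k s (C - A) = 0" using \<Gamma>_support[OF fin(3)] CA J by auto
    then show "op_comp W s (op_comp W t (m (insert s (insert t A))) (\<Gamma> k s (C - A))) (Y (J - C)) = 0"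
      using W.comp_zero_right[OF W.familyD[OF m(1) fin(1)], of t] W.comp_zero_left[OF W.familyD[OF that fin(2)]]
      by simp
  qed
  moreover have "app W m (dot W \<eta> (\<Gamma> i j)) J = dot W (app W m \<eta>) (\<Gamma> i j) J + W.triple s t m \<eta> (\<Gamma> i j) J"
  proof -
    have "app W m (dot W \<eta> (\<Gamma> i j)) J = dot W \<eta> (\<Gamma> i j) J - conv W s m (dot W \<eta> (\<Gamma> i j)) J"
      using W.dot_eq_conv[OF m(1,2) d0 J(2)] by (simp add: app_def)
    also have "\<dots> = conv_off t \<eta> (\<Gamma> i j) J - conv W s m (conv_off t \<eta> (\<Gamma> i j)) J"
    proof -
      have "dot W \<eta> (\<Gamma> i j) A = conv_off t \<eta> (\<Gamma> i j) A" if "A \<subseteq> J" for A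
        using W.dot_eq_conv[OF \<eta> family_\<Gamma>, of t A] that J by (auto simp: conv_off_def)
      then show ?thesis by (simp add: W.conv_cong[of J m s m "dot W \<eta> (\<Gamma> i j)" "conv_off t \<eta> (\<Gamma> i j)"])
    qed
    also have "\<dots> = app W m (conv_off t \<eta> (\<Gamma> i j)) J"
      using W.dot_eq_conv[OF m(1,2) family_conv_off[OF \<eta>(1) family_\<Gamma>] J(2)] by (simp add: app_def)
    also have "\<dots> = conv W t (app W m \<eta>) (\<Gamma> i j) J + W.triple s t m \<eta> (\<Gamma> i j) J"
      using J by (intro app_conv_off[OF \<eta>(1) family_\<Gamma>]) auto
    also have "conv W t (app W m \<eta>) (\<Gamma> i j) J = dot W (app W m \<eta>) (\<Gamma> i j) J"
      using W.dot_eq_conv[OF W.family_app[OF m(1) \<eta>(1)] W.symmetric_family_app[OF m(1,2) \<eta>] family_\<Gamma> J(3)] by simp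
    finally show ?thesis .
  qed
  moreover have "W.triple s t m \<eta> (\<Gamma> i j) J = W.triple t s m (\<Gamma> i j) \<eta> J"
    using W.triple_swap[OF m(1) \<eta>(1) family_\<Gamma> J] by simp
  ultimately show ?thesis
    using app_conv_off[OF family_\<Gamma> \<eta>(1) J] app_conv_off[OF family_\<Gamma> R J] restrict_app[OF \<eta>(1) J(1,2) ij]
    by (simp add: app_\<Gamma> tr[OF R])
qed

text \<open>
  If the generators vary by \<open>y\<close>, then \<open>\<Gamma>\<close> varies by \<open>vary i j y\<close>.
\<close>

definition vary :: "nat \<Rightarrow> nat \<Rightarrow> (nat set \<Rightarrow> nat \<Rightarrow> 'a) \<Rightarrow> nat set \<Rightarrow> nat \<Rightarrow> 'a" where
  "vary i j y = solve W m (restrict_to i j y + dot W y (\<Gamma> i j))"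

lemma family_vary_arg: "family W c e y \<Longrightarrow> family W c e (restrict_to i j y + dot W y (\<Gamma> i j))"
  using W.family_dot[of c e y 0 "\<Gamma> i j"] family_\<Gamma> by (simp add: W.family_add W.family_restrict_to)

lemma family_vary: "family W c e y \<Longrightarrow> family W c e (vary i j y)"
  unfolding vary_def by (rule W.family_solve[OF m(1) family_vary_arg])

lemma app_vary: "family W c e y \<Longrightarrow> app W m (vary i j y) = restrict_to i j y + dot W y (\<Gamma> i j)"
  unfolding vary_def by (rule W.app_solve[OF m family_vary_arg])

text \<open>Both sides have the same image under \<open>app\<close> on every subset of J, and all
  these subsets avoid s.\<close>

lemma vary_eq_lie:
  assumes \<eta>: "family W c e \<eta>" "symmetric_family W \<eta>"
    and J: "finite J" "s \<notin> J" and ij: "i \<noteq> j" "s \<noteq> i" "s \<noteq> j"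
  shows "vary i j (app W m \<eta>) J = lie s i j \<eta> J"
proof (rule W.app_unique[OF m family_vary[OF W.family_app[OF m(1) \<eta>(1)]] family_lie[OF \<eta>(1)] _ J(1) order.refl])
  fix A assume A: "A \<subseteq> J"
  define t where "t = fresh (insert s A)"
  have fin: "finite A" using A J finite_subset by auto
  then have "t \<notin> insert s A" unfolding t_def by (intro fresh) auto
  moreover have "s \<notin> A" using A J by auto
  ultimately show "app W m (vary i j (app W m \<eta>)) A = app W m (lie s i j \<eta>) A"
    using app_lie[OF \<eta> fin _ _ _ ij, of t] app_vary[OF W.family_app[OF m(1) \<eta>(1)]] A J by auto
qed

text \<open>Applying D to the equation for \<Gamma> yields the equation that defines
  \<open>vary\<close>.\<close>

lemma vary_derivation:
  assumes D: "derivation P e D"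
  shows "vary i j ((\<lambda>X. D \<circ> X) \<circ> m) = (\<lambda>X. D \<circ> X) \<circ> \<Gamma> i j"
  unfolding vary_def
proof (rule W.solve_eqI[OF m])
  note DW = derivation_power_series[OF D]
  have Dm: "family W c e ((\<lambda>X. D \<circ> X) \<circ> m)" using W.family_derivation[OF DW m(1)] by simp
  show "family W c e (restrict_to i j ((\<lambda>X. D \<circ> X) \<circ> m) + dot W ((\<lambda>X. D \<circ> X) \<circ> m) (\<Gamma> i j))"
    by (rule family_vary_arg[OF Dm])
  show D\<Gamma>: "family W c e ((\<lambda>X. D \<circ> X) \<circ> \<Gamma> i j)" using W.family_derivation[OF DW family_\<Gamma>] by simp
  have "restrict_to i j ((\<lambda>X. D \<circ> X) \<circ> m) = (\<lambda>X. D \<circ> X) \<circ> restrict_to i j m"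
    using derivation_zero[OF D] by (auto simp: restrict_to_def fun_eq_iff)
  also have "restrict_to i j m = \<Gamma> i j - dot W m (\<Gamma> i j)"
    using app_\<Gamma>[of i j] by (simp add: app_def)
  also have "(\<lambda>X. D \<circ> X) \<circ> (\<Gamma> i j - dot W m (\<Gamma> i j)) =
      ((\<lambda>X. D \<circ> X) \<circ> \<Gamma> i j) - ((\<lambda>X. D \<circ> X) \<circ> dot W m (\<Gamma> i j))"
  proof
    fix I
    show "((\<lambda>X. D \<circ> X) \<circ> (\<Gamma> i j - dot W m (\<Gamma> i j))) I =
      (((\<lambda>X. D \<circ> X) \<circ> \<Gamma> i j) - ((\<lambda>X. D \<circ> X) \<circ> dot W m (\<Gamma> i j))) I"
    proof (cases "finite I")
      case True
      show ?thesis
        using W.derivation_diff[OF DW W.familyD[OF family_\<Gamma> True, simplified] W.familyD[OF W.family_dot[OF m(1) family_\<Gamma>] True, simplified]]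
        by simp
    next
      case False
      then show ?thesis
        using W.family_infinite[OF family_\<Gamma> False] W.family_infinite[OF W.family_dot[OF m(1) family_\<Gamma>] False]
        by (simp add: fun_eq_iff derivation_zero[OF D])
    qed
  qed
  also have "(\<lambda>X. D \<circ> X) \<circ> dot W m (\<Gamma> i j) =
      dot W ((\<lambda>X. D \<circ> X) \<circ> m) (\<Gamma> i j) + dot W m ((\<lambda>X. D \<circ> X) \<circ> \<Gamma> i j)"
    using W.dot_derivation[OF DW m(1) family_\<Gamma>] by simp
  finally have "restrict_to i j ((\<lambda>X. D \<circ> X) \<circ> m) = ((\<lambda>X. D \<circ> X) \<circ> \<Gamma> i j) -
      (dot W ((\<lambda>X. D \<circ> X) \<circ> m) (\<Gamma> i j) + dot W m ((\<lambda>X. D \<circ> X) \<circ> \<Gamma> i j))" .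
  then show "app W m ((\<lambda>X. D \<circ> X) \<circ> \<Gamma> i j) =
      restrict_to i j ((\<lambda>X. D \<circ> X) \<circ> m) + dot W ((\<lambda>X. D \<circ> X) \<circ> m) (\<Gamma> i j)"
    unfolding app_def by (simp only: diff_diff_eq[symmetric]) (simp add: algebra_simps)
qed

subsection \<open>The action formula as a truncation\<close>

text \<open>Multiplication by w^p. It commutes with products and with \<open>app\<close>, so
  coefficients beyond p can be handled without renumbering them inside products.\<close>

definition wshift :: "nat \<Rightarrow> (nat set \<Rightarrow> nat \<Rightarrow> 'a) \<Rightarrow> nat set \<Rightarrow> nat \<Rightarrow> 'a" where
  "wshift p X = (\<lambda>I k. if p \<le> k then X I (k - p) else 0)"

lemma family_wshift:
  assumes X: "family W c e X"
  shows "family W c (e + 2 * int p) (wshift p X)"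
proof -
  have "wshift p X I k \<in> op_space P I (2 * c * (int (card I) - 1) + (e + 2 * int p) - 2 * int k)"
    if I: "finite I" for I k
  proof (cases "p \<le> k")
    case True
    have "X I (k - p) \<in> op_space P I (2 * c * (int (card I) - 1) + (e + 2 * int p) - 2 * int k)"
      by (rule space_cast[OF family_coeff[OF X I, of "k - p"]]) (use True in \<open>simp_all add: of_nat_diff\<close>)
    then show ?thesis using True by (simp add: wshift_def)
  qed (use I in \<open>simp add: wshift_def space_zero\<close>)
  then show ?thesis
    using W.family_infinite[OF X] by (auto simp: family_def power_series_space wshift_def fun_eq_iff)
qed

lemma wshift_add: "wshift p (X + Y) = wshift p X + wshift p Y"
  by (auto simp: wshift_def fun_eq_iff)

lemma wshift_diff: "wshift p (X - Y) = wshift p X - wshift p Y"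
  by (auto simp: wshift_def fun_eq_iff)

lemma wshift_koszul: "wshift p (koszul a b X) = koszul a b (wshift p X)"
  by (auto simp: wshift_def koszul_def fun_eq_iff)

lemma wshift_restrict_to: "wshift p (restrict_to i j X) = restrict_to i j (wshift p X)"
  by (auto simp: wshift_def restrict_to_def fun_eq_iff)

lemma conv_wshift_right:
  assumes X: "family W c e X" and Y: "family W c e' Y" and J: "finite J" "s \<notin> J"
  shows "conv W s X (wshift p Y) J = wshift p (conv W s X Y) J"
proof
  fix K
  have "(\<Sum>l\<le>K. op_comp P s (X (insert s A) l) (wshift p Y (J - A) (K - l))) =
      (if p \<le> K then \<Sum>l\<le>K - p. op_comp P s (X (insert s A) l) (Y (J - A) (K - p - l)) else 0)"
    if "A \<in> Pow J" for A
  proof -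
    have fin: "finite (insert s A)" using that J finite_subset by auto
    have "(\<Sum>l\<le>K. op_comp P s (X (insert s A) l) (wshift p Y (J - A) (K - l))) =
        (\<Sum>l\<le>K. if p + l \<le> K then op_comp P s (X (insert s A) l) (Y (J - A) (K - p - l)) else 0)"
    proof (rule sum.cong[OF HOL.refl])
      fix l assume "l \<in> {..K}"
      then have "p \<le> K - l \<longleftrightarrow> p + l \<le> K" "K - l - p = K - p - l" by auto
      then show "op_comp P s (X (insert s A) l) (wshift p Y (J - A) (K - l)) =
          (if p + l \<le> K then op_comp P s (X (insert s A) l) (Y (J - A) (K - p - l)) else 0)"
        using comp_zero_right[OF family_coeff[OF X fin], of s] by (simp add: wshift_def)
    qed
    also have "\<dots> = (\<Sum>l\<in>{l. p + l \<le> K}. op_comp P s (X (insert s A) l) (Y (J - A) (K - p - l)))"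
      by (intro sum.mono_neutral_cong_right) auto
    also have "{l. p + l \<le> K} = (if p \<le> K then {..K - p} else {})" by auto
    finally show ?thesis by simp
  qed
  then show "conv W s X (wshift p Y) J K = wshift p (conv W s X Y) J K"
    unfolding conv_coeff[OF J(1)] wshift_def by (simp add: conv_coeff[OF J(1)])
qed

lemma conv_wshift_left:
  assumes X: "family W c e X" and Y: "family W c e' Y" and J: "finite J" "s \<notin> J"
  shows "conv W s (wshift p X) Y J = wshift p (conv W s X Y) J"
proof
  fix K
  have "(\<Sum>l\<le>K. op_comp P s (wshift p X (insert s A) l) (Y (J - A) (K - l))) =
      (if p \<le> K then \<Sum>l\<le>K - p. op_comp P s (X (insert s A) l) (Y (J - A) (K - p - l)) else 0)"
    if "A \<in> Pow J" for A
  proof -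
    have fin: "finite (J - A)" using that J finite_subset by auto
    have "(\<Sum>l\<le>K. op_comp P s (wshift p X (insert s A) l) (Y (J - A) (K - l))) =
        (\<Sum>l\<in>{p..K}. op_comp P s (X (insert s A) (l - p)) (Y (J - A) (K - l)))"
      using comp_zero_left[OF family_coeff[OF Y fin], of s]
      by (intro sum.mono_neutral_cong_right) (auto simp: wshift_def)
    also have "\<dots> = (if p \<le> K then \<Sum>l\<le>K - p. op_comp P s (X (insert s A) l) (Y (J - A) (K - p - l)) else 0)"
      by (auto intro!: sum.reindex_bij_witness[where i = "\<lambda>l. l + p" and j = "\<lambda>l. l - p"])
    finally show ?thesis .
  qed
  then show "conv W s (wshift p X) Y J K = wshift p (conv W s X Y) J K"
    unfolding conv_coeff[OF J(1)] wshift_def by (simp add: conv_coeff[OF J(1)])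
qed

lemma dot_wshift:
  assumes X: "family W c e X" and Y: "family W c e' Y"
  shows "dot W X (wshift p Y) = wshift p (dot W X Y)" "dot W (wshift p X) Y = wshift p (dot W X Y)"
proof -
  have "dot W X (wshift p Y) J = wshift p (dot W X Y) J \<and> dot W (wshift p X) Y J = wshift p (dot W X Y) J" for J
  proof (cases "finite J")
    case True
    have "wshift p (dot W X Y) J = wshift p (conv W (fresh J) X Y) J"
      by (simp add: wshift_def dot_def fun_eq_iff)
    then show ?thesis
      using conv_wshift_right[OF X Y True fresh[OF True]] conv_wshift_left[OF X Y True fresh[OF True]]
      by (simp add: dot_def)
  qed (simp add: dot_def conv_def wshift_def fun_eq_iff)
  then show "dot W X (wshift p Y) = wshift p (dot W X Y)" "dot W (wshift p X) Y = wshift p (dot W X Y)"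
    by (auto simp: fun_eq_iff)
qed

lemma app_wshift: "family W c e Y \<Longrightarrow> app W m (wshift p Y) = wshift p (app W m Y)"
  by (simp add: app_def dot_wshift[OF m(1)] wshift_diff)

lemma vary_wshift:
  assumes y: "family W c e y"
  shows "vary i j (wshift p y) = wshift p (vary i j y)"
  unfolding vary_def[of i j "wshift p y"]
proof (rule W.solve_eqI[OF m family_vary_arg[OF family_wshift[OF y]] family_wshift[OF family_vary[OF y]]])
  show "app W m (wshift p (vary i j y)) = restrict_to i j (wshift p y) + dot W (wshift p y) (\<Gamma> i j)"
    unfolding app_wshift[OF family_vary[OF y]] app_vary[OF y]
    by (simp add: wshift_add wshift_restrict_to dot_wshift(2)[OF y family_\<Gamma>])
qed

abbreviation "coeffwise D \<equiv> (\<lambda>X::nat \<Rightarrow> 'a. D \<circ> X)"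

definition G :: "('a \<Rightarrow> 'a) \<Rightarrow> nat set \<Rightarrow> nat \<Rightarrow> 'a" where
  "G D = solve W m (coeffwise D \<circ> m)"

definition act :: "('a \<Rightarrow> 'a) \<Rightarrow> nat \<Rightarrow> nat set \<Rightarrow> nat \<Rightarrow> 'a" where
  "act D p I k = app W m (above p (G D)) I (Suc (k + p))"

lemma family_Dm:
  assumes D: "derivation P e D"
  shows "family W c e (coeffwise D \<circ> m)" "symmetric_family W (coeffwise D \<circ> m)"
  using W.family_derivation[OF derivation_power_series[OF D] m(1)]
    W.symmetric_family_derivation[OF derivation_power_series[OF D] m(1,2)] by simp_all

lemma family_G:
  assumes D: "derivation P e D"
  shows "family W c e (G D)" "symmetric_family W (G D)"
  unfolding G_def
  using W.family_solve[OF m(1) family_Dm(1)[OF D]] W.symmetric_family_solve[OF m family_Dm[OF D]] by simp_all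

lemma app_G: "derivation P e D \<Longrightarrow> app W m (G D) = coeffwise D \<circ> m"
  unfolding G_def by (rule W.app_solve[OF m family_Dm(1)])

lemma family_above_G:
  assumes D: "derivation P e D"
  shows "family W c e (above p (G D))" "symmetric_family W (above p (G D))"
  using family_above[OF family_G(1)[OF D]] symmetric_family_above[OF family_G(2)[OF D]] by simp_all

lemma G_small:
  assumes D: "derivation P e D" and J: "finite J" "card J < 2"
  shows "G D J = 0"
  using J
proof (induction "card J" arbitrary: J rule: less_induct)
  case less
  have "(coeffwise D \<circ> m) J = 0"
    using less.prems derivation_zero[OF D] by (auto simp: gen_family_def fun_eq_iff)
  moreover have "op_comp W (fresh J) (m (insert (fresh J) A)) (G D (J - A)) = 0" if A: "A \<in> Pow J - {{}}" for A
  proof -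
    have fin: "finite (insert (fresh J) A)" using A less.prems finite_subset by auto
    have "card (J - A) < card J" using A less.prems by (intro psubset_card_mono) auto
    then have "G D (J - A) = 0" using less.hyps[of "J - A"] less.prems by simp
    then show ?thesis using W.comp_zero_right[OF W.familyD[OF m(1) fin]] by simp
  qed
  ultimately show ?case
    unfolding G_def solve.simps[of W m _ J] using less.prems by simp
qed

lemma is_gens_act:
  assumes D: "derivation P e D"
  shows "is_gens P d (e - 2 * int p) (act D p)"
  unfolding is_gens_def
proof (intro allI impI conjI)
  fix I :: "nat set" and k assume I: "finite I" "2 \<le> card I"
  have fam: "family W c e (app W m (above p (G D)))" "symmetric_family W (app W m (above p (G D)))"
    using W.family_app[OF m(1) family_above_G(1)[OF D]] W.symmetric_family_app[OF m(1,2) family_above_G[OF D]] by simp_all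
  show "act D p I k \<in> op_space P I (mu_deg d (card I) k + (e - 2 * int p))"
    unfolding act_def using family_coeff[OF fam(1) I(1)]
    by (rule space_cast) (simp_all add: mu_deg_def algebra_simps)
  fix \<sigma> :: "nat \<Rightarrow> nat" assume "inj_on \<sigma> I"
  then show "act D p (\<sigma> ` I) k = op_relabel P \<sigma> (act D p I k)"
    unfolding act_def using W.symmetric_familyD[OF fam(2) I(1)] by simp
qed

text \<open>Passing from the series to the operations \<open>act D p\<close> forgets exponents up to
  p and sets with fewer than two labels. Nothing is lost: neither the truncated G nor its product
  with m has coefficients up to p, and G vanishes on fewer than two labels.\<close>

lemma wshift_act:
  assumes D: "derivation P e D"
  shows "wshift p (gen_family (act D p)) = app W m (above p (G D))"
proof (intro ext)
  fix I K
  let ?A = "above p (G D)"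
  note A = family_above_G(1)[OF D]
  have le: "app W m ?A I K = 0" if "K \<le> p"
  proof -
    have "dot W m ?A I K = 0"
      by (rule dot_coeff_zero[OF m(1) A]) (use that in \<open>auto simp: above_def\<close>)
    then show ?thesis using that by (simp add: app_def above_def)
  qed
  have small: "app W m ?A I = 0" if "finite I" "card I < 2"
  proof -
    have small: "?A B = 0" if "B \<subseteq> I" for B
    proof -
      have "finite B" "card B < 2"
        using that \<open>finite I\<close> \<open>card I < 2\<close> card_mono[of I B] finite_subset[of B I] by auto
      then show ?thesis using G_small[OF D] by (auto simp: above_def fun_eq_iff)
    qed
    have "conv W (fresh I) m ?A I = 0"
      unfolding conv_def
    proof (simp add: that(1), intro sum.neutral ballI)
      fix B assume "B \<in> Pow I"
      then have "finite (insert (fresh I) B)" using that(1) finite_subset by auto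
      then show "op_comp W (fresh I) (m (insert (fresh I) B)) (?A (I - B)) = 0"
        using small[of "I - B"] W.comp_zero_right[OF W.familyD[OF m(1)], of _ "fresh I"] by simp
    qed
    then show ?thesis using small[of I] by (simp add: app_def dot_def)
  qed
  show "wshift p (gen_family (act D p)) I K = app W m ?A I K"
  proof (cases "finite I \<and> 2 \<le> card I \<and> p < K")
    case True
    then have "Suc (K - p - 1 + p) = K" by simp
    then show ?thesis using True by (simp add: wshift_def gen_family_def act_def)
  next
    case False
    then consider "infinite I" | "finite I" "card I < 2" | "K \<le> p" by linarith
    then show ?thesis
    proof cases
      case 1
      then show ?thesis
        using W.family_infinite[OF W.family_app[OF m(1) A]] by (simp add: wshift_def gen_family_def)
    next
      case 2
      then show ?thesis using small by (simp add: wshift_def gen_family_def)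
    next
      case 3
      then show ?thesis using le by (simp add: wshift_def gen_family_def)
    qed
  qed
qed

end

section \<open>Generators that satisfy the relations\<close>

locale hc_point = hc_gens +
  assumes rel: "satisfies_relations P d g"
begin

lemma \<Gamma>_bound:
  assumes J: "finite J" and "i \<noteq> j" "d < K"
  shows "\<Gamma> i j J K = 0"
proof (cases "i \<in> J \<and> j \<in> J")
  case True
  obtain \<sigma> where "bij_betw \<sigma> {1..card J} J"
    using ex_bij_betw_nat_finite_1[OF J] by blast
  then have \<sigma>: "inj_on \<sigma> {1..card J}" "\<sigma> ` {1..card J} = J" by (auto simp: bij_betw_def)
  then obtain i' j' where ij: "i' \<in> {1..card J}" "i = \<sigma> i'" "j' \<in> {1..card J}" "j = \<sigma> j'"
    using True by (metis imageE)
  have "2 \<le> card J" using card_mono[OF J, of "{i, j}"] True assms(2) by simp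
  moreover have "i' \<noteq> j'" using ij assms(2) by auto
  ultimately have "\<Gamma> i' j' {1..card J} K = 0"
    using rel ij assms(3) unfolding satisfies_relations_iff by blast
  then show ?thesis
    using \<Gamma>_relabel[OF _ \<sigma>(1) ij(1,3)] \<sigma>(2) ij by simp
qed (use \<Gamma>_support[OF J] in simp)

text \<open>The presentation does not list the vanishing of generators of negative degree as a rule;
  the relations imply it. For distinct i, j in J, m on J is \<Gamma> minus m \<cdot> \<Gamma>. The
  first term stops at exponent d; in the second, \<Gamma> absorbs at least two labels but at most d
  of the exponent, which leaves m on a smaller set with an exponent that is too large.\<close>

lemma gen_family_bounded: "bounded_family m"
proof -
  have "m J K = 0" if "finite J" "c * (int (card J) - 1) < int K" for J K
    using that
  proof (induction "card J" arbitrary: J K rule: less_induct)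
    case less
    show ?case
    proof (cases "2 \<le> card J")
      case True
      then obtain B where "B \<subseteq> J" "card B = 2" by (rule obtain_subset_with_card_n)
      then obtain i j where ij: "i \<in> J" "j \<in> J" "i \<noteq> j"
        unfolding card_2_iff by blast
      have dK: "d < K"
      proof -
        have "c * 1 \<le> c * (int (card J) - 1)" using True by (intro mult_left_mono) auto
        then show ?thesis using less.prems(2) by simp
      qed
      define s where "s = fresh J"
      have s: "s \<notin> J" using fresh[OF less.prems(1)] by (simp add: s_def)
      have "conv W s m (\<Gamma> i j) J K = 0"
      proof (rule conv_coeff_zero[OF m(1) family_\<Gamma> less.prems(1) s])
        fix A l assume A: "A \<subseteq> J" and l: "l \<le> K"
        have fin: "finite A" "s \<notin> A" using A s less.prems(1) finite_subset by auto
        show "m (insert s A) l = 0 \<or> \<Gamma> i j (J - A) (K - l) = 0"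
        proof (cases "{i, j} \<subseteq> J - A \<and> K - l \<le> d")
          case False
          then show ?thesis
            using \<Gamma>_support[of "J - A" i j] \<Gamma>_bound[of "J - A" i j "K - l"] less.prems(1) ij(3) by auto
        next
          case True
          \<comment> \<open>At least two labels go to \<Gamma> and one is gained by the slot, so m
            is evaluated on fewer labels than J has.\<close>
          have "card A + card {i, j} \<le> card J"
            using True A less.prems(1) fin by (subst card_Un_disjoint[symmetric]) (auto intro!: card_mono)
          then have AJ: "card A + 2 \<le> card J" using ij(3) by simp
          have "int K \<le> c + int l" using True by linarith
          then have "c * (int (card J) - 1) - c < int l" using less.prems(2) by linarith
          moreover have "c * (int (card A) + 1) \<le> c * (int (card J) - 1)"
            using AJ by (intro mult_left_mono) auto
          ultimately have "c * (int (card (insert s A)) - 1) < int l"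
            using fin by (simp add: algebra_simps)
          then show ?thesis using less.hyps[of "insert s A" l] AJ fin by simp
        qed
      qed
      moreover have "m J K = \<Gamma> i j J K - conv W s m (\<Gamma> i j) J K"
      proof -
        have "restrict_to i j m J = \<Gamma> i j J - dot W m (\<Gamma> i j) J"
          using app_\<Gamma>[of i j] by (metis app_def fun_diff_def)
        then show ?thesis
          using W.dot_eq_conv[OF m(1,2) family_\<Gamma> s] ij by (simp add: restrict_to_def)
      qed
      ultimately show ?thesis using \<Gamma>_bound[OF less.prems(1) ij(3) dK] by simp
    qed (simp add: gen_family_def)
  qed
  then show ?thesis by (simp add: bounded_family_def)
qed

text \<open>The bounds add up: m on A with the slot contributes at most d|A|, the solution on J - A
  at most d(|J - A| - 1).\<close>

lemma solve_bounded:
  assumes y: "family W c e y" "bounded_family y"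
  shows "bounded_family (solve W m y)"
proof -
  have "solve W m y J K = 0" if "finite J" "c * (int (card J) - 1) < int K" for J K
    using that
  proof (induction "card J" arbitrary: J K rule: less_induct)
    case less
    note J = less.prems(1)
    have "op_comp W (fresh J) (m (insert (fresh J) A)) (solve W m y (J - A)) K = 0" if A: "A \<in> Pow J - {{}}" for A
    proof -
      have fin: "finite A" "fresh J \<notin> A" "finite (J - A)" using A fresh[OF J] J finite_subset by auto
      have lt: "card (J - A) < card J" using A J by (intro psubset_card_mono) auto
      have cJ: "card J = card A + card (J - A)"
        using J A fin by (metis DiffD1 PowD card_Diff_subset card_mono le_add_diff_inverse)
      have "op_comp P (fresh J) (m (insert (fresh J) A) l) (solve W m y (J - A) (K - l)) = 0" if l: "l \<le> K" for l
      proof (cases "c * int (card A) < int l")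
        case True
        then have "m (insert (fresh J) A) l = 0"
          using gen_family_bounded fin unfolding bounded_family_def by simp
        then show ?thesis
          using comp_zero_left[OF family_coeff[OF W.family_solve[OF m(1) y(1)] fin(3)]] by simp
      next
        case False
        have "c * (int (card (J - A)) - 1) < int (K - l)"
          using False less.prems(2) cJ l by (simp add: of_nat_diff algebra_simps)
        then have "solve W m y (J - A) (K - l) = 0" using less.hyps[OF lt fin(3)] by simp
        then show ?thesis
          using comp_zero_right[OF family_coeff[OF m(1), of "insert (fresh J) A"]] fin by simp
      qed
      then show ?thesis by (simp add: power_series_comp)
    qed
    moreover have "y J K = 0" using y(2) less.prems by (simp add: bounded_family_def)
    ultimately show ?case
      unfolding solve.simps[of W m y J] using J by (simp add: sum_fun_apply)
  qed
  then show ?thesis by (simp add: bounded_family_def)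
qed

text \<open>Each summand is \<eta>, of exponent at most p, or its product with one \<Gamma>, of
  exponent at most d. The labels i, j, s are distinct because the bound for \<Gamma> concerns two
  different labels.\<close>

lemma lie_coeff_zero:
  assumes \<eta>: "family W c e \<eta>" and zero: "\<And>I K. p < K \<Longrightarrow> \<eta> I K = 0"
    and J: "finite J" and ij: "i \<noteq> j" "s \<noteq> i" "s \<noteq> j" and K: "p + d < K"
  shows "lie s i j \<eta> J K = 0"
proof -
  have 1: "conv_off s (\<Gamma> i' j') Y J K = 0"
    if Y: "family W c e Y" "\<And>I K. p < K \<Longrightarrow> Y I K = 0" and ij': "i' \<noteq> j'" for Y i' j'
  proof (cases "s \<in> J")
    case False
    have "conv W s (\<Gamma> i' j') Y J K = 0"
    proof (rule conv_coeff_zero[OF family_\<Gamma> Y(1) J False])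
      fix A l assume "A \<subseteq> J" "l \<le> K"
      then show "\<Gamma> i' j' (insert s A) l = 0 \<or> Y (J - A) (K - l) = 0"
        using \<Gamma>_bound[of "insert s A" i' j' l] Y(2)[of "K - l"] ij' K J finite_subset[of A J]
        by (cases "d < l") auto
    qed
    then show ?thesis by (simp add: conv_off_def)
  qed (simp add: conv_off_def)
  have "dot W \<eta> (\<Gamma> i j) J K = 0"
  proof (rule dot_coeff_zero[OF \<eta> family_\<Gamma>])
    fix I I' :: "nat set" and l assume "finite I'" "l \<le> K"
    then show "\<eta> I l = 0 \<or> \<Gamma> i j I' (K - l) = 0"
      using \<Gamma>_bound[of I' i j "K - l"] zero[of l] ij K by (cases "p < l") auto
  qed
  moreover have "restrict_to a b \<eta> I K' = 0" if "p < K'" for a b I K'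
    using zero[OF that] by (simp add: restrict_to_def)
  ultimately show ?thesis
    using 1[OF \<eta> zero] 1[OF W.family_restrict_to[OF \<eta>]] ij K by (simp add: lie_def)
qed

lemma lie_add:
  assumes "family W c e \<eta>" "family W c e \<theta>"
  shows "lie s i j (\<eta> + \<theta>) = lie s i j \<eta> + lie s i j \<theta>"
proof -
  have r: "restrict_to a b (\<eta> + \<theta>) = restrict_to a b \<eta> + restrict_to a b \<theta>" for a b
    by (auto simp: restrict_to_def fun_eq_iff)
  have co: "conv_off s (\<Gamma> a b) (X + Y) = conv_off s (\<Gamma> a b) X + conv_off s (\<Gamma> a b) Y"
    if "family W c e X" "family W c e Y" for a b X Y
    using W.conv_add_right[OF family_\<Gamma> that] by (auto simp: conv_off_def fun_eq_iff)
  show ?thesis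
    unfolding lie_def r
    by (simp add: co assms W.family_restrict_to W.dot_add_left[OF assms family_\<Gamma>])
qed

lemma vary_above_coeff_zero:
  assumes D: "derivation P e D" and J: "finite J" and ij: "i \<noteq> j" and K: "p + d < K"
  shows "vary i j (app W m (above p (G D))) J K = 0"
proof -
  note G = family_G[OF D]
  note A = family_above_G[OF D] and B = family_below[OF G(1)]
  \<comment> \<open>The slot must also differ from the marked labels, even if these are not in
    J.\<close>
  define s where "s = fresh (insert i (insert j J))"
  have "s \<notin> insert i (insert j J)" unfolding s_def using J by (intro fresh) auto
  then have s: "s \<notin> J" "s \<noteq> i" "s \<noteq> j" by auto
  have "\<Gamma> i j J K = 0" by (rule \<Gamma>_bound[OF J ij]) (use K in simp)
  then have "vary i j (app W m (G D)) J K = 0"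
    unfolding app_G[OF D] vary_derivation[OF D] using derivation_zero[OF D] by simp
  then have "lie s i j (above p (G D) + below p (G D)) J K = 0"
    using vary_eq_lie[OF G J s(1) ij s(2,3)] by (simp add: above_add_below)
  moreover have "lie s i j (below p (G D)) J K = 0"
    by (rule lie_coeff_zero[OF B(1) _ J ij s(2,3) K]) (simp add: below_def)
  ultimately show ?thesis
    using vary_eq_lie[OF A J s(1) ij s(2,3), of p] by (simp add: lie_add[OF A(1) B(1)])
qed

lemma vary_act:
  assumes D: "derivation P e D" and J: "finite J" and ij: "i \<noteq> j" and K: "d < K"
  shows "vary i j (gen_family (act D p)) J K = 0"
proof -
  note fam = family_gen_family[OF is_gens_act[OF D]]
  have "vary i j (gen_family (act D p)) J K = wshift p (vary i j (gen_family (act D p))) J (K + p)"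
    by (simp add: wshift_def)
  also have "\<dots> = vary i j (app W m (above p (G D))) J (K + p)"
    unfolding vary_wshift[OF fam, symmetric] wshift_act[OF D] ..
  also have "\<dots> = 0"
    by (rule vary_above_coeff_zero[OF D J ij]) (use K in simp)
  finally show ?thesis .
qed

text \<open>G inherits the bound d(|I| - 1) from m, and cutting off everything up to that bound
  leaves nothing. The constant d n is a convenient upper estimate; it serves as the cutoff for all
  sums over p on n labels.\<close>

lemma act_eq_zero:
  assumes D: "derivation P e D" and n: "2 \<le> n" and p: "d * n \<le> p"
  shows "act D p {1..n} k = 0"
proof -
  have "bounded_family (coeffwise D \<circ> m)"
    using gen_family_bounded derivation_zero[OF D] by (simp add: bounded_family_def)
  then have "bounded_family (G D)" unfolding G_def by (rule solve_bounded[OF family_Dm(1)[OF D]])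
  then have "above p (G D) I K = 0" if "I \<subseteq> {1..n}" for I K
  proof -
    have "card I \<le> n" "finite I" using card_mono[OF _ that] finite_subset[OF that] by auto
    then have "c * (int (card I) - 1) \<le> c * int n" by (intro mult_left_mono) auto
    also have "\<dots> \<le> int p" using p by (metis of_nat_le_iff of_nat_mult)
    finally show ?thesis
      using \<open>bounded_family (G D)\<close> \<open>finite I\<close> by (auto simp: above_def bounded_family_def)
  qed
  then have z: "above p (G D) I = 0" if "I \<subseteq> {1..n}" for I using that by (simp add: fun_eq_iff)
  have "dot W m (above p (G D)) {1..n} = 0"
    unfolding dot_def conv_def
  proof (simp, intro sum.neutral ballI)
    fix B assume "B \<in> Pow {Suc 0..n}"
    then have "finite (insert (fresh {Suc 0..n}) B)" using finite_subset by auto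
    then show "op_comp W (fresh {Suc 0..n}) (m (insert (fresh {Suc 0..n}) B)) (above p (G D) ({Suc 0..n} - B)) = 0"
      using z[of "{1..n} - B"] W.comp_zero_right[OF W.familyD[OF m(1)], of _ "fresh {Suc 0..n}"] by simp
  qed
  then show ?thesis using z[of "{1..n}"] by (simp add: act_def app_def)
qed

end

section \<open>The bracket on generators\<close>

lemma above_linear:
  "above N (X + Y) = above N X + above N Y" "above N (X - Y) = above N X - above N Y"
  "above N (koszul a b X) = koszul a b (above N X)"
  by (auto simp: above_def koszul_def fun_eq_iff)

context hc_gens
begin

text \<open>The terms A \<cdot> B cancel on the left, leaving minus the associator of m, A, B, which
  is graded symmetric in A and B.\<close>

lemma app_pre_lie:
  assumes A: "family W c e1 A" "symmetric_family W A" and B: "family W c e2 B" "symmetric_family W B"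
  shows "dot W (app W m A) B - app W m (dot W A B) =
    koszul e1 e2 (dot W (app W m B) A - app W m (dot W B A))"
proof -
  have "dot W (app W m A) B - app W m (dot W A B) = - (dot W (dot W m A) B - dot W m (dot W A B))"
    using W.dot_diff_left[OF A(1) _ B(1), of "dot W m A"] W.family_dot[OF m(1) A(1)] by (simp add: app_def)
  also have "\<dots> = - koszul e1 e2 (dot W (dot W m B) A - dot W m (dot W B A))"
    unfolding W.dot_pre_lie[OF m(1,2) A B] ..
  also have "\<dots> = koszul e1 e2 (- (dot W (dot W m B) A - dot W m (dot W B A)))" by simp
  also have "- (dot W (dot W m B) A - dot W m (dot W B A)) = dot W (app W m B) A - app W m (dot W B A)"
    using W.dot_diff_left[OF B(1) _ A(1), of "dot W m B"] W.family_dot[OF m(1) B(1)] by (simp add: app_def)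
  finally show ?thesis .
qed

text \<open>The Leibniz rule for m \<cdot> B, with D m expressed through G.\<close>

lemma derivation_app:
  assumes D: "derivation P e1 D" and B: "family W c e2 B"
  shows "coeffwise D \<circ> app W m B = app W m (coeffwise D \<circ> B) - dot W (app W m (G D)) B"
proof -
  note DW = derivation_power_series[OF D]
  note mB = W.family_dot[OF m(1) B, simplified]
  have "coeffwise D \<circ> app W m B = (coeffwise D \<circ> B) - (coeffwise D \<circ> dot W m B)"
  proof
    fix I show "(coeffwise D \<circ> app W m B) I = ((coeffwise D \<circ> B) - (coeffwise D \<circ> dot W m B)) I"
    proof (cases "finite I")
      case True
      then show ?thesis
        using W.derivation_diff[OF DW W.familyD[OF B True] W.familyD[OF mB True]] by (simp add: app_def)
    next
      case False
      then show ?thesis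
        using W.family_infinite[OF B False] W.family_infinite[OF mB False] W.derivation_zero[OF DW]
        by (simp add: app_def)
    qed
  qed
  also have "coeffwise D \<circ> dot W m B = dot W (coeffwise D \<circ> m) B + dot W m (coeffwise D \<circ> B)"
    using W.dot_derivation[OF DW m(1) B] by simp
  finally have eq: "coeffwise D \<circ> app W m B = (coeffwise D \<circ> B) -
      (dot W (coeffwise D \<circ> m) B + dot W m (coeffwise D \<circ> B))" .
  show ?thesis unfolding app_G[OF D] eq by (simp only: app_def diff_diff_eq add.commute)
qed

text \<open>The derivative of \<open>act D p\<close>, \<open>D\<close> of degree \<open>e1\<close>, when the generators vary by \<open>y\<close> of degree \<open>e2\<close>.\<close>

definition dG :: "('a \<Rightarrow> 'a) \<Rightarrow> int \<Rightarrow> int \<Rightarrow> (nat set \<Rightarrow> nat \<Rightarrow> 'a) \<Rightarrow> nat set \<Rightarrow> nat \<Rightarrow> 'a" where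
  "dG D e1 e2 y = solve W m ((coeffwise D \<circ> y) + koszul e1 e2 (dot W y (G D)))"

definition dact :: "('a \<Rightarrow> 'a) \<Rightarrow> int \<Rightarrow> int \<Rightarrow> nat \<Rightarrow> (nat set \<Rightarrow> nat \<Rightarrow> 'a) \<Rightarrow> nat set \<Rightarrow> nat \<Rightarrow> 'a" where
  "dact D e1 e2 p y I k =
     (app W m (above p (dG D e1 e2 y)) - koszul e1 e2 (dot W y (above p (G D)))) I (Suc (k + p))"

lemma family_dG_arg:
  assumes D: "derivation P e1 D" and y: "family W c e y"
  shows "family W c (e + e1) ((coeffwise D \<circ> y) + koszul e1 e2 (dot W y (G D)))"
  using W.family_derivation[OF derivation_power_series[OF D] y] W.family_dot[OF y family_G(1)[OF D]]
  by (intro W.family_add W.family_koszul) auto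

lemma family_dG:
  assumes D: "derivation P e1 D" and y: "family W c e y"
  shows "family W c (e + e1) (dG D e1 e2 y)"
  unfolding dG_def by (rule W.family_solve[OF m(1) family_dG_arg[OF D y]])

lemma app_dG:
  assumes D: "derivation P e1 D" and y: "family W c e y"
  shows "app W m (dG D e1 e2 y) = (coeffwise D \<circ> y) + koszul e1 e2 (dot W y (G D))"
  unfolding dG_def by (rule W.app_solve[OF m family_dG_arg[OF D y]])

text \<open>After multiplication by w^q the variation of m is b - m \<cdot> b. The equation for
  \<open>dG\<close> can then be solved in closed form: \<open>derivation_app\<close> and
  \<open>app_pre_lie\<close> turn its right-hand side into an image under
  \<open>app\<close>.\<close>

lemma wshift_dG_act:
  fixes q :: nat
  assumes D1: "derivation P e1 D1" and D2: "derivation P e2 D2"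
  defines "A \<equiv> G D1" and "b \<equiv> above q (G D2)"
  shows "wshift q (dG D1 e1 e2 (gen_family (act D2 q))) =
    (coeffwise D1 \<circ> b) - dot W A b + koszul e1 e2 (dot W b A)"
proof -
  let ?y = "gen_family (act D2 q)"
  note DW = derivation_power_series[OF D1]
  note A = family_G[OF D1, folded A_def] and b = family_above_G[OF D2, of q, folded b_def]
  note y = family_gen_family[OF is_gens_act[OF D2, of q]]
  have wy: "wshift q ?y = app W m b" unfolding b_def by (rule wshift_act[OF D2])
  note f1 = W.family_derivation[OF DW b(1)]
  note f2 = W.family_dot[OF A(1) b(1), unfolded add.commute[of e1]]
  note f3 = W.family_koszul[OF W.family_dot[OF b(1) A(1)], of e1 e2]
  have deg: "e2 - 2 * int q + e1 + 2 * int q = e2 + e1" by simp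
  show ?thesis
  proof (rule W.app_inject[OF m family_wshift[OF family_dG[OF D1 y], where p = q, unfolded deg]])
    show "family W c (e2 + e1) ((coeffwise D1 \<circ> b) - dot W A b + koszul e1 e2 (dot W b A))"
      by (intro W.family_add W.family_diff f1 f2 f3)
    have "app W m (wshift q (dG D1 e1 e2 ?y)) =
        wshift q ((coeffwise D1 \<circ> ?y) + koszul e1 e2 (dot W ?y A))"
      unfolding app_wshift[OF family_dG[OF D1 y]] app_dG[OF D1 y] A_def ..
    also have "\<dots> = (coeffwise D1 \<circ> wshift q ?y) + koszul e1 e2 (dot W (wshift q ?y) A)"
    proof -
      have "wshift q (coeffwise D1 \<circ> ?y) = coeffwise D1 \<circ> wshift q ?y"
        using derivation_zero[OF D1] by (auto simp: wshift_def fun_eq_iff)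
      then show ?thesis by (simp add: wshift_add wshift_koszul dot_wshift(2)[OF y A(1)])
    qed
    also have "\<dots> = app W m (coeffwise D1 \<circ> b) - dot W (app W m A) b + koszul e1 e2 (dot W (app W m b) A)"
      unfolding wy derivation_app[OF D1 b(1)] A_def ..
    also have "\<dots> = app W m (coeffwise D1 \<circ> b) - app W m (dot W A b) + koszul e1 e2 (app W m (dot W b A))"
      using app_pre_lie[OF A b] by (simp add: algebra_simps)
    also have "\<dots> = app W m ((coeffwise D1 \<circ> b) - dot W A b + koszul e1 e2 (dot W b A))"
      unfolding W.app_add[OF m(1) W.family_diff[OF f1 f2] f3] W.app_diff[OF m(1) f1 f2]
        W.app_koszul[OF m(1) W.family_dot[OF b(1) A(1)]] ..
    finally show "app W m (wshift q (dG D1 e1 e2 ?y)) =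
        app W m ((coeffwise D1 \<circ> b) - dot W A b + koszul e1 e2 (dot W b A))" .
  qed
qed

lemma dact_act:
  fixes q :: nat
  assumes D1: "derivation P e1 D1" and D2: "derivation P e2 D2"
  defines "A \<equiv> G D1" and "b \<equiv> above q (G D2)"
  shows "dact D1 e1 e2 p (gen_family (act D2 q)) I k =
    (app W m (above (p + q) ((coeffwise D1 \<circ> b) - dot W A b + koszul e1 e2 (dot W b A))) -
      koszul e1 e2 (dot W (app W m b) (above p A))) I (Suc (k + (p + q)))"
proof -
  let ?y = "gen_family (act D2 q)"
  let ?K = "dG D1 e1 e2 ?y"
  note y = family_gen_family[OF is_gens_act[OF D2, of q]]
  note fK = family_dG[OF D1 y]
  have "dact D1 e1 e2 p ?y I k =
      wshift q (app W m (above p ?K) - koszul e1 e2 (dot W ?y (above p A))) I (Suc (k + (p + q)))"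
    by (simp add: dact_def wshift_def A_def)
  also have "wshift q (app W m (above p ?K) - koszul e1 e2 (dot W ?y (above p A))) =
      app W m (wshift q (above p ?K)) - koszul e1 e2 (dot W (wshift q ?y) (above p A))"
    unfolding A_def wshift_diff wshift_koszul dot_wshift(2)[OF y family_above_G(1)[OF D1]]
      app_wshift[OF family_above[OF fK]] ..
  also have "wshift q (above p ?K) = above (p + q) (wshift q ?K)"
    by (auto simp: wshift_def above_def fun_eq_iff)
  also have "wshift q ?y = app W m b" unfolding b_def by (rule wshift_act[OF D2])
  also have "wshift q ?K = (coeffwise D1 \<circ> b) - dot W A b + koszul e1 e2 (dot W b A)"
    unfolding A_def b_def by (rule wshift_dG_act[OF D1 D2])
  finally show ?thesis .
qed

text \<open>The computation for the variation, now with the full series and antisymmetrized: under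
  \<open>app\<close> the pre-Lie identity absorbs the products, and what remains is the graded
  commutator of D1 and D2 applied to m.\<close>

lemma G_bracket:
  assumes D1: "derivation P e1 D1" and D2: "derivation P e2 D2"
    and D: "derivation P (e1 + e2) D" and bracket: "\<And>I j x. x \<in> op_space P I j \<Longrightarrow> D x = D1 (D2 x) - koszul e1 e2 (D2 (D1 x))"
  defines "A \<equiv> G D1" and "B \<equiv> G D2"
  shows "G D = (coeffwise D1 \<circ> B) - koszul e1 e2 (coeffwise D2 \<circ> A) - dot W A B + koszul e1 e2 (dot W B A)"
    (is "_ = ?C")
proof -
  note A = family_G[OF D1, folded A_def] and B = family_G[OF D2, folded B_def]
  note f1 = W.family_derivation[OF derivation_power_series[OF D1] B(1), unfolded add.commute[of e2]]
  note f2 = W.family_derivation[OF derivation_power_series[OF D2] A(1)]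
  note f3 = W.family_dot[OF A(1) B(1)]
  note f4 = W.family_dot[OF B(1) A(1), unfolded add.commute[of e2]]
  note k2 = W.family_koszul[OF f2, of e1 e2] and k4 = W.family_koszul[OF f4, of e1 e2]
  have C: "family W c (e1 + e2) ?C" by (intro W.family_add W.family_diff f1 k2 f3 k4)
  have "app W m ?C = app W m (coeffwise D1 \<circ> B) - koszul e1 e2 (app W m (coeffwise D2 \<circ> A)) -
      app W m (dot W A B) + koszul e1 e2 (app W m (dot W B A))"
    unfolding W.app_add[OF m(1) W.family_diff[OF W.family_diff[OF f1 k2] f3] k4]
      W.app_diff[OF m(1) W.family_diff[OF f1 k2] f3] W.app_diff[OF m(1) f1 k2]
      W.app_koszul[OF m(1) f2] W.app_koszul[OF m(1) f4] ..
  also have "\<dots> = (app W m (coeffwise D1 \<circ> B) - dot W (app W m A) B) -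
      koszul e1 e2 (app W m (coeffwise D2 \<circ> A) - dot W (app W m B) A)"
    using app_pre_lie[OF A B] by (simp add: algebra_simps)
  also have "\<dots> = (coeffwise D1 \<circ> app W m B) - koszul e1 e2 (coeffwise D2 \<circ> app W m A)"
    by (simp only: derivation_app[OF D1 B(1), folded A_def] derivation_app[OF D2 A(1), folded B_def])
  also have "\<dots> = (coeffwise D1 \<circ> (coeffwise D2 \<circ> m)) - koszul e1 e2 (coeffwise D2 \<circ> (coeffwise D1 \<circ> m))"
    unfolding A_def B_def app_G[OF D1] app_G[OF D2] ..
  also have "\<dots> = coeffwise D \<circ> m"
  proof (intro ext)
    fix I k
    show "((coeffwise D1 \<circ> (coeffwise D2 \<circ> m)) - koszul e1 e2 (coeffwise D2 \<circ> (coeffwise D1 \<circ> m))) I k =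
        (coeffwise D \<circ> m) I k"
    proof (cases "finite I")
      case True
      then show ?thesis using bracket[OF family_coeff[OF m(1) True]] by (simp add: koszul_fun)
    next
      case False
      then have "m I = 0" by (simp add: gen_family_def fun_eq_iff)
      then show ?thesis
        using derivation_zero[OF D] derivation_zero[OF D1] derivation_zero[OF D2] by (simp add: koszul_fun)
    qed
  qed
  finally show ?thesis
    unfolding G_def[of D] by (rule W.solve_eqI[OF m family_Dm(1)[OF D] C])
qed

lemma above_dot:
  assumes A: "family W c e1 A" and B: "family W c e2 B"
  shows "above (p + q) (dot W (above p A) (above q B)) = dot W (above p A) (above q B)"
    and "above (p + q) (dot W (below p A) (below q B)) = 0"
proof -
  show "above (p + q) (dot W (above p A) (above q B)) = dot W (above p A) (above q B)"
  proof (intro ext)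
    fix I k
    have "dot W (above p A) (above q B) I k = 0" if "k \<le> p + q"
      by (rule dot_coeff_zero[OF family_above[OF A] family_above[OF B]]) (use that in \<open>auto simp: above_def\<close>)
    then show "above (p + q) (dot W (above p A) (above q B)) I k = dot W (above p A) (above q B) I k"
      by (auto simp: above_def[of "p + q"])
  qed
  show "above (p + q) (dot W (below p A) (below q B)) = 0"
  proof (intro ext)
    fix I k
    have "dot W (below p A) (below q B) I k = 0" if "p + q < k"
      by (rule dot_coeff_zero[OF family_below[OF A] family_below[OF B]]) (use that in \<open>auto simp: below_def\<close>)
    then show "above (p + q) (dot W (below p A) (below q B)) I k = 0 I k"
      by (auto simp: above_def)
  qed
qed

lemma coeffwise_add:
  assumes D: "derivation P e' D" and X: "family W c e X" and Y: "family W c e Y"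
  shows "coeffwise D \<circ> (X + Y) = (coeffwise D \<circ> X) + (coeffwise D \<circ> Y)"
proof
  fix I show "(coeffwise D \<circ> (X + Y)) I = ((coeffwise D \<circ> X) + (coeffwise D \<circ> Y)) I"
  proof (cases "finite I")
    case True
    then show ?thesis
      using W.derivationD(2)[OF derivation_power_series[OF D] W.familyD[OF X True] W.familyD[OF Y True]]
      by simp
  next
    case False
    then show ?thesis
      using W.family_infinite[OF X False] W.family_infinite[OF Y False] derivation_zero[OF D]
      by (simp add: fun_eq_iff)
  qed
qed

lemma dact_add:
  assumes D: "derivation P e1 D" and y: "family W c e y" "family W c e y'"
  shows "dact D e1 e2 p (y + y') I k = dact D e1 e2 p y I k + dact D e1 e2 p y' I k"
proof -
  note G = family_G(1)[OF D] and aG = family_above_G(1)[OF D, of p]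
  note f = family_dG[OF D y(1), of e2] family_dG[OF D y(2), of e2]
  have "dG D e1 e2 (y + y') = dG D e1 e2 y + dG D e1 e2 y'"
    unfolding dG_def[of D e1 e2 "y + y'"]
  proof (rule W.solve_eqI[OF m family_dG_arg[OF D W.family_add[OF y]] W.family_add[OF f]])
    show "app W m (dG D e1 e2 y + dG D e1 e2 y') =
        (coeffwise D \<circ> (y + y')) + koszul e1 e2 (dot W (y + y') (G D))"
      unfolding W.app_add[OF m(1) f] app_dG[OF D y(1)] app_dG[OF D y(2)] coeffwise_add[OF D y]
        W.dot_add_left[OF y G] by (simp add: algebra_simps)
  qed
  then show ?thesis
    unfolding dact_def
    by (simp add: above_linear W.app_add[OF m(1) family_above[OF f(1)] family_above[OF f(2)]]
        W.dot_add_left[OF y aG])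
qed

lemma dact_sum:
  assumes D: "derivation P e1 D" and y: "\<And>i. i \<in> A \<Longrightarrow> family W c e (y i)"
  shows "dact D e1 e2 p (\<Sum>i\<in>A. y i) I k = (\<Sum>i\<in>A. dact D e1 e2 p (y i) I k)"
proof -
  have fz: "family W c e 0" by (simp add: family_def W.space_zero)
  have zero: "dact D e1 e2 p 0 I k = 0" using dact_add[OF D fz fz, of e2 p I k] by simp
  have "family W c e (\<Sum>i\<in>A. y i) \<and> dact D e1 e2 p (\<Sum>i\<in>A. y i) I k = (\<Sum>i\<in>A. dact D e1 e2 p (y i) I k)"
    using y
  proof (induction A rule: infinite_finite_induct)
    case (insert a A)
    then have f: "family W c e (y a)" "family W c e (\<Sum>i\<in>A. y i)"
      and IH: "dact D e1 e2 p (\<Sum>i\<in>A. y i) I k = (\<Sum>i\<in>A. dact D e1 e2 p (y i) I k)" by simp_all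
    show ?case
      by (simp only: sum.insert[OF insert(1,2)] W.family_add[OF f] dact_add[OF D f] IH simp_thms)
  qed (simp_all only: sum.infinite sum.empty fz zero not_False_eq_True simp_thms)
  then show ?thesis ..
qed

text \<open>Split the two series as A = a + a' at p and B = b + b' at q. The derivatives of G give
  each of a \<cdot> b and b \<cdot> a twice, and the terms outside the truncation give them once
  with the opposite sign; the mixed products occur once. This is the formula for the bracket except
  for D1 b', D2 a', a' \<cdot> b' and b' \<cdot> a', which have degree at most p + q in w and are
  removed by the truncation.\<close>

lemma act_bracket:
  assumes D1: "derivation P e1 D1" and D2: "derivation P e2 D2"
    and D: "derivation P (e1 + e2) D" and bracket: "\<And>I j x. x \<in> op_space P I j \<Longrightarrow> D x = D1 (D2 x) - koszul e1 e2 (D2 (D1 x))"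
  shows "dact D1 e1 e2 p (gen_family (act D2 q)) I k -
      koszul e1 e2 (dact D2 e2 e1 q (gen_family (act D1 p)) I k) = act D (p + q) I k"
proof -
  define s where "s = (koszul e1 e2 :: (nat set \<Rightarrow> nat \<Rightarrow> 'a) \<Rightarrow> _)"
  define A B where "A = G D1" and "B = G D2"
  define a a' b b' where "a = above p A" and "a' = below p A" and "b = above q B" and "b' = below q B"
  have s: "s (X + Y) = s X + s Y" "s (X - Y) = s X - s Y" "s (s X) = X" "s (- X) = - s X" for X Y
    by (simp_all add: s_def)
  have ks: "koszul e2 e1 = s" unfolding s_def using koszul_commute by blast
  have AA: "A = a + a'" "B = b + b'" by (simp_all add: a_def a'_def b_def b'_def above_add_below)
  note fA = family_G[OF D1, folded A_def] and fB = family_G[OF D2, folded B_def]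
  note fa = family_above[OF fA(1), of p, folded a_def] symmetric_family_above[OF fA(2), of p, folded a_def]
    and fb = family_above[OF fB(1), of q, folded b_def] symmetric_family_above[OF fB(2), of q, folded b_def]
    and fa' = family_below[OF fA(1), of p, folded a'_def] and fb' = family_below[OF fB(1), of q, folded b'_def]
  let ?N = "p + q"
  let ?K1 = "(coeffwise D1 \<circ> b) - dot W A b + s (dot W b A)"
  let ?K2 = "(coeffwise D2 \<circ> a) - dot W B a + s (dot W a B)"
  have comm: "?N = q + p" by simp
  have "dact D1 e1 e2 p (gen_family (act D2 q)) I k =
      (app W m (above ?N ?K1) - s (dot W (app W m b) a)) I (Suc (k + ?N))"
    unfolding dact_act[OF D1 D2] A_def B_def a_def b_def s_def ..
  moreover have "dact D2 e2 e1 q (gen_family (act D1 p)) I k =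
      (app W m (above ?N ?K2) - s (dot W (app W m a) b)) I (Suc (k + ?N))"
    unfolding dact_act[OF D2 D1] A_def B_def a_def b_def ks comm ..
  ultimately have "dact D1 e1 e2 p (gen_family (act D2 q)) I k -
      koszul e1 e2 (dact D2 e2 e1 q (gen_family (act D1 p)) I k) =
    ((app W m (above ?N ?K1) - s (dot W (app W m b) a)) -
      s (app W m (above ?N ?K2) - s (dot W (app W m a) b))) I (Suc (k + ?N))"
    by (simp add: s_def koszul_fun)
  also have "(app W m (above ?N ?K1) - s (dot W (app W m b) a)) -
      s (app W m (above ?N ?K2) - s (dot W (app W m a) b)) =
    app W m (above ?N ?K1) - s (app W m (above ?N ?K2)) + (app W m (dot W a b) - s (app W m (dot W b a)))"
    using app_pre_lie[OF fa fb, folded s_def] unfolding s by (simp add: algebra_simps)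
  also have "\<dots> = app W m (above ?N ?K1 - s (above ?N ?K2) + (dot W a b - s (dot W b a)))"
  proof -
    note c = add.commute[of e2 e1]
    note d1 = W.family_derivation[OF derivation_power_series[OF D1] fb(1), unfolded c]
    note d2 = W.family_derivation[OF derivation_power_series[OF D2] fa(1)]
    note ab = W.family_dot[OF fa(1) fb(1)] and ba = W.family_dot[OF fb(1) fa(1), unfolded c]
    note Ab = W.family_dot[OF fA(1) fb(1)] and bA = W.family_dot[OF fb(1) fA(1), unfolded c]
    note Ba = W.family_dot[OF fB(1) fa(1), unfolded c] and aB = W.family_dot[OF fa(1) fB(1)]
    have sf: "family W c e (s X)" if "family W c e X" for e X
      unfolding s_def by (rule W.family_koszul[OF that])
    have as: "app W m (s X) = s (app W m X)" if "family W c e X" for e X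
      unfolding s_def by (rule W.app_koszul[OF m(1) that])
    have K1: "family W c (e1 + e2) (above ?N ?K1)"
      by (intro family_above W.family_add W.family_diff sf d1 Ab bA)
    have K2: "family W c (e1 + e2) (above ?N ?K2)"
      by (intro family_above W.family_add W.family_diff sf d2 Ba aB)
    show ?thesis
      unfolding W.app_add[OF m(1) W.family_diff[OF K1 sf[OF K2]] W.family_diff[OF ab sf[OF ba]]]
        W.app_diff[OF m(1) K1 sf[OF K2]] W.app_diff[OF m(1) ab sf[OF ba]] as[OF K2] as[OF ba] ..
  qed
  also have "above ?N ?K1 - s (above ?N ?K2) + (dot W a b - s (dot W b a)) = above ?N (G D)"
  proof -
    have above_s: "above ?N (s X) = s (above ?N X)" for X by (simp add: s_def above_linear)
    have dots: "dot W A b = dot W a b + dot W a' b" "dot W b A = dot W b a + dot W b a'"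
      "dot W B a = dot W b a + dot W b' a" "dot W a B = dot W a b + dot W a b'"
      "dot W A B = dot W a b + dot W a b' + (dot W a' b + dot W a' b')"
      "dot W B A = dot W b a + dot W b a' + (dot W b' a + dot W b' a')"
      unfolding AA
      using W.dot_add_left[OF fa(1) fa' fb(1)] W.dot_add_right[OF fb(1) fa(1) fa'] W.dot_add_left[OF fb(1) fb' fa(1)]
        W.dot_add_right[OF fa(1) fb(1) fb'] W.dot_add_left[OF fa(1) fa' W.family_add[OF fb(1) fb']]
        W.dot_add_right[OF fa' fb(1) fb'] W.dot_add_left[OF fb(1) fb' W.family_add[OF fa(1) fa']]
        W.dot_add_right[OF fb' fa(1) fa'] by simp_all
    have below_D: "above ?N (coeffwise D1 \<circ> b') = 0" "above ?N (coeffwise D2 \<circ> a') = 0"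
      using derivation_zero[OF D1] derivation_zero[OF D2]
      by (auto simp: above_def below_def b'_def a'_def fun_eq_iff)
    \<comment> \<open>The products a \<cdot> b and b \<cdot> a have no coefficients up to p + q, so
      the terms outside the truncation may be moved inside it.\<close>
    have z: "above ?N (dot W a' b') = 0" "above ?N (dot W b' a') = 0"
      "above ?N (dot W a b) = dot W a b" "above ?N (dot W b a) = dot W b a"
      using above_dot[OF fA(1) fB(1), of p q] above_dot[OF fB(1) fA(1), of q p]
      by (simp_all add: a_def a'_def b_def b'_def add.commute)
    have "G D = (coeffwise D1 \<circ> B) - s (coeffwise D2 \<circ> A) - dot W A B + s (dot W B A)"
      unfolding A_def B_def s_def by (rule G_bracket[OF D1 D2 D bracket])
    also have "\<dots> = (coeffwise D1 \<circ> b) + (coeffwise D1 \<circ> b') - s ((coeffwise D2 \<circ> a) + (coeffwise D2 \<circ> a')) -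
        dot W A B + s (dot W B A)"
      unfolding AA(1)[THEN arg_cong[where f = "\<lambda>X. coeffwise D2 \<circ> X"]] AA(2)[THEN arg_cong[where f = "\<lambda>X. coeffwise D1 \<circ> X"]]
        coeffwise_add[OF D1 fb(1) fb'] coeffwise_add[OF D2 fa(1) fa'] ..
    finally show ?thesis
      unfolding dots by (simp add: above_linear above_s s below_D z)
  qed
  finally show ?thesis unfolding act_def .
qed

end

section \<open>Families over dual numbers\<close>

context base_change_step
begin

definition low_family :: "(nat set \<Rightarrow> nat \<Rightarrow> nat set \<Rightarrow> 'a) \<Rightarrow> nat set \<Rightarrow> nat \<Rightarrow> nat set \<Rightarrow> 'a" where
  "low_family X = (\<lambda>I k. low r (X I k))"

definition high_family :: "(nat set \<Rightarrow> nat \<Rightarrow> nat set \<Rightarrow> 'a) \<Rightarrow> nat set \<Rightarrow> nat \<Rightarrow> nat set \<Rightarrow> 'a" where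
  "high_family X = (\<lambda>I k. high r (X I k))"

abbreviation "V \<equiv> power_series Q"
abbreviation "V' \<equiv> power_series Q'"

lemma low_high_family_simps:
  "low_family (X - Y) = low_family X - low_family Y" "high_family (X - Y) = high_family X - high_family Y"
  "low_family (restrict_to i j X) = restrict_to i j (low_family X)"
  "high_family (restrict_to i j X) = restrict_to i j (high_family X)"
  "low_family (above p X) = above p (low_family X)" "high_family (above p X) = above p (high_family X)"
  by (auto simp: low_family_def high_family_def restrict_to_def above_def fun_eq_iff low_def high_def)

sublocale Q': operad Q' by (rule operad_step)

sublocale V: operad V by (rule Q.operad_power_series)

sublocale V': operad V' by (rule Q'.operad_power_series)

lemma family_low:
  assumes X: "family V' b e X"
  shows "family V b e (low_family X)"
  using low_space[OF Q'.family_coeff[OF X]] V'.family_infinite[OF X]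
  by (simp add: family_def power_series_space low_family_def fun_eq_iff low_def)

lemma family_high:
  assumes X: "family V' b e X"
  shows "family V b (e - c) (high_family X)"
proof -
  have "high_family X I k \<in> op_space Q I (2 * b * (int (card I) - 1) + (e - c) - 2 * int k)" if "finite I" for I k
    unfolding high_family_def by (rule space_cast[OF high_space[OF Q'.family_coeff[OF X that]]]) auto
  then show ?thesis
    using V'.family_infinite[OF X] by (simp add: family_def power_series_space high_family_def fun_eq_iff high_def)
qed

lemma low_conv: "low_family (conv V' s X Y) J = conv V s (low_family X) (low_family Y) J"
proof (cases "finite J")
  case True
  then show ?thesis
    by (simp add: low_family_def Q.conv_coeff Q'.conv_coeff low_high_sum low_comp fun_eq_iff)
qed (simp add: low_family_def conv_def fun_eq_iff)

lemma high_conv: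
  assumes X: "family V' b e1 X" and Y: "family V' b e2 Y" and s: "s \<notin> J"
  shows "high_family (conv V' s X Y) J =
    conv V s (low_family X) (high_family Y) J + koszul c e2 (conv V s (high_family X) (low_family Y) J)"
proof (cases "finite J")
  case True
  show ?thesis
  proof
    fix K
    have "high r (op_comp Q' s (X (insert s A) l) (Y (J - A) (K - l))) =
        op_comp Q s (low r (X (insert s A) l)) (high r (Y (J - A) (K - l))) +
        koszul c e2 (op_comp Q s (high r (X (insert s A) l)) (low r (Y (J - A) (K - l))))"
      if "A \<in> Pow J" for A l
    proof -
      have fin: "finite (insert s A)" "finite (J - A)" "(insert s A - {s}) \<inter> (J - A) = {}"
        using that True finite_subset by auto
      have "koszul c (2 * b * (int (card (J - A)) - 1) + e2 - 2 * int (K - l)) x = koszul c e2 x" for x :: "nat set \<Rightarrow> 'a"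
        by (simp add: koszul_def)
      then show ?thesis
        using high_comp[OF Q'.family_coeff[OF X fin(1)] Q'.family_coeff[OF Y fin(2)] _ fin(3)]
        unfolding Q.scale_koszul by simp
    qed
    then show "high_family (conv V' s X Y) J K = (conv V s (low_family X) (high_family Y) J +
        koszul c e2 (conv V s (high_family X) (low_family Y) J)) K"
      using True
      by (simp add: high_family_def low_family_def Q.conv_coeff Q'.conv_coeff low_high_sum sum.distrib
          koszul_sum koszul_fun[of c e2 "conv V s _ _ _"] cong: sum.cong_simp)
  qed
qed (simp add: high_family_def conv_def fun_eq_iff koszul_fun)

lemma low_dot: "low_family (dot V' X Y) = dot V (low_family X) (low_family Y)"
proof
  fix J show "low_family (dot V' X Y) J = dot V (low_family X) (low_family Y) J"
    using low_conv[of "fresh J" X Y J] by (simp add: dot_def low_family_def)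
qed

lemma high_dot:
  assumes X: "family V' b e1 X" and Y: "family V' b e2 Y"
  shows "high_family (dot V' X Y) =
    dot V (low_family X) (high_family Y) + koszul c e2 (dot V (high_family X) (low_family Y))"
proof
  fix J
  show "high_family (dot V' X Y) J =
    (dot V (low_family X) (high_family Y) + koszul c e2 (dot V (high_family X) (low_family Y))) J"
  proof (cases "finite J")
    case True
    then show ?thesis using high_conv[OF X Y fresh[OF True]] by (simp add: dot_def high_family_def koszul_fun)
  qed (simp add: dot_def conv_def high_family_def fun_eq_iff koszul_fun)
qed

lemma extend_map_low_high:
  assumes D: "derivation P e D"
  shows "low r (extend_map D X) = extend_map D (low r X)" "high r (extend_map D X) = extend_map D (high r X)"
  using P.derivation_zero[OF D] by (auto simp: low_def high_def extend_map_def fun_eq_iff)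

end

text \<open>A first-order deformation \<open>g + y \<epsilon>\<close> of generators.\<close>

locale deformation = base_change_step P \<delta> "- e" + N: hc_gens "base_change P \<delta>" d g
  for P :: "('k::field_char_0, 'a::ab_group_add) operad_str" and \<delta> e d g +
  fixes y :: "nat set \<Rightarrow> nat \<Rightarrow> nat set \<Rightarrow> 'a" and g' :: "nat set \<Rightarrow> nat \<Rightarrow> nat set \<Rightarrow> 'a"
  assumes gens': "is_gens Q' d 0 g'"
    and low_g': "finite I \<Longrightarrow> 2 \<le> card I \<Longrightarrow> low r (g' I k) = g I k"
    and high_g': "finite I \<Longrightarrow> 2 \<le> card I \<Longrightarrow> high r (g' I k) = y I k"
begin

sublocale N': hc_gens Q' d g'
  by unfold_locales (rule gens')

lemma low_m': "low_family N'.m = N.m"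
  using low_g' by (auto simp: low_family_def gen_family_def fun_eq_iff low_def)

lemma high_m': "high_family N'.m = gen_family y"
  using high_g' by (auto simp: high_family_def gen_family_def fun_eq_iff high_def)

lemma family_y: "family V (int d) e (gen_family y)"
  using family_high[OF N'.m(1)] by (simp add: high_m')

lemma low_app: "low_family (app V' N'.m X) = app V N.m (low_family X)"
  by (simp add: app_def low_high_family_simps low_dot low_m')

lemma high_app:
  assumes "family V' (int d) e1 X"
  shows "high_family (app V' N'.m X) = app V N.m (high_family X) - koszul e e1 (dot V (gen_family y) (low_family X))"
proof -
  have "koszul (- e) e1 Z = koszul e e1 Z" for Z :: "nat set \<Rightarrow> nat \<Rightarrow> nat set \<Rightarrow> 'a"
    by (simp add: koszul_def)
  then show ?thesis
    using high_dot[OF N'.m(1) assms] by (simp add: app_def low_high_family_simps low_m' high_m' algebra_simps)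
qed

lemma low_\<Gamma>: "low_family (N'.\<Gamma> i j) = N.\<Gamma> i j"
  unfolding N.\<Gamma>_def
proof (rule V.solve_eqI[OF N.m V.family_restrict_to[OF N.m(1)], symmetric])
  show "family V (int d) 0 (low_family (N'.\<Gamma> i j))" by (rule family_low[OF N'.family_\<Gamma>])
  show "app V N.m (low_family (N'.\<Gamma> i j)) = restrict_to i j N.m"
    unfolding low_app[symmetric] N'.app_\<Gamma> by (simp add: low_high_family_simps low_m')
qed

text \<open>The \<epsilon>-component of the equation for \<Gamma> over the dual numbers is the
  equation that defines \<open>vary\<close>; this is the sense in which \<open>vary\<close> is a
  variation.\<close>

lemma high_\<Gamma>: "high_family (N'.\<Gamma> i j) = N.vary i j (gen_family y)"
  unfolding N.vary_def
proof (rule V.solve_eqI[OF N.m N.family_vary_arg[OF family_y], symmetric])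
  show "family V (int d) e (high_family (N'.\<Gamma> i j))" using family_high[OF N'.family_\<Gamma>] by simp
  have "app V N.m (high_family (N'.\<Gamma> i j)) - dot V (gen_family y) (N.\<Gamma> i j) = restrict_to i j (gen_family y)"
    using high_app[OF N'.family_\<Gamma>[of i j]] unfolding N'.app_\<Gamma>
    by (simp add: low_high_family_simps high_m' low_\<Gamma>)
  then show "app V N.m (high_family (N'.\<Gamma> i j)) = restrict_to i j (gen_family y) + dot V (gen_family y) (N.\<Gamma> i j)"
    by (simp add: algebra_simps)
qed

lemma satisfies_relations':
  assumes "satisfies_relations Q d g"
    and vary: "\<And>n i j K. i \<noteq> j \<Longrightarrow> d < K \<Longrightarrow> N.vary i j (gen_family y) {1..n} K = 0"
  shows "satisfies_relations Q' d g'"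
  unfolding N'.satisfies_relations_iff
proof (intro allI impI)
  fix n i j K assume *: "2 \<le> (n::nat)" "i \<in> {1..n}" "j \<in> {1..n}" "i \<noteq> j" "d < K"
  let ?X = "N'.\<Gamma> i j {1..n} K"
  have sp: "?X \<in> op_space Q' {1..n} (2 * int d * (int n - 1) - 2 * int K)"
    using Q'.family_coeff[OF N'.family_\<Gamma>, of "{1..n}" i j K] by simp
  have "low r ?X = 0"
    using low_\<Gamma>[of i j] assms(1) * unfolding N.satisfies_relations_iff low_family_def fun_eq_iff by metis
  moreover have "high r ?X = 0"
    using high_\<Gamma>[of i j] vary[OF *(4,5), of n] unfolding high_family_def fun_eq_iff by metis
  ultimately show "?X = 0"
    by (intro eqI[OF sp Q'.space_zero[of "{1..n}" 0]]) auto
qed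

lemma low_G:
  assumes D: "derivation P e1 D"
  shows "low_family (N'.G (extend_map D)) = N.G (extend_map D)"
proof -
  let ?D = "extend_map D"
  note DQ = P.derivation_extend_map[OF D, where \<delta> = \<delta>] and DQ' = P.derivation_extend_map[OF D, where \<delta> = "\<delta> @ [- e]"]
  have "low_family (N'.coeffwise ?D \<circ> N'.m) = N.coeffwise ?D \<circ> low_family N'.m"
    by (simp add: low_family_def extend_map_low_high[OF D] fun_eq_iff)
  then show ?thesis
    unfolding N.G_def
    by (intro V.solve_eqI[OF N.m N.family_Dm(1)[OF DQ] family_low[OF N'.family_G(1)[OF DQ']], symmetric])
      (simp add: low_app[symmetric] N'.app_G[OF DQ'] low_m')
qed

lemma low_act:
  assumes D: "derivation P e1 D"
  shows "low r (N'.act (extend_map D) p I k) = N.act (extend_map D) p I k"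
proof -
  have "low r (N'.act (extend_map D) p I k) =
      low_family (app V' N'.m (above p (N'.G (extend_map D)))) I (Suc (k + p))"
    by (simp add: N'.act_def low_family_def)
  then show ?thesis unfolding low_app N.act_def by (simp add: low_high_family_simps low_G[OF D])
qed

text \<open>The \<epsilon>-component of the equation for G is the one that defines
  \<open>dG\<close>. Truncation commutes with taking components, and the remaining summand of
  \<open>dact\<close> comes from the variation of m in \<open>app\<close>.\<close>

lemma high_act:
  assumes D: "derivation P e1 D"
  shows "high r (N'.act (extend_map D) p I k) = N.dact (extend_map D) e1 e p (gen_family y) I k"
proof -
  let ?D = "extend_map D"
  note DQ = P.derivation_extend_map[OF D, where \<delta> = \<delta>] and DQ' = P.derivation_extend_map[OF D, where \<delta> = "\<delta> @ [- e]"]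
  note lh = extend_map_low_high[OF D]
  have koz: "koszul e e1 Z = koszul e1 e Z" for Z :: "nat set \<Rightarrow> nat \<Rightarrow> nat set \<Rightarrow> 'a"
    by (rule koszul_commute)
  note lowG = low_G[OF D]
  have highG: "high_family (N'.G ?D) = N.dG ?D e1 e (gen_family y)"
    unfolding N.dG_def
  proof (rule V.solve_eqI[OF N.m N.family_dG_arg[OF DQ family_y], symmetric])
    show "family V (int d) (e + e1) (high_family (N'.G ?D))"
      using family_high[OF N'.family_G(1)[OF DQ']] by (simp add: add.commute)
    have "high_family (N'.coeffwise ?D \<circ> N'.m) = N.coeffwise ?D \<circ> gen_family y"
      unfolding high_m'[symmetric] by (simp add: high_family_def lh fun_eq_iff)
    then show "app V N.m (high_family (N'.G ?D)) =
        (N.coeffwise ?D \<circ> gen_family y) + koszul e1 e (dot V (gen_family y) (N.G ?D))"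
      using high_app[OF N'.family_G(1)[OF DQ']] unfolding N'.app_G[OF DQ'] lowG koz
      by (simp add: algebra_simps)
  qed
  have "high r (N'.act ?D p I k) = high_family (app V' N'.m (above p (N'.G ?D))) I (Suc (k + p))"
    by (simp add: N'.act_def high_family_def)
  also have "\<dots> = N.dact ?D e1 e p (gen_family y) I k"
    unfolding high_app[OF N'.family_above_G(1)[OF DQ']] N.dact_def
    by (simp add: low_high_family_simps lowG highG koz)
  finally show ?thesis .
qed

end

section \<open>The derivations given by the action formula\<close>

context operad
begin

lemma conv_lincomb:
  assumes X: "family P c e X" and Y: "\<And>i. i \<in> A \<Longrightarrow> family P c e' (Y i)" and s: "s \<notin> J"
  shows "conv P s X (\<lambda>I. \<Sum>i\<in>A. op_scale P (w i) (Y i I)) J = (\<Sum>i\<in>A. op_scale P (w i) (conv P s X (Y i) J))"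
proof (cases "finite J")
  case True
  have "op_comp P s (X (insert s B)) (\<Sum>i\<in>A. op_scale P (w i) (Y i (J - B))) =
      (\<Sum>i\<in>A. op_scale P (w i) (op_comp P s (X (insert s B)) (Y i (J - B))))" if "B \<in> Pow J" for B
  proof -
    have B: "finite B" "s \<notin> B" "finite (J - B)" "(insert s B - {s}) \<inter> (J - B) = {}"
      using that True s finite_subset by auto
    note Xs = family_slot[OF X B(1,2)] and Ys = familyD[OF Y B(3)]
    have "op_comp P s (X (insert s B)) (\<Sum>i\<in>A. op_scale P (w i) (Y i (J - B))) =
        (\<Sum>i\<in>A. op_comp P s (X (insert s B)) (op_scale P (w i) (Y i (J - B))))"
      by (rule comp_sum_right[OF B(3) space_scale[OF Ys] Xs _ B(4)]) auto
    also have "\<dots> = (\<Sum>i\<in>A. op_scale P (w i) (op_comp P s (X (insert s B)) (Y i (J - B))))"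
      using B(4) by (intro sum.cong HOL.refl comp_scale_right[OF Xs Ys]) auto
    finally show ?thesis .
  qed
  then have "conv P s X (\<lambda>I. \<Sum>i\<in>A. op_scale P (w i) (Y i I)) J =
      (\<Sum>B\<in>Pow J. \<Sum>i\<in>A. op_scale P (w i) (op_comp P s (X (insert s B)) (Y i (J - B))))"
    using True by (simp add: conv_def)
  also have "\<dots> = (\<Sum>i\<in>A. \<Sum>B\<in>Pow J. op_scale P (w i) (op_comp P s (X (insert s B)) (Y i (J - B))))"
    by (rule sum.swap)
  finally show ?thesis using True by (simp add: conv_def vs.scale_sum_right)
qed (simp add: conv_def)

lemma family_lincomb:
  assumes "\<And>i. i \<in> A \<Longrightarrow> family P c e (Y i)"
  shows "family P c e (\<lambda>I. \<Sum>i\<in>A. op_scale P (w i) (Y i I))"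
  using familyD[OF assms] family_infinite[OF assms] by (auto simp: family_def intro!: space_sum space_scale)

lemma app_lincomb:
  assumes m: "family P c 0 m" and Y: "\<And>i. i \<in> A \<Longrightarrow> family P c e (Y i)"
  shows "app P m (\<lambda>I. \<Sum>i\<in>A. op_scale P (w i) (Y i I)) = (\<lambda>I. \<Sum>i\<in>A. op_scale P (w i) (app P m (Y i) I))"
proof
  fix J
  have "dot P m (\<lambda>I. \<Sum>i\<in>A. op_scale P (w i) (Y i I)) J = (\<Sum>i\<in>A. op_scale P (w i) (dot P m (Y i) J))"
  proof (cases "finite J")
    case True
    then show ?thesis unfolding dot_def by (intro conv_lincomb[OF m Y fresh])
  qed (simp add: dot_def conv_def)
  then show "app P m (\<lambda>I. \<Sum>i\<in>A. op_scale P (w i) (Y i I)) J = (\<Sum>i\<in>A. op_scale P (w i) (app P m (Y i) J))"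
    by (simp add: app_def sum_subtractf vs.scale_right_diff_distrib)
qed

end

context hc_gens
begin

text \<open>The solution G depends linearly on D, and truncation and \<open>app\<close> preserve
  linear combinations.\<close>

lemma act_lincomb:
  assumes Di: "\<And>i. i \<in> A \<Longrightarrow> derivation P e (D i)" and D: "derivation P e D'"
    and eq: "\<And>I j x. x \<in> op_space P I j \<Longrightarrow> D' x = (\<Sum>i\<in>A. op_scale P (w i) (D i x))"
  shows "act D' p I k = (\<Sum>i\<in>A. op_scale P (w i) (act (D i) p I k))"
proof -
  let ?Y = "\<lambda>I. \<Sum>i\<in>A. op_scale W (w i) (G (D i) I)"
  have scale: "(\<Sum>i\<in>A. op_scale W (w i) (X i)) k = (\<Sum>i\<in>A. op_scale P (w i) (X i k))" for X :: "'b \<Rightarrow> nat \<Rightarrow> 'a" and k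
    by (simp add: sum_fun_apply)
  have "app W m ?Y = (\<lambda>I. \<Sum>i\<in>A. op_scale W (w i) (app W m (G (D i)) I))"
    by (rule W.app_lincomb[OF m(1) family_G(1)[OF Di]])
  also have "\<dots> = (\<lambda>I. \<Sum>i\<in>A. op_scale W (w i) ((coeffwise (D i) \<circ> m) I))"
    using app_G[OF Di] by (intro ext sum.cong) auto
  also have "\<dots> = coeffwise D' \<circ> m"
  proof (intro ext)
    fix I k
    show "(\<Sum>i\<in>A. op_scale W (w i) ((coeffwise (D i) \<circ> m) I)) k = (coeffwise D' \<circ> m) I k"
    proof (cases "finite I")
      case True
      then show ?thesis using eq[OF family_coeff[OF m(1) True]] by (simp only: scale) simp
    next
      case False
      then have "m I = 0" by (simp add: gen_family_def fun_eq_iff)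
      then show ?thesis using eq[OF space_zero[of "{}"]] by (simp only: scale) simp
    qed
  qed
  finally have G: "G D' = ?Y"
    unfolding G_def[of D'] by (intro W.solve_eqI[OF m family_Dm(1)[OF D] W.family_lincomb[OF family_G(1)[OF Di]]]) auto
  have "above p ?Y = (\<lambda>I. \<Sum>i\<in>A. op_scale W (w i) (above p (G (D i)) I))"
    by (intro ext) (simp add: above_def sum_fun_apply)
  then have "app W m (above p (G D')) = (\<lambda>I. \<Sum>i\<in>A. op_scale W (w i) (app W m (above p (G (D i))) I))"
    unfolding G using W.app_lincomb[OF m(1) family_above_G(1)[OF Di]] by simp
  then show ?thesis unfolding act_def by (simp only: scale)
qed

end

lemma f_derivation_hom_cong:
  assumes "f_derivation P Q f e E" "\<And>I j u. u \<in> op_space P I j \<Longrightarrow> f' u = f u"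
  shows "f_derivation P Q f' e E"
  using assms unfolding f_derivation_def by simp

context operad
begin

lemma Hom_points_hc_point:
  assumes "f \<in> Hom_points d P \<delta>"
  shows "hc_point (base_change P \<delta>) d (\<lambda>I p. f (mu d I p))"
proof -
  interpret Q: operad "base_change P \<delta>" by (rule operad_base_change)
  have f: "operad_hom (HyperCom d) (base_change P \<delta>) f" using assms by (simp add: Hom_points_def)
  show ?thesis
    by unfold_locales (rule Q.hom_gens[OF f], rule Q.hom_relations[OF f])
qed

text \<open>The generators f + y \<epsilon> satisfy the relations over dual numbers: the part
  without \<epsilon> because f is a morphism, the \<epsilon>-part by the hypothesis on
  \<open>vary\<close>. The universal property yields a morphism, whose \<epsilon>-component is the
  derivation.\<close>

lemma f_derivation_exists:
  assumes f: "f \<in> Hom_points d P \<delta>" and y: "is_gens (base_change P \<delta>) d e y"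
    and vary: "\<And>n i j K. i \<noteq> j \<Longrightarrow> d < K \<Longrightarrow>
      hc_gens.vary (base_change P \<delta>) (\<lambda>I p. f (mu d I p)) i j (gen_family y) {1..n} K = 0"
  shows "\<exists>E. f_derivation (HyperCom d) (base_change P \<delta>) f e E \<and>
    (\<forall>n k. 2 \<le> n \<longrightarrow> E (mu d {1..n} k) = y {1..n} k)"
proof -
  interpret base_change_step P \<delta> "- e" by (rule base_change_step)
  interpret N: hc_point Q d "\<lambda>I p. f (mu d I p)" by (rule Hom_points_hc_point[OF f])
  let ?g = "\<lambda>I p. f (mu d I p)"
  \<comment> \<open>Constant functions at a dummy argument reuse the encoding of tangent points for
    single elements.\<close>
  define g' where "g' I k = tangent_point \<delta> (\<lambda>_. ?g I k) (\<lambda>_. y I k) ()" for I k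
  have sp: "?g I k \<in> op_space Q I (mu_deg d (card I) k)" "y I k \<in> op_space Q I (mu_deg d (card I) k + e)"
    if "finite I" "2 \<le> card I" for I k
    using N.gens y that by (simp_all add: is_gens_def)
  have lh: "low r (g' I k) = ?g I k" "high r (g' I k) = y I k" "\<And>S. \<not> S \<subseteq> {..<Suc r} \<Longrightarrow> g' I k S = 0"
    if "finite I" "2 \<le> card I" for I k
    unfolding g'_def
    using tangent_low_high[of "\<lambda>_. ?g I k" "()" I "mu_deg d (card I) k" "\<lambda>_. y I k" "mu_deg d (card I) k + e"]
      sp[OF that] by simp_all
  have sp': "g' I k \<in> op_space Q' I (mu_deg d (card I) k)" if "finite I" "2 \<le> card I" for I k
    using sp[OF that] lh[OF that] by (intro spaceI) simp_all
  have gens': "is_gens Q' d 0 g'"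
    unfolding is_gens_def
  proof (intro allI impI conjI)
    fix I :: "nat set" and k assume I: "finite I" "2 \<le> card I"
    show "g' I k \<in> op_space Q' I (mu_deg d (card I) k + 0)" using sp'[OF I] by simp
    fix \<sigma> :: "nat \<Rightarrow> nat" assume \<sigma>: "inj_on \<sigma> I"
    have I': "finite (\<sigma> ` I)" "2 \<le> card (\<sigma> ` I)" using I \<sigma> by (simp_all add: card_image)
    show "g' (\<sigma> ` I) k = op_relabel Q' \<sigma> (g' I k)"
    proof (rule eqI[OF sp'[OF I'] Q'.relabel_space[OF sp'[OF I] \<sigma>]])
      show "low r (g' (\<sigma> ` I) k) = low r (op_relabel Q' \<sigma> (g' I k))"
        using N.gens I \<sigma> lh[OF I] lh[OF I'] by (simp add: is_gens_def)
      show "high r (g' (\<sigma> ` I) k) = high r (op_relabel Q' \<sigma> (g' I k))"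
        using y I \<sigma> lh[OF I] lh[OF I'] by (simp add: is_gens_def)
    qed
  qed
  interpret deformation P \<delta> e d ?g y g'
    by unfold_locales (use gens' lh in auto)
  have rel': "satisfies_relations Q' d g'" by (rule satisfies_relations'[OF N.rel vary])
  let ?F = "\<lambda>u. ev Q' g' (rep u)"
  note hom = Q'.hom_of_gens[OF gens' rel']
  have F: "?F \<in> Hom_points d P (\<delta> @ [- e])" using hom(1) by (simp add: Hom_points_def)
  \<comment> \<open>The low part of the new morphism is a morphism with the same values on
    generators as f, hence equal to f.\<close>
  have low: "low r (?F u) = f u" if u: "u \<in> op_space (HyperCom d) I j" for u I j
  proof -
    obtain t where t: "wf_term d t" "u = hc_class d t" using u by (rule HyperComE)
    have l: "operad_hom (HyperCom d) Q (\<lambda>u. low r (?F u))" and fh: "operad_hom (HyperCom d) Q f"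
      using hom_low_high(1)[OF F] f by (simp_all add: Hom_points_def)
    have "ev Q (\<lambda>I p. low r (?F (mu d I p))) t = ev Q ?g t" if "wf_term d t" for t
      using that
    proof (induction t)
      case (Gen I p)
      then show ?case using hom(2)[of "Gen I p"] lh(1)[of I p] by (simp add: mu_def)
    qed auto
    then show ?thesis using Q.hom_ev[OF l t(1)] Q.hom_ev[OF fh t(1)] t by simp
  qed
  have "f_derivation (HyperCom d) Q f e (\<lambda>u. high r (?F u))"
    by (rule f_derivation_hom_cong[OF hom_low_high(2)[OF F]]) (simp add: low)
  moreover have "high r (?F (mu d {1..n} k)) = y {1..n} k" if "2 \<le> n" for n k
    using hom(2)[of "Gen {1..n} k"] lh(2)[of "{1..n}" k] that by (simp add: mu_def)
  ultimately show ?thesis by (intro exI[of _ "\<lambda>u. high r (?F u)"]) simp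
qed

lemma action_formula_eq_act:
  assumes f: "f \<in> Hom_points d P \<delta>" and D: "derivation P e D" and n: "2 \<le> n"
  shows "action_formula d P D p \<delta> f n k =
    hc_gens.act (base_change P \<delta>) (\<lambda>I p. f (mu d I p)) (extend_map D) p {1..n} k"
proof -
  interpret N: hc_point "base_change P \<delta>" d "\<lambda>I p. f (mu d I p)" by (rule Hom_points_hc_point[OF f])
  let ?Q = "base_change P \<delta>"
  note DQ = derivation_extend_map[OF D, where \<delta> = \<delta>]
  \<comment> \<open>The first block in the formula has at least two labels, so y may be set to zero
    on smaller sets.\<close>
  define y where "y S p = (if finite S \<and> 2 \<le> card S then extend_map D (f (mu d S p)) else 0)" for S p
  have ysp: "y S p \<in> op_space ?Q S (mu_deg d (card S) p + e)" if "finite S" for S p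
    using N.derivationD(1)[OF DQ] N.gens that N.space_zero by (simp add: y_def is_gens_def)
  have y0: "y S p = 0" if "card S < 2" for S p using that by (simp add: y_def)
  have gy: "gen_family y = N.coeffwise (extend_map D) \<circ> N.m"
    using N.derivation_zero[OF DQ] by (auto simp: gen_family_def y_def fun_eq_iff)
  have "(\<Sum>(Ss, ps)\<in>action_index n p. nest (op_comp ?Q) (\<lambda>S r. f (mu d S r))
          (extend_map D (f (mu d (hd Ss) (hd ps)))) (zip (tl Ss) (butlast (tl ps) @ [k + last ps]))) =
     (\<Sum>(Ss, ps)\<in>action_index n p. nest (op_comp ?Q) (\<lambda>S r. f (mu d S r))
          (y (hd Ss) (hd ps)) (zip (tl Ss) (butlast (tl ps) @ [k + last ps])))"
  proof (rule sum.cong[OF HOL.refl])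
    fix x assume x: "x \<in> action_index n p"
    then have "2 \<le> card (hd (fst x))" by (auto simp: action_index_def)
    moreover from this have "finite (hd (fst x))" using card.infinite by fastforce
    ultimately show "(case x of (Ss, ps) \<Rightarrow> nest (op_comp ?Q) (\<lambda>S r. f (mu d S r))
          (extend_map D (f (mu d (hd Ss) (hd ps)))) (zip (tl Ss) (butlast (tl ps) @ [k + last ps]))) =
        (case x of (Ss, ps) \<Rightarrow> nest (op_comp ?Q) (\<lambda>S r. f (mu d S r))
          (y (hd Ss) (hd ps)) (zip (tl Ss) (butlast (tl ps) @ [k + last ps])))"
      by (simp add: y_def split_def)
  qed
  moreover have "extend_map D (f (mu d {1..n} (k + p))) = y {1..n} (k + p)" using n by (simp add: y_def)
  ultimately have "action_formula d P D p \<delta> f n k = y {1..n} (k + p) +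
      (\<Sum>(Ss, ps)\<in>action_index n p. nest (op_comp ?Q) (\<lambda>S r. f (mu d S r))
          (y (hd Ss) (hd ps)) (zip (tl Ss) (butlast (tl ps) @ [k + last ps])))"
    by (simp add: action_formula_def)
  also have "\<dots> = N.act (extend_map D) p {1..n} k"
    unfolding N.act_def N.G_def gy[symmetric]
    by (rule N.action_sum_eq_app[OF N.gens ysp y0 n])
  finally show ?thesis .
qed

end

text \<open>The argument e is the degree of the vector field, so D has degree e + 2p. The choice is
  unambiguous on elements of the operad, since a derivation along f is determined by its values on
  generators.\<close>

definition monomial_vf ::
  "nat \<Rightarrow> ('k::field_char_0, 'a::ab_group_add) operad_str \<Rightarrow> ('a \<Rightarrow> 'a) \<Rightarrow> nat \<Rightarrow> int \<Rightarrow> int list \<Rightarrow>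
    ('k hterm set \<Rightarrow> nat set \<Rightarrow> 'a) \<Rightarrow> 'k hterm set \<Rightarrow> nat set \<Rightarrow> 'a" where
  "monomial_vf d P D p e \<delta> f = (SOME E. f_derivation (HyperCom d) (base_change P \<delta>) f e E \<and>
     (\<forall>n k. 2 \<le> n \<longrightarrow> E (mu d {1..n} k) = action_formula d P D p \<delta> f n k))"

context operad
begin

lemma monomial_vf:
  assumes f: "f \<in> Hom_points d P \<delta>" and D: "derivation P (e + 2 * int p) D"
  shows "f_derivation (HyperCom d) (base_change P \<delta>) f e (monomial_vf d P D p e \<delta> f)"
    and "2 \<le> n \<Longrightarrow> monomial_vf d P D p e \<delta> f (mu d {1..n} k) = action_formula d P D p \<delta> f n k"
proof -
  interpret N: hc_point "base_change P \<delta>" d "\<lambda>I p. f (mu d I p)" by (rule Hom_points_hc_point[OF f])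
  note DQ = derivation_extend_map[OF D, where \<delta> = \<delta>]
  have "is_gens (base_change P \<delta>) d e (N.act (extend_map D) p)" using N.is_gens_act[OF DQ, of p] by simp
  then have "\<exists>E. f_derivation (HyperCom d) (base_change P \<delta>) f e E \<and>
      (\<forall>n k. 2 \<le> n \<longrightarrow> E (mu d {1..n} k) = N.act (extend_map D) p {1..n} k)"
    by (rule f_derivation_exists[OF f]) (rule N.vary_act[OF DQ], auto)
  then have "\<exists>E. f_derivation (HyperCom d) (base_change P \<delta>) f e E \<and>
      (\<forall>n k. 2 \<le> n \<longrightarrow> E (mu d {1..n} k) = action_formula d P D p \<delta> f n k)"
    using action_formula_eq_act[OF f D] by auto
  from someI_ex[OF this]
  show "f_derivation (HyperCom d) (base_change P \<delta>) f e (monomial_vf d P D p e \<delta> f)"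
    and "2 \<le> n \<Longrightarrow> monomial_vf d P D p e \<delta> f (mu d {1..n} k) = action_formula d P D p \<delta> f n k"
    unfolding monomial_vf_def[symmetric] by blast+
qed

lemma f_derivation_lincomb:
  fixes R :: "('k, 'x) operad_str"
  assumes f: "operad_hom R P f" and E: "\<And>i. i \<in> A \<Longrightarrow> f_derivation R P f e (E i)"
  shows "f_derivation R P f e (\<lambda>u. \<Sum>i\<in>A. op_scale P (w i) (E i u))"
  unfolding f_derivation_def add
proof (intro conjI allI ballI impI)
  note D = f_derivationD[OF E]
  have fin: "finite I" if "u \<in> op_space R I j" for u I j
    using operad_homD(1)[OF f that] by (rule space_finite)
  fix I j and u assume u: "u \<in> op_space R I j"
  note Du = D(1)[OF _ u]
  show "(\<Sum>i\<in>A. op_scale P (w i) (E i u)) \<in> op_space P I (j + e)"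
    by (intro space_sum[OF fin[OF u]] space_scale[OF Du])
  show "(\<Sum>i\<in>A. op_scale P (w i) (E i (op_add R u v))) =
      (\<Sum>i\<in>A. op_scale P (w i) (E i u)) + (\<Sum>i\<in>A. op_scale P (w i) (E i v))"
    if "v \<in> op_space R I j" for v 
    using D(2)[OF _ u that] by (simp add: add vs.scale_right_distrib sum.distrib)
  show "(\<Sum>i\<in>A. op_scale P (w i) (E i (op_scale R c u))) = op_scale P c (\<Sum>i\<in>A. op_scale P (w i) (E i u))" for c
    using D(3)[OF _ u] by (simp add: vs.scale_sum_right vs.scale_left_commute mult.commute)
  show "(\<Sum>i\<in>A. op_scale P (w i) (E i (op_relabel R \<sigma> u))) =
      op_relabel P \<sigma> (\<Sum>i\<in>A. op_scale P (w i) (E i u))" if \<sigma>: "inj_on \<sigma> I" for \<sigma>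
    using D(4)[OF _ u \<sigma>] by (simp add: relabel_sum[OF \<sigma> fin[OF u] space_scale[OF Du]] relabel_scale[OF Du \<sigma>])
  fix J k s v
  assume v: "v \<in> op_space R J k" and s: "s \<in> I" "(I - {s}) \<inter> J = {}"
  note Dv = D(1)[OF _ v] and fu = operad_homD(1)[OF f u] and fv = operad_homD(1)[OF f v]
  have "op_comp P s (\<Sum>i\<in>A. op_scale P (w i) (E i u)) (f v) = (\<Sum>i\<in>A. op_scale P (w i) (op_comp P s (E i u) (f v)))"
    by (simp add: comp_sum_left[OF fin[OF u] space_scale[OF Du] fv s] comp_scale_left[OF Du fv s])
  moreover have "op_comp P s (f u) (\<Sum>i\<in>A. op_scale P (w i) (E i v)) = (\<Sum>i\<in>A. op_scale P (w i) (op_comp P s (f u) (E i v)))"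
    by (simp add: comp_sum_right[OF fin[OF v] space_scale[OF Dv] fu s] comp_scale_right[OF fu Dv s])
  ultimately show "(\<Sum>i\<in>A. op_scale P (w i) (E i (op_comp R s u v))) =
      op_comp P s (\<Sum>i\<in>A. op_scale P (w i) (E i u)) (f v) +
      op_scale P (ksgn e j) (op_comp P s (f u) (\<Sum>i\<in>A. op_scale P (w i) (E i v)))"
    using D(5)[OF _ u v s]
    by (cases "odd e \<and> odd j")
      (auto simp: add vs.scale_right_distrib vs.scale_right_diff_distrib sum.distrib sum_subtractf koszul_def sum_negf)
qed

lemma monomial_vf_lincomb:
  assumes f: "f \<in> Hom_points d P \<delta>" and Di: "\<And>i. i \<in> A \<Longrightarrow> derivation P (e + 2 * int p) (D i)"
    and D: "derivation P (e + 2 * int p) D'"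
    and eq: "\<And>I j x. x \<in> op_space P I j \<Longrightarrow> D' x = (\<Sum>i\<in>A. op_scale P (w i) (D i x))"
    and u: "u \<in> op_space (HyperCom d) I j"
  shows "monomial_vf d P D' p e \<delta> f u =
    (\<Sum>i\<in>A. op_scale (base_change P \<delta>) (w i) (monomial_vf d P (D i) p e \<delta> f u))"
proof -
  interpret N: hc_point "base_change P \<delta>" d "\<lambda>I p. f (mu d I p)" by (rule Hom_points_hc_point[OF f])
  have fh: "operad_hom (HyperCom d) (base_change P \<delta>) f" using f by (simp add: Hom_points_def)
  obtain t where t: "wf_term d t" "u = hc_class d t" using u by (rule HyperComE)
  have eq': "extend_map D' X = (\<Sum>i\<in>A. op_scale (base_change P \<delta>) (w i) (extend_map (D i) X))"
    if "X \<in> op_space (base_change P \<delta>) I j" for X I j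
  proof
    fix S
    have "D' (X S) = (\<Sum>i\<in>A. op_scale P (w i) (D i (X S)))"
      using that eq[of "X S"] eq[OF space_zero[of "{}"]] unfolding base_change_space
      by (cases "S \<subseteq> {..<length \<delta>}") auto
    then show "extend_map D' X S = (\<Sum>i\<in>A. op_scale (base_change P \<delta>) (w i) (extend_map (D i) X)) S"
      by (simp add: sum_fun_apply extend_map_def)
  qed
  show ?thesis
    unfolding t(2)
  proof (rule N.f_derivation_cong[OF fh monomial_vf(1)[OF f D] N.f_derivation_lincomb[OF fh monomial_vf(1)[OF f Di]] t(1)])
    fix n k assume "(n, k) \<in> gens_of t"
    then have n: "2 \<le> n" by (rule gens_of_ge[OF t(1)])
    show "monomial_vf d P D' p e \<delta> f (mu d {1..n} k) =
        (\<Sum>i\<in>A. op_scale (base_change P \<delta>) (w i) (monomial_vf d P (D i) p e \<delta> f (mu d {1..n} k)))"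
    proof -
      have "N.act (extend_map D') p {1..n} k =
          (\<Sum>i\<in>A. op_scale (base_change P \<delta>) (w i) (N.act (extend_map (D i)) p {1..n} k))"
        by (rule N.act_lincomb[OF derivation_extend_map[OF Di] derivation_extend_map[OF D] eq'])
      also have "\<dots> = (\<Sum>i\<in>A. op_scale (base_change P \<delta>) (w i) (monomial_vf d P (D i) p e \<delta> f (mu d {1..n} k)))"
        by (intro sum.cong HOL.refl) (simp only: monomial_vf(2)[OF f Di n] action_formula_eq_act[OF f Di n])
      finally show ?thesis
        unfolding monomial_vf(2)[OF f D n] action_formula_eq_act[OF f D n] .
    qed
  qed
qed

lemma f_derivation_zero:
  assumes f: "operad_hom (HyperCom d) P f"
  shows "f_derivation (HyperCom d) P f e (\<lambda>u. 0)"
  using f_derivation_lincomb[OF f, of "{}"] by simp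

text \<open>The bound comes from the arities in one term for u and is thus uniform in f, D and the
  dual numbers. This uniformity is used when fields are evaluated at tangent points, which live over
  larger algebras.\<close>

lemma monomial_vf_eventually_zero:
  assumes u: "u \<in> op_space (HyperCom d) I j"
  shows "\<exists>N. \<forall>p e \<delta> f D. N \<le> p \<longrightarrow> f \<in> Hom_points d P \<delta> \<longrightarrow> derivation P (e + 2 * int p) D \<longrightarrow>
    monomial_vf d P D p e \<delta> f u = 0"
proof -
  obtain t where t: "wf_term d t" "u = hc_class d t" using u by (rule HyperComE)
  define N where "N = d * Max (insert 0 (fst ` gens_of t))"
  have "monomial_vf d P D p e \<delta> f u = 0"
    if "N \<le> p" and f: "f \<in> Hom_points d P \<delta>" and D: "derivation P (e + 2 * int p) D" for p e \<delta> f D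
  proof -
    interpret Q: hc_point "base_change P \<delta>" d "\<lambda>I p. f (mu d I p)" by (rule Hom_points_hc_point[OF f])
    have fh: "operad_hom (HyperCom d) (base_change P \<delta>) f" using f by (simp add: Hom_points_def)
    show ?thesis
      unfolding t(2)
    proof (rule Q.f_derivation_cong[OF fh monomial_vf(1)[OF f D] Q.f_derivation_zero[OF fh] t(1)])
      fix n k assume nk: "(n, k) \<in> gens_of t"
      then have n: "2 \<le> n" by (rule gens_of_ge[OF t(1)])
      have "n \<le> Max (insert 0 (fst ` gens_of t))"
        using nk finite_gens_of[of t] by (intro Max_ge) force+
      then have "d * n \<le> p" using \<open>N \<le> p\<close> unfolding N_def by (meson le_trans mult_le_mono2)
      then show "monomial_vf d P D p e \<delta> f (mu d {1..n} k) = 0"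
        unfolding monomial_vf(2)[OF f D n] action_formula_eq_act[OF f D n]
        by (rule Q.act_eq_zero[OF derivation_extend_map[OF D] n])
    qed
  qed
  then show ?thesis by blast
qed

end

section \<open>Polynomiality\<close>

text \<open>The target may have any label set, because the inner compositions of a nested product
  live on subsets of {1..n}.\<close>

definition multilinear_on ::
  "('k::field_char_0, 'a::ab_group_add) operad_str \<Rightarrow> (nat \<times> nat) list \<Rightarrow> nat set \<Rightarrow> int \<Rightarrow>
   ('a list \<Rightarrow> 'a) \<Rightarrow> bool" where
  "multilinear_on P gs I c T \<longleftrightarrow>
     (\<forall>xs js. length xs = length gs \<longrightarrow> length js = length gs \<longrightarrow>
        (\<forall>i<length gs. xs ! i \<in> op_space P {1..fst (gs ! i)} (js ! i)) \<longrightarrow>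
        T xs \<in> op_space P I (sum_list js + c) \<and>
        (\<forall>i<length gs. \<forall>y\<in>op_space P {1..fst (gs ! i)} (js ! i).
           T (xs[i := xs ! i + y]) = T xs + T (xs[i := y])) \<and>
        (\<forall>i<length gs. \<forall>b. T (xs[i := op_scale P b (xs ! i)]) = op_scale P b (T xs)))"

lemma graded_multilinear_iff: "graded_multilinear P gs n c T \<longleftrightarrow> multilinear_on P gs {1..n} c T"
  by (simp add: graded_multilinear_def multilinear_on_def)

lemma multilinear_onD:
  assumes "multilinear_on P gs I c T" "length xs = length gs" "length js = length gs"
    and "\<And>i. i < length gs \<Longrightarrow> xs ! i \<in> op_space P {1..fst (gs ! i)} (js ! i)"
  shows "T xs \<in> op_space P I (sum_list js + c)"
    and "i < length gs \<Longrightarrow> y \<in> op_space P {1..fst (gs ! i)} (js ! i) \<Longrightarrow> T (xs[i := xs ! i + y]) = T xs + T (xs[i := y])"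
    and "i < length gs \<Longrightarrow> T (xs[i := op_scale P b (xs ! i)]) = op_scale P b (T xs)"
proof -
  have "T xs \<in> op_space P I (sum_list js + c) \<and>
        (\<forall>i<length gs. \<forall>y\<in>op_space P {1..fst (gs ! i)} (js ! i).
           T (xs[i := xs ! i + y]) = T xs + T (xs[i := y])) \<and>
        (\<forall>i<length gs. \<forall>b. T (xs[i := op_scale P b (xs ! i)]) = op_scale P b (T xs))"
    using assms(1)[unfolded multilinear_on_def, rule_format, OF assms(2,3)] assms(4) by blast
  then show "T xs \<in> op_space P I (sum_list js + c)"
    and "i < length gs \<Longrightarrow> y \<in> op_space P {1..fst (gs ! i)} (js ! i) \<Longrightarrow> T (xs[i := xs ! i + y]) = T xs + T (xs[i := y])"
    and "i < length gs \<Longrightarrow> T (xs[i := op_scale P b (xs ! i)]) = op_scale P b (T xs)"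
    by simp_all
qed

definition koszul_product :: "('k::field_char_0, 'a) operad_str \<Rightarrow> int list \<Rightarrow> (nat set \<Rightarrow> 'a) list \<Rightarrow> nat set list \<Rightarrow> 'k" where
  "koszul_product P \<delta> Xs Us = (\<Prod>b<length Xs. \<Prod>a<b.
     ksgn (eps_deg \<delta> (Us ! a)) (degree_of P ((Xs ! b) (Us ! b))) * eps_sign \<delta> (Us ! a) (Us ! b))"

lemma extend_multilinear_eq:
  "extend_multilinear P \<delta> T Xs S = (if S \<subseteq> {..<length \<delta>} then
     (\<Sum>Us\<in>{Us \<in> set_splits S. length Us = length Xs}.
        op_scale P (koszul_product P \<delta> Xs Us) (T (map2 (\<lambda>X U. X U) Xs Us))) else 0)"
  by (simp add: extend_multilinear_def koszul_product_def)

text \<open>The factors that involve the first index split off: the first product of \<epsilon>'s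
  passes all later coefficients and is ordered against all later products of \<epsilon>'s.\<close>

lemma koszul_product_Cons:
  "koszul_product P \<delta> (X # Xs) (U # Us) =
    (\<Prod>b<length Xs. ksgn (eps_deg \<delta> U) (degree_of P ((Xs ! b) (Us ! b))) * eps_sign \<delta> U (Us ! b)) *
    koszul_product P \<delta> Xs Us"
  unfolding koszul_product_def
  by (simp add: prod.lessThan_Suc_shift prod.distrib del: prod.lessThan_Suc)

lemma set_splits_Cons: "U # Us \<in> set_splits S \<longleftrightarrow> U \<subseteq> S \<and> Us \<in> set_splits (S - U)"
  unfolding set_splits_def by auto

lemma splits_Suc:
  "{Us \<in> set_splits S. length Us = Suc q} =
    (\<lambda>(U, Us). U # Us) ` (SIGMA U:Pow S. {Us \<in> set_splits (S - U). length Us = q})"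
proof (rule set_eqI, rule iffI)
  fix Us assume "Us \<in> {Us \<in> set_splits S. length Us = Suc q}"
  then obtain U Us' where "Us = U # Us'" "length Us' = q" "U # Us' \<in> set_splits S"
    by (cases Us) auto
  then show "Us \<in> (\<lambda>(U, Us). U # Us) ` (SIGMA U:Pow S. {Us \<in> set_splits (S - U). length Us = q})"
    by (intro image_eqI[of _ _ "(U, Us')"]) (auto simp: set_splits_Cons)
qed (auto simp: set_splits_Cons)

lemma finite_splits: "finite S \<Longrightarrow> finite {Us \<in> set_splits S. length Us = q}"
  by (rule finite_subset[OF _ finite_lists_length_eq[of "Pow S" q]]) (auto simp: set_splits_def)

lemma eps_splits:
  assumes "Us \<in> set_splits S" "finite S"
  shows "eps_deg \<delta> S = (\<Sum>b<length Us. eps_deg \<delta> (Us ! b))"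
    and "eps_sign \<delta> U S = (\<Prod>b<length Us. eps_sign \<delta> U (Us ! b))"
proof -
  have "eps_deg \<delta> S = (\<Sum>b<length Us. eps_deg \<delta> (Us ! b)) \<and>
      (eps_sign \<delta> U S :: 'a) = (\<Prod>b<length Us. eps_sign \<delta> U (Us ! b))"
    using assms
  proof (induction Us arbitrary: S)
    case Nil
    then show ?case by (simp add: set_splits_def eps_deg_def eps_sign_def)
  next
    case (Cons V Us)
    then have V: "V \<subseteq> S" and Us: "Us \<in> set_splits (S - V)" by (auto simp: set_splits_Cons)
    have fin: "finite V" "finite (S - V)" using V Cons.prems(2) finite_subset by auto
    have "eps_deg \<delta> S = eps_deg \<delta> V + eps_deg \<delta> (S - V)"
      unfolding eps_deg_def using V Cons.prems(2) by (simp add: sum.subset_diff add.commute)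
    moreover have "(eps_sign \<delta> U S :: 'a) = eps_sign \<delta> U V * eps_sign \<delta> U (S - V)"
      unfolding eps_sign_def using V Cons.prems(2)
      by (simp add: prod.subset_diff[of V S] prod.distrib mult.commute)
    ultimately show ?case
      using Cons.IH[OF Us fin(2)] by (simp add: sum.lessThan_Suc_shift prod.lessThan_Suc_shift del: sum.lessThan_Suc prod.lessThan_Suc)
  qed
  then show "eps_deg \<delta> S = (\<Sum>b<length Us. eps_deg \<delta> (Us ! b))"
    and "eps_sign \<delta> U S = (\<Prod>b<length Us. eps_sign \<delta> U (Us ! b) :: 'a)" by blast+
qed

context operad
begin

lemma multilinear_zero:
  assumes T: "multilinear_on P gs I c T" and len: "length xs = length gs" "length js = length gs"
    and typed: "\<And>i. i < length gs \<Longrightarrow> xs ! i \<in> op_space P {1..fst (gs ! i)} (js ! i)"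
    and i: "i < length gs" "xs ! i = 0"
  shows "T xs = 0"
proof -
  have "xs[i := op_scale P 0 (xs ! i)] = xs" using i by (metis list_update_id vs.scale_zero_left)
  then show ?thesis using multilinear_onD(3)[OF T len typed i(1), of 0] by simp
qed

lemma extend_multilinear_term:
  assumes Xs: "length Xs = length gs" "length js = length gs"
    "\<And>i. i < length gs \<Longrightarrow> Xs ! i \<in> op_space (base_change P \<delta>) {1..fst (gs ! i)} (js ! i)"
    and S: "S \<subseteq> {..<length \<delta>}" and Us: "Us \<in> set_splits S" "length Us = length gs"
  defines "xs \<equiv> map2 (\<lambda>X U. X U) Xs Us" and "js' \<equiv> map2 (\<lambda>j U. j - eps_deg \<delta> U) js Us"
  shows "length xs = length gs" "length js' = length gs"
    "\<And>i. i < length gs \<Longrightarrow> xs ! i \<in> op_space P {1..fst (gs ! i)} (js' ! i)"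
    "sum_list js' = sum_list js - eps_deg \<delta> S"
proof -
  show len: "length xs = length gs" "length js' = length gs" using Xs Us by (simp_all add: xs_def js'_def)
  show "xs ! i \<in> op_space P {1..fst (gs ! i)} (js' ! i)" if i: "i < length gs" for i
  proof -
    have "Us ! i \<in> set Us" using i Us(2) by simp
    then have "Us ! i \<subseteq> {..<length \<delta>}" using Us(1) S unfolding set_splits_def by blast
    then have "(Xs ! i) (Us ! i) \<in> op_space P {1..fst (gs ! i)} (js ! i - eps_deg \<delta> (Us ! i))"
      using Xs(3)[OF i] unfolding base_change_space by blast
    then show ?thesis using i Xs Us by (simp add: xs_def js'_def)
  qed
  have fS: "finite S" using S finite_subset by blast
  have "sum_list js' = (\<Sum>i<length gs. js ! i - eps_deg \<delta> (Us ! i))"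
    using Xs Us len by (simp add: sum_list_sum_nth js'_def atLeast0LessThan)
  also have "\<dots> = sum_list js - eps_deg \<delta> S"
    using Xs Us by (simp add: sum_subtractf eps_splits(1)[OF Us(1) fS] sum_list_sum_nth atLeast0LessThan)
  finally show "sum_list js' = sum_list js - eps_deg \<delta> S" .
qed

lemma extend_multilinear_space:
  assumes T: "multilinear_on P gs I c T"
    and Xs: "length Xs = length gs" "length js = length gs"
    "\<And>i. i < length gs \<Longrightarrow> Xs ! i \<in> op_space (base_change P \<delta>) {1..fst (gs ! i)} (js ! i)"
    and I: "finite I"
  shows "extend_multilinear P \<delta> T Xs \<in> op_space (base_change P \<delta>) I (sum_list js + c)"
  unfolding base_change_space
proof (intro conjI allI impI)
  fix S assume S: "S \<subseteq> {..<length \<delta>}"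
  have "T (map2 (\<lambda>X U. X U) Xs Us) \<in> op_space P I (sum_list js + c - eps_deg \<delta> S)"
    if "Us \<in> set_splits S" "length Us = length gs" for Us
    using multilinear_onD(1)[OF T extend_multilinear_term(1-3)[OF Xs S that]]
      extend_multilinear_term(4)[OF Xs S that] by (simp add: algebra_simps)
  then show "extend_multilinear P \<delta> T Xs S \<in> op_space P I (sum_list js + c - eps_deg \<delta> S)"
    unfolding extend_multilinear_eq using S Xs(1) I by (auto intro!: space_sum space_scale)
qed (simp add: extend_multilinear_eq)

text \<open>T has degree c and ends up to the right of the first argument, which it has to pass.
  Over dual numbers this becomes a sign between c and the \<epsilon>'s of the first argument, whose
  total degree is even.\<close>

definition comp_multilinear :: "int \<Rightarrow> (nat \<Rightarrow> nat) \<Rightarrow> ('a list \<Rightarrow> 'a) \<Rightarrow> 'a list \<Rightarrow> 'a" where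
  "comp_multilinear c \<sigma> T xs = op_scale P (ksgn c (degree_of P (hd xs)))
     (op_comp P 0 (op_relabel P \<sigma> (hd xs)) (T (tl xs)))"

lemma comp_multilinear:
  assumes T: "multilinear_on P gs I c T" and A: "finite A" "0 \<notin> A" "A \<inter> I = {}"
    and \<sigma>: "inj_on \<sigma> {1..k}" "\<sigma> ` {1..k} = insert 0 A"
  shows "multilinear_on P ((k, l) # gs) (A \<union> I) c (comp_multilinear c \<sigma> T)"
  unfolding multilinear_on_def
proof (intro allI impI)
  fix xs js
  assume len: "length xs = length ((k, l) # gs)" "length js = length ((k, l) # gs)"
    and typed: "\<forall>i<length ((k, l) # gs). xs ! i \<in> op_space P {1..fst (((k, l) # gs) ! i)} (js ! i)"
  obtain x xs' where xs: "xs = x # xs'" "length xs' = length gs" using len by (cases xs) auto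
  obtain j js' where js: "js = j # js'" "length js' = length gs" using len by (cases js) auto
  have x: "x \<in> op_space P {1..k} j" using typed xs js by auto
  have xs': "xs' ! i \<in> op_space P {1..fst (gs ! i)} (js' ! i)" if "i < length gs" for i
    using typed[rule_format, of "Suc i"] that xs js by simp
  have TD: "T xs' \<in> op_space P I (sum_list js' + c)"
    "\<And>i y. i < length gs \<Longrightarrow> y \<in> op_space P {1..fst (gs ! i)} (js' ! i) \<Longrightarrow> T (xs'[i := xs' ! i + y]) = T xs' + T (xs'[i := y])"
    "\<And>i b. i < length gs \<Longrightarrow> T (xs'[i := op_scale P b (xs' ! i)]) = op_scale P b (T xs')"
    using multilinear_onD[OF T xs(2) js(2) xs'] by blast+
  have rx: "op_relabel P \<sigma> y \<in> op_space P (insert 0 A) j" if "y \<in> op_space P {1..k} j" for y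
    using relabel_space[OF that \<sigma>(1)] \<sigma>(2) by simp
  have disj: "0 \<in> insert 0 A" "(insert 0 A - {0}) \<inter> I = {}" using A by auto
  have eqI: "(insert 0 A - {0}) \<union> I = A \<union> I" using A by auto
  have C: "comp_multilinear c \<sigma> T (y # ys) = koszul c j (op_comp P 0 (op_relabel P \<sigma> y) (T ys))"
    if "y \<in> op_space P {1..k} j" "T ys \<in> op_space P I i" for y ys i
  proof (cases "y = 0")
    case True
    then show ?thesis using comp_zero_left[OF that(2)] by (simp add: comp_multilinear_def)
  next
    case False
    then show ?thesis using degree_of_eq[OF that(1) False] by (simp add: comp_multilinear_def)
  qed
  note Tsp = TD(1)
  have 1: "comp_multilinear c \<sigma> T xs \<in> op_space P (A \<union> I) (sum_list js + c)"
    unfolding xs(1) C[OF x Tsp]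
    by (rule space_koszul, rule space_cast[OF comp_space[OF rx[OF x] Tsp disj]]) (use eqI js in auto)
  have 2: "comp_multilinear c \<sigma> T (xs[i := xs ! i + y]) = comp_multilinear c \<sigma> T xs + comp_multilinear c \<sigma> T (xs[i := y])"
    if i: "i < length ((k, l) # gs)" and y: "y \<in> op_space P {1..fst (((k, l) # gs) ! i)} (js ! i)" for i y
  proof (cases i)
    case 0
    then have y': "y \<in> op_space P {1..k} j" using y js by simp
    show ?thesis
      using 0 C[OF x Tsp] C[OF y' Tsp] C[OF space_add[OF x y'] Tsp] relabel_add[OF x y' \<sigma>(1)]
        comp_add_left[OF rx[OF x] rx[OF y'] Tsp disj] by (simp add: xs)
  next
    case (Suc i')
    then have i': "i' < length gs" and y': "y \<in> op_space P {1..fst (gs ! i')} (js' ! i')" using i y js by auto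
    have up: "\<And>l. l < length gs \<Longrightarrow> xs'[i' := z] ! l \<in> op_space P {1..fst (gs ! l)} (js' ! l)"
      if "z \<in> op_space P {1..fst (gs ! i')} (js' ! i')" for z
      using xs' that i' xs(2) by (auto simp: nth_list_update)
    have sp: "T (xs'[i' := z]) \<in> op_space P I (sum_list js' + c)"
      if "z \<in> op_space P {1..fst (gs ! i')} (js' ! i')" for z
      using multilinear_onD(1)[OF T _ js(2) up[OF that]] xs(2) by simp
    show ?thesis
      using Suc C[OF x Tsp] C[OF x sp[OF y']] C[OF x sp[OF space_add[OF xs'[OF i'] y']]] TD(2)[OF i' y']
        comp_add_right[OF rx[OF x] Tsp sp[OF y'] disj] by (simp add: xs)
  qed
  have 3: "comp_multilinear c \<sigma> T (xs[i := op_scale P b (xs ! i)]) = op_scale P b (comp_multilinear c \<sigma> T xs)"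
    if i: "i < length ((k, l) # gs)" for i b
  proof -
    have kb: "koszul c j (op_scale P b z) = op_scale P b (koszul c j z)" for z by (simp add: koszul_def)
    show ?thesis
    proof (cases i)
      case 0
      show ?thesis
        using 0 C[OF x Tsp] C[OF space_scale[OF x] Tsp, of b] relabel_scale[OF x \<sigma>(1), of b]
          comp_scale_left[OF rx[OF x] Tsp disj, of b] by (simp add: xs kb)
    next
      case (Suc i')
      then have i': "i' < length gs" using i by auto
      have sp: "T (xs'[i' := op_scale P b (xs' ! i')]) \<in> op_space P I (sum_list js' + c)"
        unfolding TD(3)[OF i'] by (rule space_scale[OF Tsp])
      show ?thesis
        using Suc C[OF x Tsp] C[OF x sp] TD(3)[OF i', of b] comp_scale_right[OF rx[OF x] Tsp disj, of b]
        by (simp add: xs kb)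
    qed
  qed
  show "comp_multilinear c \<sigma> T xs \<in> op_space P (A \<union> I) (sum_list js + c) \<and>
      (\<forall>i<length ((k, l) # gs). \<forall>y\<in>op_space P {1..fst (((k, l) # gs) ! i)} (js ! i).
         comp_multilinear c \<sigma> T (xs[i := xs ! i + y]) = comp_multilinear c \<sigma> T xs + comp_multilinear c \<sigma> T (xs[i := y])) \<and>
      (\<forall>i<length ((k, l) # gs). \<forall>b. comp_multilinear c \<sigma> T (xs[i := op_scale P b (xs ! i)]) =
         op_scale P b (comp_multilinear c \<sigma> T xs))"
    using 1 2 3 by blast
qed

text \<open>The induction step for polynomiality. The \<epsilon>'s of X pass the later arguments on
  the left side and the value of T on the right side; the degrees of these differ by c, and the sign
  in \<open>comp_multilinear\<close> compensates for it because j is even.\<close>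

lemma extend_comp_multilinear:
  assumes T: "multilinear_on P gs I c T" and I: "finite I"
    and Xs: "length Xs = length gs" "length js = length gs"
    "\<And>i. i < length gs \<Longrightarrow> Xs ! i \<in> op_space (base_change P \<delta>) {1..fst (gs ! i)} (js ! i)"
    and X: "X \<in> op_space (base_change P \<delta>) {1..k} j" "even j"
    and A: "finite A" "0 \<notin> A" "A \<inter> I = {}"
    and \<sigma>: "inj_on \<sigma> {1..k}" "\<sigma> ` {1..k} = insert 0 A"
  shows "extend_multilinear P \<delta> (comp_multilinear c \<sigma> T) (X # Xs) =
    op_comp (base_change P \<delta>) 0 (op_relabel (base_change P \<delta>) \<sigma> X) (extend_multilinear P \<delta> T Xs)"
proof
  fix S
  show "extend_multilinear P \<delta> (comp_multilinear c \<sigma> T) (X # Xs) S =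
    op_comp (base_change P \<delta>) 0 (op_relabel (base_change P \<delta>) \<sigma> X) (extend_multilinear P \<delta> T Xs) S"
  proof (cases "S \<subseteq> {..<length \<delta>}")
    case S: True
    then have fS: "finite S" using finite_subset by blast
    let ?sp = "\<lambda>S. {Us \<in> set_splits S. length Us = length gs}"
    let ?t = "\<lambda>Us. T (map2 (\<lambda>X U. X U) Xs Us)"
    let ?E = "extend_multilinear P \<delta> T Xs"
    \<comment> \<open>The sign in the composition over dual numbers, with the degree that the value
      of the extension has at S - U whenever it is non-zero.\<close>
    define \<kappa> where "\<kappa> U = (ksgn (eps_deg \<delta> U) (sum_list js + c - eps_deg \<delta> (S - U)) * eps_sign \<delta> U (S - U) :: 'k)" for U
    have disj: "0 \<in> insert 0 A" "(insert 0 A - {0}) \<inter> I = {}" using A by auto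
    have rX: "op_relabel P \<sigma> (X U) \<in> op_space P (insert 0 A) (j - eps_deg \<delta> U)" if "U \<in> Pow S" for U
    proof -
      have "U \<subseteq> {..<length \<delta>}" using that S by auto
      then have "X U \<in> op_space P {1..k} (j - eps_deg \<delta> U)" using X(1) unfolding base_change_space by blast
      from relabel_space[OF this \<sigma>(1)] show ?thesis using \<sigma>(2) by simp
    qed
    have tsp: "?t Us \<in> op_space P I (sum_list js + c - eps_deg \<delta> (S - U))"
      if "U \<in> Pow S" "Us \<in> ?sp (S - U)" for U Us
    proof -
      have SU: "S - U \<subseteq> {..<length \<delta>}" using S by auto
      have Us: "Us \<in> set_splits (S - U)" "length Us = length gs" using that by auto
      show ?thesis
        by (rule space_cast[OF multilinear_onD(1)[OF T extend_multilinear_term(1-3)[OF Xs SU Us]]])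
          (use extend_multilinear_term(4)[OF Xs SU Us] in auto)
    qed
    have summand: "op_scale P (koszul_product P \<delta> (X # Xs) (U # Us)) (comp_multilinear c \<sigma> T (X U # map2 (\<lambda>X U. X U) Xs Us)) =
        op_scale P (\<kappa> U * koszul_product P \<delta> Xs Us) (op_comp P 0 (op_relabel P \<sigma> (X U)) (?t Us))"
      if U: "U \<in> Pow S" and Us: "Us \<in> ?sp (S - U)" for U Us
    \<comment> \<open>Where an argument vanishes \<open>degree_of\<close> is meaningless, but then
      both sides vanish by multilinearity.\<close>
    proof (cases "X U = 0 \<or> (\<exists>b<length gs. (Xs ! b) (Us ! b) = 0)")
      case True
      then show ?thesis
      proof
        assume "X U = 0"
        then show ?thesis using comp_zero_left[OF tsp[OF U Us]] by (simp add: comp_multilinear_def)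
      next
        assume "\<exists>b<length gs. (Xs ! b) (Us ! b) = 0"
        then obtain b where b: "b < length gs" "(Xs ! b) (Us ! b) = 0" by blast
        have SU: "S - U \<subseteq> {..<length \<delta>}" using S by auto
        have Us': "Us \<in> set_splits (S - U)" "length Us = length gs" using Us by auto
        have "?t Us = 0"
          by (rule multilinear_zero[OF T extend_multilinear_term(1-3)[OF Xs SU Us'] b(1)]) (use b Xs(1) Us'(2) in auto)
        then show ?thesis using comp_zero_right[OF rX[OF U] disj(1)] by (simp add: comp_multilinear_def)
      qed
    next
      case False
      have SU: "S - U \<subseteq> {..<length \<delta>}" "U \<subseteq> {..<length \<delta>}" "finite (S - U)" using S U fS by auto
      have Us': "Us \<in> set_splits (S - U)" "length Us = length gs" using Us by auto
      have deg: "degree_of P ((Xs ! b) (Us ! b)) = js ! b - eps_deg \<delta> (Us ! b)" if b: "b < length gs" for b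
      proof -
        have "(Xs ! b) (Us ! b) \<in> op_space P {1..fst (gs ! b)} (js ! b - eps_deg \<delta> (Us ! b))"
          using extend_multilinear_term(3)[OF Xs SU(1) Us' b] b Xs(1,2) Us' by simp
        then show ?thesis by (rule degree_of_eq) (use False b in blast)
      qed
      have "X U \<in> op_space P {1..k} (j - eps_deg \<delta> U)" using X(1) SU(2) unfolding base_change_space by blast
      then have degX: "degree_of P (X U) = j - eps_deg \<delta> U" using degree_of_eq False by blast
      have "(\<Prod>b<length Xs. ksgn (eps_deg \<delta> U) (degree_of P ((Xs ! b) (Us ! b))) * eps_sign \<delta> U (Us ! b)) =
          (\<Prod>b<length gs. ksgn (eps_deg \<delta> U) (js ! b - eps_deg \<delta> (Us ! b))) * (eps_sign \<delta> U (S - U) :: 'k)"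
        using deg Xs(1) Us' by (simp add: prod.distrib eps_splits(2)[OF Us'(1) SU(3)])
      also have "(\<Prod>b<length gs. ksgn (eps_deg \<delta> U) (js ! b - eps_deg \<delta> (Us ! b))) =
          (ksgn (eps_deg \<delta> U) (\<Sum>b<length gs. js ! b - eps_deg \<delta> (Us ! b)) :: 'k)"
        by (rule ksgn_sum[symmetric]) simp
      also have "(\<Sum>b<length gs. js ! b - eps_deg \<delta> (Us ! b)) = sum_list js - eps_deg \<delta> (S - U)"
        using Xs(2) Us' by (simp add: sum_subtractf eps_splits(1)[OF Us'(1) SU(3)] sum_list_sum_nth atLeast0LessThan)
      finally have "koszul_product P \<delta> (X # Xs) (U # Us) * ksgn c (degree_of P (X U)) =
          ksgn (eps_deg \<delta> U) (sum_list js - eps_deg \<delta> (S - U)) * ksgn c (eps_deg \<delta> U) *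
          eps_sign \<delta> U (S - U) * koszul_product P \<delta> Xs Us"
        using X(2) degX by (simp add: koszul_product_Cons ksgn_def)
      also have "ksgn (eps_deg \<delta> U) (sum_list js - eps_deg \<delta> (S - U)) * ksgn c (eps_deg \<delta> U) =
          (ksgn (eps_deg \<delta> U) (sum_list js + c - eps_deg \<delta> (S - U)) :: 'k)"
        by (auto simp: ksgn_def)
      finally show ?thesis by (simp add: comp_multilinear_def \<kappa>_def del: scale_koszul)
    qed
    have E: "?E (S - U) \<in> op_space P I (sum_list js + c - eps_deg \<delta> (S - U))" if "U \<in> Pow S" for U
    proof -
      have "S - U \<subseteq> {..<length \<delta>}" using S by auto
      then show ?thesis
        using extend_multilinear_space[OF T Xs I, unfolded base_change_space] by simp
    qed
    have "extend_multilinear P \<delta> (comp_multilinear c \<sigma> T) (X # Xs) S =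
        (\<Sum>(U, Us)\<in>(SIGMA U:Pow S. ?sp (S - U)).
          op_scale P (koszul_product P \<delta> (X # Xs) (U # Us)) (comp_multilinear c \<sigma> T (X U # map2 (\<lambda>X U. X U) Xs Us)))"
    proof -
      have inj: "inj_on (\<lambda>(U, Us). U # Us) (SIGMA U:Pow S. ?sp (S - U))" by (auto simp: inj_on_def)
      show ?thesis
        unfolding extend_multilinear_eq using S Xs(1)
        by (simp add: splits_Suc sum.reindex[OF inj[unfolded split_def]] split_def)
    qed
    also have "\<dots> = (\<Sum>U\<in>Pow S. \<Sum>Us\<in>?sp (S - U).
          op_scale P (koszul_product P \<delta> (X # Xs) (U # Us)) (comp_multilinear c \<sigma> T (X U # map2 (\<lambda>X U. X U) Xs Us)))"
      using fS by (subst sum.Sigma) (auto intro!: finite_splits)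
    also have "\<dots> = (\<Sum>U\<in>Pow S. op_scale P (\<kappa> U) (op_comp P 0 (op_relabel P \<sigma> (X U)) (?E (S - U))))"
    proof (rule sum.cong[OF HOL.refl])
      fix U assume U: "U \<in> Pow S"
      have "(\<Sum>Us\<in>?sp (S - U). op_scale P (koszul_product P \<delta> (X # Xs) (U # Us)) (comp_multilinear c \<sigma> T (X U # map2 (\<lambda>X U. X U) Xs Us))) =
          op_scale P (\<kappa> U) (\<Sum>Us\<in>?sp (S - U). op_scale P (koszul_product P \<delta> Xs Us) (op_comp P 0 (op_relabel P \<sigma> (X U)) (?t Us)))"
        using summand[OF U] by (simp add: vs.scale_sum_right)
      also have "(\<Sum>Us\<in>?sp (S - U). op_scale P (koszul_product P \<delta> Xs Us) (op_comp P 0 (op_relabel P \<sigma> (X U)) (?t Us))) =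
          op_comp P 0 (op_relabel P \<sigma> (X U)) (\<Sum>Us\<in>?sp (S - U). op_scale P (koszul_product P \<delta> Xs Us) (?t Us))"
      proof -
        have "op_comp P 0 (op_relabel P \<sigma> (X U)) (\<Sum>Us\<in>?sp (S - U). op_scale P (koszul_product P \<delta> Xs Us) (?t Us)) =
            (\<Sum>Us\<in>?sp (S - U). op_comp P 0 (op_relabel P \<sigma> (X U)) (op_scale P (koszul_product P \<delta> Xs Us) (?t Us)))"
          by (rule comp_sum_right[OF I space_scale[OF tsp[OF U]] rX[OF U] disj])
        also have "\<dots> = (\<Sum>Us\<in>?sp (S - U). op_scale P (koszul_product P \<delta> Xs Us) (op_comp P 0 (op_relabel P \<sigma> (X U)) (?t Us)))"
          by (intro sum.cong HOL.refl comp_scale_right[OF rX[OF U] tsp[OF U] disj])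
        finally show ?thesis ..
      qed
      also have "(\<Sum>Us\<in>?sp (S - U). op_scale P (koszul_product P \<delta> Xs Us) (?t Us)) = ?E (S - U)"
        using S Xs(1) by (auto simp: extend_multilinear_eq)
      finally show "(\<Sum>Us\<in>?sp (S - U). op_scale P (koszul_product P \<delta> (X # Xs) (U # Us)) (comp_multilinear c \<sigma> T (X U # map2 (\<lambda>X U. X U) Xs Us))) =
          op_scale P (\<kappa> U) (op_comp P 0 (op_relabel P \<sigma> (X U)) (?E (S - U)))" .
    qed
    also have "\<dots> = op_comp (base_change P \<delta>) 0 (op_relabel (base_change P \<delta>) \<sigma> X) ?E S"
    proof -
      have "op_scale P (\<kappa> U) (op_comp P 0 (op_relabel P \<sigma> (X U)) (?E (S - U))) =
          op_scale P (ksgn (eps_deg \<delta> U) (degree_of P (?E (S - U))) * eps_sign \<delta> U (S - U))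
            (op_comp P 0 (op_relabel P \<sigma> (X U)) (?E (S - U)))" if U: "U \<in> Pow S" for U
      proof (cases "?E (S - U) = 0")
        case True
        then show ?thesis using comp_zero_right[OF rX[OF U] disj(1)] by simp
      next
        case False
        then show ?thesis using degree_of_eq[OF E[OF U] False] by (simp add: \<kappa>_def)
      qed
      from sum.cong[OF HOL.refl this, of "Pow S"] show ?thesis using S by (simp add: base_change_comp)
    qed
    finally show ?thesis .
  qed (simp add: extend_multilinear_eq base_change_comp)
qed

text \<open>Induction along the chain from the innermost block outwards. The innermost operation
  enters through D after relabelling from a standard label set; each further operation becomes the
  new first argument of the monomial.\<close>

lemma chain_monomial:
  assumes D: "derivation P e D"
    and "finite I" "0 \<notin> I" "(Ss, ps) \<in> chain_index I K" "2 \<le> card (hd Ss)"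
  shows "\<exists>gs T. (\<forall>(m, l)\<in>set gs. 2 \<le> m) \<and>
    (\<Sum>(m, l)\<leftarrow>gs. mu_deg d m l) = 2 * int d * (int (card I) - 1) - 2 * int K \<and>
    multilinear_on P gs I e T \<and>
    (\<forall>\<delta>. \<forall>f\<in>Hom_points d P \<delta>. nest (op_comp (base_change P \<delta>)) (\<lambda>S r. f (mu d S r))
        (extend_map D (f (mu d (hd Ss) (hd ps)))) (zip (tl Ss) (tl ps)) =
      extend_multilinear P \<delta> T (map (\<lambda>(m, l). f (mu d {1..m} l)) gs))"
  using assms(2-)
proof (induction Ss arbitrary: I ps K rule: rev_induct)
  case Nil
  then show ?case by (simp add: chain_index_def)
next
  case (snoc A Ss)
  show ?case
  proof (cases "Ss = []")
    case True
    then obtain p where p: "ps = [p]" "A = I" "K = Suc p"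
      using snoc.prems(3) by (auto simp: chain_index_def ordered_partitions_singleton length_Suc_conv)
    have I: "finite I" "2 \<le> card I" using snoc.prems True p by auto
    obtain \<sigma> where \<sigma>: "inj_on \<sigma> {1..card I}" "\<sigma> ` {1..card I} = I"
      "\<And>p. (mu d I p :: 'k hterm set) = op_relabel (HyperCom d) \<sigma> (mu d {1..card I} p)"
      using mu_standard[OF I] by metis
    define T where "T xs = D (op_relabel P \<sigma> (hd xs))" for xs
    have "multilinear_on P [(card I, p)] I e T"
      unfolding multilinear_on_def
    proof (intro allI impI)
      fix xs js
      assume len: "length xs = length [(card I, p)]" "length js = length [(card I, p)]"
        and typed: "\<forall>i<length [(card I, p)]. xs ! i \<in> op_space P {1..fst ([(card I, p)] ! i)} (js ! i)"
      obtain x where x: "xs = [x]" using len(1) by (auto simp: length_Suc_conv)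
      obtain j where j: "js = [j]" using len(2) by (auto simp: length_Suc_conv)
      have xs: "x \<in> op_space P {1..card I} j" using typed x j by simp
      have r: "op_relabel P \<sigma> y \<in> op_space P I j" if "y \<in> op_space P {1..card I} j" for y
        using relabel_space[OF that \<sigma>(1)] \<sigma>(2) by simp
      have "T [x + y] = T [x] + T [y]" if "y \<in> op_space P {1..card I} j" for y
        using relabel_add[OF xs that \<sigma>(1)] derivationD(2)[OF D r[OF xs] r[OF that]] by (simp add: T_def)
      moreover have "T [op_scale P b x] = op_scale P b (T [x])" for b
        using relabel_scale[OF xs \<sigma>(1)] derivationD(3)[OF D r[OF xs]] by (simp add: T_def)
      moreover have "T [x] \<in> op_space P I (j + e)"
        using derivationD(1)[OF D r[OF xs]] by (simp add: T_def)
      ultimately show "T xs \<in> op_space P I (sum_list js + e) \<and>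
        (\<forall>i<length [(card I, p)]. \<forall>y\<in>op_space P {1..fst ([(card I, p)] ! i)} (js ! i).
           T (xs[i := xs ! i + y]) = T xs + T (xs[i := y])) \<and>
        (\<forall>i<length [(card I, p)]. \<forall>b. T (xs[i := op_scale P b (xs ! i)]) = op_scale P b (T xs))"
        by (simp add: x j)
    qed
    moreover have "extend_map D (f (mu d I p)) = extend_multilinear P \<delta> T [f (mu d {1..card I} p)]"
      if f: "f \<in> Hom_points d P \<delta>" for f \<delta>
    proof
      fix S
      have fh: "operad_hom (HyperCom d) (base_change P \<delta>) f" using f by (simp add: Hom_points_def)
      have "f (mu d I p) = op_relabel (base_change P \<delta>) \<sigma> (f (mu d {1..card I} p))"
        unfolding \<sigma>(3) by (rule operad_homD(4)[OF fh mu_space \<sigma>(1)]) (use I in auto)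
      moreover have "{Us \<in> set_splits S. length Us = Suc 0} = {[S]}"
        by (auto simp: set_splits_def length_Suc_conv)
      moreover have "f (mu d I p) S = 0" if "\<not> S \<subseteq> {..<length \<delta>}"
        using operad_homD(1)[OF fh mu_space[OF I]] that by (simp add: base_change_space)
      ultimately show "extend_map D (f (mu d I p)) S = extend_multilinear P \<delta> T [f (mu d {1..card I} p)] S"
        using derivation_zero[OF D]
        by (auto simp: extend_multilinear_eq koszul_product_def extend_map_def T_def)
    qed
    ultimately show ?thesis
      using p True I(2)
      by (intro exI[of _ "[(card I, p)]"] exI[of _ T]) (auto simp: nest_def mu_deg_def algebra_simps)
  next
    case False
    then obtain qs p where p: "ps = qs @ [p]"
      using snoc.prems(3) by (cases ps rule: rev_cases) (auto simp: chain_index_def)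
    have A: "A \<noteq> {}" "A \<subseteq> I" and in_chain: "(Ss, qs) \<in> chain_index (I - A) (K - Suc p)" and K: "Suc p \<le> K"
      using snoc.prems(3) False p by (auto simp: chain_index_def ordered_partitions_snoc)
    have qs: "qs \<noteq> []" "length qs = length Ss" using in_chain by (auto simp: chain_index_def)
    have fin: "finite A" "finite (I - A)" "0 \<notin> A" using A snoc.prems finite_subset by auto
    have "0 < card A" using A(1) fin(1) by (simp add: card_gt_0_iff)
    then have A': "finite (insert 0 A)" "2 \<le> card (insert 0 A)" "card (insert 0 A) = Suc (card A)" using fin by auto
    obtain \<sigma> where \<sigma>: "inj_on \<sigma> {1..Suc (card A)}" "\<sigma> ` {1..Suc (card A)} = insert 0 A"
      "\<And>p. (mu d (insert 0 A) p :: 'k hterm set) = op_relabel (HyperCom d) \<sigma> (mu d {1..Suc (card A)} p)"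
      using mu_standard[OF A'(1,2)] unfolding A'(3) by metis
    obtain gs T where gs: "\<forall>(m, l)\<in>set gs. 2 \<le> m"
      and deg: "(\<Sum>(m, l)\<leftarrow>gs. mu_deg d m l) = 2 * int d * (int (card (I - A)) - 1) - 2 * int (K - Suc p)"
      and T: "multilinear_on P gs (I - A) e T"
      and val: "\<And>\<delta> f. f \<in> Hom_points d P \<delta> \<Longrightarrow> nest (op_comp (base_change P \<delta>)) (\<lambda>S r. f (mu d S r))
          (extend_map D (f (mu d (hd Ss) (hd qs)))) (zip (tl Ss) (tl qs)) =
        extend_multilinear P \<delta> T (map (\<lambda>(m, l). f (mu d {1..m} l)) gs)"
      using snoc.IH[OF fin(2) _ in_chain] snoc.prems(2,4) False by auto
    let ?gs = "(Suc (card A), p) # gs" and ?T = "comp_multilinear e \<sigma> T"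
    have dis: "A \<inter> (I - A) = {}" and un: "A \<union> (I - A) = I" using A by auto
    have T': "multilinear_on P ?gs I e ?T"
      using comp_multilinear[OF T fin(1,3) dis \<sigma>(1,2)] un by simp
    have "card I = card A + card (I - A)"
      using A snoc.prems(1) fin by (metis card_Diff_subset card_mono le_add_diff_inverse)
    then have deg': "(\<Sum>(m, l)\<leftarrow>?gs. mu_deg d m l) = 2 * int d * (int (card I) - 1) - 2 * int K"
      using K deg by (simp add: mu_deg_def of_nat_diff algebra_simps)
    have val': "nest (op_comp (base_change P \<delta>)) (\<lambda>S r. f (mu d S r))
          (extend_map D (f (mu d (hd (Ss @ [A])) (hd ps)))) (zip (tl (Ss @ [A])) (tl ps)) =
        extend_multilinear P \<delta> ?T (map (\<lambda>(m, l). f (mu d {1..m} l)) ?gs)"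
      if f: "f \<in> Hom_points d P \<delta>" for \<delta> f
    proof -
      have fh: "operad_hom (HyperCom d) (base_change P \<delta>) f" using f by (simp add: Hom_points_def)
      have X: "f (mu d {1..Suc (card A)} p) \<in> op_space (base_change P \<delta>) {1..Suc (card A)} (mu_deg d (Suc (card A)) p)"
        using operad_homD(1)[OF fh mu_space[of "{1..Suc (card A)}" d p]] \<open>0 < card A\<close> by simp
      have Xs: "map (\<lambda>(m, l). f (mu d {1..m} l)) gs ! i \<in> op_space (base_change P \<delta>) {1..fst (gs ! i)}
          (map (\<lambda>(m, l). mu_deg d m l) gs ! i)" if i: "i < length gs" for i
      proof -
        obtain m l where ml: "gs ! i = (m, l)" by (cases "gs ! i")
        then have "2 \<le> m" using gs nth_mem[OF i] by auto
        then show ?thesis using operad_homD(1)[OF fh mu_space[of "{1..m}" d l]] ml i by simp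
      qed
      have "f (mu d (insert 0 A) p) = op_relabel (base_change P \<delta>) \<sigma> (f (mu d {1..Suc (card A)} p))"
        unfolding \<sigma>(3) by (rule operad_homD(4)[OF fh mu_space \<sigma>(1)]) (use A' in auto)
      then show ?thesis
        using extend_comp_multilinear[OF T fin(2) _ _ Xs X _ fin(1,3) dis \<sigma>(1,2)] val[OF f] p qs False
        by (simp add: nest_snoc mu_deg_def)
    qed
    show ?thesis
      by (rule exI[of _ ?gs], rule exI[of _ ?T]) (use gs deg' T' val' \<open>0 < card A\<close> in auto)
  qed
qed

definition polynomial_in_generators ::
  "nat \<Rightarrow> nat \<Rightarrow> int \<Rightarrow> (int list \<Rightarrow> ('k hterm set \<Rightarrow> nat set \<Rightarrow> 'a) \<Rightarrow> nat set \<Rightarrow> 'a) \<Rightarrow> bool" where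
  "polynomial_in_generators d n c V \<longleftrightarrow> (\<exists>Ms.
     (\<forall>(gs, T)\<in>set Ms. (\<forall>(m, l)\<in>set gs. 2 \<le> m) \<and>
        graded_multilinear P gs n (c - (\<Sum>(m, l)\<leftarrow>gs. mu_deg d m l)) T) \<and>
     (\<forall>\<delta>. \<forall>f\<in>Hom_points d P \<delta>.
        V \<delta> f = (\<Sum>(gs, T)\<leftarrow>Ms. extend_multilinear P \<delta> T (map (\<lambda>(m, l). f (mu d {1..m} l)) gs))))"

lemma polynomial_add:
  assumes "polynomial_in_generators d n c V" "polynomial_in_generators d n c W"
  shows "polynomial_in_generators d n c (\<lambda>\<delta> f. V \<delta> f + W \<delta> f)"
proof -
  obtain Ms Ns where
    "\<forall>(gs, T)\<in>set Ms. (\<forall>(m, l)\<in>set gs. 2 \<le> m) \<and>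
        graded_multilinear P gs n (c - (\<Sum>(m, l)\<leftarrow>gs. mu_deg d m l)) T"
    "\<forall>\<delta>. \<forall>f\<in>Hom_points d P \<delta>.
        V \<delta> f = (\<Sum>(gs, T)\<leftarrow>Ms. extend_multilinear P \<delta> T (map (\<lambda>(m, l). f (mu d {1..m} l)) gs))"
    "\<forall>(gs, T)\<in>set Ns. (\<forall>(m, l)\<in>set gs. 2 \<le> m) \<and>
        graded_multilinear P gs n (c - (\<Sum>(m, l)\<leftarrow>gs. mu_deg d m l)) T"
    "\<forall>\<delta>. \<forall>f\<in>Hom_points d P \<delta>.
        W \<delta> f = (\<Sum>(gs, T)\<leftarrow>Ns. extend_multilinear P \<delta> T (map (\<lambda>(m, l). f (mu d {1..m} l)) gs))"
    using assms unfolding polynomial_in_generators_def by blast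
  then show ?thesis
    unfolding polynomial_in_generators_def by (intro exI[of _ "Ms @ Ns"]) auto
qed

lemma polynomial_sum:
  assumes "\<And>i. i \<in> A \<Longrightarrow> polynomial_in_generators d n c (V i)"
  shows "polynomial_in_generators d n c (\<lambda>\<delta> f. \<Sum>i\<in>A. V i \<delta> f)"
proof -
  have zero: "polynomial_in_generators d n c (\<lambda>\<delta> f. 0)"
    unfolding polynomial_in_generators_def by (rule exI[of _ "[]"]) auto
  show ?thesis
    using assms
  proof (induction A rule: infinite_finite_induct)
    case (insert i A)
    have "polynomial_in_generators d n c (\<lambda>\<delta> f. V i \<delta> f + (\<Sum>i\<in>A. V i \<delta> f))"
      by (rule polynomial_add) (use insert in auto)
    then show ?case by (simp only: sum.insert[OF insert(1,2)])
  qed (simp_all add: zero)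
qed

lemma chain_polynomial:
  assumes D: "derivation P (e + 2 * int p) D" and chain: "(Ss, ps) \<in> chain_index {1..n} (Suc (k + p))"
    and "2 \<le> card (hd Ss)"
  shows "polynomial_in_generators d n (e + mu_deg d n k)
    (\<lambda>\<delta> f. nest (op_comp (base_change P \<delta>)) (\<lambda>S r. f (mu d S r))
      (extend_map D (f (mu d (hd Ss) (hd ps)))) (zip (tl Ss) (tl ps)))"
proof -
  obtain gs T where gs: "\<forall>(m, l)\<in>set gs. 2 \<le> m"
    and deg: "(\<Sum>(m, l)\<leftarrow>gs. mu_deg d m l) = 2 * int d * (int (card {1..n}) - 1) - 2 * int (Suc (k + p))"
    and T: "multilinear_on P gs {1..n} (e + 2 * int p) T"
    and val: "\<And>\<delta> f. f \<in> Hom_points d P \<delta> \<Longrightarrow> nest (op_comp (base_change P \<delta>)) (\<lambda>S r. f (mu d S r))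
          (extend_map D (f (mu d (hd Ss) (hd ps)))) (zip (tl Ss) (tl ps)) =
        extend_multilinear P \<delta> T (map (\<lambda>(m, l). f (mu d {1..m} l)) gs)"
    using chain_monomial[OF D _ _ chain assms(3), of d] by auto
  \<comment> \<open>The chain has exponent k + p + 1 rather than k + 1; the resulting 2p is the
    difference between the degrees of D and of its vector field.\<close>
  have "e + mu_deg d n k - (\<Sum>(m, l)\<leftarrow>gs. mu_deg d m l) = e + 2 * int p"
    unfolding deg by (simp add: mu_deg_def algebra_simps)
  from T[folded this] show ?thesis
    unfolding polynomial_in_generators_def graded_multilinear_iff
    using gs val by (intro exI[of _ "[(gs, T)]"]) simp
qed

lemma action_formula_polynomial:
  assumes D: "derivation P (e + 2 * int p) D" and n: "2 \<le> n"
  shows "polynomial_in_generators d n (e + mu_deg d n k) (\<lambda>\<delta> f. action_formula d P D p \<delta> f n k)"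
proof -
  \<comment> \<open>The first term of the formula is the chain with the single block {1..n}.\<close>
  have "polynomial_in_generators d n (e + mu_deg d n k) (\<lambda>\<delta> f. extend_map D (f (mu d {1..n} (k + p))))"
    using chain_polynomial[OF D, of "[{1..n}]" "[k + p]" n k d] n
    by (simp add: nest_def chain_index_def ordered_partitions_singleton)
  moreover have "polynomial_in_generators d n (e + mu_deg d n k) (\<lambda>\<delta> f. case x of (Ss, ps) \<Rightarrow>
        nest (op_comp (base_change P \<delta>)) (\<lambda>S r. f (mu d S r))
          (extend_map D (f (mu d (hd Ss) (hd ps)))) (zip (tl Ss) (butlast (tl ps) @ [k + last ps])))"
    if x: "x \<in> action_index n p" for x
  proof -
    obtain Ss ps where xs: "x = (Ss, ps)" by (cases x)
    obtain p0 qs where ps: "ps = p0 # qs" "qs \<noteq> []"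
      using x xs by (cases ps; cases "tl ps") (auto simp: action_index_def)
    have "sum_list qs = sum_list (butlast qs) + last qs"
      using ps(2) by (metis append_butlast_last_id sum_list.append sum_list.Cons sum_list.Nil add_0_right)
    \<comment> \<open>Adding k to the last upper index turns an index of the formula into a chain of
      exponent k + p + 1.\<close>
    then have "(Ss, p0 # butlast qs @ [k + last qs]) \<in> chain_index {1..n} (Suc (k + p))"
      using x xs ps by (auto simp: action_index_def chain_index_def)
    from chain_polynomial[OF D this] show ?thesis using x xs ps by (simp add: action_index_def)
  qed
  ultimately show ?thesis
    unfolding action_formula_def by (intro polynomial_add polynomial_sum)
qed

end

section \<open>The vector field of a power series of derivations\<close>

lemma HyperCom_closed:
  "u \<in> op_space (HyperCom d) I j \<Longrightarrow> v \<in> op_space (HyperCom d) I j \<Longrightarrow>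
    op_add (HyperCom d) u v \<in> op_space (HyperCom d) I j"
  "u \<in> op_space (HyperCom d) I j \<Longrightarrow> op_scale (HyperCom d) c u \<in> op_space (HyperCom d) I j"
  "u \<in> op_space (HyperCom d) I j \<Longrightarrow> inj_on \<sigma> I \<Longrightarrow>
    op_relabel (HyperCom d) \<sigma> u \<in> op_space (HyperCom d) (\<sigma> ` I) j"
  "u \<in> op_space (HyperCom d) I i \<Longrightarrow> v \<in> op_space (HyperCom d) J j \<Longrightarrow> s \<in> I \<Longrightarrow> (I - {s}) \<inter> J = {} \<Longrightarrow>
    op_comp (HyperCom d) s u v \<in> op_space (HyperCom d) ((I - {s}) \<union> J) (i + j)"
proof -
  show "op_add (HyperCom d) u v \<in> op_space (HyperCom d) I j"
    if u: "u \<in> op_space (HyperCom d) I j" and v: "v \<in> op_space (HyperCom d) I j"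
  proof -
    obtain t where t: "wf_term d t" "arity t = I" "tdeg d t = j" "u = hc_class d t" using u by (rule HyperComE)
    obtain t' where t': "wf_term d t'" "arity t' = I" "tdeg d t' = j" "v = hc_class d t'" using v by (rule HyperComE)
    show ?thesis using hc_class_ops(1)[of d t t'] hc_class_space[of d "Add t t'"] t t' by simp
  qed
  show "op_scale (HyperCom d) c u \<in> op_space (HyperCom d) I j" if u: "u \<in> op_space (HyperCom d) I j"
  proof -
    obtain t where t: "wf_term d t" "arity t = I" "tdeg d t = j" "u = hc_class d t" using u by (rule HyperComE)
    show ?thesis using hc_class_ops(2)[of d c t] hc_class_space[of d "Scale c t"] t by simp
  qed
  show "op_relabel (HyperCom d) \<sigma> u \<in> op_space (HyperCom d) (\<sigma> ` I) j"
    if u: "u \<in> op_space (HyperCom d) I j" and \<sigma>: "inj_on \<sigma> I"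
  proof -
    obtain t where t: "wf_term d t" "arity t = I" "tdeg d t = j" "u = hc_class d t" using u by (rule HyperComE)
    show ?thesis using hc_class_ops(3)[of d \<sigma> t] hc_class_space[of d "Relabel \<sigma> t"] t \<sigma> by simp
  qed
  show "op_comp (HyperCom d) s u v \<in> op_space (HyperCom d) ((I - {s}) \<union> J) (i + j)"
    if u: "u \<in> op_space (HyperCom d) I i" and v: "v \<in> op_space (HyperCom d) J j"
      and s: "s \<in> I" "(I - {s}) \<inter> J = {}"
  proof -
    obtain t where t: "wf_term d t" "arity t = I" "tdeg d t = i" "u = hc_class d t" using u by (rule HyperComE)
    obtain t' where t': "wf_term d t'" "arity t' = J" "tdeg d t' = j" "v = hc_class d t'" using v by (rule HyperComE)
    show ?thesis using hc_class_ops(4)[of d s t t'] hc_class_space[of d "Comp s t t'"] t t' s by simp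
  qed
qed

text \<open>Each condition on a derivation involves at most three elements, so an infinite sum that
  is finite on every element inherits the conditions from its finite partial sums.\<close>

lemma f_derivation_locally:
  fixes E :: "'k::field_char_0 hterm set \<Rightarrow> 'b"
  assumes loc: "\<And>I i J j K k u v w. \<lbrakk>u \<in> op_space (HyperCom d) I i; v \<in> op_space (HyperCom d) J j;
      w \<in> op_space (HyperCom d) K k\<rbrakk> \<Longrightarrow>
      \<exists>F. f_derivation (HyperCom d) Q f e F \<and> F u = E u \<and> F v = E v \<and> F w = E w"
  shows "f_derivation (HyperCom d) Q f e E"
  unfolding f_derivation_def
proof (intro conjI allI ballI impI)
  fix I j and u :: "'k hterm set" assume u: "u \<in> op_space (HyperCom d) I j"
  show "E u \<in> op_space Q I (j + e)"
    using loc[OF u u u] f_derivationD(1)[OF _ u] by metis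
  show "E (op_add (HyperCom d) u v) = op_add Q (E u) (E v)" if v: "v \<in> op_space (HyperCom d) I j" for v
    using loc[OF u v HyperCom_closed(1)[OF u v]] f_derivationD(2)[OF _ u v] by metis
  show "E (op_scale (HyperCom d) c u) = op_scale Q c (E u)" for c
    using loc[OF u u HyperCom_closed(2)[OF u, of c]] f_derivationD(3)[OF _ u, where c = c] by metis
  show "E (op_relabel (HyperCom d) \<sigma> u) = op_relabel Q \<sigma> (E u)" if \<sigma>: "inj_on \<sigma> I" for \<sigma>
    using loc[OF u u HyperCom_closed(3)[OF u \<sigma>]] f_derivationD(4)[OF _ u \<sigma>] by metis
  show "E (op_comp (HyperCom d) s u v) =
      op_add Q (op_comp Q s (E u) (f v)) (op_scale Q (ksgn e j) (op_comp Q s (f u) (E v)))"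
    if v: "v \<in> op_space (HyperCom d) J k" and s: "s \<in> I" "(I - {s}) \<inter> J = {}" for J k s v
    using loc[OF u v HyperCom_closed(4)[OF u v s]] f_derivationD(5)[OF _ u v s] by metis
qed

definition degrees ::
  "('k::field_char_0, 'a::ab_group_add) operad_str \<Rightarrow> (int \<Rightarrow> 'a \<Rightarrow> 'a) \<Rightarrow> int set" where
  "degrees P D = {e. \<exists>I j. \<exists>x\<in>op_space P I j. D e x \<noteq> 0}"

lemma not_degrees: "e \<notin> degrees P D \<Longrightarrow> x \<in> op_space P I j \<Longrightarrow> D e x = 0"
  by (auto simp: degrees_def)

lemma Der_iff: "D \<in> Der P \<longleftrightarrow> (\<forall>e. derivation P e (D e)) \<and> finite (degrees P D)"
  by (simp add: Der_def degrees_def)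

lemma Der_seriesD:
  assumes "a \<in> Der_series P"
  shows "a p \<in> Der P" "derivation P e (a p e)" "finite (degrees P (a p))"
  using assms by (simp_all add: Der_series_def Der_iff)

text \<open>The component of degree e of the coefficient of z^p contributes to the vector field in
  degree e - 2p, as z has degree -2.\<close>

definition vf_degrees ::
  "('k::field_char_0, 'a::ab_group_add) operad_str \<Rightarrow> (nat \<Rightarrow> int \<Rightarrow> 'a \<Rightarrow> 'a) \<Rightarrow> nat \<Rightarrow> int set" where
  "vf_degrees P a M = (\<Union>p<M. (\<lambda>e. e - 2 * int p) ` degrees P (a p))"

lemma finite_vf_degrees: "a \<in> Der_series P \<Longrightarrow> finite (vf_degrees P a M)"
  by (simp add: vf_degrees_def Der_seriesD(3))

lemma not_vf_degrees:
  assumes "e \<notin> vf_degrees P a M" "p < M" "x \<in> op_space P I j"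
  shows "a p (e + 2 * int p) x = 0"
proof (rule not_degrees[OF _ assms(3)])
  show "e + 2 * int p \<notin> degrees P (a p)"
  proof
    assume "e + 2 * int p \<in> degrees P (a p)"
    then have "e \<in> (\<lambda>e. e - 2 * int p) ` degrees P (a p)" by (intro image_eqI[of _ _ "e + 2 * int p"]) auto
    then show False using assms(1,2) unfolding vf_degrees_def by blast
  qed
qed

definition action_vf ::
  "nat \<Rightarrow> ('k::field_char_0, 'a::ab_group_add) operad_str \<Rightarrow> (nat \<Rightarrow> int \<Rightarrow> 'a \<Rightarrow> 'a) \<Rightarrow> int \<Rightarrow> int list \<Rightarrow>
    ('k hterm set \<Rightarrow> nat set \<Rightarrow> 'a) \<Rightarrow> 'k hterm set \<Rightarrow> nat set \<Rightarrow> 'a" where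
  "action_vf d P a e \<delta> f u = Sum_any (\<lambda>p. monomial_vf d P (a p (e + 2 * int p)) p e \<delta> f u)"

context operad
begin

lemma f_derivation_sum:
  fixes R :: "('k, 'x) operad_str"
  assumes "operad_hom R P f" "\<And>i. i \<in> A \<Longrightarrow> f_derivation R P f e (E i)"
  shows "f_derivation R P f e (\<lambda>u. \<Sum>i\<in>A. E i u)"
  using f_derivation_lincomb[OF assms, where w = "\<lambda>_. 1"] by simp

lemma operad_hom_id: "operad_hom P P (\<lambda>x. x)"
  by (simp add: operad_hom_def)

lemma Der_lincomb:
  assumes A: "finite A" and D: "\<And>i. i \<in> A \<Longrightarrow> D i \<in> Der P"
  shows "(\<lambda>e x. \<Sum>i\<in>A. op_scale P (w i) (D i e x)) \<in> Der P"
  unfolding Der_iff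
proof (intro conjI allI)
  show "derivation P e (\<lambda>x. \<Sum>i\<in>A. op_scale P (w i) (D i e x))" for e
    using D by (intro f_derivation_lincomb[OF operad_hom_id]) (simp add: Der_iff)
  have "degrees P (\<lambda>e x. \<Sum>i\<in>A. op_scale P (w i) (D i e x)) \<subseteq> (\<Union>i\<in>A. degrees P (D i))"
  proof
    fix e assume "e \<in> degrees P (\<lambda>e x. \<Sum>i\<in>A. op_scale P (w i) (D i e x))"
    then obtain I j x where x: "x \<in> op_space P I j" "(\<Sum>i\<in>A. op_scale P (w i) (D i e x)) \<noteq> 0"
      by (auto simp: degrees_def)
    then obtain i where "i \<in> A" "op_scale P (w i) (D i e x) \<noteq> 0" by (meson sum.not_neutral_contains_not_neutral)
    then show "e \<in> (\<Union>i\<in>A. degrees P (D i))" using x(1) by (auto simp: degrees_def)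
  qed
  then show "finite (degrees P (\<lambda>e x. \<Sum>i\<in>A. op_scale P (w i) (D i e x)))"
    by (rule finite_subset) (use A D in \<open>auto simp: Der_iff\<close>)
qed

lemma z_monomial_Der_series:
  assumes "D \<in> Der P"
  shows "z_monomial D p \<in> Der_series P"
proof -
  have "(0 :: int \<Rightarrow> 'a \<Rightarrow> 'a) \<in> Der P"
    using Der_lincomb[of "{}" "\<lambda>_ :: unit. D" "\<lambda>_. 0"] by (simp add: zero_fun_def)
  then show ?thesis using assms by (simp add: Der_series_def z_monomial_def)
qed

lemma monomial_vf_zero:
  assumes f: "f \<in> Hom_points d P \<delta>" and D: "derivation P (e + 2 * int p) D"
    and zero: "\<And>I j x. x \<in> op_space P I j \<Longrightarrow> D x = 0" and u: "u \<in> op_space (HyperCom d) I j"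
  shows "monomial_vf d P D p e \<delta> f u = 0"
proof -
  have "monomial_vf d P D p e \<delta> f u =
      (\<Sum>i\<in>({} :: unit set). op_scale (base_change P \<delta>) 0 (monomial_vf d P D p e \<delta> f u))"
    by (rule monomial_vf_lincomb[OF f _ D _ u]) (use zero in auto)
  then show ?thesis by simp
qed

lemma monomial_vf_mu:
  assumes f: "f \<in> Hom_points d P \<delta>" and D: "derivation P (e + 2 * int p) D" and S: "finite S" "2 \<le> card S"
  shows "monomial_vf d P D p e \<delta> f (mu d S k) =
    hc_gens.act (base_change P \<delta>) (\<lambda>I p. f (mu d I p)) (extend_map D) p S k"
proof -
  interpret N: hc_point "base_change P \<delta>" d "\<lambda>I p. f (mu d I p)" by (rule Hom_points_hc_point[OF f])
  from mu_standard[OF S, where d = d and 'k = 'k] obtain \<sigma> where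
    \<sigma>: "inj_on \<sigma> {1..card S}" "\<sigma> ` {1..card S} = S"
    "mu d S k = op_relabel (HyperCom d) \<sigma> (mu d {1..card S} k :: 'k hterm set)"
    by metis
  have I: "finite {1..card S}" "2 \<le> card {1..card S}" using S by simp_all
  have "monomial_vf d P D p e \<delta> f (mu d S k) =
      op_relabel (base_change P \<delta>) \<sigma> (monomial_vf d P D p e \<delta> f (mu d {1..card S} k))"
    unfolding \<sigma>(3) by (rule f_derivationD(4)[OF monomial_vf(1)[OF f D] mu_space[OF I] \<sigma>(1)])
  also have "\<dots> = op_relabel (base_change P \<delta>) \<sigma> (N.act (extend_map D) p {1..card S} k)"
    unfolding monomial_vf(2)[OF f D S(2)] action_formula_eq_act[OF f D S(2)] ..
  also have "\<dots> = N.act (extend_map D) p (\<sigma> ` {1..card S}) k"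
    using N.is_gens_act[OF derivation_extend_map[OF D], of p] I \<sigma>(1) unfolding is_gens_def by metis
  finally show ?thesis by (simp only: \<sigma>(2))
qed

lemma monomial_vf_mu_zero:
  assumes f: "f \<in> Hom_points d P \<delta>" and D: "derivation P (e + 2 * int p) D" and S: "finite S" "2 \<le> card S"
    and p: "d * card S \<le> p"
  shows "monomial_vf d P D p e \<delta> f (mu d S k) = 0"
proof -
  interpret N: hc_point "base_change P \<delta>" d "\<lambda>I p. f (mu d I p)" by (rule Hom_points_hc_point[OF f])
  from mu_standard[OF S, where d = d and 'k = 'k] obtain \<sigma> where
    \<sigma>: "inj_on \<sigma> {1..card S}"
    "mu d S k = op_relabel (HyperCom d) \<sigma> (mu d {1..card S} k :: 'k hterm set)"
    by metis
  have I: "finite {1..card S}" "2 \<le> card {1..card S}" using S by simp_all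
  have "monomial_vf d P D p e \<delta> f (mu d S k) =
      op_relabel (base_change P \<delta>) \<sigma> (monomial_vf d P D p e \<delta> f (mu d {1..card S} k))"
    unfolding \<sigma>(2) by (rule f_derivationD(4)[OF monomial_vf(1)[OF f D] mu_space[OF I] \<sigma>(1)])
  also have "monomial_vf d P D p e \<delta> f (mu d {1..card S} k) = 0"
    unfolding monomial_vf(2)[OF f D S(2)] action_formula_eq_act[OF f D S(2)]
    by (rule N.act_eq_zero[OF derivation_extend_map[OF D] S(2) p])
  finally show ?thesis using N.relabel_zero by simp
qed

lemma action_vf_eq_sum:
  assumes "\<And>p. M \<le> p \<Longrightarrow> monomial_vf d P (a p (e + 2 * int p)) p e \<delta> f u = 0"
  shows "action_vf d P a e \<delta> f u = (\<Sum>p<M. monomial_vf d P (a p (e + 2 * int p)) p e \<delta> f u)"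
  unfolding action_vf_def by (rule Sum_any.expand_superset) (use assms in \<open>auto simp: not_le[symmetric]\<close>)

lemma action_vf_eventually:
  assumes u: "u \<in> op_space (HyperCom d) I j"
  shows "\<exists>N. \<forall>M a e \<delta> f. N \<le> M \<longrightarrow> a \<in> Der_series P \<longrightarrow> f \<in> Hom_points d P \<delta> \<longrightarrow>
    action_vf d P a e \<delta> f u = (\<Sum>p<M. monomial_vf d P (a p (e + 2 * int p)) p e \<delta> f u)"
proof -
  obtain N where N: "\<And>p e \<delta> f D. \<lbrakk>N \<le> p; f \<in> Hom_points d P \<delta>; derivation P (e + 2 * int p) D\<rbrakk> \<Longrightarrow>
      monomial_vf d P D p e \<delta> f u = 0"
    using monomial_vf_eventually_zero[OF u] by blast
  show ?thesis
    by (intro exI[of _ N] allI impI action_vf_eq_sum N Der_seriesD(2)) auto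
qed

lemma action_vf_f_derivation:
  assumes a: "a \<in> Der_series P" and f: "f \<in> Hom_points d P \<delta>"
  shows "f_derivation (HyperCom d) (base_change P \<delta>) f e (action_vf d P a e \<delta> f)"
proof (rule f_derivation_locally)
  interpret Q: operad "base_change P \<delta>" by (rule operad_base_change)
  have fh: "operad_hom (HyperCom d) (base_change P \<delta>) f" using f by (simp add: Hom_points_def)
  fix I i J j K k and u v w :: "'k hterm set"
  assume u: "u \<in> op_space (HyperCom d) I i" and v: "v \<in> op_space (HyperCom d) J j"
    and w: "w \<in> op_space (HyperCom d) K k"
  let ?F = "\<lambda>M u. \<Sum>p<M. monomial_vf d P (a p (e + 2 * int p)) p e \<delta> f u"
  obtain N1 where N1: "\<And>M a e \<delta> f. \<lbrakk>N1 \<le> M; a \<in> Der_series P; f \<in> Hom_points d P \<delta>\<rbrakk> \<Longrightarrow>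
      action_vf d P a e \<delta> f u = (\<Sum>p<M. monomial_vf d P (a p (e + 2 * int p)) p e \<delta> f u)"
    using action_vf_eventually[OF u] by blast
  obtain N2 where N2: "\<And>M a e \<delta> f. \<lbrakk>N2 \<le> M; a \<in> Der_series P; f \<in> Hom_points d P \<delta>\<rbrakk> \<Longrightarrow>
      action_vf d P a e \<delta> f v = (\<Sum>p<M. monomial_vf d P (a p (e + 2 * int p)) p e \<delta> f v)"
    using action_vf_eventually[OF v] by blast
  obtain N3 where N3: "\<And>M a e \<delta> f. \<lbrakk>N3 \<le> M; a \<in> Der_series P; f \<in> Hom_points d P \<delta>\<rbrakk> \<Longrightarrow>
      action_vf d P a e \<delta> f w = (\<Sum>p<M. monomial_vf d P (a p (e + 2 * int p)) p e \<delta> f w)"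
    using action_vf_eventually[OF w] by blast
  \<comment> \<open>One partial sum that is long enough for all three elements.\<close>
  let ?M = "N1 + N2 + N3"
  have "f_derivation (HyperCom d) (base_change P \<delta>) f e (?F ?M)"
    by (rule Q.f_derivation_sum[OF fh monomial_vf(1)[OF f Der_seriesD(2)[OF a]]])
  then show "\<exists>F. f_derivation (HyperCom d) (base_change P \<delta>) f e F \<and>
      F u = action_vf d P a e \<delta> f u \<and> F v = action_vf d P a e \<delta> f v \<and> F w = action_vf d P a e \<delta> f w"
    using N1[of ?M, OF _ a f] N2[of ?M, OF _ a f] N3[of ?M, OF _ a f] by (intro exI[of _ "?F ?M"]) simp
qed

lemma action_vf_mu:
  assumes a: "a \<in> Der_series P" and f: "f \<in> Hom_points d P \<delta>" and S: "finite S" "2 \<le> card S"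
    and M: "d * card S \<le> M"
  shows "action_vf d P a e \<delta> f (mu d S k) = (\<Sum>p<M. monomial_vf d P (a p (e + 2 * int p)) p e \<delta> f (mu d S k))"
  by (rule action_vf_eq_sum, rule monomial_vf_mu_zero[OF f Der_seriesD(2)[OF a] S]) (use M in auto)

lemma action_vf_not_degrees:
  assumes a: "a \<in> Der_series P" and f: "f \<in> Hom_points d P \<delta>" and u: "u \<in> op_space (HyperCom d) I j"
    and e: "e \<notin> vf_degrees P a M"
    and eq: "action_vf d P a e \<delta> f u = (\<Sum>p<M. monomial_vf d P (a p (e + 2 * int p)) p e \<delta> f u)"
  shows "action_vf d P a e \<delta> f u = 0"
  unfolding eq
  by (rule sum.neutral) (use monomial_vf_zero[OF f Der_seriesD(2)[OF a] not_vf_degrees[OF e] u] in auto)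

lemma action_vf_vector_field:
  assumes a: "a \<in> Der_series P"
  shows "vector_field d P (action_vf d P a)"
  unfolding vector_field_def homogeneous_vector_field_def
proof (intro conjI allI impI ballI)
  show "f_derivation (HyperCom d) (base_change P \<delta>) f e (action_vf d P a e \<delta> f)" if "f \<in> Hom_points d P \<delta>" for f \<delta> e
    by (rule action_vf_f_derivation[OF a that])
  fix n k :: nat assume n: "2 \<le> n"
  have S: "finite {1..n}" "2 \<le> card {1..n}" using n by simp_all
  \<comment> \<open>On n labels all powers of z from d n on act as zero, so the infinite sum is a
    finite sum of polynomials.\<close>
  have eq: "action_vf d P a e \<delta> f (mu d {1..n} k) =
      (\<Sum>p<d * n. monomial_vf d P (a p (e + 2 * int p)) p e \<delta> f (mu d {1..n} k))"
    if "f \<in> Hom_points d P \<delta>" for f \<delta> e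
    by (rule action_vf_mu[OF a that S]) simp
  show "\<exists>Ms. (\<forall>(gs, T)\<in>set Ms. (\<forall>(m, l)\<in>set gs. 2 \<le> m) \<and>
           graded_multilinear P gs n (e + mu_deg d n k - (\<Sum>(m, l)\<leftarrow>gs. mu_deg d m l)) T) \<and>
        (\<forall>\<delta>. \<forall>f\<in>Hom_points d P \<delta>. action_vf d P a e \<delta> f (mu d {1..n} k) =
             (\<Sum>(gs, T)\<leftarrow>Ms. extend_multilinear P \<delta> T (map (\<lambda>(m, l). f (mu d {1..m} l)) gs)))" for e
  proof -
    have "polynomial_in_generators d n (e + mu_deg d n k)
        (\<lambda>\<delta> f. \<Sum>p<d * n. action_formula d P (a p (e + 2 * int p)) p \<delta> f n k)"
      by (intro polynomial_sum action_formula_polynomial Der_seriesD(2)[OF a] n)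
    then show ?thesis
      unfolding polynomial_in_generators_def
      by (simp add: eq monomial_vf(2)[OF _ Der_seriesD(2)[OF a] n] del: One_nat_def cong: ball_cong)
  qed
  have "{e. \<exists>\<delta>. \<exists>f\<in>Hom_points d P \<delta>. action_vf d P a e \<delta> f (mu d {1..n} k) \<noteq> 0} \<subseteq> vf_degrees P a (d * n)"
    using action_vf_not_degrees[OF a _ mu_space[OF S] _ eq] by blast
  then show "finite {e. \<exists>\<delta>. \<exists>f\<in>Hom_points d P \<delta>. action_vf d P a e \<delta> f (mu d {1..n} k) \<noteq> 0}"
    by (rule finite_subset) (rule finite_vf_degrees[OF a])
qed

lemma action_vf_lincomb:
  assumes ai: "\<And>i. i \<in> A \<Longrightarrow> a i \<in> Der_series P" and a': "a' \<in> Der_series P"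
    and eq: "\<And>p e I j x. x \<in> op_space P I j \<Longrightarrow> a' p e x = (\<Sum>i\<in>A. op_scale P (w i) (a i p e x))"
    and f: "f \<in> Hom_points d P \<delta>" and u: "u \<in> op_space (HyperCom d) I j"
  shows "action_vf d P a' e \<delta> f u = (\<Sum>i\<in>A. op_scale (base_change P \<delta>) (w i) (action_vf d P (a i) e \<delta> f u))"
proof -
  interpret Q: operad "base_change P \<delta>" by (rule operad_base_change)
  obtain N where "\<And>M a e \<delta> f. \<lbrakk>N \<le> M; a \<in> Der_series P; f \<in> Hom_points d P \<delta>\<rbrakk> \<Longrightarrow>
      action_vf d P a e \<delta> f u = (\<Sum>p<M. monomial_vf d P (a p (e + 2 * int p)) p e \<delta> f u)"
    using action_vf_eventually[OF u] by blast
  note N = this[OF order_refl _ f]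
  have "action_vf d P a' e \<delta> f u = (\<Sum>p<N. \<Sum>i\<in>A. op_scale (base_change P \<delta>) (w i)
      (monomial_vf d P (a i p (e + 2 * int p)) p e \<delta> f u))"
    unfolding N[OF a'] by (intro sum.cong HOL.refl monomial_vf_lincomb[OF f Der_seriesD(2)[OF ai] Der_seriesD(2)[OF a'] eq u])
  also have "\<dots> = (\<Sum>i\<in>A. \<Sum>p<N. op_scale (base_change P \<delta>) (w i)
      (monomial_vf d P (a i p (e + 2 * int p)) p e \<delta> f u))"
    by (rule sum.swap)
  also have "\<dots> = (\<Sum>i\<in>A. op_scale (base_change P \<delta>) (w i) (action_vf d P (a i) e \<delta> f u))"
    by (intro sum.cong HOL.refl) (simp only: N[OF ai] Q.vs.scale_sum_right)
  finally show ?thesis .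
qed

lemma action_vf_z_monomial:
  assumes D: "D \<in> Der P" and f: "f \<in> Hom_points d P \<delta>" and u: "u \<in> op_space (HyperCom d) I j"
  shows "action_vf d P (z_monomial D p) e \<delta> f u = monomial_vf d P (D (e + 2 * int p)) p e \<delta> f u"
proof -
  have "monomial_vf d P (z_monomial D p p' (e + 2 * int p')) p' e \<delta> f u = 0" if "p' \<noteq> p" for p'
    by (rule monomial_vf_zero[OF f Der_seriesD(2)[OF z_monomial_Der_series[OF D]] _ u])
      (use that in \<open>simp add: z_monomial_def\<close>)
  then have "action_vf d P (z_monomial D p) e \<delta> f u =
      (\<Sum>p'\<in>{p}. monomial_vf d P (z_monomial D p p' (e + 2 * int p')) p' e \<delta> f u)"
    unfolding action_vf_def by (intro Sum_any.expand_superset) auto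
  then show ?thesis by (simp add: z_monomial_def)
qed

lemma Der_series_add:
  assumes "a \<in> Der_series P" "b \<in> Der_series P"
  shows "a + b \<in> Der_series P"
proof -
  have "(a + b) p \<in> Der P" for p
  proof -
    have "(\<lambda>e x. \<Sum>i\<in>UNIV. op_scale P 1 ((if i then a p else b p) e x)) \<in> Der P"
      by (rule Der_lincomb) (use assms in \<open>auto simp: Der_series_def\<close>)
    also have "(\<lambda>e x. \<Sum>i\<in>UNIV. op_scale P 1 ((if i then a p else b p) e x)) = (a + b) p"
      by (simp add: UNIV_bool fun_eq_iff add.commute)
    finally show ?thesis .
  qed
  then show ?thesis by (simp add: Der_series_def)
qed

lemma Der_series_scale: "a \<in> Der_series P \<Longrightarrow> (\<lambda>p e x. op_scale P c (a p e x)) \<in> Der_series P"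
  using Der_lincomb[of "{()}" "\<lambda>_. a _" "\<lambda>_. c"] by (simp add: Der_series_def)

lemma action_vf_assignment: "action_assignment d P (action_vf d P)"
  unfolding action_assignment_def
proof (intro conjI ballI allI impI)
  show "vector_field d P (action_vf d P a)" if "a \<in> Der_series P" for a
    by (rule action_vf_vector_field[OF that])
  show "vf_eq d P (action_vf d P (a + b)) (action_vf d P a + action_vf d P b)"
    if ab: "a \<in> Der_series P" "b \<in> Der_series P" for a b
    unfolding vf_eq_def
  proof (intro allI ballI)
    fix e \<delta> f I j and u :: "'k hterm set" assume f: "f \<in> Hom_points d P \<delta>" and u: "u \<in> op_space (HyperCom d) I j"
    interpret Q: operad "base_change P \<delta>" by (rule operad_base_change)
    have "action_vf d P (a + b) e \<delta> f u =
        (\<Sum>i\<in>UNIV. op_scale (base_change P \<delta>) 1 (action_vf d P (if i then a else b) e \<delta> f u))"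
      by (rule action_vf_lincomb[OF _ Der_series_add[OF ab] _ f u]) (use ab in \<open>auto simp: UNIV_bool add.commute\<close>)
    then show "action_vf d P (a + b) e \<delta> f u = (action_vf d P a + action_vf d P b) e \<delta> f u"
      unfolding Q.vs.scale_one by (simp add: UNIV_bool add.commute)
  qed
  show "vf_eq d P (action_vf d P (\<lambda>p e x. op_scale P c (a p e x)))
      (\<lambda>e \<delta> f u. op_scale (base_change P \<delta>) c (action_vf d P a e \<delta> f u))"
    if a: "a \<in> Der_series P" for a c
    unfolding vf_eq_def
  proof (intro allI ballI)
    fix e \<delta> f I j and u :: "'k hterm set" assume f: "f \<in> Hom_points d P \<delta>" and u: "u \<in> op_space (HyperCom d) I j"
    have "action_vf d P (\<lambda>p e x. op_scale P c (a p e x)) e \<delta> f u =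
        (\<Sum>i\<in>{()}. op_scale (base_change P \<delta>) c (action_vf d P a e \<delta> f u))"
      by (rule action_vf_lincomb[OF _ Der_series_scale[OF a] _ f u]) (use a in auto)
    then show "action_vf d P (\<lambda>p e x. op_scale P c (a p e x)) e \<delta> f u =
        op_scale (base_change P \<delta>) c (action_vf d P a e \<delta> f u)" by simp
  qed
  fix a e \<delta> f I j and u :: "'k hterm set"
  assume a: "a \<in> Der_series P" and f: "f \<in> Hom_points d P \<delta>" and u: "u \<in> op_space (HyperCom d) I j"
  note z = action_vf_z_monomial[OF Der_seriesD(1)[OF a] f u]
  obtain N where "\<And>p e \<delta> f D. \<lbrakk>N \<le> p; f \<in> Hom_points d P \<delta>; derivation P (e + 2 * int p) D\<rbrakk> \<Longrightarrow>
      monomial_vf d P D p e \<delta> f u = 0"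
    using monomial_vf_eventually_zero[OF u] by blast
  then have "{p. action_vf d P (z_monomial (a p) p) e \<delta> f u \<noteq> 0} \<subseteq> {..<N}"
    using f Der_seriesD(2)[OF a] by (auto simp: z not_le[symmetric])
  then show "finite {p. action_vf d P (z_monomial (a p) p) e \<delta> f u \<noteq> 0}" by (rule finite_subset) simp
  show "action_vf d P a e \<delta> f u = Sum_any (\<lambda>p. action_vf d P (z_monomial (a p) p) e \<delta> f u)"
    by (simp only: z) (simp only: action_vf_def)
next
  fix D p n k e \<delta> f
  assume D: "D \<in> Der P" and n: "2 \<le> (n::nat)" and f: "f \<in> Hom_points d P \<delta>"
  have De: "derivation P (e - 2 * int p + 2 * int p) (D e)" using D by (simp add: Der_iff)
  have S: "finite {1..n}" "2 \<le> card {1..n}" using n by simp_all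
  show "action_vf d P (z_monomial D p) (e - 2 * int p) \<delta> f (mu d {1..n} k) = action_formula d P (D e) p \<delta> f n k"
    using action_vf_z_monomial[OF D f mu_space[OF S], of p "e - 2 * int p" k] monomial_vf(2)[OF f De n] by simp
qed

text \<open>For a monomial in z the formula fixes the derivation on generators, hence everywhere;
  the clause on infinite sums reduces a series to monomials.\<close>

lemma action_assignment_unique:
  assumes Y: "action_assignment d P Y" and Y': "action_assignment d P Y'" and a: "a \<in> Der_series P"
  shows "vf_eq d P (Y' a) (Y a)"
  unfolding vf_eq_def
proof (intro allI ballI)
  fix e \<delta> f I j and u :: "'k hterm set"
  assume f: "f \<in> Hom_points d P \<delta>" and u: "u \<in> op_space (HyperCom d) I j"
  interpret Q: operad "base_change P \<delta>" by (rule operad_base_change)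
  have fh: "operad_hom (HyperCom d) (base_change P \<delta>) f" using f by (simp add: Hom_points_def)
  obtain t where t: "wf_term d t" "u = hc_class d t" using u by (rule HyperComE)
  have val: "Z a e \<delta> f u = Sum_any (\<lambda>p. Z (z_monomial (a p) p) e \<delta> f u)"
    and der: "f_derivation (HyperCom d) (base_change P \<delta>) f e (Z (z_monomial (a p) p) e \<delta> f)"
    and gen: "2 \<le> n \<Longrightarrow> Z (z_monomial (a p) p) e \<delta> f (mu d {1..n} k) = action_formula d P (a p (e + 2 * int p)) p \<delta> f n k"
    if Z: "action_assignment d P Z" for Z p n k
  proof -
    show "Z a e \<delta> f u = Sum_any (\<lambda>p. Z (z_monomial (a p) p) e \<delta> f u)"
      using Z[unfolded action_assignment_def, THEN conjunct2, THEN conjunct2, THEN conjunct2, THEN conjunct1] a f u by blast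
    have "vector_field d P (Z (z_monomial (a p) p))"
      using Z[unfolded action_assignment_def, THEN conjunct1] z_monomial_Der_series[OF Der_seriesD(1)[OF a]] by blast
    then show "f_derivation (HyperCom d) (base_change P \<delta>) f e (Z (z_monomial (a p) p) e \<delta> f)"
      using f by (simp add: vector_field_def homogeneous_vector_field_def)
    assume n: "2 \<le> n"
    have "\<forall>D\<in>Der P. \<forall>p n k. 2 \<le> n \<longrightarrow> (\<forall>e \<delta>. \<forall>f\<in>Hom_points d P \<delta>.
        Z (z_monomial D p) (e - 2 * int p) \<delta> f (mu d {1..n} k) = action_formula d P (D e) p \<delta> f n k)"
      using Z by (simp add: action_assignment_def)
    from this[rule_format, OF Der_seriesD(1)[OF a] n f, of p p "e + 2 * int p" k]
    show "Z (z_monomial (a p) p) e \<delta> f (mu d {1..n} k) = action_formula d P (a p (e + 2 * int p)) p \<delta> f n k"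
      by simp
  qed
  have "Y' (z_monomial (a p) p) e \<delta> f u = Y (z_monomial (a p) p) e \<delta> f u" for p
    unfolding t(2)
    by (rule Q.f_derivation_cong[OF fh der[OF Y'] der[OF Y] t(1)])
      (use gens_of_ge[OF t(1)] gen[OF Y] gen[OF Y'] in auto)
  then show "Y' a e \<delta> f u = Y a e \<delta> f u" using val[OF Y] val[OF Y'] by simp
qed

end

section \<open>The bracket of the vector fields\<close>

lemma nest_cong:
  assumes "\<And>S p. (S, p) \<in> set L \<Longrightarrow> g (insert 0 S) p = g' (insert 0 S) p"
  shows "nest cmp g x L = nest cmp g' x L"
  unfolding nest_def by (rule foldl_cong) (use assms in auto)

text \<open>An outer block misses the two or more labels of the first block, so together with the
  slot it still has fewer than n elements. On n labels a direction given by an infinite sum may thus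
  be replaced by a partial sum that is correct up to n labels.\<close>

lemma action_formula_cong:
  assumes eq: "\<And>S p. \<lbrakk>finite S; 2 \<le> card S; card S \<le> n\<rbrakk> \<Longrightarrow> f (mu d S p) = f' (mu d S p)" and n: "2 \<le> n"
  shows "action_formula d P D p \<delta> f n k = action_formula d P D p \<delta> f' n k"
proof -
  have "nest (op_comp (base_change P \<delta>)) (\<lambda>S r. f (mu d S r))
          (extend_map D (f (mu d (hd Ss) (hd ps)))) (zip (tl Ss) (butlast (tl ps) @ [k + last ps])) =
        nest (op_comp (base_change P \<delta>)) (\<lambda>S r. f' (mu d S r))
          (extend_map D (f' (mu d (hd Ss) (hd ps)))) (zip (tl Ss) (butlast (tl ps) @ [k + last ps]))"
    if index: "(Ss, ps) \<in> action_index n p" for Ss ps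
  proof -
    obtain A As where Ss: "Ss = A # As" using index by (cases Ss) (auto simp: action_index_def)
    have A: "A \<subseteq> {1..n}" "2 \<le> card A" and As: "\<And>B. B \<in> set As \<Longrightarrow> B \<subseteq> {1..n} - A \<and> B \<noteq> {}"
      using index Ss by (auto simp: action_index_def ordered_partitions_def set_splits_def)
    have fin: "finite A" using A(1) finite_subset by blast
    have "f (mu d A (hd ps)) = f' (mu d A (hd ps))"
      using eq[OF fin A(2)] card_mono[OF _ A(1)] by simp
    moreover have "f (mu d (insert 0 B) r) = f' (mu d (insert 0 B) r)" if "B \<in> set As" for B r
    proof (rule eq)
      have B: "B \<subseteq> {1..n} - A" "B \<noteq> {}" using As[OF that] by simp_all
      then have fB: "finite B" "0 \<notin> B" using finite_subset by auto
      have "card B \<le> n - card A" using card_mono[OF _ B(1)] A(1) fin by (simp add: card_Diff_subset)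
      moreover have "0 < card B" using B(2) fB by (simp add: card_gt_0_iff)
      ultimately show "finite (insert 0 B)" "2 \<le> card (insert 0 B)" "card (insert 0 B) \<le> n"
        using fB A(2) by simp_all
    qed
    ultimately show ?thesis
      unfolding Ss by (auto intro!: nest_cong dest: set_zip_leftD)
  qed
  then have "(\<Sum>(Ss, ps)\<in>action_index n p. nest (op_comp (base_change P \<delta>)) (\<lambda>S r. f (mu d S r))
          (extend_map D (f (mu d (hd Ss) (hd ps)))) (zip (tl Ss) (butlast (tl ps) @ [k + last ps]))) =
      (\<Sum>(Ss, ps)\<in>action_index n p. nest (op_comp (base_change P \<delta>)) (\<lambda>S r. f' (mu d S r))
          (extend_map D (f' (mu d (hd Ss) (hd ps)))) (zip (tl Ss) (butlast (tl ps) @ [k + last ps])))"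
    by (intro sum.cong) auto
  then show ?thesis using eq[of "{1..n}" "k + p"] n by (simp add: action_formula_def)
qed

lemma dir_deriv_eq: "dir_deriv V \<delta> f e E u = high (length \<delta>) (V (\<delta> @ [- e]) (tangent_point \<delta> f E) u)"
  by (simp add: dir_deriv_def high_def)

section \<open>Graded commutators of derivations\<close>

definition commutator ::
  "('k::field_char_0, 'a::ab_group_add) operad_str \<Rightarrow> int \<Rightarrow> int \<Rightarrow> ('a \<Rightarrow> 'a) \<Rightarrow> ('a \<Rightarrow> 'a) \<Rightarrow> 'a \<Rightarrow> 'a" where
  "commutator P e1 e2 D1 D2 x = D1 (D2 x) - op_scale P (ksgn e1 e2) (D2 (D1 x))"

context operad
begin

lemma comp_diff_koszul:
  assumes s: "s \<in> I" "(I - {s}) \<inter> J = {}"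
  shows "\<lbrakk>x \<in> op_space P I i; x' \<in> op_space P I i; y \<in> op_space P J j\<rbrakk> \<Longrightarrow>
      op_comp P s (x - koszul a b x') y = op_comp P s x y - koszul a b (op_comp P s x' y)"
    and "\<lbrakk>x \<in> op_space P I i; y \<in> op_space P J j; y' \<in> op_space P J j\<rbrakk> \<Longrightarrow>
      op_comp P s x (y - koszul a b y') = op_comp P s x y - koszul a b (op_comp P s x y')"
proof -
  show "op_comp P s (x - koszul a b x') y = op_comp P s x y - koszul a b (op_comp P s x' y)"
    if x: "x \<in> op_space P I i" "x' \<in> op_space P I i" and y: "y \<in> op_space P J j"
    using comp_add_left[OF x(1) space_neg[OF x(2)] y s] comp_add_left[OF x y s] comp_neg_left[OF x(2) y s]
    by (simp add: koszul_def)
  show "op_comp P s x (y - koszul a b y') = op_comp P s x y - koszul a b (op_comp P s x y')"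
    if x: "x \<in> op_space P I i" and y: "y \<in> op_space P J j" "y' \<in> op_space P J j"
    using comp_add_right[OF x y(1) space_neg[OF y(2)] s] comp_add_right[OF x y s] comp_neg_right[OF x y(2) s]
    by (simp add: koszul_def)
qed

lemma derivation_commutator:
  assumes D1: "derivation P e1 D1" and D2: "derivation P e2 D2"
  shows "derivation P (e1 + e2) (commutator P e1 e2 D1 D2)"
  unfolding f_derivation_def add
proof (intro conjI allI ballI impI)
  note A = derivationD[OF D1] and B = derivationD[OF D2]
  fix I j x assume x: "x \<in> op_space P I j"
  have AB: "D1 (D2 x) \<in> op_space P I (j + (e1 + e2))" "D2 (D1 x) \<in> op_space P I (j + (e1 + e2))"
    using A(1)[OF B(1)[OF x]] B(1)[OF A(1)[OF x]] by (simp_all add: algebra_simps)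
  show "commutator P e1 e2 D1 D2 x \<in> op_space P I (j + (e1 + e2))"
    unfolding commutator_def scale_koszul by (intro space_diff space_koszul AB)
  show "commutator P e1 e2 D1 D2 (x + y) = commutator P e1 e2 D1 D2 x + commutator P e1 e2 D1 D2 y"
    if y: "y \<in> op_space P I j" for y
    using A(2)[OF x y] B(2)[OF x y] A(2)[OF B(1)[OF x] B(1)[OF y]] B(2)[OF A(1)[OF x] A(1)[OF y]]
    by (simp add: commutator_def)
  show "commutator P e1 e2 D1 D2 (op_scale P c x) = op_scale P c (commutator P e1 e2 D1 D2 x)" for c
    unfolding commutator_def scale_koszul
    using A(3)[OF x, of c] B(3)[OF x, of c] A(3)[OF B(1)[OF x], of c] B(3)[OF A(1)[OF x], of c]
    by (simp add: koszul_def vs.scale_right_diff_distrib vs.scale_right_distrib)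
  show "commutator P e1 e2 D1 D2 (op_relabel P \<sigma> x) = op_relabel P \<sigma> (commutator P e1 e2 D1 D2 x)"
    if \<sigma>: "inj_on \<sigma> I" for \<sigma>
    using A(4)[OF x \<sigma>] B(4)[OF x \<sigma>] A(4)[OF B(1)[OF x] \<sigma>] B(4)[OF A(1)[OF x] \<sigma>]
      relabel_diff[OF AB(1) space_koszul[OF AB(2)] \<sigma>, of e1 e2] relabel_koszul[OF AB(2) \<sigma>, of e1 e2]
    by (simp add: commutator_def)
  fix J k s y
  assume y: "y \<in> op_space P J k" and s: "s \<in> I" "(I - {s}) \<inter> J = {}"
  have A5: "D1 (op_comp P s u v) = op_comp P s (D1 u) v + koszul e1 i (op_comp P s u (D1 v))"
    if "u \<in> op_space P I i" "v \<in> op_space P J l" for u v i l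
    using A(5)[OF that s] by simp
  have B5: "D2 (op_comp P s u v) = op_comp P s (D2 u) v + koszul e2 i (op_comp P s u (D2 v))"
    if "u \<in> op_space P I i" "v \<in> op_space P J l" for u v i l
    using B(5)[OF that s] by simp
  have sp: "op_comp P s u v \<in> op_space P ((I - {s}) \<union> J) (i + l)"
    if "u \<in> op_space P I i" "v \<in> op_space P J l" for u v i l
    using comp_space[OF that s] .
  have kz: "derivation P e D \<Longrightarrow> u \<in> op_space P K l \<Longrightarrow> D (koszul p q u) = koszul p q (D u)" for e D u K l p q
    by (simp add: koszul_def derivation_neg)
  have 1: "D1 (D2 (op_comp P s x y)) = op_comp P s (D1 (D2 x)) y + koszul e1 (j + e2) (op_comp P s (D2 x) (D1 y)) +
      koszul e2 j (op_comp P s (D1 x) (D2 y) + koszul e1 j (op_comp P s x (D1 (D2 y))))"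
  proof -
    have "D1 (D2 (op_comp P s x y)) = D1 (op_comp P s (D2 x) y) + D1 (koszul e2 j (op_comp P s x (D2 y)))"
      unfolding B5[OF x y]
      by (rule A(2)[OF space_cast[OF sp[OF B(1)[OF x] y]] space_koszul[OF sp[OF x B(1)[OF y]]]]) auto
    then show ?thesis
      unfolding kz[OF D1 sp[OF x B(1)[OF y]]] A5[OF B(1)[OF x] y] A5[OF x B(1)[OF y]] .
  qed
  have 2: "D2 (D1 (op_comp P s x y)) = op_comp P s (D2 (D1 x)) y + koszul e2 (j + e1) (op_comp P s (D1 x) (D2 y)) +
      koszul e1 j (op_comp P s (D2 x) (D1 y) + koszul e2 j (op_comp P s x (D2 (D1 y))))"
  proof -
    have "D2 (D1 (op_comp P s x y)) = D2 (op_comp P s (D1 x) y) + D2 (koszul e1 j (op_comp P s x (D1 y)))"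
      unfolding A5[OF x y]
      by (rule B(2)[OF space_cast[OF sp[OF A(1)[OF x] y]] space_koszul[OF sp[OF x A(1)[OF y]]]]) auto
    then show ?thesis
      unfolding kz[OF D2 sp[OF x A(1)[OF y]]] B5[OF A(1)[OF x] y] B5[OF x A(1)[OF y]] .
  qed
  have ABy: "D1 (D2 y) \<in> op_space P J (k + (e1 + e2))" "D2 (D1 y) \<in> op_space P J (k + (e1 + e2))"
    using A(1)[OF B(1)[OF y]] B(1)[OF A(1)[OF y]] by (simp_all add: algebra_simps)
  have l: "op_comp P s (commutator P e1 e2 D1 D2 x) y =
      op_comp P s (D1 (D2 x)) y - koszul e1 e2 (op_comp P s (D2 (D1 x)) y)"
    unfolding commutator_def scale_koszul by (rule comp_diff_koszul(1)[OF s AB y])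
  have r: "op_comp P s x (commutator P e1 e2 D1 D2 y) =
      op_comp P s x (D1 (D2 y)) - koszul e1 e2 (op_comp P s x (D2 (D1 y)))"
    unfolding commutator_def scale_koszul by (rule comp_diff_koszul(2)[OF s x ABy])
  show "commutator P e1 e2 D1 D2 (op_comp P s x y) = op_comp P s (commutator P e1 e2 D1 D2 x) y +
      op_scale P (ksgn (e1 + e2) j) (op_comp P s x (commutator P e1 e2 D1 D2 y))"
    unfolding l r unfolding commutator_def 1 2 scale_koszul
    by (cases "odd e1"; cases "odd e2"; cases "odd j") (simp_all add: koszul_def)
qed

lemma derivation_cong:
  assumes D: "derivation P e D" and eq: "\<And>I j x. x \<in> op_space P I j \<Longrightarrow> D' x = D x"
  shows "derivation P e D'"
  unfolding f_derivation_def add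
proof (intro conjI allI ballI impI)
  note A = derivationD[OF D]
  fix I j x assume x: "x \<in> op_space P I j"
  note ex = eq[OF x]
  show "D' x \<in> op_space P I (j + e)" using A(1)[OF x] ex by simp
  show "D' (x + y) = D' x + D' y" if y: "y \<in> op_space P I j" for y
    using A(2)[OF x y] ex eq[OF y] eq[OF space_add[OF x y]] by simp
  show "D' (op_scale P c x) = op_scale P c (D' x)" for c
    using A(3)[OF x] ex eq[OF space_scale[OF x]] by simp
  show "D' (op_relabel P \<sigma> x) = op_relabel P \<sigma> (D' x)" if \<sigma>: "inj_on \<sigma> I" for \<sigma>
    using A(4)[OF x \<sigma>] ex eq[OF relabel_space[OF x \<sigma>]] by simp
  show "D' (op_comp P s x y) = op_comp P s (D' x) y + op_scale P (ksgn e j) (op_comp P s x (D' y))"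
    if y: "y \<in> op_space P J k" and s: "s \<in> I" "(I - {s}) \<inter> J = {}" for J k s y
    using A(5)[OF x y s] ex eq[OF y] eq[OF comp_space[OF x y s]] by simp
qed

lemma commutator_zero:
  assumes "derivation P e1 (D1 e1)" "derivation P e2 (D2 e2)" "e1 \<notin> degrees P D1 \<or> e2 \<notin> degrees P D2"
    and x: "x \<in> op_space P I j"
  shows "commutator P e1 e2 (D1 e1) (D2 e2) x = 0"
  using assms(3)
proof
  assume "e1 \<notin> degrees P D1"
  note z = not_degrees[OF this]
  show ?thesis
    using z[OF derivationD(1)[OF assms(2) x]] z[OF x] derivation_zero[OF assms(2)] by (simp add: commutator_def)
next
  assume "e2 \<notin> degrees P D2"
  note z = not_degrees[OF this]
  show ?thesis
    using z[OF derivationD(1)[OF assms(1) x]] z[OF x] derivation_zero[OF assms(1)] by (simp add: commutator_def)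
qed

lemma Der_bracket_eq:
  assumes a: "a \<in> Der_series P" and b: "b \<in> Der_series P" and x: "x \<in> op_space P I j"
    and T: "\<And>r. r \<le> s \<Longrightarrow> finite (T r)" "\<And>r. r \<le> s \<Longrightarrow> degrees P (a r) \<subseteq> T r"
  shows "Der_bracket P a b s e x =
    (\<Sum>r\<le>s. \<Sum>e1\<in>T r. commutator P e1 (e - e1) (a r e1) (b (s - r) (e - e1)) x)"
  unfolding Der_bracket_def commutator_def[symmetric]
proof (intro sum.cong HOL.refl Sum_any.expand_superset)
  fix r assume r: "r \<in> {..s}"
  show "finite (T r)" using T r by simp
  show "{e1. commutator P e1 (e - e1) (a r e1) (b (s - r) (e - e1)) x \<noteq> 0} \<subseteq> T r"
  proof
    fix e1 assume "e1 \<in> {e1. commutator P e1 (e - e1) (a r e1) (b (s - r) (e - e1)) x \<noteq> 0}"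
    then have "e1 \<in> degrees P (a r)"
      using commutator_zero[of e1 "a r" "e - e1" "b (s - r)", OF Der_seriesD(2)[OF a] Der_seriesD(2)[OF b] _ x] by blast
    then show "e1 \<in> T r" using T(2)[of r] r by auto
  qed
qed

lemma Der_bracket_Der_series:
  assumes a: "a \<in> Der_series P" and b: "b \<in> Der_series P"
  shows "Der_bracket P a b \<in> Der_series P"
proof -
  have "Der_bracket P a b s \<in> Der P" for s
    unfolding Der_iff
  proof (intro conjI allI)
    note eq = Der_bracket_eq[OF a b _ Der_seriesD(3)[OF a] order_refl, of _ _ _ s]
    show "derivation P e (Der_bracket P a b s e)" for e
    proof (rule derivation_cong[OF _ eq])
      have "derivation P e (commutator P e1 (e - e1) (a r e1) (b (s - r) (e - e1)))" for r e1
        using derivation_commutator[OF Der_seriesD(2)[OF a, of e1 r] Der_seriesD(2)[OF b, of "e - e1" "s - r"]] by simp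
      then show "derivation P e (\<lambda>x. \<Sum>r\<le>s. \<Sum>e1\<in>degrees P (a r). commutator P e1 (e - e1) (a r e1) (b (s - r) (e - e1)) x)"
        by (intro f_derivation_sum operad_hom_id)
    qed
    have "degrees P (Der_bracket P a b s) \<subseteq>
        (\<Union>r\<le>s. (\<lambda>(e1, e2). e1 + e2) ` (degrees P (a r) \<times> degrees P (b (s - r))))"
    proof
      fix e assume "e \<in> degrees P (Der_bracket P a b s)"
      then obtain I j x where x: "x \<in> op_space P I j" "Der_bracket P a b s e x \<noteq> 0" by (auto simp: degrees_def)
      then obtain r where r: "r \<le> s"
        "(\<Sum>e1\<in>degrees P (a r). commutator P e1 (e - e1) (a r e1) (b (s - r) (e - e1)) x) \<noteq> 0"
        unfolding eq[OF x(1)] by (meson atMost_iff sum.not_neutral_contains_not_neutral)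
      then obtain e1 where e1: "e1 \<in> degrees P (a r)" "commutator P e1 (e - e1) (a r e1) (b (s - r) (e - e1)) x \<noteq> 0"
        by (meson sum.not_neutral_contains_not_neutral)
      then have "e - e1 \<in> degrees P (b (s - r))"
        using commutator_zero[of e1 "a r" "e - e1" "b (s - r)", OF Der_seriesD(2)[OF a] Der_seriesD(2)[OF b] _ x(1)] by blast
      then have "e \<in> (\<lambda>(e1, e2). e1 + e2) ` (degrees P (a r) \<times> degrees P (b (s - r)))"
        using e1(1) by (intro image_eqI[of _ _ "(e1, e - e1)"]) auto
      then show "e \<in> (\<Union>r\<le>s. (\<lambda>(e1, e2). e1 + e2) ` (degrees P (a r) \<times> degrees P (b (s - r))))"
        using r(1) by blast
    qed
    then show "finite (degrees P (Der_bracket P a b s))"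
      by (rule finite_subset) (auto intro!: Der_seriesD(3)[OF a] Der_seriesD(3)[OF b])
  qed
  then show ?thesis by (simp add: Der_series_def)
qed

section \<open>Vector fields at tangent points\<close>

lemma deformation_tangent:
  assumes f: "f \<in> Hom_points d P \<delta>" and E: "f_derivation (HyperCom d) (base_change P \<delta>) f e E"
  shows "deformation P \<delta> e d (\<lambda>I p. f (mu d I p)) (\<lambda>I k. E (mu d I k)) (\<lambda>I k. tangent_point \<delta> f E (mu d I k))"
proof -
  interpret base_change_step P \<delta> "- e" by (rule base_change_step)
  interpret N: hc_point Q d "\<lambda>I p. f (mu d I p)" by (rule Hom_points_hc_point[OF f])
  have fh: "operad_hom (HyperCom d) Q f" using f by (simp add: Hom_points_def)
  have F: "operad_hom (HyperCom d) Q' (tangent_point \<delta> f E)"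
    using tangent_point_hom[OF f E] by (simp add: Hom_points_def)
  have lh: "low r (tangent_point \<delta> f E (mu d I k)) = f (mu d I k)"
    "high r (tangent_point \<delta> f E (mu d I k)) = E (mu d I k)" if "finite I" "2 \<le> card I" for I k
    using tangent_low_high[of f "mu d I k" I "mu_deg d (card I) k" E "mu_deg d (card I) k + e"]
      operad_homD(1)[OF fh mu_space[OF that]] f_derivationD(1)[OF E mu_space[OF that]] by simp_all
  show ?thesis
    by unfold_locales (use Q'.hom_gens[OF F] lh in auto)
qed

lemma low_f_derivation:
  assumes E: "f_derivation R (base_change P (\<delta> @ [c])) f' e E"
  shows "f_derivation R (base_change P \<delta>) (\<lambda>u. low (length \<delta>) (f' u)) e (\<lambda>u. low (length \<delta>) (E u))"
proof -
  interpret base_change_step P \<delta> c by (rule base_change_step)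
  note D = f_derivationD[OF E]
  show ?thesis
    unfolding f_derivation_def
  proof (intro conjI allI ballI impI)
    fix I j u assume u: "u \<in> op_space R I j"
    show "low r (E u) \<in> op_space Q I (j + e)" by (rule low_space[OF D(1)[OF u]])
    show "low r (E (op_add R u v)) = op_add Q (low r (E u)) (low r (E v))" if "v \<in> op_space R I j" for v
      using D(2)[OF u that] by simp
    show "low r (E (op_scale R b u)) = op_scale Q b (low r (E u))" for b
      using D(3)[OF u, of b] by simp
    show "low r (E (op_relabel R \<sigma> u)) = op_relabel Q \<sigma> (low r (E u))" if "inj_on \<sigma> I" for \<sigma>
      using D(4)[OF u that] by simp
    show "low r (E (op_comp R s u v)) = op_add Q (op_comp Q s (low r (E u)) (low r (f' v)))
        (op_scale Q (ksgn e j) (op_comp Q s (low r (f' u)) (low r (E v))))"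
      if "v \<in> op_space R J k" "s \<in> I" "(I - {s}) \<inter> J = {}" for J k s v
      using D(5)[OF u that] by (simp add: low_comp koszul_def del: base_change_simps(2))
  qed
qed

text \<open>Naturality: setting \<epsilon> to zero turns the field at f + E \<epsilon> into the
  field at f. Both sides are derivations along f, so generators suffice, and there
  \<open>act\<close> commutes with taking low parts.\<close>

lemma low_action_vf:
  assumes a: "a \<in> Der_series P" and f: "f \<in> Hom_points d P \<delta>"
    and E: "f_derivation (HyperCom d) (base_change P \<delta>) f e2 E" and u: "u \<in> op_space (HyperCom d) I j"
  shows "low (length \<delta>) (action_vf d P a e1 (\<delta> @ [- e2]) (tangent_point \<delta> f E) u) = action_vf d P a e1 \<delta> f u"
proof -
  interpret Q: operad "base_change P \<delta>" by (rule operad_base_change)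
  interpret deformation P \<delta> e2 d "\<lambda>I p. f (mu d I p)" "\<lambda>I k. E (mu d I k)"
    "\<lambda>I k. tangent_point \<delta> f E (mu d I k)" by (rule deformation_tangent[OF f E])
  let ?F = "tangent_point \<delta> f E"
  note F = tangent_point_hom[OF f E]
  have fh: "operad_hom (HyperCom d) (base_change P \<delta>) f" using f by (simp add: Hom_points_def)
  have lowF: "low r (?F v) = f v" if "v \<in> op_space (HyperCom d) J k" for J k v
    using tangent_low_high(1)[of f v J k E "k + e2"] operad_homD(1)[OF fh that] f_derivationD(1)[OF E that] by simp
  have der: "f_derivation (HyperCom d) (base_change P \<delta>) f e1 (\<lambda>u. low r (action_vf d P a e1 (\<delta> @ [- e2]) ?F u))"
    by (rule f_derivation_hom_cong[OF low_f_derivation[OF action_vf_f_derivation[OF a F]]])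
      (simp add: lowF)
  obtain t where t: "wf_term d t" "u = hc_class d t" using u by (rule HyperComE)
  show ?thesis
    unfolding t(2)
  proof (rule Q.f_derivation_cong[OF fh der action_vf_f_derivation[OF a f] t(1)])
    fix n k assume "(n, k) \<in> gens_of t"
    then have n: "2 \<le> n" by (rule gens_of_ge[OF t(1)])
    then have S: "finite {1..n}" "2 \<le> card {1..n}" by simp_all
    show "low r (action_vf d P a e1 (\<delta> @ [- e2]) ?F (mu d {1..n} k)) = action_vf d P a e1 \<delta> f (mu d {1..n} k)"
      unfolding action_vf_mu[OF a F S order_refl] action_vf_mu[OF a f S order_refl] low_high_sum
        monomial_vf_mu[OF F Der_seriesD(2)[OF a] S] monomial_vf_mu[OF f Der_seriesD(2)[OF a] S]
      by (intro sum.cong HOL.refl low_act[OF Der_seriesD(2)[OF a]])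
  qed
qed

text \<open>The second-order Leibniz rule: besides the two expected terms there are cross terms, in
  which each field differentiates one factor. Odd arguments are treated separately, as everything
  vanishes on them.\<close>

lemma high_f_derivation_comp:
  assumes f: "f \<in> Hom_points d P \<delta>" and E: "f_derivation (HyperCom d) (base_change P \<delta>) f e2 E"
    and V: "f_derivation (HyperCom d) (base_change P (\<delta> @ [- e2])) (tangent_point \<delta> f E) e1 V"
    and low: "\<And>I j u. u \<in> op_space (HyperCom d) I j \<Longrightarrow> low (length \<delta>) (V u) = F u"
    and u: "u \<in> op_space (HyperCom d) I i" and v: "v \<in> op_space (HyperCom d) J j"
    and s: "s \<in> I" "(I - {s}) \<inter> J = {}" and even: "even i" "even j"
  shows "high (length \<delta>) (V (op_comp (HyperCom d) s u v)) =
    op_comp (base_change P \<delta>) s (high (length \<delta>) (V u)) (f v) + op_comp (base_change P \<delta>) s (F u) (E v) +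
    (koszul e1 e2 (op_comp (base_change P \<delta>) s (E u) (F v)) +
      op_comp (base_change P \<delta>) s (f u) (high (length \<delta>) (V v)))"
proof -
  interpret base_change_step P \<delta> "- e2" by (rule base_change_step)
  let ?F = "tangent_point \<delta> f E"
  have fh: "operad_hom (HyperCom d) Q f" using f by (simp add: Hom_points_def)
  have F: "operad_hom (HyperCom d) Q' ?F" using tangent_point_hom[OF f E] by (simp add: Hom_points_def)
  have lh: "low r (?F v) = f v" "high r (?F v) = E v" if "v \<in> op_space (HyperCom d) J k" for J k v
    using tangent_low_high[of f v J k E "k + e2"] operad_homD(1)[OF fh that] f_derivationD(1)[OF E that] by simp_all
  note FD = operad_homD(1)[OF F] and VD = f_derivationD(1)[OF V]
  have "ksgn e1 i = (1 :: 'k)" "ksgn (- e2) j = (1 :: 'k)" using even by (simp_all add: ksgn_def)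
  moreover have "koszul (- e2) (j + e1) X = koszul e1 e2 X" for X :: "nat set \<Rightarrow> 'a"
    using even by (auto simp: koszul_def)
  ultimately show ?thesis
    using f_derivationD(5)[OF V u v s] high_comp[OF VD[OF u] FD[OF v] s] high_comp[OF FD[OF u] VD[OF v] s]
      low[OF u] low[OF v] lh[OF u] lh[OF v]
    by (simp del: base_change_simps(2) add: Q.scale_koszul Q'.vs.scale_one Q.vs.scale_one)
qed

text \<open>The cross terms of \<open>high_f_derivation_comp\<close> for the two orders agree up to
  the Koszul sign and cancel, so the bracket is a derivation along f although neither directional
  derivative need be one.\<close>

lemma f_derivation_vf_bracket:
  assumes f: "f \<in> Hom_points d P \<delta>" and E: "f_derivation (HyperCom d) (base_change P \<delta>) f e2 E"
    and F: "f_derivation (HyperCom d) (base_change P \<delta>) f e1 F"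
    and V: "f_derivation (HyperCom d) (base_change P (\<delta> @ [- e2])) (tangent_point \<delta> f E) e1 V"
    and lowV: "\<And>I j u. u \<in> op_space (HyperCom d) I j \<Longrightarrow> low (length \<delta>) (V u) = F u"
    and W: "f_derivation (HyperCom d) (base_change P (\<delta> @ [- e1])) (tangent_point \<delta> f F) e2 W"
    and lowW: "\<And>I j u. u \<in> op_space (HyperCom d) I j \<Longrightarrow> low (length \<delta>) (W u) = E u"
  shows "f_derivation (HyperCom d) (base_change P \<delta>) f (e1 + e2)
    (\<lambda>u. high (length \<delta>) (V u) - op_scale (base_change P \<delta>) (ksgn e1 e2) (high (length \<delta>) (W u)))"
proof -
  interpret Q: operad "base_change P \<delta>" by (rule operad_base_change)
  interpret A: base_change_step P \<delta> "- e2" by (rule base_change_step)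
  interpret B: base_change_step P \<delta> "- e1" by (rule base_change_step)
  let ?r = "length \<delta>" and ?Q = "base_change P \<delta>" and ?H = "HyperCom d :: ('k, 'k hterm set) operad_str"
  note VD = f_derivationD[OF V] and WD = f_derivationD[OF W]
  have fh: "operad_hom ?H ?Q f" using f by (simp add: Hom_points_def)
  have Fh: "operad_hom ?H (base_change P (\<delta> @ [- e2])) (tangent_point \<delta> f E)"
    "operad_hom ?H (base_change P (\<delta> @ [- e1])) (tangent_point \<delta> f F)"
    using tangent_point_hom[OF f E] tangent_point_hom[OF f F] by (simp_all add: Hom_points_def)
  have sp: "high ?r (V u) \<in> op_space ?Q I (j + (e1 + e2))" "high ?r (W u) \<in> op_space ?Q I (j + (e1 + e2))"
    if u: "u \<in> op_space ?H I j" for u I j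
    using A.high_space[OF VD(1)[OF u]] B.high_space[OF WD(1)[OF u]] by (simp_all add: algebra_simps)
  let ?B = "\<lambda>u. high ?r (V u) - koszul e1 e2 (high ?r (W u))"
  have "f_derivation ?H ?Q f (e1 + e2) ?B"
    unfolding f_derivation_def Q.add
  proof (intro conjI allI ballI impI)
    fix I j u assume u: "u \<in> op_space ?H I j"
    show "?B u \<in> op_space ?Q I (j + (e1 + e2))" by (intro Q.space_diff Q.space_koszul sp[OF u])
    show "?B (op_add ?H u v) = ?B u + ?B v" if v: "v \<in> op_space ?H I j" for v
      using VD(2)[OF u v] WD(2)[OF u v] by simp
    show "?B (op_scale ?H b u) = op_scale ?Q b (?B u)" for b
    proof -
      have "high ?r (V (op_scale ?H b u)) = op_scale ?Q b (high ?r (V u))"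
        "high ?r (W (op_scale ?H b u)) = op_scale ?Q b (high ?r (W u))"
        using VD(3)[OF u, of b] WD(3)[OF u, of b] by simp_all
      then show ?thesis
        by (simp add: koszul_def Q.vs.scale_right_diff_distrib Q.vs.scale_right_distrib del: base_change_simps(2))
    qed
    show "?B (op_relabel ?H \<sigma> u) = op_relabel ?Q \<sigma> (?B u)" if \<sigma>: "inj_on \<sigma> I" for \<sigma>
    proof -
      have "op_relabel ?Q \<sigma> (?B u) = op_relabel ?Q \<sigma> (high ?r (V u)) - koszul e1 e2 (op_relabel ?Q \<sigma> (high ?r (W u)))"
        using Q.relabel_diff[OF sp(1)[OF u] Q.space_koszul[OF sp(2)[OF u]] \<sigma>] Q.relabel_koszul[OF sp(2)[OF u] \<sigma>]
        by simp
      moreover have "high ?r (V (op_relabel ?H \<sigma> u)) = op_relabel ?Q \<sigma> (high ?r (V u))"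
        "high ?r (W (op_relabel ?H \<sigma> u)) = op_relabel ?Q \<sigma> (high ?r (W u))"
        using VD(4)[OF u \<sigma>] WD(4)[OF u \<sigma>] by simp_all
      ultimately show ?thesis by simp
    qed
    fix J k s v
    assume v: "v \<in> op_space ?H J k" and s: "s \<in> I" "(I - {s}) \<inter> J = {}"
    note fu = operad_homD(1)[OF fh u] and fv = operad_homD(1)[OF fh v]
    have l: "op_comp ?Q s (?B u) (f v) = op_comp ?Q s (high ?r (V u)) (f v) - koszul e1 e2 (op_comp ?Q s (high ?r (W u)) (f v))"
      by (rule Q.comp_diff_koszul(1)[OF s sp[OF u] fv])
    have r: "op_comp ?Q s (f u) (?B v) = op_comp ?Q s (f u) (high ?r (V v)) - koszul e1 e2 (op_comp ?Q s (f u) (high ?r (W v)))"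
      by (rule Q.comp_diff_koszul(2)[OF s fu sp[OF v]])
    show "?B (op_comp ?H s u v) = op_comp ?Q s (?B u) (f v) +
        op_scale ?Q (ksgn (e1 + e2) j) (op_comp ?Q s (f u) (?B v))"
    proof (cases "even j \<and> even k")
      case True
      have "koszul e2 e1 X = koszul e1 e2 X" for X :: "nat set \<Rightarrow> 'a" by (rule koszul_commute)
      then show ?thesis
        using high_f_derivation_comp[OF f E V lowV u v s] high_f_derivation_comp[OF f F W lowW u v s] True
        unfolding l r Q.scale_koszul by (simp add: algebra_simps)
    next
      case False
      have zero: "V w = 0" "W w = 0" "f w = 0" "tangent_point \<delta> f E w = 0" "tangent_point \<delta> f F w = 0"
        if "w \<in> op_space ?H K l" "odd l" for w K l
        using A.Q'.f_derivation_odd[OF Fh(1) V that] B.Q'.f_derivation_odd[OF Fh(2) W that]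
          Q.f_derivation_odd[OF fh E that] by simp_all
      have V0: "V (op_comp ?H s u v) = 0" "W (op_comp ?H s u v) = 0"
        unfolding VD(5)[OF u v s] WD(5)[OF u v s]
        using False zero[OF u] zero[OF v]
          A.Q'.comp_zero_left[OF VD(1)[OF v]] A.Q'.comp_zero_left[OF operad_homD(1)[OF Fh(1) v]]
          A.Q'.comp_zero_right[OF VD(1)[OF u] s(1)] A.Q'.comp_zero_right[OF operad_homD(1)[OF Fh(1) u] s(1)]
          B.Q'.comp_zero_left[OF WD(1)[OF v]] B.Q'.comp_zero_left[OF operad_homD(1)[OF Fh(2) v]]
          B.Q'.comp_zero_right[OF WD(1)[OF u] s(1)] B.Q'.comp_zero_right[OF operad_homD(1)[OF Fh(2) u] s(1)]
        by auto
      show ?thesis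
        unfolding l r V0
        using False zero[OF u] zero[OF v]
          Q.comp_zero_left[OF fv] Q.comp_zero_right[OF fu s(1)]
          Q.comp_zero_left[OF sp(1)[OF v]] Q.comp_zero_left[OF sp(2)[OF v]]
          Q.comp_zero_right[OF sp(1)[OF u] s(1)] Q.comp_zero_right[OF sp(2)[OF u] s(1)]
        by auto
    qed
  qed
  then show ?thesis unfolding Q.scale_koszul .
qed

end

section \<open>The bracket formula for the action\<close>

context operad
begin

text \<open>The \<epsilon>-component of \<open>act\<close> at a tangent point is
  \<open>dact\<close>, which is additive in the direction; up to n labels the direction is a finite
  sum of values of monomial fields.\<close>

lemma dir_deriv_action_vf:
  fixes d :: nat and f :: "'k hterm set \<Rightarrow> nat set \<Rightarrow> 'a"
  assumes a: "a \<in> Der_series P" and b: "b \<in> Der_series P" and f: "f \<in> Hom_points d P \<delta>" and n: "2 \<le> n"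
  defines "g \<equiv> \<lambda>I p. f (mu d I p)"
  shows "dir_deriv (action_vf d P a e1) \<delta> f e2 (action_vf d P b e2 \<delta> f) (mu d {1..n} k) =
    (\<Sum>p<d * n. \<Sum>q<d * n. hc_gens.dact (base_change P \<delta>) g (extend_map (a p (e1 + 2 * int p))) (e1 + 2 * int p) e2 p
      (gen_family (hc_gens.act (base_change P \<delta>) g (extend_map (b q (e2 + 2 * int q))) q)) {1..n} k)"
proof -
  interpret Q: operad "base_change P \<delta>" by (rule operad_base_change)
  have fh: "operad_hom (HyperCom d) (base_change P \<delta>) f" using f by (simp add: Hom_points_def)
  have S: "finite {1..n}" "2 \<le> card {1..n}" using n by simp_all
  let ?E = "action_vf d P b e2 \<delta> f"
  \<comment> \<open>A partial sum of the second field that agrees with it on generators with at most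
    n labels. As a direction it is a finite sum of monomial contributions on all label sets at once,
    so \<open>dact\<close> can be expanded.\<close>
  define F where "F = (\<lambda>u. \<Sum>q<d * n. monomial_vf d P (b q (e2 + 2 * int q)) q e2 \<delta> f u)"
  have E: "f_derivation (HyperCom d) (base_change P \<delta>) f e2 ?E" by (rule action_vf_f_derivation[OF b f])
  have F: "f_derivation (HyperCom d) (base_change P \<delta>) f e2 F"
    unfolding F_def by (rule Q.f_derivation_sum[OF fh monomial_vf(1)[OF f Der_seriesD(2)[OF b]]])
  have EF: "?E (mu d I l) = F (mu d I l)" if I: "finite I" "2 \<le> card I" "card I \<le> n" for I l
    unfolding F_def by (rule action_vf_mu[OF b f I(1,2)]) (use I(3) in simp)
  interpret deformation P \<delta> e2 d g "\<lambda>I k. F (mu d I k)" "\<lambda>I k. tangent_point \<delta> f F (mu d I k)"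
    unfolding g_def by (rule deformation_tangent[OF f F])
  let ?tE = "tangent_point \<delta> f ?E" and ?tF = "tangent_point \<delta> f F"
  note tE = tangent_point_hom[OF f E] and tF = tangent_point_hom[OF f F]
  have t_eq: "?tE (mu d I l) = ?tF (mu d I l)" if "finite I" "2 \<le> card I" "card I \<le> n" for I l
    unfolding tangent_point_def EF[OF that] ..
  note aD = Der_seriesD(2)[OF a]
  have y: "gen_family (\<lambda>I k. F (mu d I k)) =
      (\<Sum>q<d * n. gen_family (N.act (extend_map (b q (e2 + 2 * int q))) q))"
  proof (intro ext)
    fix I l S
    show "gen_family (\<lambda>I k. F (mu d I k)) I l S =
        (\<Sum>q<d * n. gen_family (N.act (extend_map (b q (e2 + 2 * int q))) q)) I l S"
    proof (cases "finite I \<and> 2 \<le> card I \<and> 0 < l")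
      case True
      then show ?thesis
        using monomial_vf_mu[OF f Der_seriesD(2)[OF b], folded g_def]
        by (simp add: gen_family_def F_def sum_fun_apply)
    next
      case False
      then have "gen_family Y I l = 0" for Y :: "nat set \<Rightarrow> nat \<Rightarrow> nat set \<Rightarrow> 'a"
        by (auto simp: gen_family_def)
      then show ?thesis by (simp add: sum_fun_apply)
    qed
  qed
  have fam: "family N.W (int d) e2 (gen_family (N.act (extend_map (b q (e2 + 2 * int q))) q))" for q
    using Q.family_gen_family[OF N.is_gens_act[OF derivation_extend_map[OF Der_seriesD(2)[OF b, of "e2 + 2 * int q" q]], of q]] by simp
  have "high r (action_vf d P a e1 (\<delta> @ [- e2]) ?tE (mu d {1..n} k)) =
      (\<Sum>p<d * n. high r (action_formula d P (a p (e1 + 2 * int p)) p (\<delta> @ [- e2]) ?tE n k))"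
    using action_vf_mu[OF a tE S, of "d * n" e1 k] monomial_vf(2)[OF tE aD n] by (simp add: low_high_sum)
  also have "\<dots> = (\<Sum>p<d * n. high r (N'.act (extend_map (a p (e1 + 2 * int p))) p {1..n} k))"
    using action_formula_cong[of n ?tE d ?tF, OF t_eq n] action_formula_eq_act[OF tF aD n] by simp
  also have "\<dots> = (\<Sum>p<d * n. N.dact (extend_map (a p (e1 + 2 * int p))) (e1 + 2 * int p) e2 p
      (gen_family (\<lambda>I k. F (mu d I k))) {1..n} k)"
    by (intro sum.cong HOL.refl high_act[OF aD])
  also have "\<dots> = (\<Sum>p<d * n. \<Sum>q<d * n. N.dact (extend_map (a p (e1 + 2 * int p))) (e1 + 2 * int p) e2 p
      (gen_family (N.act (extend_map (b q (e2 + 2 * int q))) q)) {1..n} k)"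
    unfolding y by (intro sum.cong HOL.refl N.dact_sum[OF derivation_extend_map[OF aD] fam])
  finally show ?thesis unfolding dir_deriv_eq .
qed

lemma extend_map_commutator:
  "extend_map (commutator P e1 e2 D1 D2) X =
    extend_map D1 (extend_map D2 X) - koszul e1 e2 (extend_map D2 (extend_map D1 X))"
  by (simp add: extend_map_def commutator_def fun_eq_iff koszul_fun)

text \<open>A pair of monomials with z^p and z^q contributes the action of a commutator at p + q.
  This vanishes once p + q reaches d n, so the square of indices can be cut down to a triangle; its
  diagonals give the coefficients of the bracket of power series.\<close>

lemma action_vf_bracket_mu:
  fixes d :: nat and f :: "'k hterm set \<Rightarrow> nat set \<Rightarrow> 'a"
  assumes a: "a \<in> Der_series P" and b: "b \<in> Der_series P" and f: "f \<in> Hom_points d P \<delta>" and n: "2 \<le> n"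
    and T: "finite T" "vf_degrees P a (d * n) \<subseteq> T"
  shows "(\<Sum>e1\<in>T. dir_deriv (action_vf d P a e1) \<delta> f (e - e1) (action_vf d P b (e - e1) \<delta> f) (mu d {1..n} k) -
      op_scale (base_change P \<delta>) (ksgn e1 (e - e1))
        (dir_deriv (action_vf d P b (e - e1)) \<delta> f e1 (action_vf d P a e1 \<delta> f) (mu d {1..n} k))) =
    action_vf d P (Der_bracket P a b) e \<delta> f (mu d {1..n} k)"
proof -
  interpret Q: operad "base_change P \<delta>" by (rule operad_base_change)
  interpret N: hc_point "base_change P \<delta>" d "\<lambda>I p. f (mu d I p)" by (rule Hom_points_hc_point[OF f])
  have S: "finite {1..n}" "2 \<le> card {1..n}" using n by simp_all
  note aD = Der_seriesD(2)[OF a] and bD = Der_seriesD(2)[OF b]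
  note ab = Der_bracket_Der_series[OF a b]
  define C where "C e1 p q = commutator P (e1 + 2 * int p) (e - e1 + 2 * int q) (a p (e1 + 2 * int p)) (b q (e - e1 + 2 * int q))"
    for e1 p q
  define h where "h e1 p q = N.act (extend_map (C e1 p q)) (p + q) {1..n} k" for e1 p q
  have C: "derivation P (e + 2 * int (p + q)) (C e1 p q)" for e1 p q
  proof -
    have "e1 + 2 * int p + (e - e1 + 2 * int q) = e + 2 * int (p + q)" by simp
    then show ?thesis
      unfolding C_def using derivation_commutator[OF aD[of "e1 + 2 * int p" p] bD[of "e - e1 + 2 * int q" q]] by metis
  qed
  have h0: "h e1 p q = 0" if "d * n \<le> p + q" for e1 p q
    unfolding h_def by (rule N.act_eq_zero[OF derivation_extend_map[OF C] n that])
  have "dir_deriv (action_vf d P a e1) \<delta> f (e - e1) (action_vf d P b (e - e1) \<delta> f) (mu d {1..n} k) -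
      op_scale (base_change P \<delta>) (ksgn e1 (e - e1))
        (dir_deriv (action_vf d P b (e - e1)) \<delta> f e1 (action_vf d P a e1 \<delta> f) (mu d {1..n} k)) =
    (\<Sum>p<d * n. \<Sum>q<d * n. h e1 p q)" for e1
  proof -
    let ?e2 = "e - e1"
    let ?A = "\<lambda>p. extend_map (a p (e1 + 2 * int p))" and ?B = "\<lambda>q. extend_map (b q (?e2 + 2 * int q))"
    \<comment> \<open>Derivations and their vector fields differ in degree by even numbers, so signs
      may be computed from either.\<close>
    have par: "koszul e1 ?e2 X = koszul (e1 + 2 * int p) (?e2 + 2 * int q) X" for X :: "nat set \<Rightarrow> 'a" and p q :: nat
      by (simp add: koszul_def)
    have dact2: "N.dact D (i + 2 * int q) j p Y I l = N.dact D (i + 2 * int q) (j + 2 * int r) p Y I l" for D i j p q r Y I l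
      unfolding N.dact_def N.dG_def by (simp add: koszul_def)
    have summand: "N.dact (?A p) (e1 + 2 * int p) ?e2 p (gen_family (N.act (?B q) q)) {1..n} k -
        koszul e1 ?e2 (N.dact (?B q) (?e2 + 2 * int q) e1 q (gen_family (N.act (?A p) p)) {1..n} k) = h e1 p q" for p q
      unfolding h_def par[of _ p q] dact2[of _ e1 p ?e2 _ _ _ _ q] dact2[of _ ?e2 q e1 _ _ _ _ p]
    proof (rule N.act_bracket[OF derivation_extend_map[OF aD] derivation_extend_map[OF bD]])
      show "derivation (base_change P \<delta>) (e1 + 2 * int p + (?e2 + 2 * int q)) (extend_map (C e1 p q))"
        unfolding C_def by (rule derivation_extend_map[OF derivation_commutator[OF aD bD]])
    qed (simp add: C_def extend_map_commutator)
    show ?thesis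
      unfolding dir_deriv_action_vf[OF a b f n] dir_deriv_action_vf[OF b a f n] Q.scale_koszul
      unfolding koszul_sum
      by (subst (2) sum.swap) (simp only: sum_subtractf[symmetric] summand)
  qed
  then have "(\<Sum>e1\<in>T. dir_deriv (action_vf d P a e1) \<delta> f (e - e1) (action_vf d P b (e - e1) \<delta> f) (mu d {1..n} k) -
      op_scale (base_change P \<delta>) (ksgn e1 (e - e1))
        (dir_deriv (action_vf d P b (e - e1)) \<delta> f e1 (action_vf d P a e1 \<delta> f) (mu d {1..n} k))) =
    (\<Sum>e1\<in>T. \<Sum>p<d * n. \<Sum>q<d * n. h e1 p q)" by simp
  also have "\<dots> = (\<Sum>e1\<in>T. \<Sum>s<d * n. \<Sum>p\<le>s. h e1 p (s - p))"
  proof (rule sum.cong[OF HOL.refl])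
    fix e1
    have "(\<Sum>p<d * n. \<Sum>q<d * n. h e1 p q) = (\<Sum>(p, q)\<in>{..<d * n} \<times> {..<d * n}. h e1 p q)"
      by (rule sum.cartesian_product)
    also have "\<dots> = (\<Sum>(p, q)\<in>{(p, q). p + q < d * n}. h e1 p q)"
      by (rule sum.mono_neutral_right) (use h0 in \<open>auto simp: not_less\<close>)
    also have "\<dots> = (\<Sum>s<d * n. \<Sum>p\<le>s. h e1 p (s - p))" by (rule sum.triangle_reindex)
    finally show "(\<Sum>p<d * n. \<Sum>q<d * n. h e1 p q) = (\<Sum>s<d * n. \<Sum>p\<le>s. h e1 p (s - p))" .
  qed
  also have "\<dots> = (\<Sum>s<d * n. \<Sum>e1\<in>T. \<Sum>p\<le>s. h e1 p (s - p))" by (rule sum.swap)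
  also have "\<dots> = action_vf d P (Der_bracket P a b) e \<delta> f (mu d {1..n} k)"
  proof -
    have "(\<Sum>e1\<in>T. \<Sum>p\<le>s. h e1 p (s - p)) =
        N.act (extend_map (Der_bracket P a b s (e + 2 * int s))) s {1..n} k" if s: "s < d * n" for s
    proof -
      let ?A = "T \<times> {..s}"
      let ?D = "\<lambda>(e1, p). extend_map (C e1 p (s - p))"
      have D: "derivation (base_change P \<delta>) (e + 2 * int s) (?D i)" if "i \<in> ?A" for i
        using that C[of "snd i" "s - snd i" "fst i"] by (auto intro!: derivation_extend_map)
      have br: "Der_bracket P a b s (e + 2 * int s) x = (\<Sum>(e1, p)\<in>?A. C e1 p (s - p) x)"
        if x: "x \<in> op_space P I j" for x I j
      proof -
        \<comment> \<open>Degree e1 of a vector field corresponds to degree e1 + 2p of the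
          derivation in the coefficient of z^p.\<close>
        let ?T = "\<lambda>p. (\<lambda>e1. e1 + 2 * int p) ` T"
        have sub: "degrees P (a p) \<subseteq> ?T p" if "p \<le> s" for p
        proof
          fix e' assume "e' \<in> degrees P (a p)"
          then have "e' - 2 * int p \<in> vf_degrees P a (d * n)"
            unfolding vf_degrees_def using that s by (intro UN_I[of p] imageI) auto
          then show "e' \<in> ?T p" using T(2) by (intro image_eqI[of _ _ "e' - 2 * int p"]) auto
        qed
        have "Der_bracket P a b s (e + 2 * int s) x = (\<Sum>p\<le>s. \<Sum>e'\<in>?T p.
            commutator P e' (e + 2 * int s - e') (a p e') (b (s - p) (e + 2 * int s - e')) x)"
          by (rule Der_bracket_eq[OF a b x _ sub]) (use T(1) in auto)
        also have "\<dots> = (\<Sum>p\<le>s. \<Sum>e1\<in>T. C e1 p (s - p) x)"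
        proof (rule sum.cong[OF HOL.refl])
          fix p assume "p \<in> {..s}"
          then have eq: "e + 2 * int s - (e1 + 2 * int p) = e - e1 + 2 * int (s - p)" for e1 by auto
          have inj: "inj_on (\<lambda>e1. e1 + 2 * int p) T" by (auto simp: inj_on_def)
          show "(\<Sum>e'\<in>?T p. commutator P e' (e + 2 * int s - e') (a p e') (b (s - p) (e + 2 * int s - e')) x) =
              (\<Sum>e1\<in>T. C e1 p (s - p) x)"
            by (simp only: sum.reindex[OF inj] o_def eq C_def)
        qed
        also have "\<dots> = (\<Sum>e1\<in>T. \<Sum>p\<le>s. C e1 p (s - p) x)" by (rule sum.swap)
        also have "\<dots> = (\<Sum>(e1, p)\<in>?A. C e1 p (s - p) x)" by (rule sum.cartesian_product)
        finally show ?thesis .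
      qed
      have "extend_map (Der_bracket P a b s (e + 2 * int s)) X = (\<Sum>i\<in>?A. op_scale (base_change P \<delta>) 1 (?D i X))"
        if X: "X \<in> op_space (base_change P \<delta>) I j" for X I j
      proof
        fix U
        have "\<exists>I j. X U \<in> op_space P I j"
        proof (cases "U \<subseteq> {..<length \<delta>}")
          case True
          then have "X U \<in> op_space P I (j - eps_deg \<delta> U)" using X by (simp add: base_change_space)
          then show ?thesis by blast
        next
          case False
          then have "X U \<in> op_space P {} 0" using X space_zero[of "{}" 0] by (simp add: base_change_space)
          then show ?thesis by blast
        qed
        then obtain I j where "X U \<in> op_space P I j" by blast
        from br[OF this] show "extend_map (Der_bracket P a b s (e + 2 * int s)) X U =
            (\<Sum>i\<in>?A. op_scale (base_change P \<delta>) 1 (?D i X)) U"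
          by (simp add: extend_map_def sum_fun_apply split_def)
      qed
      then have "N.act (extend_map (Der_bracket P a b s (e + 2 * int s))) s {1..n} k =
          (\<Sum>i\<in>?A. op_scale (base_change P \<delta>) 1 (N.act (?D i) s {1..n} k))"
        by (intro N.act_lincomb[OF D derivation_extend_map[OF Der_seriesD(2)[OF ab]]])
      also have "\<dots> = (\<Sum>(e1, p)\<in>?A. h e1 p (s - p))"
        unfolding Q.vs.scale_one by (intro sum.cong HOL.refl) (auto simp: h_def)
      also have "\<dots> = (\<Sum>e1\<in>T. \<Sum>p\<le>s. h e1 p (s - p))" by (rule sum.cartesian_product[symmetric])
      finally show ?thesis ..
    qed
    then have "(\<Sum>s<d * n. \<Sum>e1\<in>T. \<Sum>p\<le>s. h e1 p (s - p)) =
        (\<Sum>s<d * n. N.act (extend_map (Der_bracket P a b s (e + 2 * int s))) s {1..n} k)" by simp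
    also have "\<dots> = action_vf d P (Der_bracket P a b) e \<delta> f (mu d {1..n} k)"
      using action_vf_mu[OF ab f S, of "d * n"] monomial_vf_mu[OF f Der_seriesD(2)[OF ab] S] by simp
    finally show ?thesis .
  qed
  finally show ?thesis .
qed

lemma action_vf_bracket:
  assumes a: "a \<in> Der_series P" and b: "b \<in> Der_series P"
  shows "vf_eq d P (action_vf d P (Der_bracket P a b)) (vf_bracket P (action_vf d P a) (action_vf d P b))"
  unfolding vf_eq_def
proof (intro allI ballI)
  fix e \<delta> f I j and u :: "'k hterm set"
  assume f: "f \<in> Hom_points d P \<delta>" and u: "u \<in> op_space (HyperCom d) I j"
  interpret Q: operad "base_change P \<delta>" by (rule operad_base_change)
  let ?V = "action_vf d P a" and ?W = "action_vf d P b"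
  have fh: "operad_hom (HyperCom d) (base_change P \<delta>) f" using f by (simp add: Hom_points_def)
  define B where "B e1 u = dir_deriv (?V e1) \<delta> f (e - e1) (?W (e - e1) \<delta> f) u -
      op_scale (base_change P \<delta>) (ksgn e1 (e - e1)) (dir_deriv (?W (e - e1)) \<delta> f e1 (?V e1 \<delta> f) u)" for e1 u
  note Vf = action_vf_f_derivation[OF a f] and Wf = action_vf_f_derivation[OF b f]
  note tV = tangent_point_hom[OF f Vf] and tW = tangent_point_hom[OF f Wf]
  have B: "f_derivation (HyperCom d) (base_change P \<delta>) f e (B e1)" for e1
    using f_derivation_vf_bracket[OF f Wf[of "e - e1"] Vf[of e1] action_vf_f_derivation[OF a tW] low_action_vf[OF a f Wf]
        action_vf_f_derivation[OF b tV] low_action_vf[OF b f Vf]]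
    unfolding B_def dir_deriv_eq by simp
  obtain t where t: "wf_term d t" "u = hc_class d t" using u by (rule HyperComE)
  obtain N where N: "\<And>M a e \<delta> f. \<lbrakk>N \<le> M; a \<in> Der_series P; f \<in> Hom_points d P \<delta>\<rbrakk> \<Longrightarrow>
      action_vf d P a e \<delta> f u = (\<Sum>p<M. monomial_vf d P (a p (e + 2 * int p)) p e \<delta> f u)"
    using action_vf_eventually[OF u] by blast
  \<comment> \<open>Large enough both for the element u itself and for every generator in the term
    t.\<close>
  define M where "M = N + d * Max (insert 0 (fst ` gens_of t))"
  \<comment> \<open>Outside T the first field has no component of degree e1 at u and the second none
    of degree e - e1, at any tangent point; each fact removes one of the two summands of the
    bracket.\<close>
  define T where "T = vf_degrees P a M \<union> (\<lambda>e2. e - e2) ` vf_degrees P b M"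
  have NM: "N \<le> M" by (simp add: M_def)
  have T: "finite T" unfolding T_def using finite_vf_degrees[OF a] finite_vf_degrees[OF b] by blast
  have "B e1 u = 0" if "e1 \<notin> T" for e1
  proof -
    have e1: "e1 \<notin> vf_degrees P a M" using that by (simp add: T_def)
    have e2: "e - e1 \<notin> vf_degrees P b M"
    proof
      assume "e - e1 \<in> vf_degrees P b M"
      then have "e1 \<in> (\<lambda>e2. e - e2) ` vf_degrees P b M" by (intro image_eqI[of _ _ "e - e1"]) auto
      then show False using that by (simp add: T_def)
    qed
    show ?thesis
      unfolding B_def dir_deriv_eq action_vf_not_degrees[OF a tW u e1 N[OF NM a tW]]
        action_vf_not_degrees[OF b tV u e2 N[OF NM b tV]] by (simp add: fun_eq_iff)
  qed
  then have "vf_bracket P ?V ?W e \<delta> f u = (\<Sum>e1\<in>T. B e1 u)"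
    unfolding vf_bracket_def B_def[symmetric] by (intro Sum_any.expand_superset T) auto
  also have "\<dots> = action_vf d P (Der_bracket P a b) e \<delta> f u"
    unfolding t(2)
  proof (rule Q.f_derivation_cong[OF fh Q.f_derivation_sum[OF fh B]
        action_vf_f_derivation[OF Der_bracket_Der_series[OF a b] f] t(1)])
    fix n k assume nk: "(n, k) \<in> gens_of t"
    have n: "2 \<le> n" by (rule gens_of_ge[OF t(1) nk])
    have "n \<le> Max (insert 0 (fst ` gens_of t))"
      using nk finite_gens_of[of t] by (intro Max_ge) force+
    then have "d * n \<le> M" unfolding M_def by (simp add: trans_le_add2)
    then have "vf_degrees P a (d * n) \<subseteq> T" unfolding T_def vf_degrees_def by fastforce
    then show "(\<Sum>e1\<in>T. B e1 (mu d {1..n} k)) = action_vf d P (Der_bracket P a b) e \<delta> f (mu d {1..n} k)"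
      unfolding B_def by (rule action_vf_bracket_mu[OF a b f n T])
  qed
  finally show "action_vf d P (Der_bracket P a b) e \<delta> f u = vf_bracket P ?V ?W e \<delta> f u" ..
qed

end

theorem proposition6p1:
  fixes \<O> :: "('k::field_char_0, 'a::ab_group_add) operad_str" and d :: nat
  assumes "operad \<O>" and "1 \<le> d"
  shows "\<exists>Y. action_assignment d \<O> Y \<and>
    (\<forall>Y'. action_assignment d \<O> Y' \<longrightarrow> (\<forall>a\<in>Der_series \<O>. vf_eq d \<O> (Y' a) (Y a))) \<and>
    (\<forall>a\<in>Der_series \<O>. \<forall>b\<in>Der_series \<O>.
       vf_eq d \<O> (Y (Der_bracket \<O> a b)) (vf_bracket \<O> (Y a) (Y b)))"
proof -
  interpret operad \<O> by (rule assms(1))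
  show ?thesis
    by (intro exI[of _ "action_vf d \<O>"] conjI allI impI ballI action_vf_assignment
        action_assignment_unique[OF action_vf_assignment] action_vf_bracket)
qed

end
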